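(* Let $M$ and $N$ be pointed metric spaces and assume that $M$ is complete. Let $f:M\to N$ be a Lipschitz map with $f(0)=0$, and let $\widehat f:\mathcal F(M)\to\mathcal F(N)$ be its linearization. The following are equivalent: (i) $f$ is curve-flat, that is, for every compact $K\subset\mathbb R$ and every Lipschitz map $\gamma:K\to M$, $$\lim_{\substack{y\to x\\ y\in K}}\frac{d(f(\gamma(x)),f(\gamma(y)))}{|x-y|}=0\quad\text{for }\lambda\text{-almost every }x\in K,$$ where $\lambda$ is the Lebesgue measure on $\mathbb R$; (ii) $\widehat f$ is a Radon-Nikodým operator; (iii) $\widehat f$ is a Dunford-Pettis operator; (iv) $\widehat f$ does not fix any copy of $L_1$.
   Context: All Banach spaces are real. A pointed metric space is a metric space with a distinguished point, denoted $0$. $\mathrm{Lip}_0(M)$ is the Banach space of Lipschitz functions $g:M\to\mathbb R$ with $g(0)=0$, normed by the best Lipschitz constant. For $x\in M$, $\delta_M(x)\in \mathrm{Lip}_0(M)^*$ is evaluation at $x$. The Lipschitz-free space is $\mathcal F(M)=\overline{\mathrm{span}}^{\|\cdot\|}\{\delta_M(x):x\in M\}\subset\mathrm{Lip}_0(M)^*$. For a Lipschitz $f:M\to N$ with $f(0)=0$, $\widehat f:\mathcal F(M)\to\mathcal F(N)$ is the unique bounded linear operator with $\widehat f(\delta_M(x))=\delta_N(f(x))$ for all $x\in M$. A bounded operator $T:X\to Y$ between Banach spaces is: Dunford-Pettis if it is weak-to-norm sequentially continuous; Radon-Nikodým if for every probability space and every $X$-valued martingale $(M_n)$ bounded in $L_1(X)$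 (Bochner space), the martingale $(T\circ M_n)$ converges pointwise (in the norm of $Y$) almost everywhere. $T$ fixes a copy of $L_1=L_1([0,1])$ if there is a subspace $Z\subset X$ isomorphic to $L_1$ such that $T|_Z$ is an isomorphic embedding. *)

theory Defs
  imports "HOL-Probability.Probability"
begin

section \<open>Lipschitz functions vanishing at the distinguished point\<close>

text \<open>
  A pointed metric space is a type of sort \<open>{metric_space, zero}\<close>; the constant \<open>0\<close> is its
  distinguished point, and no algebraic law about it is assumed.
\<close>

typedef (overloaded) 'a lip0 =
  "{g :: 'a::{metric_space, zero} \<Rightarrow> real. g 0 = 0 \<and> (\<exists>L. L-lipschitz_on UNIV g)}"
  morphisms lip0_apply Lip0
  by (rule exI[of _ "\<lambda>_. 0"]) (auto intro: lipschitz_on_constant)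

setup_lifting type_definition_lip0

lemma lip0_eqI: "(\<And>x. lip0_apply g x = lip0_apply h x) \<Longrightarrow> g = h"
  by transfer auto

instantiation lip0 :: ("{metric_space, zero}") real_normed_vector
begin

lift_definition zero_lip0 :: "'a lip0" is "\<lambda>_. 0"
  by (auto intro: lipschitz_on_constant)

lift_definition plus_lip0 :: "'a lip0 \<Rightarrow> 'a lip0 \<Rightarrow> 'a lip0" is "\<lambda>g h x. g x + h x"
  by (auto intro: lipschitz_on_add)

lift_definition minus_lip0 :: "'a lip0 \<Rightarrow> 'a lip0 \<Rightarrow> 'a lip0" is "\<lambda>g h x. g x - h x"
  by (auto intro: lipschitz_on_diff)

lift_definition uminus_lip0 :: "'a lip0 \<Rightarrow> 'a lip0" is "\<lambda>g x. - g x"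
  by auto

lift_definition scaleR_lip0 :: "real \<Rightarrow> 'a lip0 \<Rightarrow> 'a lip0" is "\<lambda>c g x. c * g x"
  by (auto intro: lipschitz_on_cmult_real)

lift_definition norm_lip0 :: "'a lip0 \<Rightarrow> real" is "\<lambda>g. Inf {L. L-lipschitz_on UNIV g}" .

definition sgn_lip0 :: "'a lip0 \<Rightarrow> 'a lip0" where
  "sgn_lip0 g = scaleR (inverse (norm g)) g"

definition dist_lip0 :: "'a lip0 \<Rightarrow> 'a lip0 \<Rightarrow> real" where
  "dist_lip0 g h = norm (g - h)"

definition uniformity_lip0 :: "('a lip0 \<times> 'a lip0) filter" where
  "uniformity_lip0 = (INF e\<in>{0<..}. principal {(g, h). dist g h < e})"

definition open_lip0 :: "'a lip0 set \<Rightarrow> bool" where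
  "open_lip0 U = (\<forall>g\<in>U. \<forall>\<^sub>F (g', h) in uniformity. g' = g \<longrightarrow> h \<in> U)"

lemma lip0_norm_lipschitz: "(norm g)-lipschitz_on UNIV (lip0_apply g)" for g :: "'a lip0"
proof transfer
  fix g :: "'a \<Rightarrow> real"
  let ?S = "{L. L-lipschitz_on UNIV g}"
  assume "g 0 = 0 \<and> (\<exists>L. L-lipschitz_on UNIV g)"
  then have ne: "?S \<noteq> {}" by auto
  show "(Inf ?S)-lipschitz_on UNIV g"
  proof (rule lipschitz_onI)
    show "0 \<le> Inf ?S"
      by (rule cInf_greatest[OF ne]) (auto dest: lipschitz_on_nonneg)
    fix x y
    show "dist (g x) (g y) \<le> Inf ?S * dist x y"
    proof (cases "x = y")
      case False
      then have "dist x y > 0" by simp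
      have "dist (g x) (g y) / dist x y \<le> Inf ?S"
        using \<open>dist x y > 0\<close>
        by (intro cInf_greatest[OF ne]) (auto simp: divide_le_eq dest: lipschitz_onD)
      then show ?thesis using \<open>dist x y > 0\<close> by (simp add: divide_le_eq)
    qed simp
  qed
qed

lemma lip0_norm_le: "norm g \<le> L" if "L-lipschitz_on UNIV (lip0_apply g)" for g :: "'a lip0"
  using that
  by transfer (auto intro!: cInf_lower bdd_belowI[of _ 0] dest: lipschitz_on_nonneg)

lemma lip0_apply_simps:
  "lip0_apply 0 x = 0"
  "lip0_apply (g + h) x = lip0_apply g x + lip0_apply h x"
  "lip0_apply (g - h) x = lip0_apply g x - lip0_apply h x"
  "lip0_apply (- g) x = - lip0_apply g x"
  "lip0_apply (c *\<^sub>R g) x = c * lip0_apply g x"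
  "lip0_apply g 0 = 0" for x :: 'a
  by (transfer; simp)+

lemma lip0_norm_scaleR_le: "norm (c *\<^sub>R g) \<le> \<bar>c\<bar> * norm g" for g :: "'a lip0"
proof (rule lip0_norm_le)
  have *: "lip0_apply (c *\<^sub>R g) = (\<lambda>x. c * lip0_apply g x)"
    by (auto simp: lip0_apply_simps)
  show "(\<bar>c\<bar> * norm g)-lipschitz_on UNIV (lip0_apply (c *\<^sub>R g))"
    unfolding * by (intro lipschitz_on_cmult_real lip0_norm_lipschitz)
qed

instance
proof
  fix g h k :: "'a lip0" and c d :: real
  show "g + h + k = g + (h + k)" "g + h = h + g" "0 + g = g" "- g + g = 0" "g - h = g + - h"
    "c *\<^sub>R (g + h) = c *\<^sub>R g + c *\<^sub>R h" "(c + d) *\<^sub>R g = c *\<^sub>R g + d *\<^sub>R g"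
    "c *\<^sub>R d *\<^sub>R g = (c * d) *\<^sub>R g" "1 *\<^sub>R g = g"
    by (auto intro!: lip0_eqI simp: lip0_apply_simps algebra_simps)
  show "dist g h = norm (g - h)" by (fact dist_lip0_def)
  show "sgn g = scaleR (inverse (norm g)) g" by (fact sgn_lip0_def)
  show "uniformity = (INF e\<in>{0<..}. principal {(g, h::'a lip0). dist g h < e})"
    by (fact uniformity_lip0_def)
  show "open U = (\<forall>g\<in>U. \<forall>\<^sub>F (g', h) in uniformity. g' = g \<longrightarrow> h \<in> U)" for U :: "'a lip0 set"
    by (fact open_lip0_def)
  show "norm g = 0 \<longleftrightarrow> g = 0"
  proof
    assume 0: "norm g = 0"
    have "lip0_apply g x = 0" for x
      using lipschitz_onD[OF lip0_norm_lipschitz[of g], of x 0] 0 by (simp add: lip0_apply_simps)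
    then show "g = 0" by (auto intro!: lip0_eqI simp: lip0_apply_simps)
  next
    assume "g = 0"
    then have "0-lipschitz_on UNIV (lip0_apply g)"
      by (auto simp: lip0_apply_simps intro!: lipschitz_onI)
    from lip0_norm_le[OF this] show "norm g = 0"
      using lipschitz_on_nonneg[OF lip0_norm_lipschitz[of g]] by simp
  qed
  show "norm (g + h) \<le> norm g + norm h"
  proof (rule lip0_norm_le)
    have *: "lip0_apply (g + h) = (\<lambda>x. lip0_apply g x + lip0_apply h x)"
      by (auto simp: lip0_apply_simps)
    show "(norm g + norm h)-lipschitz_on UNIV (lip0_apply (g + h))"
      unfolding * by (intro lipschitz_on_add lip0_norm_lipschitz)
  qed
  show "norm (c *\<^sub>R g) = \<bar>c\<bar> * norm g"
  proof (rule antisym[OF lip0_norm_scaleR_le])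
    show "\<bar>c\<bar> * norm g \<le> norm (c *\<^sub>R g)"
    proof (cases "c = 0")
      case True
      then show ?thesis
        using lipschitz_on_nonneg[OF lip0_norm_lipschitz[of "c *\<^sub>R g"]] by simp
    next
      case False
      then have "g = inverse c *\<^sub>R (c *\<^sub>R g)"
        by (auto intro!: lip0_eqI simp: lip0_apply_simps)
      with lip0_norm_scaleR_le[of "inverse c" "c *\<^sub>R g"] have "norm g \<le> \<bar>inverse c\<bar> * norm (c *\<^sub>R g)"
        by simp
      with False show ?thesis by (simp add: field_simps)
    qed
  qed
qed

end


section \<open>The Lipschitz-free space\<close>

lift_definition delta :: "'a::{metric_space, zero} \<Rightarrow> 'a lip0 \<Rightarrow>\<^sub>L real" is
  "\<lambda>x g. lip0_apply g x"
proof (rule bounded_linear_intro)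
  fix x :: 'a and g h :: "'a lip0" and r :: real
  show "lip0_apply (g + h) x = lip0_apply g x + lip0_apply h x"
    "lip0_apply (r *\<^sub>R g) x = r *\<^sub>R lip0_apply g x"
    by (simp_all add: lip0_apply_simps)
  show "norm (lip0_apply g x) \<le> norm g * dist x 0"
    using lipschitz_onD[OF lip0_norm_lipschitz[of g], of x 0]
    by (simp add: lip0_apply_simps dist_real_def)
qed

definition free_functionals :: "('a::{metric_space, zero} lip0 \<Rightarrow>\<^sub>L real) set" where
  "free_functionals = closure (span (range delta))"

lemma free_functionals_closed: "closed free_functionals"
  by (simp add: free_functionals_def)

lemma free_functionals_subspace: "subspace free_functionals"
proof -
  let ?S = "span (range delta) :: ('a lip0 \<Rightarrow>\<^sub>L real) set"
  show ?thesis
    unfolding free_functionals_def subspace_def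
  proof (intro conjI ballI allI)
    show "0 \<in> closure ?S"
      using closure_subset span_zero by blast
    fix u v assume u: "u \<in> closure ?S"
    then obtain us where us: "\<And>n. us n \<in> ?S" "us \<longlonglongrightarrow> u"
      by (auto simp: closure_sequential)
    show "c *\<^sub>R u \<in> closure ?S" for c
      unfolding closure_sequential using us
      by (intro exI[of _ "\<lambda>n. c *\<^sub>R us n"]) (auto intro: span_scale tendsto_scaleR)
    assume "v \<in> closure ?S"
    then obtain vs where vs: "\<And>n. vs n \<in> ?S" "vs \<longlonglongrightarrow> v"
      by (auto simp: closure_sequential)
    show "u + v \<in> closure ?S"
      unfolding closure_sequential using us vs
      by (intro exI[of _ "\<lambda>n. us n + vs n"]) (auto intro: span_add tendsto_add)
  qed
qed

typedef (overloaded) 'a lip_free = "free_functionals :: ('a::{metric_space, zero} lip0 \<Rightarrow>\<^sub>L real) set"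
  morphisms free_functional Lip_free
  using subspace_0[OF free_functionals_subspace] by blast

setup_lifting type_definition_lip_free

instantiation lip_free :: ("{metric_space, zero}") real_normed_vector
begin

lift_definition zero_lip_free :: "'a lip_free" is 0
  by (rule subspace_0[OF free_functionals_subspace])

lift_definition plus_lip_free :: "'a lip_free \<Rightarrow> 'a lip_free \<Rightarrow> 'a lip_free" is "(+)"
  by (rule subspace_add[OF free_functionals_subspace])

lift_definition minus_lip_free :: "'a lip_free \<Rightarrow> 'a lip_free \<Rightarrow> 'a lip_free" is "(-)"
  by (rule subspace_diff[OF free_functionals_subspace])

lift_definition uminus_lip_free :: "'a lip_free \<Rightarrow> 'a lip_free" is uminus
  by (rule subspace_neg[OF free_functionals_subspace])

lift_definition scaleR_lip_free :: "real \<Rightarrow> 'a lip_free \<Rightarrow> 'a lip_free" is scaleR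
  by (rule subspace_scale[OF free_functionals_subspace])

lift_definition norm_lip_free :: "'a lip_free \<Rightarrow> real" is norm .

lift_definition dist_lip_free :: "'a lip_free \<Rightarrow> 'a lip_free \<Rightarrow> real" is dist .

definition sgn_lip_free :: "'a lip_free \<Rightarrow> 'a lip_free" where
  "sgn_lip_free u = scaleR (inverse (norm u)) u"

definition uniformity_lip_free :: "('a lip_free \<times> 'a lip_free) filter" where
  "uniformity_lip_free = (INF e\<in>{0<..}. principal {(u, v). dist u v < e})"

definition open_lip_free :: "'a lip_free set \<Rightarrow> bool" where
  "open_lip_free U = (\<forall>u\<in>U. \<forall>\<^sub>F (u', v) in uniformity. u' = u \<longrightarrow> v \<in> U)"

instance
proof
  fix u v w :: "'a lip_free" and c d :: real
  show "u + v + w = u + (v + w)" "u + v = v + u" "0 + u = u" "- u + u = 0" "u - v = u + - v"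
    "c *\<^sub>R (u + v) = c *\<^sub>R u + c *\<^sub>R v" "(c + d) *\<^sub>R u = c *\<^sub>R u + d *\<^sub>R u"
    "c *\<^sub>R d *\<^sub>R u = (c * d) *\<^sub>R u" "1 *\<^sub>R u = u"
    by (transfer; simp add: algebra_simps)+
  show "dist u v = norm (u - v)" by transfer (rule dist_norm)
  show "sgn u = scaleR (inverse (norm u)) u" by (fact sgn_lip_free_def)
  show "uniformity = (INF e\<in>{0<..}. principal {(u, v::'a lip_free). dist u v < e})"
    by (fact uniformity_lip_free_def)
  show "open U = (\<forall>u\<in>U. \<forall>\<^sub>F (u', v) in uniformity. u' = u \<longrightarrow> v \<in> U)" for U :: "'a lip_free set"
    by (fact open_lip_free_def)
  show "norm u = 0 \<longleftrightarrow> u = 0" by transfer simp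
  show "norm (u + v) \<le> norm u + norm v" by transfer (rule norm_triangle_ineq)
  show "norm (c *\<^sub>R u) = \<bar>c\<bar> * norm u" by transfer simp
qed

end

instance lip_free :: ("{metric_space, zero}") banach
proof
  fix X :: "nat \<Rightarrow> 'a lip_free"
  assume "Cauchy X"
  then have "Cauchy (\<lambda>n. free_functional (X n))"
    by (simp add: Cauchy_def dist_lip_free.rep_eq)
  then obtain l where lim: "(\<lambda>n. free_functional (X n)) \<longlonglongrightarrow> l"
    using Cauchy_convergent unfolding convergent_def by blast
  then have "l \<in> free_functionals"
    by (rule closed_sequentially[OF free_functionals_closed free_functional])
  note l = this lim
  then have "X \<longlonglongrightarrow> Lip_free l"
    by (simp add: tendsto_iff dist_lip_free.rep_eq Lip_free_inverse)
  then show "convergent X" by (auto simp: convergent_def)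
qed

lift_definition free_delta :: "'a::{metric_space, zero} \<Rightarrow> 'a lip_free" is delta
  unfolding free_functionals_def by (metis closure_subset rangeI span_base subsetD)

definition linearization ::
  "('a::{metric_space, zero} \<Rightarrow> 'b::{metric_space, zero}) \<Rightarrow> 'a lip_free \<Rightarrow>\<^sub>L 'b lip_free" where
  "linearization f = (THE T. \<forall>x. blinfun_apply T (free_delta x) = free_delta (f x))"

lemma closure_span_free_delta: "closure (span (range free_delta)) = UNIV"
proof -
  have lin: "linear (free_functional :: 'a lip_free \<Rightarrow> _)"
    by (rule linearI) (transfer; simp)+
  have img: "span (range delta) = free_functional ` span (range (free_delta :: 'a \<Rightarrow> _))"
    by (simp add: linear_span_image[OF lin, symmetric] image_image free_delta.rep_eq)
  have "u \<in> closure (span (range free_delta))" for u :: "'a lip_free"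
    unfolding closure_approachable
  proof (intro allI impI)
    fix e :: real assume "e > 0"
    moreover have "free_functional u \<in> closure (span (range delta))"
      using free_functional[of u] by (simp add: free_functionals_def)
    ultimately obtain y where "y \<in> span (range delta)" "dist y (free_functional u) < e"
      by (auto simp: closure_approachable)
    then show "\<exists>v\<in>span (range free_delta). dist v u < e"
      unfolding img by (auto simp: dist_lip_free.rep_eq)
  qed
  then show ?thesis by auto
qed

lemma linearization_unique:
  fixes T S :: "'a::{metric_space, zero} lip_free \<Rightarrow>\<^sub>L 'b::real_normed_vector"
  assumes "\<And>x. blinfun_apply T (free_delta x) = blinfun_apply S (free_delta x)"
  shows "T = S"
proof (rule blinfun_eqI)
  fix u
  have "closed {u. blinfun_apply T u = blinfun_apply S u}"
    by (intro closed_Collect_eq continuous_intros)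
  moreover have "span (range free_delta) \<subseteq> {u. blinfun_apply T u = blinfun_apply S u}"
    using assms
    by (intro span_minimal) (auto simp: subspace_def blinfun.bilinear_simps)
  ultimately have "closure (span (range free_delta)) \<subseteq> {u. blinfun_apply T u = blinfun_apply S u}"
    by (rule closure_minimal[rotated])
  then show "blinfun_apply T u = blinfun_apply S u"
    unfolding closure_span_free_delta by auto
qed

lemma linearization_exists:
  fixes f :: "'a::{metric_space, zero} \<Rightarrow> 'b::{metric_space, zero}"
  assumes L: "L-lipschitz_on UNIV f" and f0: "f 0 = 0"
  shows "\<exists>T. \<forall>x. blinfun_apply T (free_delta x) = free_delta (f x)"
proof -
  define C where "C h = Lip0 (\<lambda>x. lip0_apply h (f x))" for h :: "'b lip0"
  have lip: "(norm h * L)-lipschitz_on UNIV (\<lambda>x. lip0_apply h (f x))" for h :: "'b lip0"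
    using lipschitz_on_compose2[OF L lipschitz_on_subset[OF lip0_norm_lipschitz[of h]]]
    by (simp add: mult.commute)
  have C: "lip0_apply (C h) x = lip0_apply h (f x)" for h x
    unfolding C_def using lip[of h] by (subst Lip0_inverse) (auto simp: f0 lip0_apply_simps)
  have "bounded_linear C"
  proof (rule bounded_linear_intro)
    show "C (g + h) = C g + C h" "C (r *\<^sub>R g) = r *\<^sub>R C g" for g h r
      by (auto intro!: lip0_eqI simp: C lip0_apply_simps)
    show "norm (C h) \<le> norm h * L" for h
    proof (rule lip0_norm_le)
      have "lip0_apply (C h) = (\<lambda>x. lip0_apply h (f x))" by (auto simp: C)
      then show "(norm h * L)-lipschitz_on UNIV (lip0_apply (C h))" using lip by simp
    qed
  qed
  then obtain CB where CB: "blinfun_apply CB = C"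
    using bounded_linear_Blinfun_apply by blast
  define A where "A \<mu> = \<mu> o\<^sub>L CB" for \<mu> :: "'a lip0 \<Rightarrow>\<^sub>L real"
  have A_lin: "bounded_linear A"
    unfolding A_def by (rule bounded_bilinear.bounded_linear_left[OF bounded_bilinear_blinfun_compose])
  have A_delta: "A (delta x) = delta (f x)" for x
    by (rule blinfun_eqI) (simp add: A_def CB delta.rep_eq C)
  have A_span: "A ` span (range delta) \<subseteq> span (range delta)"
    unfolding linear_span_image[OF bounded_linear.linear[OF A_lin], symmetric]
    by (rule span_mono) (auto simp: A_delta)
  have A_free: "A \<mu> \<in> free_functionals" if "\<mu> \<in> free_functionals" for \<mu>
  proof -
    have "A ` closure (span (range delta)) \<subseteq> closure (span (range delta))"
      using A_span closure_subset
      by (intro image_closure_subset linear_continuous_on[OF A_lin]) (auto intro: order_trans)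
    with that show ?thesis by (auto simp: free_functionals_def)
  qed
  define T where "T u = Lip_free (A (free_functional u))" for u
  have T: "free_functional (T u) = A (free_functional u)" for u
    unfolding T_def by (simp add: Lip_free_inverse A_free free_functional)
  have inj: "u = v" if "free_functional u = free_functional v" for u v :: "'b lip_free"
    using that by (simp add: free_functional_inject)
  obtain K where K: "\<And>\<mu>. norm (A \<mu>) \<le> norm \<mu> * K"
    using bounded_linear.bounded[OF A_lin] by auto
  have "bounded_linear T"
    by (rule bounded_linear_intro[where K = K])
      (auto intro!: inj simp: T plus_lip_free.rep_eq scaleR_lip_free.rep_eq norm_lip_free.rep_eq K
        linear_add[OF bounded_linear.linear[OF A_lin]] linear_scale[OF bounded_linear.linear[OF A_lin]])
  then obtain TB where TB: "blinfun_apply TB = T"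
    using bounded_linear_Blinfun_apply by blast
  have "blinfun_apply TB (free_delta x) = free_delta (f x)" for x
    by (rule inj) (simp add: TB T free_delta.rep_eq A_delta)
  then show ?thesis by blast
qed

lemma linearization_free_delta:
  assumes "\<exists>L. L-lipschitz_on UNIV f" and "f 0 = 0"
  shows "blinfun_apply (linearization f) (free_delta x) = free_delta (f x)"
proof -
  have "\<exists>!T. \<forall>x. blinfun_apply T (free_delta x) = free_delta (f x)"
    using assms linearization_exists by (auto intro!: linearization_unique)
  from theI'[OF this] show ?thesis
    unfolding linearization_def by blast
qed


section \<open>Curve-flat maps\<close>

text \<open>At isolated points of \<open>K\<close> the filter \<open>at x within K\<close> is trivial, so the limit holds vacuously.\<close>

definition curve_flat :: "('a::metric_space \<Rightarrow> 'b::metric_space) \<Rightarrow> bool" where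
  "curve_flat f \<longleftrightarrow>
    (\<forall>(K :: real set) \<gamma>. compact K \<longrightarrow> (\<exists>L. L-lipschitz_on K \<gamma>) \<longrightarrow>
      (AE x in lebesgue. x \<in> K \<longrightarrow>
        ((\<lambda>y. dist (f (\<gamma> x)) (f (\<gamma> y)) / \<bar>x - y\<bar>) \<longlongrightarrow> 0) (at x within K)))"


section \<open>Dunford-Pettis operators\<close>

definition weakly_convergent_to :: "(nat \<Rightarrow> 'x::real_normed_vector) \<Rightarrow> 'x \<Rightarrow> bool" where
  "weakly_convergent_to u l \<longleftrightarrow>
    (\<forall>\<phi> :: 'x \<Rightarrow>\<^sub>L real. (\<lambda>n. blinfun_apply \<phi> (u n)) \<longlonglongrightarrow> blinfun_apply \<phi> l)"

definition dunford_pettis :: "('x::banach \<Rightarrow>\<^sub>L 'y::banach) \<Rightarrow> bool" where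
  "dunford_pettis T \<longleftrightarrow>
    (\<forall>u l. weakly_convergent_to u l \<longrightarrow> (\<lambda>n. blinfun_apply T (u n)) \<longlonglongrightarrow> blinfun_apply T l)"


section \<open>Operators fixing a copy of \<open>L\<^sub>1\<close>\<close>

definition L1_rel :: "(real \<Rightarrow> real) \<Rightarrow> (real \<Rightarrow> real) \<Rightarrow> bool" where
  "L1_rel f g \<longleftrightarrow> integrable (lebesgue_on {0..1}) f \<and> integrable (lebesgue_on {0..1}) g \<and>
    (AE x in lebesgue_on {0..1}. f x = g x)"

quotient_type L1 = "real \<Rightarrow> real" / partial: L1_rel
proof (rule part_equivpI)
  show "\<exists>f. L1_rel f f" by (rule exI[of _ "\<lambda>_. 0"]) (simp add: L1_rel_def)
  show "symp L1_rel" by (auto simp: symp_def L1_rel_def)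
  show "transp L1_rel"
    unfolding transp_def L1_rel_def by (auto elim: AE_mp)
qed

instantiation L1 :: real_normed_vector
begin

lift_definition zero_L1 :: L1 is "\<lambda>_. 0"
  by (simp add: L1_rel_def)

lift_definition plus_L1 :: "L1 \<Rightarrow> L1 \<Rightarrow> L1" is "\<lambda>f g x. f x + g x"
  by (auto simp: L1_rel_def)

lift_definition minus_L1 :: "L1 \<Rightarrow> L1 \<Rightarrow> L1" is "\<lambda>f g x. f x - g x"
  by (auto simp: L1_rel_def)

lift_definition uminus_L1 :: "L1 \<Rightarrow> L1" is "\<lambda>f x. - f x"
  by (auto simp: L1_rel_def)

lift_definition scaleR_L1 :: "real \<Rightarrow> L1 \<Rightarrow> L1" is "\<lambda>c f x. c * f x"
  by (auto simp: L1_rel_def)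

lift_definition norm_L1 :: "L1 \<Rightarrow> real" is "\<lambda>f. integral\<^sup>L (lebesgue_on {0..1}) (\<lambda>x. \<bar>f x\<bar>)"
  by (auto simp: L1_rel_def intro!: integral_cong_AE)

definition sgn_L1 :: "L1 \<Rightarrow> L1" where
  "sgn_L1 f = scaleR (inverse (norm f)) f"

definition dist_L1 :: "L1 \<Rightarrow> L1 \<Rightarrow> real" where
  "dist_L1 f g = norm (f - g)"

definition uniformity_L1 :: "(L1 \<times> L1) filter" where
  "uniformity_L1 = (INF e\<in>{0<..}. principal {(f, g). dist f g < e})"

definition open_L1 :: "L1 set \<Rightarrow> bool" where
  "open_L1 U = (\<forall>f\<in>U. \<forall>\<^sub>F (f', g) in uniformity. f' = f \<longrightarrow> g \<in> U)"

instance
proof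
  fix f g h :: L1 and c d :: real
  show "f + g + h = f + (g + h)" "f + g = g + f" "0 + f = f" "- f + f = 0" "f - g = f + - g"
    "c *\<^sub>R (f + g) = c *\<^sub>R f + c *\<^sub>R g" "(c + d) *\<^sub>R f = c *\<^sub>R f + d *\<^sub>R f"
    "c *\<^sub>R d *\<^sub>R f = (c * d) *\<^sub>R f" "1 *\<^sub>R f = f"
    by (transfer; simp add: L1_rel_def algebra_simps)+
  show "dist f g = norm (f - g)" by (fact dist_L1_def)
  show "sgn f = scaleR (inverse (norm f)) f" by (fact sgn_L1_def)
  show "uniformity = (INF e\<in>{0<..}. principal {(f, g::L1). dist f g < e})"
    by (fact uniformity_L1_def)
  show "open U = (\<forall>f\<in>U. \<forall>\<^sub>F (f', g) in uniformity. f' = f \<longrightarrow> g \<in> U)" for U :: "L1 set"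
    by (fact open_L1_def)
  show "norm f = 0 \<longleftrightarrow> f = 0"
    by transfer (simp add: L1_rel_def integral_nonneg_eq_0_iff_AE)
  show "norm (f + g) \<le> norm f + norm g"
  proof transfer
    fix f g :: "real \<Rightarrow> real"
    assume "L1_rel f f" "L1_rel g g"
    then have [simp]: "integrable (lebesgue_on {0..1}) f" "integrable (lebesgue_on {0..1}) g"
      by (auto simp: L1_rel_def)
    have "(\<integral>x. \<bar>f x + g x\<bar> \<partial>lebesgue_on {0..1}) \<le> (\<integral>x. \<bar>f x\<bar> + \<bar>g x\<bar> \<partial>lebesgue_on {0..1})"
      by (intro integral_mono) auto
    then show "(\<integral>x. \<bar>f x + g x\<bar> \<partial>lebesgue_on {0..1}) \<le>
        (\<integral>x. \<bar>f x\<bar> \<partial>lebesgue_on {0..1}) + (\<integral>x. \<bar>g x\<bar> \<partial>lebesgue_on {0..1})"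
      by simp
  qed
  show "norm (c *\<^sub>R f) = \<bar>c\<bar> * norm f"
    by transfer (simp add: abs_mult)
qed

end

definition isomorphic_embedding_on ::
  "'x set \<Rightarrow> ('x::real_normed_vector \<Rightarrow>\<^sub>L 'y::real_normed_vector) \<Rightarrow> bool" where
  "isomorphic_embedding_on Z T \<longleftrightarrow> (\<exists>c>0. \<forall>z\<in>Z. norm (blinfun_apply T z) \<ge> c * norm z)"

definition fixes_copy_of_L1 :: "('x::banach \<Rightarrow>\<^sub>L 'y::banach) \<Rightarrow> bool" where
  "fixes_copy_of_L1 T \<longleftrightarrow>
    (\<exists>Z. subspace Z \<and>
      (\<exists>J :: L1 \<Rightarrow>\<^sub>L 'x. isomorphic_embedding_on UNIV J \<and> range (blinfun_apply J) = Z) \<and>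
      isomorphic_embedding_on Z T)"


section \<open>Radon-Nikodym operators\<close>

text \<open>
  The Bochner integral of the library is restricted to second countable spaces, which would exclude
  the Lipschitz-free space of a nonseparable metric space. The definition below is the library's
  definition without that restriction; the approximation in mean by simple functions makes the
  integrand almost everywhere separably valued.
\<close>

inductive bochner_has_integral :: "'p measure \<Rightarrow> ('p \<Rightarrow> 'x::real_normed_vector) \<Rightarrow> 'x \<Rightarrow> bool"
  for M f x where
  "f \<in> borel_measurable M \<Longrightarrow>
    (\<And>i. Bochner_Integration.simple_bochner_integrable M (s i)) \<Longrightarrow>
    (\<lambda>i. \<integral>\<^sup>+\<omega>. norm (f \<omega> - s i \<omega>) \<partial>M) \<longlonglongrightarrow> 0 \<Longrightarrow>
    (\<lambda>i. Bochner_Integration.simple_bochner_integral M (s i)) \<longlonglongrightarrow> x \<Longrightarrow>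
    bochner_has_integral M f x"

definition bochner_integrable :: "'p measure \<Rightarrow> ('p \<Rightarrow> 'x::real_normed_vector) \<Rightarrow> bool" where
  "bochner_integrable M f \<longleftrightarrow> (\<exists>x. bochner_has_integral M f x)"

text \<open>
  The last clause says that \<open>X m\<close> is a conditional expectation of \<open>X n\<close> given \<open>F m\<close>: both have the same
  Bochner integral over each \<open>A \<in> F m\<close>. Of \<open>F n\<close> only the sigma-algebra matters.
\<close>

definition bochner_martingale ::
  "'p measure \<Rightarrow> (nat \<Rightarrow> 'p measure) \<Rightarrow> (nat \<Rightarrow> 'p \<Rightarrow> 'x::banach) \<Rightarrow> bool" where
  "bochner_martingale P F X \<longleftrightarrow>
    (\<forall>n. subalgebra P (F n)) \<and> (\<forall>m n. m \<le> n \<longrightarrow> sets (F m) \<subseteq> sets (F n)) \<and>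
    (\<forall>n. bochner_integrable (restr_to_subalg P (F n)) (X n)) \<and>
    (\<forall>m n. m \<le> n \<longrightarrow> (\<forall>A \<in> sets (F m). \<exists>x.
      bochner_has_integral P (\<lambda>\<omega>. indicator A \<omega> *\<^sub>R X m \<omega>) x \<and>
      bochner_has_integral P (\<lambda>\<omega>. indicator A \<omega> *\<^sub>R X n \<omega>) x))"

definition L1_bounded :: "'p measure \<Rightarrow> (nat \<Rightarrow> 'p \<Rightarrow> 'x::banach) \<Rightarrow> bool" where
  "L1_bounded P X \<longleftrightarrow> (\<exists>C::real. \<forall>n. (\<integral>\<^sup>+\<omega>. norm (X n \<omega>) \<partial>P) \<le> ennreal C)"

definition radon_nikodym_on :: "'p itself \<Rightarrow> ('x::banach \<Rightarrow>\<^sub>L 'y::banach) \<Rightarrow> bool" where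
  "radon_nikodym_on _ T \<longleftrightarrow>
    (\<forall>(P :: 'p measure) F X.
      prob_space P \<longrightarrow> bochner_martingale P F X \<longrightarrow> L1_bounded P X \<longrightarrow>
        (AE \<omega> in P. convergent (\<lambda>n. blinfun_apply T (X n \<omega>))))"

text \<open>
  A definition cannot quantify over the types of sample points. Probability spaces on sets of
  sequences in the domain of the operator suffice, since a martingale can be transported to its path
  space; the theorem \<open>radon_nikodym_all_types\<close> below proves that the property then holds for
  probability spaces over every type.
\<close>

definition radon_nikodym :: "('x::banach \<Rightarrow>\<^sub>L 'y::banach) \<Rightarrow> bool" where
  "radon_nikodym T \<longleftrightarrow> radon_nikodym_on TYPE(nat \<Rightarrow> 'x) T"

lemma measurable_norm_diff_simple:
  fixes f s :: "'p \<Rightarrow> 'x::real_normed_vector"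
  assumes f: "f \<in> borel_measurable M" and s: "simple_function M s"
  shows "(\<lambda>\<omega>. norm (f \<omega> - s \<omega>)) \<in> borel_measurable M"
proof -
  let ?A = "\<lambda>v. {\<omega>\<in>space M. s \<omega> = v}"
  have fin: "finite (s ` space M)" using s by (rule simple_functionD)
  have "(\<lambda>\<omega>. norm (f \<omega> - v)) \<in> borel_measurable M" for v
    using f by (rule borel_measurable_continuous_on[rotated]) (intro continuous_intros)
  moreover have "?A v \<in> sets M" for v
    using simple_functionD(2)[OF s, of "{v}"] by (simp add: vimage_def Int_def conj_commute)
  ultimately have "(\<lambda>\<omega>. \<Sum>v\<in>s ` space M. norm (f \<omega> - v) * indicator (?A v) \<omega>) \<in> borel_measurable M"
    by (intro borel_measurable_sum borel_measurable_times borel_measurable_indicator)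
  moreover have "(\<Sum>v\<in>s ` space M. norm (f \<omega> - v) * indicator (?A v) \<omega>) = norm (f \<omega> - s \<omega>)"
    if "\<omega> \<in> space M" for \<omega>
  proof -
    have "(\<Sum>v\<in>s ` space M. norm (f \<omega> - v) * indicator (?A v) \<omega>) =
        (\<Sum>v\<in>s ` space M. if v = s \<omega> then norm (f \<omega> - v) else 0)"
      using that by (intro sum.cong) (auto simp: indicator_def)
    also have "\<dots> = norm (f \<omega> - s \<omega>)"
      using that fin by (subst sum.delta) auto
    finally show ?thesis .
  qed
  ultimately show ?thesis
    by (subst measurable_cong) auto
qed

lemma simple_bochner_integral_dist_le:
  fixes f s t :: "'p \<Rightarrow> 'x::real_normed_vector"
  assumes f: "f \<in> borel_measurable M"
    and s: "Bochner_Integration.simple_bochner_integrable M s" and t: "Bochner_Integration.simple_bochner_integrable M t"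
  shows "ennreal (norm (Bochner_Integration.simple_bochner_integral M s - Bochner_Integration.simple_bochner_integral M t)) \<le>
    (\<integral>\<^sup>+ \<omega>. norm (f \<omega> - s \<omega>) \<partial>M) + (\<integral>\<^sup>+ \<omega>. norm (f \<omega> - t \<omega>) \<partial>M)"
    (is "ennreal (norm (?s - ?t)) \<le> ?S + ?T")
proof -
  have sm: "simple_function M s" "simple_function M t"
    using s t by (simp_all add: simple_bochner_integrable.simps)
  have "ennreal (norm (?s - ?t)) = norm (Bochner_Integration.simple_bochner_integral M (\<lambda>x. s x - t x))"
    using s t by (subst simple_bochner_integral_diff) auto
  also have "\<dots> \<le> Bochner_Integration.simple_bochner_integral M (\<lambda>x. norm (s x - t x))"
    using simple_bochner_integrable_compose2[of "(-)" M "s" "t"] s t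
    by (auto intro!: simple_bochner_integral_norm_bound)
  also have "\<dots> = (\<integral>\<^sup>+x. norm (s x - t x) \<partial>M)"
    using simple_bochner_integrable_compose2[of "\<lambda>x y. norm (x - y)" M "s" "t"] s t
    by (auto intro!: simple_bochner_integral_eq_nn_integral)
  also have "\<dots> \<le> (\<integral>\<^sup>+x. ennreal (norm (f x - s x)) + ennreal (norm (f x - t x)) \<partial>M)"
  proof -
    have "\<And>x. x \<in> space M \<Longrightarrow> norm (s x - t x) \<le> norm (f x - s x) + norm (f x - t x)"
      by (metis dual_order.refl norm_diff_triangle_le norm_minus_commute)
    then show ?thesis
      by (metis (mono_tags, lifting) ennreal_leI ennreal_plus nn_integral_mono norm_ge_zero)
  qed
  also have "\<dots> = ?S + ?T"
    using measurable_norm_diff_simple[OF f] sm by (intro nn_integral_add) auto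
  finally show ?thesis .
qed

lemma bochner_has_integral_unique:
  assumes "bochner_has_integral M f x" and "bochner_has_integral M f y"
  shows "x = y"
proof -
  from assms(1) obtain s where f: "f \<in> borel_measurable M"
    and s: "\<And>i. Bochner_Integration.simple_bochner_integrable M (s i)" "(\<lambda>i. \<integral>\<^sup>+\<omega>. norm (f \<omega> - s i \<omega>) \<partial>M) \<longlonglongrightarrow> 0"
      "(\<lambda>i. Bochner_Integration.simple_bochner_integral M (s i)) \<longlonglongrightarrow> x"
    by (rule bochner_has_integral.cases) blast
  from assms(2) obtain t where
    t: "\<And>i. Bochner_Integration.simple_bochner_integrable M (t i)" "(\<lambda>i. \<integral>\<^sup>+\<omega>. norm (f \<omega> - t i \<omega>) \<partial>M) \<longlonglongrightarrow> 0"
      "(\<lambda>i. Bochner_Integration.simple_bochner_integral M (t i)) \<longlonglongrightarrow> y"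
    by (rule bochner_has_integral.cases) blast
  let ?d = "\<lambda>i. norm (Bochner_Integration.simple_bochner_integral M (s i) - Bochner_Integration.simple_bochner_integral M (t i))"
  have "(\<lambda>i. ennreal (?d i)) \<longlonglongrightarrow> 0"
  proof (rule tendsto_sandwich[OF _ _ tendsto_const])
    show "(\<lambda>i. (\<integral>\<^sup>+\<omega>. norm (f \<omega> - s i \<omega>) \<partial>M) + (\<integral>\<^sup>+\<omega>. norm (f \<omega> - t i \<omega>) \<partial>M)) \<longlonglongrightarrow> 0"
      using tendsto_add[OF s(2) t(2)] by simp
  qed (auto intro!: always_eventually simple_bochner_integral_dist_le f s t)
  then have "?d \<longlonglongrightarrow> 0"
    by (simp add: ennreal_0[symmetric] del: ennreal_0)
  moreover have "?d \<longlonglongrightarrow> norm (x - y)"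
    by (intro tendsto_intros s t)
  ultimately show "x = y"
    using LIMSEQ_unique by fastforce
qed

lemma ex_nearest_point_simple_function:
  fixes g :: "'p \<Rightarrow> 'x::real_normed_vector"
  assumes g: "g \<in> borel_measurable N" and "finite V" "V \<noteq> {}"
  shows "\<exists>t. simple_function N t \<and> (\<forall>\<omega>. \<forall>v\<in>V. norm (g \<omega> - t \<omega>) \<le> norm (g \<omega> - v))"
  using assms(2,3)
proof (induction V rule: finite_ne_induct)
  case (singleton v)
  show ?case by (rule exI[of _ "\<lambda>_. v"]) auto
next
  case (insert v V)
  then obtain t where t: "simple_function N t" "\<And>\<omega> v. v \<in> V \<Longrightarrow> norm (g \<omega> - t \<omega>) \<le> norm (g \<omega> - v)"
    by blast
  have [measurable]: "(\<lambda>\<omega>. norm (g \<omega> - t \<omega>)) \<in> borel_measurable N"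
      "(\<lambda>\<omega>. norm (g \<omega> - v)) \<in> borel_measurable N"
    by (intro measurable_norm_diff_simple g t simple_function_const)+
  let ?t = "\<lambda>\<omega>. if norm (g \<omega> - v) < norm (g \<omega> - t \<omega>) then v else t \<omega>"
  have "{\<omega> \<in> space N. norm (g \<omega> - v) < norm (g \<omega> - t \<omega>)} \<in> sets N"
    by measurable
  then have "simple_function N ?t"
    using t(1) by (intro simple_function_If) auto
  moreover have "norm (g \<omega> - ?t \<omega>) \<le> norm (g \<omega> - w)" if "w \<in> insert v V" for \<omega> w
    using that t(2)[of w \<omega>] by auto
  ultimately show ?case by (intro exI[of _ ?t]) blast
qed

lemma bochner_has_integral_distr:
  fixes g :: "'q \<Rightarrow> 'x::real_normed_vector"
  assumes "finite_measure M" and \<Phi>: "\<Phi> \<in> measurable M N" and g: "g \<in> borel_measurable N"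
    and hg: "\<And>\<omega>. \<omega> \<in> space M \<Longrightarrow> h \<omega> = g (\<Phi> \<omega>)" and int: "bochner_has_integral M h x"
  shows "bochner_has_integral (distr M N \<Phi>) g x"
proof -
  interpret finite_measure M by fact
  interpret D: finite_measure "distr M N \<Phi>" by (rule finite_measure_distr[OF \<Phi>])
  from int obtain s where h: "h \<in> borel_measurable M"
    and s: "\<And>i. Bochner_Integration.simple_bochner_integrable M (s i)" "(\<lambda>i. \<integral>\<^sup>+\<omega>. norm (h \<omega> - s i \<omega>) \<partial>M) \<longlonglongrightarrow> 0"
      "(\<lambda>i. Bochner_Integration.simple_bochner_integral M (s i)) \<longlonglongrightarrow> x"
    by (rule bochner_has_integral.cases) blast
  have "finite (s i ` space M)" for i
    using s(1)[of i] by (auto elim!: simple_bochner_integrable.cases dest: simple_functionD)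
  then have "\<exists>t. simple_function N t \<and>
      (\<forall>\<omega>. \<forall>v\<in>insert 0 (s i ` space M). norm (g \<omega> - t \<omega>) \<le> norm (g \<omega> - v))" for i
    by (intro ex_nearest_point_simple_function g) auto
  then obtain t where t: "\<And>i. simple_function N (t i)"
    and near: "\<And>i \<omega> v. v \<in> insert 0 (s i ` space M) \<Longrightarrow> norm (g \<omega> - t i \<omega>) \<le> norm (g \<omega> - v)"
    by metis
  let ?D = "distr M N \<Phi>"
  have tD: "Bochner_Integration.simple_bochner_integrable ?D (t i)" for i
    using t[of i] by (auto intro!: simple_bochner_integrable.intros D.emeasure_finite
        simp: simple_function_def)
  have t\<Phi>: "simple_function M (\<lambda>\<omega>. t i (\<Phi> \<omega>))" for i
    using simple_function_comp[OF \<Phi> t[of i]] by (simp add: comp_def)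
  have t\<Phi>': "Bochner_Integration.simple_bochner_integrable M (\<lambda>\<omega>. t i (\<Phi> \<omega>))" for i
    using t\<Phi>[of i] by (auto intro!: simple_bochner_integrable.intros)
  have norms: "(\<integral>\<^sup>+\<omega>. norm (h \<omega> - t i (\<Phi> \<omega>)) \<partial>M) \<le> (\<integral>\<^sup>+\<omega>. norm (h \<omega> - s i \<omega>) \<partial>M)" for i
    by (intro nn_integral_mono ennreal_leI) (auto simp: hg intro!: near)
  have lim: "(\<lambda>i. \<integral>\<^sup>+\<omega>. norm (h \<omega> - t i (\<Phi> \<omega>)) \<partial>M) \<longlonglongrightarrow> 0"
    by (rule tendsto_sandwich[OF _ _ tendsto_const s(2)]) (auto intro!: always_eventually norms)
  have eq: "Bochner_Integration.simple_bochner_integral ?D (t i) = Bochner_Integration.simple_bochner_integral M (\<lambda>\<omega>. t i (\<Phi> \<omega>))" for i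
  proof -
    have meas: "measure ?D {\<omega> \<in> space ?D. t i \<omega> = y} = measure M {\<omega> \<in> space M. t i (\<Phi> \<omega>) = y}" for y
    proof -
      have "{\<omega> \<in> space N. t i \<omega> = y} \<in> sets N"
        using simple_functionD(2)[OF t[of i], of "{y}"] by (simp add: vimage_def Int_def conj_commute)
      moreover have "\<Phi> -` {\<omega> \<in> space N. t i \<omega> = y} \<inter> space M = {\<omega> \<in> space M. t i (\<Phi> \<omega>) = y}"
        using measurable_space[OF \<Phi>] by auto
      ultimately show ?thesis by (simp add: measure_distr[OF \<Phi>])
    qed
    have zero: "measure M {\<omega> \<in> space M. t i (\<Phi> \<omega>) = y} = 0"
      if "y \<notin> (\<lambda>\<omega>. t i (\<Phi> \<omega>)) ` space M" for y
    proof -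
      have "{\<omega> \<in> space M. t i (\<Phi> \<omega>) = y} = {}" using that by auto
      then show ?thesis by (simp only: measure_empty)
    qed
    show ?thesis
      unfolding simple_bochner_integral_def meas
      using measurable_space[OF \<Phi>] simple_functionD(1)[OF t[of i]]
      by (intro sum.mono_neutral_right) (auto simp: zero)
  qed
  let ?d = "\<lambda>i. Bochner_Integration.simple_bochner_integral M (\<lambda>\<omega>. t i (\<Phi> \<omega>)) - Bochner_Integration.simple_bochner_integral M (s i)"
  have "(\<lambda>i. ennreal (norm (?d i))) \<longlonglongrightarrow> 0"
  proof (rule tendsto_sandwich[OF _ _ tendsto_const])
    show "(\<lambda>i. (\<integral>\<^sup>+\<omega>. norm (h \<omega> - t i (\<Phi> \<omega>)) \<partial>M) + (\<integral>\<^sup>+\<omega>. norm (h \<omega> - s i \<omega>) \<partial>M)) \<longlonglongrightarrow> 0"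
      using tendsto_add[OF lim s(2)] by simp
  qed (auto intro!: always_eventually simple_bochner_integral_dist_le h s t\<Phi>')
  then have "(\<lambda>i. norm (?d i)) \<longlonglongrightarrow> 0"
    by (simp add: ennreal_0[symmetric] del: ennreal_0)
  then have "?d \<longlonglongrightarrow> 0"
    by (rule tendsto_norm_zero_cancel)
  from tendsto_add[OF this s(3)] have conv: "(\<lambda>i. Bochner_Integration.simple_bochner_integral ?D (t i)) \<longlonglongrightarrow> x"
    by (simp add: eq)
  have "(\<integral>\<^sup>+\<omega>. norm (g \<omega> - t i \<omega>) \<partial>?D) = (\<integral>\<^sup>+\<omega>. norm (h \<omega> - t i (\<Phi> \<omega>)) \<partial>M)" for i
    using measurable_norm_diff_simple[OF g t]
    by (subst nn_integral_distr[OF \<Phi>]) (auto intro!: nn_integral_cong simp: hg)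
  with lim have "(\<lambda>i. \<integral>\<^sup>+\<omega>. norm (g \<omega> - t i \<omega>) \<partial>?D) \<longlonglongrightarrow> 0" by simp
  from bochner_has_integral.intros[OF _ tD this conv] g show ?thesis by simp
qed

definition image_algebra :: "('p \<Rightarrow> 'q) \<Rightarrow> 'p measure \<Rightarrow> 'q measure" where
  "image_algebra \<Phi> Q =
    sigma (\<Phi> ` space Q) {B. B \<subseteq> \<Phi> ` space Q \<and> \<Phi> -` B \<inter> space Q \<in> sets Q}"

lemma space_image_algebra: "space (image_algebra \<Phi> Q) = \<Phi> ` space Q"
  unfolding image_algebra_def by (intro space_measure_of) auto

lemma sets_image_algebra:
  "sets (image_algebra \<Phi> Q) = {B. B \<subseteq> \<Phi> ` space Q \<and> \<Phi> -` B \<inter> space Q \<in> sets Q}"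
proof -
  have "sigma_algebra (\<Phi> ` space Q) {B. B \<subseteq> \<Phi> ` space Q \<and> \<Phi> -` B \<inter> space Q \<in> sets Q}"
    unfolding sigma_algebra_iff2
  proof (intro conjI ballI allI impI)
    fix B assume "B \<in> {B. B \<subseteq> \<Phi> ` space Q \<and> \<Phi> -` B \<inter> space Q \<in> sets Q}"
    then have "space Q - (\<Phi> -` B \<inter> space Q) \<in> sets Q" by auto
    moreover have "space Q - (\<Phi> -` B \<inter> space Q) = \<Phi> -` (\<Phi> ` space Q - B) \<inter> space Q" by auto
    ultimately show "\<Phi> ` space Q - B \<in> {B. B \<subseteq> \<Phi> ` space Q \<and> \<Phi> -` B \<inter> space Q \<in> sets Q}"
      by auto
  next
    fix A :: "nat \<Rightarrow> _" assume "range A \<subseteq> {B. B \<subseteq> \<Phi> ` space Q \<and> \<Phi> -` B \<inter> space Q \<in> sets Q}"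
    then have A: "A i \<subseteq> \<Phi> ` space Q" "\<Phi> -` A i \<inter> space Q \<in> sets Q" for i by auto
    then have "(\<Union>i. \<Phi> -` A i \<inter> space Q) \<in> sets Q" by (intro sets.countable_UN) auto
    moreover have "(\<Union>i. \<Phi> -` A i \<inter> space Q) = \<Phi> -` (\<Union>i. A i) \<inter> space Q" by auto
    moreover have "(\<Union>i. A i) \<subseteq> \<Phi> ` space Q" using A(1) by blast
    ultimately show "(\<Union>i. A i) \<in> {B. B \<subseteq> \<Phi> ` space Q \<and> \<Phi> -` B \<inter> space Q \<in> sets Q}"
      by simp
  qed auto
  then show ?thesis
    unfolding image_algebra_def by (rule sigma_algebra.sets_measure_of_eq)
qed

lemma measurable_image_algebra: "\<Phi> \<in> measurable Q (image_algebra \<Phi> Q)"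
  by (rule measurableI) (auto simp: space_image_algebra sets_image_algebra)

lemma measurable_from_image_algebra:
  assumes "(\<lambda>\<omega>. g (\<Phi> \<omega>)) \<in> measurable Q R"
  shows "g \<in> measurable (image_algebra \<Phi> Q) R"
proof (rule measurableI)
  show "g \<omega> \<in> space R" if "\<omega> \<in> space (image_algebra \<Phi> Q)" for \<omega>
    using that measurable_space[OF assms] by (auto simp: space_image_algebra)
  fix A assume "A \<in> sets R"
  from measurable_sets[OF assms this]
  show "g -` A \<inter> space (image_algebra \<Phi> Q) \<in> sets (image_algebra \<Phi> Q)"
    by (auto simp: space_image_algebra sets_image_algebra vimage_def Int_def elim: back_subst[of "\<lambda>S. S \<in> sets Q"])
qed

theorem radon_nikodym_all_types:
  fixes T :: "'x::banach \<Rightarrow>\<^sub>L 'y::banach"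
  assumes "radon_nikodym T"
  shows "radon_nikodym_on TYPE('p) T"
  unfolding radon_nikodym_on_def
proof (intro allI impI)
  fix P :: "'p measure" and F and X :: "nat \<Rightarrow> 'p \<Rightarrow> 'x"
  assume P: "prob_space P" and mart: "bochner_martingale P F X" and bdd: "L1_bounded P X"
  interpret prob_space P by fact
  define \<Phi> where "\<Phi> \<omega> = (\<lambda>n. X n \<omega>)" for \<omega>
  define N where "N = image_algebra \<Phi> P"
  define F' where "F' n = image_algebra \<Phi> (F n)" for n
  define P' where "P' = distr P N \<Phi>"
  have sub: "subalgebra P (F n)" for n
    using mart by (simp add: bochner_martingale_def)
  then have spF: "space (F n) = space P" for n
    by (simp add: subalgebra_def)
  have \<Phi>P: "\<Phi> \<in> measurable P N" unfolding N_def by (rule measurable_image_algebra)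
  have P': "prob_space P'" unfolding P'_def by (rule prob_space_distr[OF \<Phi>P])
  have intX: "\<exists>x. bochner_has_integral (restr_to_subalg P (F n)) (X n) x" for n
    using mart by (simp add: bochner_martingale_def bochner_integrable_def)
  have "X n \<in> borel_measurable (restr_to_subalg P (F n))" for n
    using intX[of n] by (auto simp: bochner_has_integral.simps)
  then have XF: "X n \<in> borel_measurable (F n)" for n
    by (subst (asm) measurable_cong_sets[OF sets_restr_to_subalg[OF sub] refl])
  have cF: "(\<lambda>\<omega>. \<omega> n) \<in> borel_measurable (F' n)" for n
    unfolding F'_def by (rule measurable_from_image_algebra) (simp add: \<Phi>_def XF)
  have XP: "X n \<in> borel_measurable P" for n
    by (rule measurable_from_subalg[OF sub XF])
  have cP: "(\<lambda>\<omega>. \<omega> n) \<in> borel_measurable N" for n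
    unfolding N_def by (rule measurable_from_image_algebra) (simp add: \<Phi>_def XP)
  have sub': "subalgebra P' (F' n)" for n
    using sub[of n] by (auto simp: subalgebra_def P'_def N_def F'_def space_image_algebra sets_image_algebra)
  have restr: "restr_to_subalg P' (F' n) = distr (restr_to_subalg P (F n)) (F' n) \<Phi>" for n
  proof (rule measure_eqI)
    have m: "\<Phi> \<in> measurable (restr_to_subalg P (F n)) (F' n)"
      unfolding F'_def measurable_cong_sets[OF sets_restr_to_subalg[OF sub] refl]
      by (rule measurable_image_algebra)
    show "sets (restr_to_subalg P' (F' n)) = sets (distr (restr_to_subalg P (F n)) (F' n) \<Phi>)"
      by (simp add: sets_restr_to_subalg[OF sub'])
    fix A assume "A \<in> sets (restr_to_subalg P' (F' n))"
    then have A: "A \<in> sets (F' n)" by (simp add: sets_restr_to_subalg[OF sub'])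
    then have AN: "A \<in> sets N" using sub'[of n] by (auto simp: subalgebra_def P'_def)
    have "\<Phi> -` A \<inter> space P \<in> sets (F n)"
      using A by (auto simp: F'_def sets_image_algebra spF)
    then have "emeasure (restr_to_subalg P (F n)) (\<Phi> -` A \<inter> space P) = emeasure P (\<Phi> -` A \<inter> space P)"
      by (rule emeasure_restr_to_subalg[OF sub])
    moreover have "emeasure P' A = emeasure P (\<Phi> -` A \<inter> space P)"
      unfolding P'_def by (rule emeasure_distr[OF \<Phi>P AN])
    ultimately show "emeasure (restr_to_subalg P' (F' n)) A =
        emeasure (distr (restr_to_subalg P (F n)) (F' n) \<Phi>) A"
      using A by (simp add: emeasure_restr_to_subalg[OF sub' A] emeasure_distr[OF m A] space_restr_to_subalg)
  qed
  have "bochner_martingale P' F' (\<lambda>n \<omega>. \<omega> n)"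
    unfolding bochner_martingale_def
  proof (intro conjI allI impI ballI)
    show "subalgebra P' (F' n)" for n by (rule sub')
    show "sets (F' m) \<subseteq> sets (F' n)" if "m \<le> n" for m n
    proof -
      have "sets (F m) \<subseteq> sets (F n)"
        using that mart unfolding bochner_martingale_def by blast
      then show ?thesis
        unfolding F'_def sets_image_algebra spF by blast
    qed
    show "bochner_integrable (restr_to_subalg P' (F' n)) (\<lambda>\<omega>. \<omega> n)" for n
    proof -
      have "\<Phi> \<in> measurable (restr_to_subalg P (F n)) (F' n)"
        unfolding F'_def measurable_cong_sets[OF sets_restr_to_subalg[OF sub] refl]
        by (rule measurable_image_algebra)
      moreover have "finite_measure (restr_to_subalg P (F n))"
        by (rule finite_measure_restr_to_subalg[OF sub]) unfold_locales
      moreover obtain x where "bochner_has_integral (restr_to_subalg P (F n)) (X n) x"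
        using intX by blast
      ultimately have "bochner_has_integral (distr (restr_to_subalg P (F n)) (F' n) \<Phi>) (\<lambda>\<omega>. \<omega> n) x"
        by (intro bochner_has_integral_distr[where h = "X n"] cF) (auto simp: \<Phi>_def)
      then show ?thesis unfolding restr bochner_integrable_def by blast
    qed
    fix m n :: nat and A assume "m \<le> n" and A: "A \<in> sets (F' m)"
    let ?A = "\<Phi> -` A \<inter> space P"
    have "?A \<in> sets (F m)"
      using A by (auto simp: F'_def sets_image_algebra spF)
    with mart \<open>m \<le> n\<close> obtain x where
      x: "bochner_has_integral P (\<lambda>\<omega>. indicator ?A \<omega> *\<^sub>R X m \<omega>) x"
         "bochner_has_integral P (\<lambda>\<omega>. indicator ?A \<omega> *\<^sub>R X n \<omega>) x"
      unfolding bochner_martingale_def by blast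
    have AN: "A \<in> sets N" using A sub'[of m] by (auto simp: subalgebra_def P'_def)
    have *: "bochner_has_integral P' (\<lambda>\<omega>. indicator A \<omega> *\<^sub>R \<omega> k) x"
      if "bochner_has_integral P (\<lambda>\<omega>. indicator ?A \<omega> *\<^sub>R X k \<omega>) x" for k
      unfolding P'_def
    proof (rule bochner_has_integral_distr[OF _ \<Phi>P _ _ that])
      show "finite_measure P" by unfold_locales
      have "(\<lambda>\<omega>. indicator ?A \<omega> *\<^sub>R X k \<omega>) \<in> borel_measurable P"
        using that by (auto simp: bochner_has_integral.simps)
      then show "(\<lambda>\<omega>. indicator A \<omega> *\<^sub>R \<omega> k) \<in> borel_measurable N"
        unfolding N_def
        by (intro measurable_from_image_algebra)
          (auto simp: \<Phi>_def indicator_def cong: measurable_cong)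
      show "indicator ?A \<omega> *\<^sub>R X k \<omega> = indicator A (\<Phi> \<omega>) *\<^sub>R \<Phi> \<omega> k" if "\<omega> \<in> space P" for \<omega>
        using that by (simp add: \<Phi>_def indicator_def)
    qed
    show "\<exists>x. bochner_has_integral P' (\<lambda>\<omega>. indicator A \<omega> *\<^sub>R \<omega> m) x \<and>
        bochner_has_integral P' (\<lambda>\<omega>. indicator A \<omega> *\<^sub>R \<omega> n) x"
      using * x by blast
  qed
  moreover have "L1_bounded P' (\<lambda>n \<omega>. \<omega> n)"
  proof -
    have "(\<integral>\<^sup>+\<omega>. norm (\<omega> n) \<partial>P') = (\<integral>\<^sup>+\<omega>. norm (X n \<omega>) \<partial>P)" for n
    proof -
      have "(\<lambda>\<omega>. norm (\<omega> n)) \<in> borel_measurable N"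
        using measurable_norm_diff_simple[OF cP[of n], of "\<lambda>_. 0"] by simp
      then show ?thesis
        unfolding P'_def by (subst nn_integral_distr[OF \<Phi>P]) (auto simp: \<Phi>_def)
    qed
    with bdd show ?thesis by (simp add: L1_bounded_def)
  qed
  ultimately have "AE \<omega> in P'. convergent (\<lambda>n. blinfun_apply T (\<omega> n))"
    using assms P' unfolding radon_nikodym_def radon_nikodym_on_def by blast
  from AE_distrD[OF \<Phi>P this[unfolded P'_def]]
  show "AE \<omega> in P. convergent (\<lambda>n. blinfun_apply T (X n \<omega>))"
    by (simp add: \<Phi>_def)
qed

end

theory Submission
  imports Defs
begin

text \<open>
  Suppose that \<open>f\<close> is curve-flat. On a compact set, chains of points whose small steps are charged their
  distance in the domain times an arbitrarily small factor nevertheless control the distance of the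
  images: limits of cheap chains are Lipschitz curves, along which \<open>f\<close> is flat. Hence a Lipschitz
  function that factors through \<open>f\<close> is, on a compact set, a uniform limit of locally flat functions,
  and families of locally flat functions at rapidly decreasing scales are weakly unconditionally Cauchy.
  A sequence in the free space (or a sequence of random elements of it) that is null on all such
  families is first localised on compact sets by a gliding hump and is then mapped by the
  linearization to a norm-null sequence. Weakly null sequences have this property. So do the differences
  of a martingale bounded in \<open>L\<^sub>1\<close>, because the means of a seminorm along a martingale increase; with
  stopping and the maximal inequality this gives almost sure convergence.

  If \<open>f\<close> is not curve-flat, a Vitali covering and a rising-sun argument yield a compact set \<open>A\<close> of positive
  measure and a Lipschitz curve on \<open>A\<close> whose image under \<open>f\<close> is bilipschitz. Subtracting the jumps across
  the gaps of \<open>A\<close> and reparametrising by the measure of \<open>A\<close> gives a Lipschitz path in the free space;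
  integrating against it embeds \<open>L\<^sub>1\<close>, and the linearization is bounded below on the image. On the other
  hand, Rademacher functions and the dyadic martingale of normalised indicators show that an operator
  that fixes a copy of \<open>L\<^sub>1\<close> is neither Dunford-Pettis nor Radon-Nikodym.
\<close>

section \<open>Compact sets of reals and flat curves\<close>

text \<open>The norm of \<open>linearization f\<close> at \<mu> is the supremum of \<mu> over the
  functions \<open>g\<close> composed with \<open>f\<close>, \<open>g\<close> 1-Lipschitz, so every
  estimate concerns families of Lipschitz functions. On a compact set such a function, minus a
  member of a finite net, splits into a locally flat part, a uniformly small part and a part
  vanishing on the compact set; curve-flatness is needed only to produce the flat part. Weakly
  unconditionally Cauchy families are the right tests because the sum of their seminorms is bounded
  by a multiple of the norm: this bound can be integrated, and along a martingale all terms can be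
  moved to one common time.

  A deterministic sequence is a random one over a one-point space, so a single result,
  \<open>curve_flat_null\<close>, serves both operator properties. It requires in addition that each
  fixed scalar functional tends to zero in mean. For martingale increments this can fail under mere
  boundedness in mean, and that is the reason for stopping: a stopped martingale is dominated by an
  integrable function.\<close>

lemma pseudometric_extension:
  fixes D :: "'a \<Rightarrow> 'a \<Rightarrow> real" and v :: "'a \<Rightarrow> real"
  assumes refl: "\<And>x. D x x = 0" and sym: "\<And>x y. D x y = D y x"
    and tri: "\<And>x y z. D x z \<le> D x y + D y z"
    and "S \<noteq> {}" and v: "\<And>p q. p \<in> S \<Longrightarrow> q \<in> S \<Longrightarrow> v p \<le> v q + D p q + \<eta>"
  obtains u where "\<And>x y. \<bar>u x - u y\<bar> \<le> D x y" "\<And>p. p \<in> S \<Longrightarrow> \<bar>u p - v p\<bar> \<le> \<eta>"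
proof
  obtain p0 where p0: "p0 \<in> S" using \<open>S \<noteq> {}\<close> by auto
  have eta: "0 \<le> \<eta>" using v[OF p0 p0] by (simp add: refl)
  \<comment> \<open>McShane's formula: u is an infimum of functions that are 1-Lipschitz for D,
    whatever v is. The defect \<eta> is therefore paid only in the agreement with v on S, not in the
    Lipschitz bound.\<close>
  define u where "u x = (INF q\<in>S. v q + D q x)" for x
  have bdd: "bdd_below ((\<lambda>q. v q + D q x) ` S)" for x
  proof (rule bdd_belowI2)
    show "v p0 - D p0 x - \<eta> \<le> v q + D q x" if "q \<in> S" for q
      using v[OF p0 that] tri[of p0 q x] sym[of q x] by linarith
  qed
  have le: "u x \<le> u y + D x y" for x y
  proof -
    have "u x - D x y \<le> v q + D q y" if "q \<in> S" for q
    proof -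
      have "u x \<le> v q + D q x" unfolding u_def by (rule cINF_lower[OF bdd that])
      with tri[of q x y] sym[of x y] show ?thesis using tri[of q y x] by linarith
    qed
    then have "u x - D x y \<le> u y"
      unfolding u_def[of y] by (intro cINF_greatest) (auto simp: \<open>S \<noteq> {}\<close>)
    then show ?thesis by linarith
  qed
  show "\<bar>u x - u y\<bar> \<le> D x y" for x y
    using le[of x y] le[of y x] sym[of x y] by linarith
  show "\<bar>u p - v p\<bar> \<le> \<eta>" if p: "p \<in> S" for p
  proof -
    have "u p \<le> v p" using cINF_lower[OF bdd p, of p] by (simp add: u_def refl)
    moreover have "v p - \<eta> \<le> u p"
      unfolding u_def using \<open>S \<noteq> {}\<close> v[OF p] sym by (intro cINF_greatest) (auto, smt (verit))
    ultimately show ?thesis using eta by linarith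
  qed
qed

lemma lipschitz_extension_real:
  fixes v :: "'a::metric_space \<Rightarrow> real"
  assumes v: "C-lipschitz_on S v"
  obtains u where "C-lipschitz_on UNIV u" "\<And>x. x \<in> S \<Longrightarrow> u x = v x"
proof (cases "S = {}")
  case True
  show ?thesis
  proof (rule that)
    show "C-lipschitz_on UNIV (\<lambda>_. 0::real)"
      using lipschitz_on_nonneg[OF v] by (auto intro: lipschitz_onI)
  qed (use True in auto)
next
  case False
  have C: "0 \<le> C" by (rule lipschitz_on_nonneg[OF v])
  obtain u where u: "\<And>x y. \<bar>u x - u y\<bar> \<le> C * dist x y" "\<And>p. p \<in> S \<Longrightarrow> \<bar>u p - v p\<bar> \<le> 0"
  proof (rule pseudometric_extension[where D = "\<lambda>x y. C * dist x y" and v = v and \<eta> = 0, OF _ _ _ False])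
    show "C * dist x z \<le> C * dist x y + C * dist y z" for x y z :: 'a
      using mult_left_mono[OF dist_triangle[of x z y] C] by (simp add: algebra_simps)
    show "v p \<le> v q + C * dist p q + 0" if "p \<in> S" "q \<in> S" for p q
      using lipschitz_onD[OF v that] by (simp add: dist_real_def)
  qed (auto simp: dist_commute)
  show ?thesis
    by (rule that[of u]) (use u C in \<open>auto intro!: lipschitz_onI simp: dist_real_def\<close>)
qed

text \<open>
  Continuous induction along \<open>K\<close>: the bound propagates to the right across a gap of \<open>K\<close>, from a point
  of right flatness, and at rate \<open>L\<close> inside the exceptional open set \<open>U\<close>.
\<close>

lemma dist_le_gaps:
  fixes h :: "real \<Rightarrow> 'b::metric_space"
  assumes K: "compact K" "a \<in> K" "b \<in> K" "a \<le> b" and L: "L-lipschitz_on K h"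
    and "open U" and c: "0 \<le> c"
    and gap: "\<And>p q. p \<in> K \<Longrightarrow> q \<in> K \<Longrightarrow> p < q \<Longrightarrow> {p<..<q} \<inter> K = {} \<Longrightarrow> a \<le> p \<Longrightarrow> q \<le> b \<Longrightarrow>
      dist (h p) (h q) \<le> c * (q - p)"
    and flat: "\<And>x. x \<in> K \<Longrightarrow> x \<notin> U \<Longrightarrow>
      \<exists>r>0. \<forall>y\<in>K. x < y \<and> y < x + r \<longrightarrow> dist (h x) (h y) \<le> c * (y - x)"
  shows "dist (h a) (h b) \<le> c * (b - a) + L * measure lborel (U \<inter> {a..b})"
proof -
  have L0: "0 \<le> L" by (rule lipschitz_on_nonneg[OF L])
  define m where "m s = measure lborel (U \<inter> {a..s})" for s
  have fm: "U \<inter> {s..t} \<in> fmeasurable lborel" for s t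
  proof (rule fmeasurableI2)
    show "{s..t} \<in> fmeasurable lborel" by (rule fmeasurableI) (cases "s \<le> t"; simp)+
  qed (use \<open>open U\<close> in auto)
  have m_mono: "m s \<le> m t" if "s \<le> t" for s t
    unfolding m_def using that fm[of a t] \<open>open U\<close> by (intro measure_mono_fmeasurable) auto
  have m_add: "m s + (t - s) \<le> m t" if "a \<le> s" "s \<le> t" "{s..t} \<subseteq> U" for s t
  proof -
    have "m s + (t - s) = measure lborel (U \<inter> {a..s}) + measure lborel {s<..t}"
      using that by (simp add: m_def)
    also have "\<dots> = measure lborel (U \<inter> {a..s} \<union> {s<..t})"
    proof (rule measure_Union[symmetric])
      show "emeasure lborel (U \<inter> {a..s}) \<noteq> \<infinity>" using fm[of a s] by (auto simp: fmeasurable_def)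
    qed (use \<open>open U\<close> that in auto)
    also have "\<dots> \<le> m t"
      unfolding m_def using that fm[of a t] \<open>open U\<close> by (intro measure_mono_fmeasurable) auto
    finally show ?thesis .
  qed
  \<comment> \<open>\<open>B s\<close> is the distance allowed between a and s; it increases with s.
    The points of K reached within this allowance form S, and the supremum of S is again such a
    point.\<close>
  define B where "B s = c * (s - a) + L * m s" for s
  have B_step: "B s + dist (h s) (h t) \<le> B t"
    if "s \<le> t" "a \<le> s" "dist (h s) (h t) \<le> c * (t - s)" for s t
    using that mult_left_mono[OF m_mono[OF that(1)] L0] by (simp add: B_def algebra_simps)
  have B_mono: "B s \<le> B t" if "s \<le> t" for s t
    unfolding B_def using that c L0 m_mono[OF that] by (intro add_mono mult_left_mono) auto
  define S where "S = {s \<in> K \<inter> {a..b}. dist (h a) (h s) \<le> B s}"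
  have aS: "a \<in> S" using K c L0 by (auto simp: S_def B_def m_def)
  have S_bdd: "bdd_above S" by (auto simp: S_def bdd_above_def)
  define t where "t = Sup S"
  have tS: "t \<in> S"
  proof -
    have "t \<in> closure S" unfolding t_def using aS S_bdd by (intro closure_contains_Sup) auto
    then obtain s where s: "\<And>n::nat. s n \<in> S" "s \<longlonglongrightarrow> t" by (auto simp: closure_sequential)
    have sK: "s n \<in> K \<inter> {a..b}" for n using s(1)[of n] by (auto simp: S_def)
    then have tK: "t \<in> K \<inter> {a..b}"
      using s(2) K(1) by (intro closed_sequentially[of "K \<inter> {a..b}" s t]) (auto intro: compact_imp_closed)
    have "continuous_on K h" by (rule lipschitz_on_continuous_on[OF L])
    then have "(\<lambda>n. h (s n)) \<longlonglongrightarrow> h t"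
      using s(2) sK tK by (auto simp: continuous_on_sequentially comp_def)
    then have "(\<lambda>n. dist (h a) (h (s n))) \<longlonglongrightarrow> dist (h a) (h t)" by (intro tendsto_intros)
    moreover have "dist (h a) (h (s n)) \<le> B t" for n
      using s(1)[of n] B_mono[of "s n" t] cSup_upper[OF s(1) S_bdd, of n] by (auto simp: S_def t_def)
    ultimately have "dist (h a) (h t) \<le> B t" by (intro LIMSEQ_le_const2[of _ _ "B t"]) auto
    with tK show ?thesis by (auto simp: S_def)
  qed
  then have tK: "t \<in> K" "a \<le> t" "t \<le> b" "dist (h a) (h t) \<le> B t" by (auto simp: S_def)
  have ext: False if "y \<in> K" "t < y" "y \<le> b" "dist (h t) (h y) \<le> B y - B t" for y
  proof -
    have "y \<in> S" using that tK dist_triangle[of "h a" "h y" "h t"] by (auto simp: S_def)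
    from cSup_upper[OF this S_bdd] that show False by (simp add: t_def)
  qed
  have "t = b"
  proof (rule ccontr)
    assume "t \<noteq> b"
    then have "t < b" using tK by simp
    let ?R = "K \<inter> {t<..b}"
    \<comment> \<open>The next point of K to the right of t. If q > t there is a gap to cross; if q
      = t, points of K accumulate at t from the right, and flatness or the exceptional set extends
      the bound.\<close>
    define q where "q = Inf ?R"
    have ne: "?R \<noteq> {}" using K \<open>t < b\<close> by auto
    have bb: "bdd_below ?R" by (intro bdd_belowI[of _ t]) auto
    have tq: "t \<le> q" unfolding q_def using ne by (intro cInf_greatest) auto
    show False
    proof (cases "q = t")
      case False
      with tq have "t < q" by simp
      have "q \<in> closure ?R" unfolding q_def using ne bb by (intro closure_contains_Inf)
      moreover have "closure ?R \<subseteq> K \<inter> {t..b}"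
        using K(1) by (intro closure_minimal) (auto intro: compact_imp_closed)
      ultimately have q: "q \<in> K" "q \<le> b" by auto
      have "{t<..<q} \<inter> K = {}"
      proof (rule ccontr)
        assume "{t<..<q} \<inter> K \<noteq> {}"
        then obtain y where y: "t < y" "y < q" "y \<in> K" by auto
        then have "y \<in> ?R" using q by auto
        from cInf_lower[OF this bb] y show False by (simp add: q_def)
      qed
      from gap[OF tK(1) q(1) \<open>t < q\<close> this tK(2) q(2)]
      have "dist (h t) (h q) \<le> c * (q - t)" .
      from B_step[OF _ tK(2) this] ext[OF q(1) \<open>t < q\<close> q(2)] \<open>t < q\<close> show False by auto
    next
      case True
      have near: "\<exists>y\<in>?R. y < t + r" if "r > 0" for r
      proof (rule ccontr)
        assume "\<not> ?thesis"
        then have "t + r \<le> q" unfolding q_def using ne by (intro cInf_greatest) force+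
        with True that show False by simp
      qed
      show False
      proof (cases "t \<in> U")
        case False
        from flat[OF tK(1) this] obtain r where r: "r > 0"
          "\<And>y. y \<in> K \<Longrightarrow> t < y \<Longrightarrow> y < t + r \<Longrightarrow> dist (h t) (h y) \<le> c * (y - t)" by blast
        from near[OF r(1)] obtain y where y: "y \<in> K" "t < y" "y \<le> b" "y < t + r" by auto
        from B_step[OF _ tK(2) r(2)[OF y(1,2,4)]] y ext[OF y(1-3)] show False by auto
      next
        case True
        with \<open>open U\<close> obtain r where r: "r > 0" "ball t r \<subseteq> U" by (auto simp: open_contains_ball)
        from near[OF r(1)] obtain y where y: "y \<in> K" "t < y" "y \<le> b" "y < t + r" by auto
        have "{t..y} \<subseteq> U" using r(2) y by (auto simp: subset_iff dist_real_def)
        from m_add[OF tK(2) _ this] y have "m t + (y - t) \<le> m y" by simp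
        from mult_left_mono[OF this L0] have "L * (y - t) \<le> L * m y - L * m t" by (simp add: algebra_simps)
        moreover have "c * (t - a) \<le> c * (y - a)" using y c by (intro mult_left_mono) auto
        moreover have "dist (h t) (h y) \<le> L * (y - t)"
          using lipschitz_onD[OF L tK(1) y(1)] y by (simp add: dist_real_def)
        ultimately have "dist (h t) (h y) \<le> B y - B t" by (simp add: B_def)
        from ext[OF y(1-3) this] show False .
      qed
    qed
  qed
  with tK(4) show ?thesis by (simp add: B_def m_def)
qed

section \<open>Chain pseudometrics: the greatest pseudometric below a symmetric cost\<close>

definition chain_dist :: "('a \<Rightarrow> 'a \<Rightarrow> real) \<Rightarrow> 'a \<Rightarrow> 'a \<Rightarrow> real" where
  "chain_dist c x y = Inf {\<Sum>i<n. c (z i) (z (Suc i)) | z n. z 0 = x \<and> z n = y}"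

context
  fixes c :: "'a \<Rightarrow> 'a \<Rightarrow> real"
  assumes nonneg: "\<And>x y. 0 \<le> c x y" and sym: "\<And>x y. c x y = c y x"
begin

lemma chain_bdd_below: "bdd_below {\<Sum>i<n. c (z i) (z (Suc i)) | z n. z 0 = x \<and> z n = y}"
  by (rule bdd_belowI[of _ 0]) (auto intro: sum_nonneg nonneg)

lemma chain_dist_le_sum:
  fixes z :: "nat \<Rightarrow> 'a"
  shows "chain_dist c (z 0) (z n) \<le> (\<Sum>i<n. c (z i) (z (Suc i)))"
  unfolding chain_dist_def by (rule cInf_lower[OF _ chain_bdd_below]) auto

text \<open>Cutting a chain at one of its points: every point of a nearly optimal chain lies nearly
  between the two ends.\<close>

lemma chain_dist_le_sum_between:
  fixes z :: "nat \<Rightarrow> 'a"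
  assumes "i \<le> n"
  shows "chain_dist c (z 0) (z i) + chain_dist c (z i) (z n) \<le> (\<Sum>i<n. c (z i) (z (Suc i)))"
proof -
  have "chain_dist c (z i) (z n) \<le> (\<Sum>j<n - i. c (z (j + i)) (z (Suc j + i)))"
    using chain_dist_le_sum[of "\<lambda>j. z (j + i)" "n - i"] assms by simp
  also have "\<dots> = (\<Sum>j\<in>{i..<n}. c (z j) (z (Suc j)))"
    using sum.shift_bounds_nat_ivl[of "\<lambda>j. c (z j) (z (Suc j))" 0 i "n - i"] assms
    by (simp add: lessThan_atLeast0)
  finally show ?thesis
    using chain_dist_le_sum[of z i] sum.atLeastLessThan_concat[of 0 i n "\<lambda>j. c (z j) (z (Suc j))"] assms
    by (simp add: lessThan_atLeast0)
qed

lemma chain_dist_le: "chain_dist c x y \<le> c x y"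
  using chain_dist_le_sum[of "\<lambda>i. if i = 0 then x else y" 1] by simp

lemma chain_nonempty: "{\<Sum>i<n. c (z i) (z (Suc i)) | z n. z 0 = x \<and> z n = y} \<noteq> {}"
proof -
  have "c x y \<in> {\<Sum>i<n. c (z i) (z (Suc i)) | z n. z 0 = x \<and> z n = y}"
    by (rule CollectI, rule exI[of _ "\<lambda>i. if i = 0 then x else y"], rule exI[of _ 1]) simp
  then show ?thesis by blast
qed

lemma chain_dist_greatest:
  assumes "\<And>z n. z 0 = x \<Longrightarrow> z n = y \<Longrightarrow> b \<le> (\<Sum>i<n. c (z i) (z (Suc i)))"
  shows "b \<le> chain_dist c x y"
  unfolding chain_dist_def by (rule cInf_greatest[OF chain_nonempty]) (use assms in auto)

lemma chain_dist_approx: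
  assumes "chain_dist c x y < b"
  obtains z n where "z 0 = x" "z n = y" "(\<Sum>i<n. c (z i) (z (Suc i))) < b"
  using assms chain_dist_greatest[of x y b] by (meson not_le)

lemma chain_dist_nonneg: "0 \<le> chain_dist c x y"
  by (rule chain_dist_greatest) (auto intro: sum_nonneg nonneg)

lemma chain_dist_refl: "chain_dist c x x = 0"
  using chain_dist_le_sum[of "\<lambda>_. x" 0] chain_dist_nonneg[of x x] by simp

lemma chain_dist_sym_le: "chain_dist c y x \<le> chain_dist c x y"
proof (rule chain_dist_greatest)
  fix z :: "nat \<Rightarrow> 'a" and n assume z: "z 0 = x" "z n = y"
  have "chain_dist c y x \<le> (\<Sum>i<n. c (z (n - i)) (z (n - Suc i)))"
    using chain_dist_le_sum[of "\<lambda>i. z (n - i)" n] z by simp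
  also have "\<dots> = (\<Sum>i<n. c (z (Suc (n - Suc i))) (z (n - Suc i)))"
    by (intro sum.cong) (auto simp: Suc_diff_Suc)
  also have "\<dots> = (\<Sum>i<n. c (z (Suc i)) (z i))"
    by (rule sum.nat_diff_reindex)
  finally show "chain_dist c y x \<le> (\<Sum>i<n. c (z i) (z (Suc i)))" by (simp add: sym)
qed

lemma chain_dist_sym: "chain_dist c x y = chain_dist c y x"
  by (intro antisym chain_dist_sym_le)

lemma chain_dist_triangle: "chain_dist c x w \<le> chain_dist c x y + chain_dist c y w"
proof -
  have *: "chain_dist c x w \<le> (\<Sum>i<n. c (z i) (z (Suc i))) + (\<Sum>i<m. c (z' i) (z' (Suc i)))"
    if "z 0 = x" "z n = y" "z' 0 = y" "z' m = w" for z z' :: "nat \<Rightarrow> 'a" and n m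
  proof -
    define t where "t i = (if i \<le> n then z i else z' (i - n))" for i
    have "chain_dist c x w \<le> (\<Sum>i<n + m. c (t i) (t (Suc i)))"
      using chain_dist_le_sum[of t "n + m"] that by (auto simp: t_def split: if_splits)
    also have "\<dots> = (\<Sum>i<n. c (t i) (t (Suc i))) + (\<Sum>i<m. c (t (n + i)) (t (Suc (n + i))))"
      by (induction m) simp_all
    also have "(\<Sum>i<n. c (t i) (t (Suc i))) = (\<Sum>i<n. c (z i) (z (Suc i)))"
      by (intro sum.cong) (auto simp: t_def)
    also have "(\<Sum>i<m. c (t (n + i)) (t (Suc (n + i)))) = (\<Sum>i<m. c (z' i) (z' (Suc i)))"
    proof (intro sum.cong refl)
      have "t (n + i) = z' i" for i using that by (cases i) (auto simp: t_def)
      from this[of i] this[of "Suc i"] show "c (t (n + i)) (t (Suc (n + i))) = c (z' i) (z' (Suc i))" for i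
        by simp (metis \<open>\<And>i. t (n + i) = z' i\<close> add_Suc_right)
    qed
    finally show ?thesis .
  qed
  have "chain_dist c x w - chain_dist c y w \<le> chain_dist c x y"
  proof (rule chain_dist_greatest)
    fix z :: "nat \<Rightarrow> 'a" and n assume z: "z 0 = x" "z n = y"
    have "chain_dist c x w - (\<Sum>i<n. c (z i) (z (Suc i))) \<le> chain_dist c y w"
      by (rule chain_dist_greatest) (use *[OF z] in \<open>simp add: algebra_simps\<close>)
    then show "chain_dist c x w - chain_dist c y w \<le> (\<Sum>i<n. c (z i) (z (Suc i)))" by simp
  qed
  then show ?thesis by simp
qed

text \<open>Telescoping along a chain. Lower bounds for chain distances are obtained by exhibiting a
  suitable test function \<phi>.\<close>

lemma chain_dist_lower:
  fixes \<phi> :: "'a \<Rightarrow> real"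
  assumes "\<And>p q. \<bar>\<phi> p - \<phi> q\<bar> \<le> c p q"
  shows "\<bar>\<phi> x - \<phi> y\<bar> \<le> chain_dist c x y"
proof (rule chain_dist_greatest)
  fix z :: "nat \<Rightarrow> 'a" and n assume z: "z 0 = x" "z n = y"
  have "\<bar>\<phi> (z 0) - \<phi> (z n)\<bar> = \<bar>\<Sum>i<n. \<phi> (z i) - \<phi> (z (Suc i))\<bar>"
    by (simp add: sum_lessThan_telescope'[where f = "\<lambda>i. \<phi> (z i)"])
  also have "\<dots> \<le> (\<Sum>i<n. c (z i) (z (Suc i)))"
    by (rule order_trans[OF sum_abs sum_mono]) (rule assms)
  finally show "\<bar>\<phi> x - \<phi> y\<bar> \<le> (\<Sum>i<n. c (z i) (z (Suc i)))" using z by simp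
qed

end

lemma chain_dist_mono:
  assumes "\<And>x y. 0 \<le> c x y" and "\<And>x y. c x y \<le> c' x y"
  shows "chain_dist c x y \<le> chain_dist c' x y"
proof -
  have "chain_dist c x y \<le> (\<Sum>i<n. c' (z i) (z (Suc i)))" if "z 0 = x" "z n = y" for z n
  proof -
    have "chain_dist c x y \<le> (\<Sum>i<n. c (z i) (z (Suc i)))"
      unfolding chain_dist_def using that assms(1)
      by (intro cInf_lower bdd_belowI[of _ 0]) (auto intro: sum_nonneg)
    also have "\<dots> \<le> (\<Sum>i<n. c' (z i) (z (Suc i)))" by (intro sum_mono assms(2))
    finally show ?thesis .
  qed
  moreover have "{\<Sum>i<n. c' (z i) (z (Suc i)) | z n. z 0 = x \<and> z n = y} \<noteq> {}"
proof -
  have "c' x y \<in> {\<Sum>i<n. c' (z i) (z (Suc i)) | z n. z 0 = x \<and> z n = y}"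
    by (rule CollectI, rule exI[of _ "\<lambda>i. if i = 0 then x else y"], rule exI[of _ 1]) simp
  then show ?thesis by blast
qed
  ultimately show ?thesis
    unfolding chain_dist_def[of c'] by (intro cInf_greatest) auto
qed

section \<open>Distances with a discount for short steps near a compact set\<close>

lemma tendsto_dist_0_transfer:
  fixes u v :: "nat \<Rightarrow> 'a::metric_space"
  assumes "(\<lambda>n. dist (u n) (v n)) \<longlonglongrightarrow> 0" and "v \<longlonglongrightarrow> l"
  shows "u \<longlonglongrightarrow> l"
proof -
  have "(\<lambda>n. dist (u n) (v n) + dist (v n) l) \<longlonglongrightarrow> 0"
    by (intro tendsto_add_zero assms(1) tendsto_dist_iff[THEN iffD1, OF assms(2)])
  then have "(\<lambda>n. dist (u n) l) \<longlonglongrightarrow> 0"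
    by (rule Lim_null_comparison[rotated]) (auto intro!: always_eventually dist_triangle)
  then show ?thesis by (rule tendsto_dist_iff[THEN iffD2])
qed

text \<open>The discount applies in a neighbourhood of K and not only on K: a function that is
  1-Lipschitz for the chain distance is then \<epsilon>-flat on an open set around K, which the
  summation over scales in \<open>wuc_flat_class\<close> relies on.\<close>

definition flat_cost :: "'a::metric_space set \<Rightarrow> real \<Rightarrow> real \<Rightarrow> 'a \<Rightarrow> 'a \<Rightarrow> real" where
  "flat_cost K \<epsilon> \<delta> p q =
    (if infdist p K < \<delta> \<and> infdist q K < \<delta> \<and> dist p q < \<delta> then \<epsilon> * dist p q else dist p q)"


context
  fixes K :: "'a::metric_space set" and \<epsilon> :: real
  assumes eps: "0 < \<epsilon>" "\<epsilon> \<le> 1"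
begin

lemma flat_cost_bounds:
  "0 \<le> flat_cost K \<epsilon> \<delta> p q" "flat_cost K \<epsilon> \<delta> p q = flat_cost K \<epsilon> \<delta> q p"
  "flat_cost K \<epsilon> \<delta> p q \<le> dist p q" "\<epsilon> * dist p q \<le> flat_cost K \<epsilon> \<delta> p q"
  using eps mult_right_mono[of \<epsilon> 1 "dist p q"] by (auto simp: flat_cost_def dist_commute)

lemma flat_cost_antimono: "\<delta> \<le> \<delta>' \<Longrightarrow> flat_cost K \<epsilon> \<delta>' p q \<le> flat_cost K \<epsilon> \<delta> p q"
  using eps mult_right_mono[of \<epsilon> 1 "dist p q"] by (auto simp: flat_cost_def)

definition fdist :: "nat \<Rightarrow> 'a \<Rightarrow> 'a \<Rightarrow> real" where
  "fdist n = chain_dist (flat_cost K \<epsilon> (inverse (real (Suc n))))"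

lemma fdist_le_dist: "fdist n x y \<le> dist x y"
  unfolding fdist_def by (rule order_trans[OF chain_dist_le]) (auto intro: flat_cost_bounds)

text \<open>The test function for \<open>chain_dist_lower\<close> is \<epsilon> times the distance
  to x.\<close>

lemma fdist_ge: "\<epsilon> * dist x y \<le> fdist n x y"
proof -
  have "\<bar>\<epsilon> * dist x x - \<epsilon> * dist x y\<bar> \<le> fdist n x y"
    unfolding fdist_def
  proof (rule chain_dist_lower)
    fix p q
    have "\<bar>\<epsilon> * dist x p - \<epsilon> * dist x q\<bar> = \<epsilon> * \<bar>dist x p - dist x q\<bar>"
      using eps by (simp add: abs_mult right_diff_distrib[symmetric])
    also have "\<dots> \<le> \<epsilon> * dist p q"
      using eps abs_dist_diff_le[of p x q] by (intro mult_left_mono) (auto simp: dist_commute)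
    also note flat_cost_bounds(4)
    finally show "\<bar>\<epsilon> * dist x p - \<epsilon> * dist x q\<bar> \<le> flat_cost K \<epsilon> (inverse (real (Suc n))) p q" .
  qed (auto intro: flat_cost_bounds)
  then show ?thesis using eps by (simp add: abs_mult)
qed

lemma fdist_triangle: "fdist n x z \<le> fdist n x y + fdist n y z"
  unfolding fdist_def by (rule chain_dist_triangle) (auto intro: flat_cost_bounds)

lemma fdist_sym: "fdist n x y = fdist n y x"
  unfolding fdist_def by (rule chain_dist_sym) (auto intro: flat_cost_bounds)

lemma fdist_mono: "m \<le> n \<Longrightarrow> fdist m x y \<le> fdist n x y"
  unfolding fdist_def by (rule chain_dist_mono) (auto intro!: flat_cost_bounds flat_cost_antimono simp: field_simps)

lemma fdist_perturb: "fdist n x y \<le> fdist n x' y' + dist x x' + dist y y'"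
  using fdist_triangle[of n x y x'] fdist_triangle[of n x' y y'] fdist_le_dist[of n x x']
    fdist_le_dist[of n y' y] dist_commute[of y y'] by linarith

text \<open>The discount zone shrinks to K as n grows, so the distances increase; the limit is a
  metric between \<epsilon> times the original one and the original one.\<close>

definition ldist :: "'a \<Rightarrow> 'a \<Rightarrow> real" where "ldist x y = (SUP n. fdist n x y)"

lemma fdist_LIMSEQ: "(\<lambda>n. fdist n x y) \<longlonglongrightarrow> ldist x y"
  unfolding ldist_def
  by (rule LIMSEQ_incseq_SUP) (auto intro!: bdd_aboveI[of _ "dist x y"] fdist_le_dist simp: incseq_def fdist_mono)

lemma fdist_le_ldist: "fdist n x y \<le> ldist x y"
  unfolding ldist_def by (rule cSUP_upper) (auto intro!: bdd_aboveI[of _ "dist x y"] fdist_le_dist)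

lemma ldist_le_dist: "ldist x y \<le> dist x y"
  by (rule LIMSEQ_le_const2[OF fdist_LIMSEQ]) (auto intro: fdist_le_dist)

lemma ldist_ge: "\<epsilon> * dist x y \<le> ldist x y"
  by (rule order_trans[OF fdist_ge fdist_le_ldist[of 0]])

lemma ldist_nonneg: "0 \<le> ldist x y"
  using ldist_ge[of x y] eps by (meson less_eq_real_def mult_nonneg_nonneg order_trans zero_le_dist)

lemma ldist_eq_0: "ldist x y = 0 \<longleftrightarrow> x = y"
  using ldist_ge[of x y] ldist_le_dist[of x y] eps ldist_nonneg[of x y]
  by (auto simp: mult_le_0_iff)

lemma ldist_triangle: "ldist x z \<le> ldist x y + ldist y z"
  by (rule LIMSEQ_le[OF fdist_LIMSEQ tendsto_add[OF fdist_LIMSEQ fdist_LIMSEQ]])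
    (auto intro: fdist_triangle)

lemma ldist_sym: "ldist x y = ldist y x"
  unfolding ldist_def by (subst fdist_sym) simp

lemma tendsto_ldist:
  assumes "u \<longlonglongrightarrow> x" "v \<longlonglongrightarrow> y"
  shows "(\<lambda>n. ldist (u n) (v n)) \<longlonglongrightarrow> ldist x y"
proof -
  have *: "ldist x y \<le> ldist x' y' + (dist x x' + dist y y')" for x x' y y'
    using ldist_triangle[of x y x'] ldist_triangle[of x' y y'] ldist_le_dist[of x x']
      ldist_le_dist[of y' y] dist_commute[of y y'] by linarith
  have "(\<lambda>n. ldist (u n) (v n) - ldist x y) \<longlonglongrightarrow> 0"
  proof (rule Lim_null_comparison)
    have "norm (ldist (u n) (v n) - ldist x y) \<le> dist (u n) x + dist (v n) y" for n
      using *[of "u n" "v n" x y] *[of x y "u n" "v n"] dist_commute[of x "u n"] dist_commute[of y "v n"]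
      by auto
    then show "\<forall>\<^sub>F n in sequentially. norm (ldist (u n) (v n) - ldist x y) \<le> dist (u n) x + dist (v n) y"
      by simp
    show "(\<lambda>n. dist (u n) x + dist (v n) y) \<longlonglongrightarrow> 0"
      by (intro tendsto_add_zero assms[THEN tendsto_dist_iff[THEN iffD1]])
  qed
  then show ?thesis by (simp add: LIM_zero_iff)
qed

text \<open>
  Near-optimal chains for \<open>fdist n\<close> either pass through points of the shrinking neighbourhoods of \<open>K\<close>
  that stay away from \<open>p\<close> and \<open>q\<close>, and these accumulate at a point between \<open>p\<close> and \<open>q\<close>, or the chain
  gets from \<open>p\<close> to \<open>q\<close> using steps of full cost only.
\<close>

lemma ldist_gap:
  assumes K: "compact K" "K \<noteq> {}"
    and no_between: "\<And>z. z \<noteq> p \<Longrightarrow> z \<noteq> q \<Longrightarrow> ldist p q < ldist p z + ldist z q"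
  shows "dist p q \<le> ldist p q"
proof (cases "p = q")
  case False
  have main: "dist p q - 2 * \<sigma> \<le> ldist p q" if \<sigma>: "0 < \<sigma>" "2 * \<sigma> < dist p q" for \<sigma>
  proof (rule ccontr)
    assume "\<not> ?thesis"
    then have less: "ldist p q < dist p q - 2 * \<sigma>" by simp
    define D where "D = dist p q - 2 * \<sigma>"
    have "\<exists>z. infdist z K < inverse (real (Suc n)) \<and> \<sigma> \<le> dist p z \<and> \<sigma> \<le> dist q z \<and>
        fdist n p z + fdist n z q \<le> ldist p q + inverse (real (Suc n))"
      if n: "inverse (real (Suc n)) \<le> D" for n
    proof -
      let ?\<delta> = "inverse (real (Suc n))"
      let ?c = "flat_cost K \<epsilon> ?\<delta>"
      have "fdist n p q < min D (ldist p q + ?\<delta>)"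
        using fdist_le_ldist[of n p q] less by (auto simp: D_def intro: le_less_trans)
      then obtain z N where z: "z 0 = p" "z N = q"
        and cost: "(\<Sum>i<N. ?c (z i) (z (Suc i))) < min D (ldist p q + ?\<delta>)"
        unfolding fdist_def by (rule chain_dist_approx[rotated 2]) (auto intro: flat_cost_bounds)
      \<comment> \<open>\<phi> vanishes on the \<sigma>-ball around p and equals D on the
        \<sigma>-ball around q. If all discounted steps have their ends in these balls, \<phi> is
        constant along each of them, a discounted step being too short to join the two balls; so the
        full-cost steps alone pay for the rise D.\<close>
      define \<phi> where "\<phi> w = min (max (dist p w - \<sigma>) 0) D" for w
      have "\<exists>i\<le>N. infdist (z i) K < ?\<delta> \<and> \<sigma> \<le> dist p (z i) \<and> \<sigma> \<le> dist q (z i)"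
      proof (rule ccontr)
        assume no: "\<not> ?thesis"
        have step: "\<bar>\<phi> (z i) - \<phi> (z (Suc i))\<bar> \<le> ?c (z i) (z (Suc i))" if "i < N" for i
        proof (cases "infdist (z i) K < ?\<delta> \<and> infdist (z (Suc i)) K < ?\<delta> \<and> dist (z i) (z (Suc i)) < ?\<delta>")
          case False
          then have "?c (z i) (z (Suc i)) = dist (z i) (z (Suc i))" by (auto simp: flat_cost_def)
          moreover have "\<bar>dist p (z i) - dist p (z (Suc i))\<bar> \<le> dist (z i) (z (Suc i))"
            using abs_dist_diff_le[of "z i" p "z (Suc i)"] by (simp add: dist_commute)
          ultimately show ?thesis by (auto simp: \<phi>_def)
        next
          case True
          have near: "dist p (z i) < \<sigma> \<or> dist q (z i) < \<sigma>"
            "dist p (z (Suc i)) < \<sigma> \<or> dist q (z (Suc i)) < \<sigma>"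
            using no True that by (auto simp: not_le dest: spec[of _ i] spec[of _ "Suc i"])
          have lo: "\<phi> w = 0" if "dist p w < \<sigma>" for w
            using that less ldist_nonneg[of p q] by (simp add: \<phi>_def D_def)
          have hi: "\<phi> w = D" if "dist q w < \<sigma>" for w
            using that dist_triangle[of p q w] dist_commute[of q w] by (simp add: \<phi>_def D_def)
          have far: "D < dist v w" if "dist p v < \<sigma>" "dist q w < \<sigma>" for v w
            using that dist_triangle[of p q v] dist_triangle[of v q w] dist_commute[of q w]
            by (simp add: D_def)
          have "\<phi> (z i) = \<phi> (z (Suc i))"
            using near lo hi far[of "z i" "z (Suc i)"] far[of "z (Suc i)" "z i"] True n
            by (auto simp: dist_commute)
          then show ?thesis by (simp add: flat_cost_bounds)
        qed
        have "D \<le> \<bar>\<phi> (z 0) - \<phi> (z N)\<bar>"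
          using z \<sigma> less ldist_nonneg[of p q] by (simp add: \<phi>_def D_def)
        also have "\<dots> = \<bar>\<Sum>i<N. \<phi> (z i) - \<phi> (z (Suc i))\<bar>"
          by (simp add: sum_lessThan_telescope'[where f = "\<lambda>i. \<phi> (z i)"])
        also have "\<dots> \<le> (\<Sum>i<N. ?c (z i) (z (Suc i)))"
          by (rule order_trans[OF sum_abs sum_mono]) (use step in auto)
        finally show False using cost by simp
      qed
      then obtain i where i: "i \<le> N" "infdist (z i) K < ?\<delta>" "\<sigma> \<le> dist p (z i)" "\<sigma> \<le> dist q (z i)"
        by blast
      have "fdist n (z 0) (z i) + fdist n (z i) (z N) \<le> (\<Sum>i<N. ?c (z i) (z (Suc i)))"
        unfolding fdist_def using i(1) by (intro chain_dist_le_sum_between) (auto intro: flat_cost_bounds)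
      with i cost z show ?thesis by (intro exI[of _ "z i"]) auto
    qed
    then obtain z where z: "\<And>n. inverse (real (Suc n)) \<le> D \<Longrightarrow> infdist (z n) K < inverse (real (Suc n))"
        "\<And>n. inverse (real (Suc n)) \<le> D \<Longrightarrow> \<sigma> \<le> dist p (z n)"
        "\<And>n. inverse (real (Suc n)) \<le> D \<Longrightarrow> \<sigma> \<le> dist q (z n)"
        "\<And>n. inverse (real (Suc n)) \<le> D \<Longrightarrow> fdist n p (z n) + fdist n (z n) q \<le> ldist p q + inverse (real (Suc n))"
      by metis
    have "0 < D" using less ldist_nonneg[of p q] by (simp add: D_def)
    then have ev: "\<forall>\<^sub>F n in sequentially. inverse (real (Suc n)) \<le> D"
      using order_tendstoD(2)[OF LIMSEQ_inverse_real_of_nat, of D] by (auto elim: eventually_mono)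
    have "\<exists>w\<in>K. infdist (z n) K = dist (z n) w" for n
    proof -
      obtain w where w: "w \<in> K" "\<And>y. y \<in> K \<Longrightarrow> dist (z n) w \<le> dist (z n) y"
        using continuous_attains_inf[OF K, of "dist (z n)"] continuous_on_dist[OF continuous_on_const continuous_on_id]
        by blast
      then have "dist (z n) w \<le> infdist (z n) K"
        using K(2) unfolding infdist_notempty[OF K(2)] by (intro cINF_greatest) auto
      with w(1) show ?thesis using infdist_le[OF w(1), of "z n"] by (intro bexI[of _ w]) auto
    qed
    then obtain w where w: "\<And>n. w n \<in> K" "\<And>n. infdist (z n) K = dist (z n) (w n)" by metis
    from K(1) w(1) obtain l r where l: "l \<in> K" "strict_mono r" "(w \<circ> r) \<longlonglongrightarrow> l"
      unfolding compact_def by metis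
    have sub: "\<forall>\<^sub>F n in sequentially. P (r n)" if "\<forall>\<^sub>F n in sequentially. P n" for P
      using that l(2) by (rule eventually_subseq[rotated])
    have "(\<lambda>n. dist (z (r n)) (w (r n))) \<longlonglongrightarrow> 0"
    proof (rule Lim_null_comparison)
      show "\<forall>\<^sub>F n in sequentially. norm (dist (z (r n)) (w (r n))) \<le> inverse (real (Suc (r n)))"
        by (rule sub, rule eventually_mono[OF ev]) (use z(1) w(2) in \<open>auto intro: less_imp_le\<close>)
      show "(\<lambda>n. inverse (real (Suc (r n)))) \<longlonglongrightarrow> 0"
        by (rule LIMSEQ_subseq_LIMSEQ[OF LIMSEQ_inverse_real_of_nat l(2), unfolded comp_def])
    qed
    then have zl: "(\<lambda>n. z (r n)) \<longlonglongrightarrow> l"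
      by (rule tendsto_dist_0_transfer[OF _ l(3)[unfolded comp_def]])
    have "\<sigma> \<le> dist p l"
      by (rule tendsto_lowerbound[OF tendsto_dist[OF tendsto_const zl]])
        (rule eventually_mono[OF sub[OF ev]], erule z(2), simp)
    moreover have "\<sigma> \<le> dist q l"
      by (rule tendsto_lowerbound[OF tendsto_dist[OF tendsto_const zl]])
        (rule eventually_mono[OF sub[OF ev]], erule z(3), simp)
    ultimately have "ldist p q < ldist p l + ldist l q"
      using \<sigma> by (intro no_between) auto
    \<comment> \<open>The index m stays fixed while the points \<open>z (r n)\<close> converge to l,
      since \<open>fdist m\<close> is controlled by the later distances; only afterwards does m tend
      to infinity.\<close>
    moreover have "fdist m p l + fdist m l q \<le> ldist p q" for m
    proof (rule tendsto_lowerbound[where F = sequentially])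
      have "(\<lambda>n. ldist p q + inverse (real (Suc (r n))) + 2 * dist (z (r n)) l) \<longlonglongrightarrow> ldist p q + 0 + 2 * 0"
        by (intro tendsto_intros tendsto_dist_iff[THEN iffD1, OF zl]
            LIMSEQ_subseq_LIMSEQ[OF LIMSEQ_inverse_real_of_nat l(2), unfolded comp_def])
      then show "(\<lambda>n. ldist p q + inverse (real (Suc (r n))) + 2 * dist (z (r n)) l) \<longlonglongrightarrow> ldist p q" by simp
      have "\<forall>\<^sub>F n in sequentially. inverse (real (Suc (r n))) \<le> D \<and> m \<le> r n"
        by (rule sub[OF eventually_conj[OF ev eventually_ge_at_top[of m]]])
      then show "\<forall>\<^sub>F n in sequentially. fdist m p l + fdist m l q
          \<le> ldist p q + inverse (real (Suc (r n))) + 2 * dist (z (r n)) l"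
      proof (rule eventually_mono)
        fix n assume n: "inverse (real (Suc (r n))) \<le> D \<and> m \<le> r n"
        let ?z = "z (r n)"
        have "fdist m p l \<le> fdist m p ?z + dist ?z l" "fdist m l q \<le> fdist m ?z q + dist ?z l"
          using fdist_perturb[of m p l p ?z] fdist_perturb[of m l q ?z q] by (auto simp: dist_commute)
        moreover have "fdist m p ?z \<le> fdist (r n) p ?z" "fdist m ?z q \<le> fdist (r n) ?z q"
          using n by (auto intro: fdist_mono)
        ultimately show "fdist m p l + fdist m l q
            \<le> ldist p q + inverse (real (Suc (r n))) + 2 * dist ?z l"
          using z(4)[of "r n"] n by linarith
      qed
    qed simp
    then have "ldist p l + ldist l q \<le> ldist p q"
      by (intro LIMSEQ_le_const2[OF tendsto_add[OF fdist_LIMSEQ fdist_LIMSEQ]]) auto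
    ultimately show False by simp
  qed
  show ?thesis
  proof (rule ccontr)
    assume "\<not> ?thesis"
    then have "ldist p q < dist p q" by simp
    moreover have "\<exists>\<sigma>>0. 2 * \<sigma> < d \<and> l < d - 2 * \<sigma>" if "l < d" "0 \<le> l" for d l :: real
      using that by (intro exI[of _ "(d - l) / 4"]) (simp add: field_simps)
    ultimately obtain \<sigma> where "0 < \<sigma>" "2 * \<sigma> < dist p q" "ldist p q < dist p q - 2 * \<sigma>"
      using ldist_nonneg by blast
    with main[of \<sigma>] show False by simp
  qed
qed (simp add: ldist_nonneg)

end

text \<open>
  A maximal \<open>ldist\<close>-geodesic subset from \<open>x\<close> to \<open>y\<close> is the image of a Lipschitz curve defined on a compact
  set of reals. Across the gaps of that set the limit distance is the original one, and
  curve-flatness takes care of the rest.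
\<close>

lemma curve_flat_le_ldist:
  fixes f :: "'a::complete_space \<Rightarrow> 'b::metric_space" and K :: "'a set"
  assumes eps: "0 < \<epsilon>" "\<epsilon> \<le> 1" and K: "compact K" "K \<noteq> {}"
    and f: "L-lipschitz_on UNIV f" "curve_flat f"
  shows "dist (f x) (f y) \<le> L * ldist K \<epsilon> x y"
proof -
  define \<rho> where "\<rho> = ldist K \<epsilon>"
  note bounds = ldist_le_dist[OF eps, of K, folded \<rho>_def] ldist_ge[OF eps, of _ _ K, folded \<rho>_def]
    ldist_nonneg[OF eps, of K, folded \<rho>_def]
  note sym = ldist_sym[OF eps, of K, folded \<rho>_def]
  note tri = ldist_triangle[OF eps, of K, folded \<rho>_def]
  note eq0 = ldist_eq_0[OF eps, of K, folded \<rho>_def]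
  note tend = tendsto_ldist[OF eps, of _ _ _ _ K, folded \<rho>_def]
  have L0: "0 \<le> L" by (rule lipschitz_on_nonneg[OF f(1)])
  define R where "R = \<rho> x y"
  \<comment> \<open>The sets containing x and y that the distance from x embeds isometrically, for
    the limit metric, into the interval from 0 to R.\<close>
  define \<A> where "\<A> = {\<Gamma>. x \<in> \<Gamma> \<and> y \<in> \<Gamma> \<and> (\<forall>p\<in>\<Gamma>. \<rho> x p \<le> R) \<and>
    (\<forall>p\<in>\<Gamma>. \<forall>q\<in>\<Gamma>. \<rho> p q = \<bar>\<rho> x p - \<rho> x q\<bar>)}"
  have rxx: "\<rho> p p = 0" for p by (simp add: eq0)
  have "\<exists>\<Gamma>\<in>\<A>. \<forall>X\<in>\<A>. \<Gamma> \<subseteq> X \<longrightarrow> X = \<Gamma>"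
  proof (rule subset_Zorn_nonempty)
    have "{x, y} \<in> \<A>" using bounds(3)[of x y] by (auto simp: \<A>_def R_def rxx sym[of y x])
    then show "\<A> \<noteq> {}" by auto
    fix \<C> assume ne: "\<C> \<noteq> {}" and "subset.chain \<A> \<C>"
    then have sub: "\<C> \<subseteq> \<A>" and ch: "\<And>X Y. X \<in> \<C> \<Longrightarrow> Y \<in> \<C> \<Longrightarrow> X \<subseteq> Y \<or> Y \<subseteq> X"
      by (auto simp: subset.chain_def)
    have "\<rho> p q = \<bar>\<rho> x p - \<rho> x q\<bar>" if XY: "X \<in> \<C>" "p \<in> X" "Y \<in> \<C>" "q \<in> Y" for p q X Y
    proof -
      obtain Z where "Z \<in> \<C>" "p \<in> Z" "q \<in> Z" using ch[OF XY(1,3)] XY by blast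
      then show ?thesis using sub unfolding \<A>_def by blast
    qed
    note iso = this
    have "x \<in> \<Union>\<C>" "y \<in> \<Union>\<C>" "\<And>p. p \<in> \<Union>\<C> \<Longrightarrow> \<rho> x p \<le> R"
      using ne sub by (auto simp: \<A>_def)
    with iso show "\<Union>\<C> \<in> \<A>" unfolding \<A>_def by blast
  qed
  then obtain \<Gamma> where G: "\<Gamma> \<in> \<A>" and max: "\<And>X. X \<in> \<A> \<Longrightarrow> \<Gamma> \<subseteq> X \<Longrightarrow> X = \<Gamma>" by blast
  have Gx: "x \<in> \<Gamma>" "y \<in> \<Gamma>" and GR: "\<And>p. p \<in> \<Gamma> \<Longrightarrow> \<rho> x p \<le> R"
    and Giso: "\<And>p q. p \<in> \<Gamma> \<Longrightarrow> q \<in> \<Gamma> \<Longrightarrow> \<rho> p q = \<bar>\<rho> x p - \<rho> x q\<bar>"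
    using G unfolding \<A>_def by blast+
  have closed: "closed \<Gamma>"
  proof -
    have "closure \<Gamma> \<in> \<A>"
      unfolding \<A>_def
    proof (intro CollectI conjI ballI)
      show "x \<in> closure \<Gamma>" "y \<in> closure \<Gamma>" using Gx closure_subset by auto
      fix p assume "p \<in> closure \<Gamma>"
      then obtain u where u: "\<And>n. u n \<in> \<Gamma>" "u \<longlonglongrightarrow> p" by (auto simp: closure_sequential)
      show "\<rho> x p \<le> R"
        by (rule LIMSEQ_le_const2[OF tend[OF tendsto_const u(2)]]) (use GR u(1) in auto)
      fix q assume "q \<in> closure \<Gamma>"
      then obtain v where v: "\<And>n. v n \<in> \<Gamma>" "v \<longlonglongrightarrow> q" by (auto simp: closure_sequential)
      have "(\<lambda>n. \<rho> (u n) (v n)) \<longlonglongrightarrow> \<bar>\<rho> x p - \<rho> x q\<bar>"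
        unfolding Giso[OF u(1) v(1)] by (intro tendsto_intros tend u(2) v(2))
      then show "\<rho> p q = \<bar>\<rho> x p - \<rho> x q\<bar>" by (rule LIMSEQ_unique[OF tend[OF u(2) v(2)]])
    qed
    then have "closure \<Gamma> = \<Gamma>" by (rule max[OF _ closure_subset])
    then show ?thesis by (metis closed_closure)
  qed
  define T where "T = \<rho> x ` \<Gamma>"
  define \<gamma> where "\<gamma> = inv_into \<Gamma> (\<rho> x)"
  have inj: "inj_on (\<rho> x) \<Gamma>"
  proof (rule inj_onI)
    fix p q assume "p \<in> \<Gamma>" "q \<in> \<Gamma>" "\<rho> x p = \<rho> x q"
    then have "\<rho> p q = 0" by (simp add: Giso)
    then show "p = q" by (simp add: eq0)
  qed
  have \<gamma>: "\<gamma> t \<in> \<Gamma>" "\<rho> x (\<gamma> t) = t" if "t \<in> T" for t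
    using that by (auto simp: \<gamma>_def T_def inv_into_into f_inv_into_f)
  have \<gamma>\<rho>: "\<gamma> (\<rho> x p) = p" if "p \<in> \<Gamma>" for p
    using that inj by (simp add: \<gamma>_def inv_into_f_f)
  have \<gamma>iso: "\<rho> (\<gamma> s) (\<gamma> t) = \<bar>s - t\<bar>" if "s \<in> T" "t \<in> T" for s t
    using that by (simp add: Giso \<gamma>)
  have lip: "(1 / \<epsilon>)-lipschitz_on T \<gamma>"
  proof (rule lipschitz_onI)
    fix s t assume "s \<in> T" "t \<in> T"
    then show "dist (\<gamma> s) (\<gamma> t) \<le> 1 / \<epsilon> * dist s t"
      using bounds(2)[of "\<gamma> s" "\<gamma> t"] eps by (simp add: \<gamma>iso dist_real_def field_simps)
  qed (use eps in simp)
  \<comment> \<open>Closedness of T is where completeness of the domain enters: \<gamma> is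
    Lipschitz, so a convergent sequence of parameters yields a Cauchy sequence of points.\<close>
  have T: "compact T"
  proof -
    have "bounded T"
      by (rule boundedI[of _ R]) (use GR bounds(3) in \<open>auto simp: T_def\<close>)
    moreover have "closed T"
      unfolding closed_sequential_limits
    proof (intro allI impI, elim conjE)
      fix s t assume s: "\<forall>n. s n \<in> T" "s \<longlonglongrightarrow> t"
      have "Cauchy (\<lambda>n. \<gamma> (s n))"
      proof (rule metric_CauchyI)
        fix e :: real assume "e > 0"
        then obtain N where "\<And>m n. m \<ge> N \<Longrightarrow> n \<ge> N \<Longrightarrow> dist (s m) (s n) < e * \<epsilon>"
          using LIMSEQ_imp_Cauchy[OF s(2)] eps by (meson metric_CauchyD mult_pos_pos)
        moreover have "dist (\<gamma> (s m)) (\<gamma> (s n)) < e" if "dist (s m) (s n) < e * \<epsilon>" for m n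
        proof -
          have "dist (\<gamma> (s m)) (\<gamma> (s n)) \<le> dist (s m) (s n) / \<epsilon>"
            using lipschitz_onD[OF lip, of "s m" "s n"] s(1) by simp
          also have "\<dots> < e" using that eps by (simp add: field_simps)
          finally show ?thesis .
        qed
        ultimately show "\<exists>M. \<forall>m\<ge>M. \<forall>n\<ge>M. dist (\<gamma> (s m)) (\<gamma> (s n)) < e" by blast
      qed
      then obtain p where p: "(\<lambda>n. \<gamma> (s n)) \<longlonglongrightarrow> p" using Cauchy_convergent by (auto simp: convergent_def)
      have "p \<in> \<Gamma>" by (rule closed_sequentially[OF closed _ p]) (use s(1) \<gamma> in auto)
      moreover have "(\<lambda>n. \<rho> x (\<gamma> (s n))) \<longlonglongrightarrow> \<rho> x p" by (intro tend tendsto_const p)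
      then have "\<rho> x p = t" using LIMSEQ_unique[OF s(2)] s(1) by (simp add: \<gamma>)
      ultimately show "t \<in> T" by (auto simp: T_def)
    qed
    ultimately show ?thesis by (simp add: compact_eq_bounded_closed)
  qed
  have TR: "0 \<in> T" "R \<in> T" "0 \<le> R"
    using Gx rxx[of x] bounds(3)[of x y] by (auto simp: T_def R_def image_iff intro: bexI[of _ x])
  have gap: "dist (\<gamma> s) (\<gamma> t) \<le> t - s" if st: "s \<in> T" "t \<in> T" "s < t" "{s<..<t} \<inter> T = {}" for s t
  proof -
    have "dist (\<gamma> s) (\<gamma> t) \<le> \<rho> (\<gamma> s) (\<gamma> t)"
      unfolding \<rho>_def
    proof (rule ldist_gap[OF eps K])
      fix z assume z: "z \<noteq> \<gamma> s" "z \<noteq> \<gamma> t"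
      show "ldist K \<epsilon> (\<gamma> s) (\<gamma> t) < ldist K \<epsilon> (\<gamma> s) z + ldist K \<epsilon> z (\<gamma> t)"
      proof (rule ccontr)
        assume "\<not> ?thesis"
        then have le: "\<rho> (\<gamma> s) z + \<rho> z (\<gamma> t) \<le> t - s"
          using \<gamma>iso[OF st(1,2)] st(3) by (simp add: \<rho>_def)
        have to_y: "\<rho> p y = R - \<rho> x p" if "p \<in> \<Gamma>" for p
          using Giso[OF that Gx(2)] GR[OF that] by (simp add: R_def)
        \<comment> \<open>The inequality \<open>le\<close> leaves no slack in the triangle
          inequalities, so z sits on a geodesic between \<gamma> s and \<gamma> t and could be added
          to \<Gamma>. Maximality then puts a parameter strictly inside the gap.\<close>
        have z_eq: "\<rho> x z = s + \<rho> (\<gamma> s) z" "\<rho> z (\<gamma> t) = t - \<rho> x z"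
          using le tri[of x y z] tri[of z y "\<gamma> t"] tri[of x z "\<gamma> s"] \<gamma>[OF st(1)] \<gamma>[OF st(2)] to_y[OF \<gamma>(1)[OF st(2)]]
          by (auto simp: R_def)
        have pz: "\<rho> p z = \<bar>\<rho> x p - \<rho> x z\<bar>" if p: "p \<in> \<Gamma>" for p
        proof (cases "\<rho> x p \<le> s")
          case True
          have "\<rho> p (\<gamma> s) = s - \<rho> x p" using Giso[OF p \<gamma>(1)[OF st(1)]] True \<gamma>[OF st(1)] by simp
          then show ?thesis
            using tri[of p z "\<gamma> s"] tri[of x z p] z_eq True bounds(3)[of "\<gamma> s" z] by auto
        next
          case False
          then have "t \<le> \<rho> x p" using st(4) p by (force simp: T_def)
          moreover from this have "\<rho> (\<gamma> t) p = \<rho> x p - t"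
            using Giso[OF \<gamma>(1)[OF st(2)] p] \<gamma>[OF st(2)] by simp
          ultimately show ?thesis
            using tri[of z p "\<gamma> t"] tri[of x p z] z_eq bounds(3)[of z "\<gamma> t"] sym[of p z] by auto
        qed
        have "\<rho> x z \<le> R"
          using z_eq bounds(3)[of z "\<gamma> t"] GR[OF \<gamma>(1)[OF st(2)]] \<gamma>(2)[OF st(2)] by simp
        moreover have "\<rho> z p = \<bar>\<rho> x z - \<rho> x p\<bar>" if "p \<in> \<Gamma>" for p
          using pz[OF that] sym[of z p] by (simp only: abs_minus_commute)
        moreover have "\<rho> z z = \<bar>\<rho> x z - \<rho> x z\<bar>" by (simp add: rxx)
        ultimately have "insert z \<Gamma> \<in> \<A>"
          unfolding \<A>_def using Gx GR Giso pz by blast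
        from max[OF this] have "z \<in> \<Gamma>" by auto
        then have "\<rho> x z \<in> T" by (auto simp: T_def)
        moreover have "0 < \<rho> (\<gamma> s) z" "0 < \<rho> z (\<gamma> t)"
          using z bounds(3)[of "\<gamma> s" z] bounds(3)[of z "\<gamma> t"] eq0[of "\<gamma> s" z] eq0[of z "\<gamma> t"]
          by (auto simp: less_le)
        ultimately have "\<rho> x z \<in> {s<..<t} \<inter> T" using z_eq by auto
        with st(4) show False by blast
      qed
    qed
    with \<gamma>iso[OF st(1,2)] st(3) show ?thesis by simp
  qed
  define bad where "bad = {t\<in>T. \<not> ((\<lambda>s. dist (f (\<gamma> t)) (f (\<gamma> s)) / \<bar>t - s\<bar>) \<longlongrightarrow> 0) (at t within T)}"
  have "AE t in lebesgue. t \<notin> bad"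
    using f(2) T lip unfolding curve_flat_def bad_def by (auto elim!: allE[of _ T] allE[of _ \<gamma>])
  then obtain N where N: "bad \<subseteq> N" "N \<in> null_sets lebesgue"
    by (auto elim!: AE_E simp: null_sets_def)
  have fl: "(L / \<epsilon>)-lipschitz_on T (\<lambda>t. f (\<gamma> t))"
    using lipschitz_on_compose2[OF lip lipschitz_on_subset[OF f(1)]] by simp
  have "dist (f (\<gamma> 0)) (f (\<gamma> R)) \<le> L * R + (R + L / \<epsilon>) * e" if e: "e > 0" for e
  proof -
    \<comment> \<open>U covers the parameters at which flatness fails. There only the crude rate
      \<open>L / \<epsilon>\<close> is known, but U exceeds a null set by measure less than e, so
      its contribution disappears with e.\<close>
    obtain U where U: "open U" "N \<subseteq> U" "U - N \<in> lmeasurable" "emeasure lebesgue (U - N) < ennreal e"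
      by (rule sets_lebesgue_outer_open[OF null_setsD2[OF N(2)] e])
    have "emeasure lborel (U \<inter> {0..R}) = emeasure lebesgue (U \<inter> {0..R})"
      using U(1) by simp
    also have "\<dots> \<le> emeasure lebesgue ((U - N) \<union> N)"
      using U(1,3) N(2) by (intro emeasure_mono) (auto dest: null_setsD2)
    also have "\<dots> = emeasure lebesgue (U - N)"
      using U(3) N(2) by (intro emeasure_Un_null_set) auto
    finally have "emeasure lborel (U \<inter> {0..R}) \<le> ennreal e" using U(4) by (simp only: less_imp_le)
    then have m: "measure lborel (U \<inter> {0..R}) \<le> e"
      using e by (simp add: measure_def enn2real_leI)
    have "dist (f (\<gamma> 0)) (f (\<gamma> R)) \<le> (L + e) * (R - 0) + L / \<epsilon> * measure lborel (U \<inter> {0..R})"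
    proof (rule dist_le_gaps[OF T TR fl U(1)])
      show "0 \<le> L + e" using L0 e by simp
      fix p q assume pq: "p \<in> T" "q \<in> T" "p < q" "{p<..<q} \<inter> T = {}"
      have "dist (f (\<gamma> p)) (f (\<gamma> q)) \<le> L * dist (\<gamma> p) (\<gamma> q)" by (rule lipschitz_onD[OF f(1)]) auto
      also have "\<dots> \<le> L * (q - p)" using gap[OF pq] L0 by (rule mult_left_mono)
      also have "\<dots> \<le> (L + e) * (q - p)" using e pq by (intro mult_right_mono) auto
      finally show "dist (f (\<gamma> p)) (f (\<gamma> q)) \<le> (L + e) * (q - p)" .
    next
      fix t assume t: "t \<in> T" "t \<notin> U"
      then have "((\<lambda>s. dist (f (\<gamma> t)) (f (\<gamma> s)) / \<bar>t - s\<bar>) \<longlongrightarrow> 0) (at t within T)"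
        using N U by (auto simp: bad_def)
      from order_tendstoD(2)[OF this e] obtain d where d: "d > 0"
        "\<And>s. s \<in> T \<Longrightarrow> s \<noteq> t \<Longrightarrow> dist s t < d \<Longrightarrow> dist (f (\<gamma> t)) (f (\<gamma> s)) / \<bar>t - s\<bar> < e"
        by (auto simp: eventually_at)
      show "\<exists>r>0. \<forall>s\<in>T. t < s \<and> s < t + r \<longrightarrow> dist (f (\<gamma> t)) (f (\<gamma> s)) \<le> (L + e) * (s - t)"
      proof (intro exI[of _ d] conjI ballI impI d(1))
        fix s assume s: "s \<in> T" "t < s \<and> s < t + d"
        then have "dist (f (\<gamma> t)) (f (\<gamma> s)) \<le> e * (s - t)"
          using d(2)[of s] by (auto simp: dist_real_def field_simps)
        also have "\<dots> \<le> (L + e) * (s - t)" using L0 s by (intro mult_right_mono) auto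
        finally show "dist (f (\<gamma> t)) (f (\<gamma> s)) \<le> (L + e) * (s - t)" .
      qed
    qed
    also have "L / \<epsilon> * measure lborel (U \<inter> {0..R}) \<le> L / \<epsilon> * e"
      using m L0 eps by (intro mult_left_mono) auto
    finally show ?thesis by (simp add: algebra_simps)
  qed
  note bound = this
  have "dist (f (\<gamma> 0)) (f (\<gamma> R)) \<le> L * R"
  proof (rule field_le_epsilon)
    fix d :: real assume d: "d > 0"
    define C where "C = R + L / \<epsilon>"
    have C: "0 \<le> C" using TR L0 eps by (simp add: C_def)
    then have "C * (d / (1 + C)) \<le> d" using d by (simp add: field_simps)
    moreover have "0 < d / (1 + C)" using d C by simp
    ultimately show "dist (f (\<gamma> 0)) (f (\<gamma> R)) \<le> L * R + d"
      using bound[of "d / (1 + C)"] unfolding C_def by linarith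
  qed
  moreover have "\<gamma> 0 = x" "\<gamma> R = y" using \<gamma>\<rho>[OF Gx(1)] \<gamma>\<rho>[OF Gx(2)] rxx[of x] by (auto simp: R_def)
  ultimately show ?thesis by (simp add: R_def \<rho>_def)
qed

text \<open>Dini's argument makes the bound of the preceding lemma uniform on \<open>K\<close>.\<close>

lemma curve_flat_chain_bound:
  fixes f :: "'a::complete_space \<Rightarrow> 'b::metric_space" and K :: "'a set"
  assumes eps: "0 < \<epsilon>" "\<epsilon> \<le> 1" and K: "compact K" "K \<noteq> {}" 
    and f: "L-lipschitz_on UNIV f" "curve_flat f" and pos: "0 < L" "0 < \<eta>" "0 < \<delta>0"
  obtains \<delta> where "0 < \<delta>" "\<delta> \<le> \<delta>0"
    "\<And>x y. x \<in> K \<Longrightarrow> y \<in> K \<Longrightarrow> dist (f x) (f y) \<le> L * chain_dist (flat_cost K \<epsilon> \<delta>) x y + \<eta>"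
proof -
  let ?F = "fdist K \<epsilon>"
  have "\<exists>N. \<forall>n\<ge>N. \<forall>x\<in>K. \<forall>y\<in>K. dist (f x) (f y) \<le> L * ?F n x y + \<eta>"
  proof (rule ccontr)
    assume "\<not> ?thesis"
    then have "\<forall>N. \<exists>x y. x \<in> K \<and> y \<in> K \<and> (\<exists>n\<ge>N. L * ?F n x y + \<eta> < dist (f x) (f y))"
      by (force simp: not_le)
    then obtain x y where xy: "\<And>N. x N \<in> K" "\<And>N. y N \<in> K"
      "\<And>N. \<exists>n\<ge>N. L * ?F n (x N) (y N) + \<eta> < dist (f (x N)) (f (y N))"
      by metis
    \<comment> \<open>The violation occurs at some n >= N; monotonicity in the index turns it into a
      violation at every m <= N, so that N can tend to infinity while m is fixed.\<close>
    have less: "L * ?F m (x N) (y N) + \<eta> < dist (f (x N)) (f (y N))" if "m \<le> N" for m N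
    proof -
      obtain n where n: "n \<ge> N" "L * ?F n (x N) (y N) + \<eta> < dist (f (x N)) (f (y N))"
        using xy(3) by blast
      have "L * ?F m (x N) (y N) \<le> L * ?F n (x N) (y N)"
        using fdist_mono[OF eps, of m n] that n(1) pos by (intro mult_left_mono) auto
      with n(2) show ?thesis by simp
    qed
    have "compact (K \<times> K)" using K by (intro compact_Times)
    moreover have "\<And>N. (x N, y N) \<in> K \<times> K" using xy by auto
    ultimately obtain l r where l: "l \<in> K \<times> K" "strict_mono r" "((\<lambda>N. (x N, y N)) \<circ> r) \<longlonglongrightarrow> l"
      unfolding compact_def by meson
    obtain a b where ab: "l = (a, b)" by (cases l)
    have lim: "(\<lambda>N. x (r N)) \<longlonglongrightarrow> a" "(\<lambda>N. y (r N)) \<longlonglongrightarrow> b"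
      using tendsto_fst[OF l(3)] tendsto_snd[OF l(3)] by (simp_all add: ab comp_def)
    have cf: "continuous_on UNIV f" by (rule lipschitz_on_continuous_on[OF f(1)])
    have flim: "(\<lambda>N. dist (f (x (r N))) (f (y (r N)))) \<longlonglongrightarrow> dist (f a) (f b)"
      using lim by (intro tendsto_dist continuous_on_tendsto_compose[OF cf]) auto
    have "L * ?F m a b + \<eta> \<le> dist (f a) (f b)" for m
    proof (rule tendsto_le[OF _ _ ])
      show "(\<lambda>N. dist (f (x (r N))) (f (y (r N))) + L * (dist a (x (r N)) + dist b (y (r N)))) \<longlonglongrightarrow> dist (f a) (f b)"
      proof -
        have "(\<lambda>N. dist (f (x (r N))) (f (y (r N))) + L * (dist a (x (r N)) + dist b (y (r N)))) \<longlonglongrightarrow>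
            dist (f a) (f b) + L * (dist a a + dist b b)"
          by (intro tendsto_intros flim lim)
        then show ?thesis by simp
      qed
      show "\<forall>\<^sub>F N in sequentially. L * ?F m a b + \<eta> \<le>
          dist (f (x (r N))) (f (y (r N))) + L * (dist a (x (r N)) + dist b (y (r N)))"
        using eventually_ge_at_top[of m]
      proof (rule eventually_mono)
        fix N assume "m \<le> N"
        then have "m \<le> r N" using seq_suble[OF l(2), of N] by simp
        from less[OF this] fdist_perturb[OF eps, of K m a b "x (r N)" "y (r N)"] pos
        have "L * ?F m a b \<le> L * ?F m (x (r N)) (y (r N)) + L * (dist a (x (r N)) + dist b (y (r N)))"
          by (simp flip: distrib_left)
        with less[OF \<open>m \<le> r N\<close>] show "L * ?F m a b + \<eta> \<le>
            dist (f (x (r N))) (f (y (r N))) + L * (dist a (x (r N)) + dist b (y (r N)))" by simp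
      qed
    qed (auto intro: tendsto_const)
    then have "L * ldist K \<epsilon> a b + \<eta> \<le> dist (f a) (f b)"
      by (intro LIMSEQ_le_const2[of "\<lambda>m. L * ?F m a b + \<eta>"] tendsto_intros fdist_LIMSEQ[OF eps]) auto
    with curve_flat_le_ldist[OF eps K f, of a b] pos show False by simp
  qed
  then obtain N where N: "\<And>n x y. n \<ge> N \<Longrightarrow> x \<in> K \<Longrightarrow> y \<in> K \<Longrightarrow> dist (f x) (f y) \<le> L * ?F n x y + \<eta>"
    by blast
  have "\<forall>\<^sub>F n in sequentially. inverse (real (Suc n)) < \<delta>0 \<and> N \<le> n"
    using order_tendstoD(2)[OF LIMSEQ_inverse_real_of_nat \<open>0 < \<delta>0\<close>] eventually_ge_at_top[of N]
    by (rule eventually_conj)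
  then obtain n where n: "inverse (real (Suc n)) < \<delta>0" "N \<le> n"
    by (auto simp: eventually_sequentially)
  show ?thesis
  proof (rule that)
    show "0 < inverse (real (Suc n))" "inverse (real (Suc n)) \<le> \<delta>0" using n(1) by auto
    show "dist (f x) (f y) \<le> L * chain_dist (flat_cost K \<epsilon> (inverse (real (Suc n)))) x y + \<eta>"
      if "x \<in> K" "y \<in> K" for x y
      using N[OF n(2) that] by (simp only: fdist_def[OF eps])
  qed
qed

section \<open>Functionals on the Lipschitz-free space\<close>

text \<open>Taken in \<open>ennreal\<close>, so that the supremum over an arbitrary class always
  exists and can be integrated directly.\<close>

definition sem :: "('x::real_normed_vector \<Rightarrow>\<^sub>L real) set \<Rightarrow> 'x \<Rightarrow> ennreal" where
  "sem \<Phi> x = (SUP \<phi>\<in>\<Phi>. ennreal \<bar>blinfun_apply \<phi> x\<bar>)"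

lemma sem_upper: "\<phi> \<in> \<Phi> \<Longrightarrow> ennreal \<bar>blinfun_apply \<phi> x\<bar> \<le> sem \<Phi> x"
  unfolding sem_def by (rule SUP_upper)

lemma sem_least: "(\<And>\<phi>. \<phi> \<in> \<Phi> \<Longrightarrow> ennreal \<bar>blinfun_apply \<phi> x\<bar> \<le> b) \<Longrightarrow> sem \<Phi> x \<le> b"
  unfolding sem_def by (rule SUP_least)

lemma sem_mono: "\<Phi> \<subseteq> \<Psi> \<Longrightarrow> sem \<Phi> x \<le> sem \<Psi> x"
  unfolding sem_def by (rule SUP_subset_mono) auto

lemma sem_add_le: "sem \<Phi> (x + y) \<le> sem \<Phi> x + sem \<Phi> y"
proof (rule sem_least)
  fix \<phi> assume "\<phi> \<in> \<Phi>"
  have "ennreal \<bar>blinfun_apply \<phi> (x + y)\<bar> \<le> ennreal \<bar>blinfun_apply \<phi> x\<bar> + ennreal \<bar>blinfun_apply \<phi> y\<bar>"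
    by (simp add: blinfun.add_right flip: ennreal_plus)
  also have "\<dots> \<le> sem \<Phi> x + sem \<Phi> y" using \<open>\<phi> \<in> \<Phi>\<close> by (intro add_mono sem_upper)
  finally show "ennreal \<bar>blinfun_apply \<phi> (x + y)\<bar> \<le> sem \<Phi> x + sem \<Phi> y" .
qed

lemma sem_minus: "sem \<Phi> (- x) = sem \<Phi> x"
  by (simp add: sem_def blinfun.minus_right)

lemma sem_diff_le: "sem \<Phi> (x - y) \<le> sem \<Phi> x + sem \<Phi> y"
  using sem_add_le[of \<Phi> x "- y"] by (simp add: sem_minus)

lemma sem_le_norm:
  assumes "\<And>\<phi>. \<phi> \<in> \<Phi> \<Longrightarrow> norm \<phi> \<le> C"
  shows "sem \<Phi> x \<le> ennreal (C * norm x)"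
proof (rule sem_least)
  fix \<phi> assume "\<phi> \<in> \<Phi>"
  then have "\<bar>blinfun_apply \<phi> x\<bar> \<le> C * norm x"
    using norm_blinfun[of \<phi> x] mult_right_mono[OF assms[of \<phi>] norm_ge_zero[of x]] by simp
  then show "ennreal \<bar>blinfun_apply \<phi> x\<bar> \<le> ennreal (C * norm x)" by (rule ennreal_leI)
qed

text \<open>Superlevel sets are unions of open sets, so the class may be uncountable.\<close>

lemma borel_measurable_sem [measurable]: "sem \<Phi> \<in> borel_measurable borel"
proof (rule borel_measurableI_greater)
  fix a
  have "{x \<in> space borel. a < sem \<Phi> x} = (\<Union>\<phi>\<in>\<Phi>. {x. a < ennreal \<bar>blinfun_apply \<phi> x\<bar>})"
    by (auto simp: sem_def less_SUP_iff)
  also have "open \<dots>"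
    by (intro open_UN ballI open_Collect_less continuous_intros continuous_on_ennreal)
  finally show "{x \<in> space borel. a < sem \<Phi> x} \<in> sets borel" by simp
qed

text \<open>Subtracting \<open>u 0\<close> admits every Lipschitz u, vanishing at the base point or
  not. For other u the term \<open>Lip0\<close> is an unspecified element, so the usable facts below
  assume a Lipschitz bound.\<close>

definition lip_functional :: "('a::{metric_space, zero} \<Rightarrow> real) \<Rightarrow> 'a lip_free \<Rightarrow>\<^sub>L real" where
  "lip_functional u = Blinfun (\<lambda>\<mu>. blinfun_apply (free_functional \<mu>) (Lip0 (\<lambda>x. u x - u 0)))"

lemma lip_functional_apply:
  "blinfun_apply (lip_functional u) \<mu> = blinfun_apply (free_functional \<mu>) (Lip0 (\<lambda>x. u x - u 0))"
proof -
  have "bounded_linear (\<lambda>\<mu>. blinfun_apply (free_functional \<mu>) g)" for g :: "'a lip0"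
  proof (rule bounded_linear_intro)
    show "norm (blinfun_apply (free_functional \<mu>) g) \<le> norm \<mu> * norm g" for \<mu>
      using norm_blinfun[of "free_functional \<mu>" g] by (simp add: norm_lip_free.rep_eq)
  qed (simp_all add: plus_lip_free.rep_eq scaleR_lip_free.rep_eq blinfun.add_left blinfun.scaleR_left)
  then show ?thesis unfolding lip_functional_def by (subst bounded_linear_Blinfun_apply) auto
qed

lemma Lip0_diff_apply:
  assumes "C-lipschitz_on UNIV u"
  shows "lip0_apply (Lip0 (\<lambda>x. u x - u 0)) = (\<lambda>x. u x - u 0)"
  by (rule Lip0_inverse) (use lipschitz_on_diff[OF assms lipschitz_on_constant] in auto)

lemma lip_functional_delta:
  assumes "C-lipschitz_on UNIV u"
  shows "blinfun_apply (lip_functional u) (free_delta x) = u x - u 0"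
  by (simp add: lip_functional_apply free_delta.rep_eq delta.rep_eq Lip0_diff_apply[OF assms])

lemma norm_lip_functional_le:
  fixes u :: "'a::{metric_space, zero} \<Rightarrow> real"
  assumes u: "C-lipschitz_on UNIV u"
  shows "norm (lip_functional u) \<le> C"
proof (rule norm_blinfun_bound)
  show "0 \<le> C" by (rule lipschitz_on_nonneg[OF u])
  fix \<mu> :: "'a lip_free"
  have "norm (Lip0 (\<lambda>x. u x - u 0)) \<le> C"
    by (rule lip0_norm_le) (use lipschitz_on_diff[OF u lipschitz_on_constant] in \<open>simp add: Lip0_diff_apply[OF u]\<close>)
  from mult_left_mono[OF this norm_ge_zero[of \<mu>]] show "norm (blinfun_apply (lip_functional u) \<mu>) \<le> C * norm \<mu>"
    using norm_blinfun[of "free_functional \<mu>" "Lip0 (\<lambda>x. u x - u 0)"]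
    by (simp add: lip_functional_apply norm_lip_free.rep_eq mult.commute)
qed

lemma abs_lip_functional_le:
  assumes u: "C-lipschitz_on UNIV u"
  shows "\<bar>blinfun_apply (lip_functional u) \<mu>\<bar> \<le> C * norm \<mu>"
  using norm_blinfun[of "lip_functional u" \<mu>] mult_right_mono[OF norm_lip_functional_le[OF u] norm_ge_zero[of \<mu>]]
  by simp

lemma lip_functional_add:
  assumes "C-lipschitz_on UNIV u" "D-lipschitz_on UNIV v"
  shows "lip_functional (\<lambda>x. u x + v x) = lip_functional u + lip_functional v"
  by (rule linearization_unique)
    (simp add: lip_functional_delta[OF assms(1)] lip_functional_delta[OF assms(2)]
      lip_functional_delta[OF lipschitz_on_add[OF assms]] blinfun.add_left)

lemma lip_functional_cmult:
  assumes "C-lipschitz_on UNIV u"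
  shows "lip_functional (\<lambda>x. c * u x) = c *\<^sub>R lip_functional u"
  by (rule linearization_unique)
    (simp add: lip_functional_delta[OF assms] lip_functional_delta[OF lipschitz_on_cmult_real[OF assms]]
      blinfun.scaleR_left algebra_simps)

lemma lipschitz_on_sum_real:
  fixes u :: "nat \<Rightarrow> 'a::metric_space \<Rightarrow> real"
  assumes "\<And>j. j < n \<Longrightarrow> (C j)-lipschitz_on A (u j)"
  shows "(\<Sum>j<n. C j)-lipschitz_on A (\<lambda>x. \<Sum>j<n. u j x)"
  using assms
proof (induction n)
  case 0
  then show ?case by (simp add: lipschitz_on_constant)
next
  case (Suc n)
  then show ?case by (simp add: lipschitz_on_add)
qed

lemma lip_functional_sum:
  fixes u :: "nat \<Rightarrow> 'a::{metric_space, zero} \<Rightarrow> real"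
  assumes "\<And>j. j < n \<Longrightarrow> C-lipschitz_on UNIV (u j)"
  shows "lip_functional (\<lambda>x. \<Sum>j<n. u j x) = (\<Sum>j<n. lip_functional (u j))"
  using assms
proof (induction n)
  case 0
  show ?case
    by (rule linearization_unique) (simp add: lip_functional_delta[OF lipschitz_on_constant])
next
  case (Suc n)
  then show ?case
    using lip_functional_add[OF lipschitz_on_sum_real[of n "\<lambda>_. C" UNIV u] Suc.prems[of n]] by simp
qed

lemma lip_functional_lip0_apply:
  "blinfun_apply (lip_functional (lip0_apply g)) \<mu> = blinfun_apply (free_functional \<mu>) g"
  by (simp add: lip_functional_apply lip0_apply_simps lip0_apply_inverse)

text \<open>The adjoint of the linearization is composition with f: both sides are bounded linear
  and agree on the point evaluations.\<close>

lemma lip_functional_linearization: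
  fixes f :: "'a::{metric_space, zero} \<Rightarrow> 'b::{metric_space, zero}"
  assumes f: "L-lipschitz_on UNIV f" "f 0 = 0" and g: "C-lipschitz_on UNIV g"
  shows "blinfun_apply (lip_functional g) (blinfun_apply (linearization f) \<mu>) =
    blinfun_apply (lip_functional (\<lambda>x. g (f x))) \<mu>"
proof -
  have gf: "(C * L)-lipschitz_on UNIV (\<lambda>x. g (f x))"
    using lipschitz_on_compose2[OF f(1) lipschitz_on_subset[OF g]] by (simp add: mult.commute)
  have ex: "\<exists>L. L-lipschitz_on UNIV f" using f(1) by blast
  have "lip_functional g o\<^sub>L linearization f = lip_functional (\<lambda>x. g (f x))"
    by (rule linearization_unique)
      (simp add: lip_functional_delta[OF g] lip_functional_delta[OF gf] f(2) linearization_free_delta[OF ex f(2)])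
  then show ?thesis by (metis blinfun_apply_blinfun_compose comp_apply)
qed

text \<open>If A contains 0, the seminorm over \<open>lip_vanish 1 A\<close> is by duality the
  distance to the closed span of the evaluations at points of A: it measures how much of an element
  is not carried by A.\<close>

definition lip_vanish :: "real \<Rightarrow> 'a set \<Rightarrow> ('a::metric_space \<Rightarrow> real) set" where
  "lip_vanish C A = {u. C-lipschitz_on UNIV u \<and> (\<forall>x\<in>A. u x = 0)}"

abbreviation lsem :: "('a::{metric_space, zero} \<Rightarrow> real) set \<Rightarrow> 'a lip_free \<Rightarrow> ennreal" where
  "lsem \<U> \<equiv> sem (lip_functional ` \<U>)"

lemma lsem_upper: "u \<in> \<U> \<Longrightarrow> ennreal \<bar>blinfun_apply (lip_functional u) \<mu>\<bar> \<le> lsem \<U> \<mu>"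
  by (rule sem_upper) auto

lemma lsem_least:
  "(\<And>u. u \<in> \<U> \<Longrightarrow> ennreal \<bar>blinfun_apply (lip_functional u) \<mu>\<bar> \<le> b) \<Longrightarrow> lsem \<U> \<mu> \<le> b"
  by (rule sem_least) auto

lemma lsem_mono: "\<U> \<subseteq> \<V> \<Longrightarrow> lsem \<U> \<mu> \<le> lsem \<V> \<mu>"
  by (rule sem_mono) auto

lemma lsem_le_norm:
  assumes "\<And>u. u \<in> \<U> \<Longrightarrow> C-lipschitz_on UNIV u"
  shows "lsem \<U> \<mu> \<le> ennreal (C * norm \<mu>)"
  by (rule sem_le_norm) (use assms norm_lip_functional_le in auto)

text \<open>The norm is inherited from the dual of the space of Lipschitz functions, whose unit ball
  is \<open>lip_vanish 1 {0}\<close>. The norm thus becomes one of the seminorms \<open>lsem\<close>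
  and shares their estimates.\<close>

lemma ennreal_norm_eq_lsem: "ennreal (norm \<mu>) = lsem (lip_vanish 1 {0}) \<mu>"
proof (rule antisym)
  show "lsem (lip_vanish 1 {0}) \<mu> \<le> ennreal (norm \<mu>)"
    using lsem_le_norm[of "lip_vanish 1 {0}" 1 \<mu>] by (simp add: lip_vanish_def)
  show "ennreal (norm \<mu>) \<le> lsem (lip_vanish 1 {0}) \<mu>"
  proof (cases "lsem (lip_vanish 1 {0}) \<mu>")
    case (real b)
    have "norm (free_functional \<mu>) \<le> b"
    proof (rule norm_blinfun_bound[OF real(1)])
      fix g :: "'a lip0"
      show "norm (blinfun_apply (free_functional \<mu>) g) \<le> b * norm g"
      proof (cases "g = 0")
        case False
        define c where "c = 1 / norm g"
        have c: "0 < c" "\<bar>c\<bar> * norm g = 1" using False by (simp_all add: c_def)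
        have "(\<bar>c\<bar> * norm g)-lipschitz_on UNIV (\<lambda>x. c * lip0_apply g x)"
          by (intro lipschitz_on_cmult_real lip0_norm_lipschitz)
        then have "(\<lambda>x. c * lip0_apply g x) \<in> lip_vanish 1 {0}"
          by (simp add: lip_vanish_def lip0_apply_simps c(2))
        from lsem_upper[OF this, of \<mu>]
        have "\<bar>c * blinfun_apply (free_functional \<mu>) g\<bar> \<le> b"
          using real by (simp add: lip_functional_cmult[OF lip0_norm_lipschitz[of g]] blinfun.scaleR_left
              lip_functional_lip0_apply ennreal_le_iff)
        then have "c * \<bar>blinfun_apply (free_functional \<mu>) g\<bar> \<le> b" using c(1) by (simp add: abs_mult)
        then show ?thesis using False by (simp add: c_def field_simps)
      qed (simp add: blinfun.zero_right)
    qed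
    then show ?thesis using real by (simp add: norm_lip_free.rep_eq ennreal_leI)
  qed simp
qed

lemma lip_vanish_cmult:
  assumes "0 < C"
  shows "lip_vanish C A = (\<lambda>u x. C * u x) ` lip_vanish 1 A"
proof (intro equalityI subsetI)
  fix u assume u: "u \<in> lip_vanish C A"
  then have "(\<bar>1 / C\<bar> * C)-lipschitz_on UNIV (\<lambda>x. (1 / C) * u x)"
    unfolding lip_vanish_def by (intro lipschitz_on_cmult_real) auto
  then have "(\<lambda>x. (1 / C) * u x) \<in> lip_vanish 1 A"
    using assms u by (simp add: lip_vanish_def)
  then show "u \<in> (\<lambda>u x. C * u x) ` lip_vanish 1 A"
    by (rule rev_image_eqI) (use assms in auto)
next
  fix u assume "u \<in> (\<lambda>u x. C * u x) ` lip_vanish 1 A"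
  then obtain v where v: "v \<in> lip_vanish 1 A" "u = (\<lambda>x. C * v x)" by auto
  then have "(\<bar>C\<bar> * 1)-lipschitz_on UNIV u"
    unfolding lip_vanish_def v(2) by (intro lipschitz_on_cmult_real) auto
  with v assms show "u \<in> lip_vanish C A" by (simp add: lip_vanish_def)
qed

lemma lsem_cmult:
  assumes C: "0 \<le> C" and u: "\<And>u. u \<in> \<U> \<Longrightarrow> D-lipschitz_on UNIV u"
  shows "lsem ((\<lambda>u x. C * u x) ` \<U>) \<mu> \<le> ennreal C * lsem \<U> \<mu>"
proof (rule lsem_least)
  fix v assume "v \<in> (\<lambda>u x. C * u x) ` \<U>"
  then obtain w where w: "w \<in> \<U>" "v = (\<lambda>x. C * w x)" by auto
  have "ennreal \<bar>blinfun_apply (lip_functional v) \<mu>\<bar> = ennreal C * ennreal \<bar>blinfun_apply (lip_functional w) \<mu>\<bar>"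
    using C by (simp add: w(2) lip_functional_cmult[OF u[OF w(1)]] blinfun.scaleR_left abs_mult ennreal_mult)
  also have "\<dots> \<le> ennreal C * lsem \<U> \<mu>" by (intro mult_left_mono lsem_upper w) simp
  finally show "ennreal \<bar>blinfun_apply (lip_functional v) \<mu>\<bar> \<le> ennreal C * lsem \<U> \<mu>" .
qed

lemma lsem_lip_vanish_le:
  assumes "0 < C"
  shows "lsem (lip_vanish C A) \<mu> \<le> ennreal C * lsem (lip_vanish 1 A) \<mu>"
  unfolding lip_vanish_cmult[OF assms] using assms by (intro lsem_cmult[where D = 1]) (auto simp: lip_vanish_def)

text \<open>Finite combinations of evaluations are dense, and a function that vanishes on the
  support of such a combination annihilates it.\<close>

lemma lip_free_approx_finite:
  fixes \<mu> :: "'a::{metric_space, zero} lip_free"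
  assumes "0 < e"
  obtains F where "finite F" "0 \<in> F" "lsem (lip_vanish 1 F) \<mu> \<le> ennreal e"
proof -
  have "\<exists>F. finite F \<and> (\<forall>u C. C-lipschitz_on UNIV u \<longrightarrow> (\<forall>x\<in>insert 0 F. u x = 0) \<longrightarrow>
      blinfun_apply (lip_functional u) v = 0)" if "v \<in> span (range free_delta)" for v :: "'a lip_free"
    using that
  proof (induction rule: span_induct_alt)
    case base
    show ?case by (intro exI[of _ "{}"]) (simp add: blinfun.zero_right)
  next
    case (step c d y)
    then obtain x F where F: "d = free_delta x" "finite F"
      "\<forall>u C. C-lipschitz_on UNIV u \<longrightarrow> (\<forall>x\<in>insert 0 F. u x = 0) \<longrightarrow> blinfun_apply (lip_functional u) y = 0"
      by auto
    show ?case
    proof (intro exI[of _ "insert x F"] conjI allI impI)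
      fix u :: "'a \<Rightarrow> real" and C assume u: "C-lipschitz_on UNIV u" "\<forall>z\<in>insert 0 (insert x F). u z = 0"
      then have "blinfun_apply (lip_functional u) y = 0" using F(3) by auto
      then show "blinfun_apply (lip_functional u) (c *\<^sub>R d + y) = 0"
        using u by (simp add: F(1) blinfun.add_right blinfun.scaleR_right lip_functional_delta[OF u(1)])
    qed (use F in simp)
  qed
  note fin = this
  have "\<mu> \<in> closure (span (range free_delta))" by (simp add: closure_span_free_delta)
  then obtain v where v: "v \<in> span (range free_delta)" "dist v \<mu> < e"
    using assms by (auto simp: closure_approachable)
  from fin[OF v(1)] obtain F where F: "finite F"
    "\<And>u C. C-lipschitz_on UNIV u \<Longrightarrow> (\<forall>x\<in>insert 0 F. u x = 0) \<Longrightarrow> blinfun_apply (lip_functional u) v = 0"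
    by blast
  show ?thesis
  proof (rule that[of "insert 0 F"])
    show "lsem (lip_vanish 1 (insert 0 F)) \<mu> \<le> ennreal e"
    proof (rule lsem_least, rule ennreal_leI)
      fix u :: "'a \<Rightarrow> real" assume "u \<in> lip_vanish 1 (insert 0 F)"
      then have u: "1-lipschitz_on UNIV u" "\<forall>x\<in>insert 0 F. u x = 0" by (auto simp: lip_vanish_def)
      have "\<bar>blinfun_apply (lip_functional u) (\<mu> - v)\<bar> \<le> 1 * norm (\<mu> - v)" by (rule abs_lip_functional_le[OF u(1)])
      then show "\<bar>blinfun_apply (lip_functional u) \<mu>\<bar> \<le> e"
        using F(2)[OF u] v(2) by (simp add: blinfun.diff_right dist_norm norm_minus_commute)
    qed
  qed (use F in auto)
qed

section \<open>Weakly unconditionally Cauchy families of function classes\<close>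

text \<open>
  Equivalently, whichever functions are chosen from the classes, their sums with arbitrary signs are
  \<open>C\<close>-Lipschitz.
\<close>

definition wuc :: "real \<Rightarrow> (nat \<Rightarrow> ('a::metric_space \<Rightarrow> real) set) \<Rightarrow> bool" where
  "wuc C \<U> \<longleftrightarrow> (\<forall>j. \<U> j \<noteq> {}) \<and>
    (\<forall>u n x y. (\<forall>j. u j \<in> \<U> j) \<longrightarrow> (\<Sum>j<n. \<bar>u j x - u j y\<bar>) \<le> C * dist x y)"

text \<open>The definition speaks of complete choice sequences; beyond n the choice is filled up
  with arbitrary members of the nonempty classes.\<close>

lemma wuc_sum_le:
  fixes \<U> :: "nat \<Rightarrow> ('a::metric_space \<Rightarrow> real) set"
  assumes "wuc C \<U>" and u: "\<And>j. j < n \<Longrightarrow> u j \<in> \<U> j"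
  shows "(\<Sum>j<n. \<bar>u j x - u j y\<bar>) \<le> C * dist x y"
proof -
  have "\<forall>j. \<exists>v. v \<in> \<U> j" using assms(1) by (auto simp: wuc_def)
  then obtain v where v: "\<And>j. v j \<in> \<U> j" by metis
  have *: "(\<Sum>j<n. \<bar>w j x - w j y\<bar>) \<le> C * dist x y" if "\<And>j. w j \<in> \<U> j" for w
    using assms(1) that unfolding wuc_def by blast
  have "(\<Sum>j<n. \<bar>(if j < n then u j else v j) x - (if j < n then u j else v j) y\<bar>) \<le> C * dist x y"
    by (rule *) (use u v in auto)
  then show ?thesis by simp
qed

lemma wuc_signed_lipschitz:
  fixes \<U> :: "nat \<Rightarrow> ('a::metric_space \<Rightarrow> real) set"
  assumes "wuc C \<U>" and u: "\<And>j. j < n \<Longrightarrow> u j \<in> \<U> j" and s: "\<And>j. j < n \<Longrightarrow> \<bar>s j\<bar> \<le> 1" and C: "0 \<le> C"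
  shows "C-lipschitz_on UNIV (\<lambda>x. \<Sum>j<n. s j * u j x)"
proof (rule lipschitz_onI[OF _ C])
  fix x y
  have "\<bar>(\<Sum>j<n. s j * u j x) - (\<Sum>j<n. s j * u j y)\<bar> = \<bar>\<Sum>j<n. s j * (u j x - u j y)\<bar>"
    by (simp add: sum_subtractf algebra_simps)
  also have "\<dots> \<le> (\<Sum>j<n. \<bar>u j x - u j y\<bar>)"
    using s by (intro order_trans[OF sum_abs] sum_mono) (auto simp: abs_mult intro!: mult_left_le_one_le)
  also have "\<dots> \<le> C * dist x y" by (rule wuc_sum_le[OF assms(1) u])
  finally show "dist (\<Sum>j<n. s j * u j x) (\<Sum>j<n. s j * u j y) \<le> C * dist x y"
    by (simp add: dist_real_def)
qed

lemma wuc_lipschitz: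
  fixes \<U> :: "nat \<Rightarrow> ('a::metric_space \<Rightarrow> real) set"
  assumes "wuc C \<U>" and "u \<in> \<U> j" and C: "0 \<le> C"
  shows "C-lipschitz_on UNIV u"
proof -
  have "\<forall>j. \<exists>v. v \<in> \<U> j" using assms(1) by (auto simp: wuc_def)
  then obtain v where v: "\<And>j. v j \<in> \<U> j" by metis
  have "C-lipschitz_on UNIV (\<lambda>x. \<Sum>i<Suc j. (if i = j then 1 else 0) * (v(j := u)) i x)"
    using v assms by (intro wuc_signed_lipschitz[OF assms(1) _ _ C]) auto
  moreover have "(\<Sum>i<Suc j. (if i = j then 1 else 0) * (v(j := u)) i x) = u x" for x
    by (simp add: if_distrib[of "\<lambda>c. c * _"] cong: if_cong)
  ultimately show ?thesis by simp
qed

text \<open>Multiplying each \<open>u j\<close> by the sign of its value at \<mu> turns the sum of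
  absolute values into the value of one C-Lipschitz function.\<close>

lemma wuc_sum_functional_le:
  fixes \<U> :: "nat \<Rightarrow> ('a::{metric_space, zero} \<Rightarrow> real) set"
  assumes w: "wuc C \<U>" and u: "\<And>j. j < n \<Longrightarrow> u j \<in> \<U> j" and C: "0 \<le> C"
  shows "(\<Sum>j<n. \<bar>blinfun_apply (lip_functional (u j)) \<mu>\<bar>) \<le> C * norm \<mu>"
proof -
  define s where "s j = sgn (blinfun_apply (lip_functional (u j)) \<mu>)" for j
  have s: "\<bar>s j\<bar> \<le> 1" for j by (simp add: s_def abs_sgn_eq)
  have uj: "C-lipschitz_on UNIV (u j)" if "j < n" for j by (rule wuc_lipschitz[OF w u[OF that] C])
  have suj: "C-lipschitz_on UNIV (\<lambda>x. s j * u j x)" if "j < n" for j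
    using lipschitz_on_cmult_real[OF uj[OF that], of "s j"]
    by (rule lipschitz_on_mono) (use s C in \<open>auto intro!: mult_left_le_one_le\<close>)
  have "(\<Sum>j<n. \<bar>blinfun_apply (lip_functional (u j)) \<mu>\<bar>) =
      (\<Sum>j<n. blinfun_apply (lip_functional (\<lambda>x. s j * u j x)) \<mu>)"
  proof (intro sum.cong refl)
    fix j assume "j \<in> {..<n}"
    then have "blinfun_apply (lip_functional (\<lambda>x. s j * u j x)) \<mu> = s j *\<^sub>R blinfun_apply (lip_functional (u j)) \<mu>"
      by (simp only: lip_functional_cmult[OF uj] lessThan_iff blinfun.scaleR_left)
    also have "\<dots> = \<bar>blinfun_apply (lip_functional (u j)) \<mu>\<bar>" by (simp add: s_def abs_sgn mult.commute)
    finally show "\<bar>blinfun_apply (lip_functional (u j)) \<mu>\<bar> = blinfun_apply (lip_functional (\<lambda>x. s j * u j x)) \<mu>" ..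
  qed
  also have "\<dots> = blinfun_apply (lip_functional (\<lambda>x. \<Sum>j<n. s j * u j x)) \<mu>"
    by (simp add: lip_functional_sum[OF suj] blinfun.sum_left)
  also have "\<dots> \<le> C * norm \<mu>"
  proof -
    have "C-lipschitz_on UNIV (\<lambda>x. \<Sum>j<n. s j * u j x)" by (rule wuc_signed_lipschitz[OF w u s C])
    from abs_lip_functional_le[OF this, of \<mu>] show ?thesis by simp
  qed
  finally show ?thesis .
qed

text \<open>Since the choices in different classes are independent, the suprema can be taken one at
  a time; c carries the terms whose choice is already fixed in the induction.\<close>

lemma sum_SUP_le:
  fixes a :: "nat \<Rightarrow> 'b \<Rightarrow> ennreal"
  assumes ne: "\<And>j. A j \<noteq> {}"
    and le: "\<And>u. (\<And>j. j < n \<Longrightarrow> u j \<in> A j) \<Longrightarrow> (\<Sum>j<n. a j (u j)) + c \<le> B"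
  shows "(\<Sum>j<n. SUP x\<in>A j. a j x) + c \<le> B"
  using le
proof (induction n arbitrary: c)
  case (Suc n)
  have "(\<Sum>j<n. SUP x\<in>A j. a j x) + (a n x + c) \<le> B" if x: "x \<in> A n" for x
  proof (rule Suc.IH)
    fix u assume u: "\<And>j. j < n \<Longrightarrow> u j \<in> A j"
    have "(\<Sum>j<Suc n. a j ((u(n := x)) j)) + c \<le> B" using x u by (intro Suc.prems) (auto simp: less_Suc_eq)
    then show "(\<Sum>j<n. a j (u j)) + (a n x + c) \<le> B" by (simp add: add.assoc)
  qed
  then have "(SUP x\<in>A n. ((\<Sum>j<n. SUP x\<in>A j. a j x) + c) + a n x) \<le> B"
    by (intro SUP_least) (simp add: ac_simps)
  then have "((\<Sum>j<n. SUP x\<in>A j. a j x) + c) + (SUP x\<in>A n. a n x) \<le> B"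
    by (subst ennreal_SUP_add_right[OF ne])
  then show ?case by (simp add: ac_simps)
qed simp

lemma wuc_sum_lsem_le:
  fixes \<U> :: "nat \<Rightarrow> ('a::{metric_space, zero} \<Rightarrow> real) set"
  assumes w: "wuc C \<U>" and C: "0 \<le> C"
  shows "(\<Sum>j<n. lsem (\<U> j) \<mu>) \<le> ennreal (C * norm \<mu>)"
  unfolding sem_def image_comp comp_def
proof (rule sum_SUP_le[where c = 0, simplified])
  show "\<U> j \<noteq> {}" for j using w by (auto simp: wuc_def)
  fix u assume "\<And>j. j < n \<Longrightarrow> u j \<in> \<U> j"
  from wuc_sum_functional_le[where n = n and \<mu> = \<mu>, OF w this C]
  show "(\<Sum>j<n. ennreal \<bar>blinfun_apply (lip_functional (u j)) \<mu>\<bar>) \<le> ennreal (C * norm \<mu>)"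
    by (simp add: ennreal_leI)
qed

text \<open>For a pair x, y at most one function is nonzero at x and at most one at y; only these
  contribute, whence the factor 2.\<close>

lemma wuc_disjoint_support:
  fixes \<U> :: "nat \<Rightarrow> ('a::metric_space \<Rightarrow> real) set"
  assumes ne: "\<And>j. \<U> j \<noteq> {}" and lip: "\<And>j u. u \<in> \<U> j \<Longrightarrow> C-lipschitz_on UNIV u"
    and disj: "\<And>i j u v x. i < j \<Longrightarrow> u \<in> \<U> i \<Longrightarrow> v \<in> \<U> j \<Longrightarrow> u x = 0 \<or> v x = 0"
  shows "wuc (2 * C) \<U>"
  unfolding wuc_def
proof (intro conjI allI impI ne)
  fix u :: "nat \<Rightarrow> 'a \<Rightarrow> real" and n :: nat and x y :: 'a assume u: "\<forall>j. u j \<in> \<U> j"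
  have C: "0 \<le> C" using lip[OF u[rule_format, of 0]] by (rule lipschitz_on_nonneg)
  have one: "(\<Sum>j\<in>{j\<in>{..<n}. u j z \<noteq> 0}. C * dist x y) \<le> C * dist x y" for z
  proof -
    have "\<exists>i. {j\<in>{..<n}. u j z \<noteq> 0} \<subseteq> {i}"
    proof (cases "{j\<in>{..<n}. u j z \<noteq> 0} = {}")
      case False
      then obtain i where i: "i < n" "u i z \<noteq> 0" by auto
      have "j = i" if "u j z \<noteq> 0" for j
        using disj[of i j "u i" "u j" z] disj[of j i "u j" "u i" z] u i that by (cases i j rule: linorder_cases) auto
      then show ?thesis by (intro exI[of _ i]) auto
    qed auto
    then obtain i where "{j\<in>{..<n}. u j z \<noteq> 0} \<subseteq> {i}" by blast
    then have "(\<Sum>j\<in>{j\<in>{..<n}. u j z \<noteq> 0}. C * dist x y) \<le> (\<Sum>j\<in>{i}. C * dist x y)"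
      using C by (intro sum_mono2) auto
    then show ?thesis by simp
  qed
  have "(\<Sum>j<n. \<bar>u j x - u j y\<bar>) \<le>
      (\<Sum>j<n. (if u j x \<noteq> 0 then C * dist x y else 0) + (if u j y \<noteq> 0 then C * dist x y else 0))"
  proof (rule sum_mono)
    fix j
    have "\<bar>u j x - u j y\<bar> \<le> C * dist x y"
      using lipschitz_onD[OF lip[OF u[rule_format, of j]], of x y] by (simp add: dist_real_def)
    moreover have "0 \<le> C * dist x y" using C by simp
    ultimately show "\<bar>u j x - u j y\<bar> \<le>
        (if u j x \<noteq> 0 then C * dist x y else 0) + (if u j y \<noteq> 0 then C * dist x y else 0)" by auto
  qed
  also have "\<dots> = (\<Sum>j\<in>{j\<in>{..<n}. u j x \<noteq> 0}. C * dist x y) + (\<Sum>j\<in>{j\<in>{..<n}. u j y \<noteq> 0}. C * dist x y)"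
    by (simp only: sum.distrib sum.inter_filter finite_lessThan)
  also have "\<dots> \<le> 2 * C * dist x y" using one[of x] one[of y] by simp
  finally show "(\<Sum>j<n. \<bar>u j x - u j y\<bar>) \<le> 2 * C * dist x y" .
qed

section \<open>Averages of weakly unconditionally Cauchy families\<close>

text \<open>The condition for \<psi> to multiply Lipschitz functions vanishing at 0. Such a function
  is at most C times the distance to 0, so oscillation of \<psi> inversely proportional to that
  distance is harmless.\<close>

definition tame :: "real \<Rightarrow> ('a::{metric_space, zero} \<Rightarrow> real) \<Rightarrow> bool" where
  "tame A \<psi> \<longleftrightarrow> (\<forall>x. 0 \<le> \<psi> x \<and> \<psi> x \<le> 1) \<and>
    (\<forall>x y. min (dist x 0) (dist y 0) * \<bar>\<psi> x - \<psi> y\<bar> \<le> A * dist x y)"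

lemma tame_one_minus: "tame A \<psi> \<Longrightarrow> tame A (\<lambda>x. 1 - \<psi> x)"
  by (auto simp: tame_def abs_minus_commute)

lemma tame_mult_lipschitz:
  assumes u: "C-lipschitz_on UNIV u" "u 0 = 0" and \<psi>: "tame A \<psi>" and A: "0 \<le> A"
  shows "(C * (1 + A))-lipschitz_on UNIV (\<lambda>x. \<psi> x * u x)"
proof (rule lipschitz_onI)
  have C: "0 \<le> C" by (rule lipschitz_on_nonneg[OF u(1)])
  then show "0 \<le> C * (1 + A)" using A by simp
  \<comment> \<open>In the product rule u is evaluated at y, the point nearer to 0, where its bound
    by \<open>C * dist y 0\<close> meets the minimum in the definition of
    \<open>tame\<close>.\<close>
  have main: "\<bar>\<psi> x * u x - \<psi> y * u y\<bar> \<le> C * (1 + A) * dist x y" if "dist y 0 \<le> dist x 0" for x y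
  proof -
    have "\<psi> x * u x - \<psi> y * u y = \<psi> x * (u x - u y) + u y * (\<psi> x - \<psi> y)" by (simp add: algebra_simps)
    also have "\<bar>\<dots>\<bar> \<le> \<psi> x * \<bar>u x - u y\<bar> + \<bar>u y\<bar> * \<bar>\<psi> x - \<psi> y\<bar>"
      using \<psi> by (intro order_trans[OF abs_triangle_ineq]) (simp add: abs_mult tame_def)
    also have "\<psi> x * \<bar>u x - u y\<bar> \<le> 1 * (C * dist x y)"
      using \<psi> lipschitz_onD[OF u(1), of x y] C by (intro mult_mono) (auto simp: tame_def dist_real_def)
    also have "\<bar>u y\<bar> * \<bar>\<psi> x - \<psi> y\<bar> \<le> (C * dist y 0) * \<bar>\<psi> x - \<psi> y\<bar>"
      using lipschitz_onD[OF u(1), of y 0] u(2) by (intro mult_right_mono) (auto simp: dist_real_def)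
    also have "\<dots> = C * (min (dist x 0) (dist y 0) * \<bar>\<psi> x - \<psi> y\<bar>)" using that by (simp add: min_def)
    also have "\<dots> \<le> C * (A * dist x y)" using \<psi> C by (intro mult_left_mono) (auto simp: tame_def)
    finally show ?thesis by (simp add: algebra_simps)
  qed
  show "dist (\<psi> x * u x) (\<psi> y * u y) \<le> C * (1 + A) * dist x y" for x y
    using main[of x y] main[of y x] by (cases "dist y 0 \<le> dist x 0") (auto simp: dist_real_def dist_commute abs_minus_commute)
qed

text \<open>The radius grows with the distance to 0, so that the multiplier is tame with a constant
  depending on r alone. With c = 1 the function is 1 on F and 0 off the r-neighbourhood; with c = 2
  it is 1 on the r-neighbourhood and 0 off the 2r-neighbourhood.\<close>

definition cutoff :: "real \<Rightarrow> 'a::{metric_space, zero} set \<Rightarrow> real \<Rightarrow> 'a \<Rightarrow> real" where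
  "cutoff c F r x = max 0 (min 1 (c - infdist x F / (r * (1 + dist x 0))))"

definition scaled_nbhd :: "'a::{metric_space, zero} set \<Rightarrow> real \<Rightarrow> 'a set" where
  "scaled_nbhd F r = {x. infdist x F \<le> r * (1 + dist x 0)}"

lemma tame_cutoff:
  fixes F :: "'a::{metric_space, zero} set"
  assumes "0 \<in> F" and r: "0 < r"
  shows "tame (2 / r) (cutoff c F r)"
  unfolding tame_def
proof (intro conjI allI)
  show "0 \<le> cutoff c F r x" "cutoff c F r x \<le> 1" for x by (auto simp: cutoff_def)
  define q where "q x = infdist x F / (r * (1 + dist x 0))" for x
  have main: "dist y 0 * \<bar>q x - q y\<bar> \<le> 2 / r * dist x y" if le: "dist y 0 \<le> dist x 0" for x y
  proof -
    define a b where "a = dist x 0" and "b = dist y 0"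
    have ab: "0 \<le> a" "0 \<le> b" "b \<le> a" "\<bar>a - b\<bar> \<le> dist x y"
      using le dist_triangle[of x 0 y] by (auto simp: a_def b_def)
    \<comment> \<open>As 0 belongs to F, the distance of y to F is at most b. This bounds the term
      that comes from the variation of the denominator.\<close>
    have iy: "0 \<le> infdist y F" "infdist y F \<le> b" using infdist_le[OF assms(1), of y] by (auto simp: b_def infdist_nonneg)
    have ixy: "\<bar>infdist x F - infdist y F\<bar> \<le> dist x y"
      using infdist_triangle[of x F y] infdist_triangle[of y F x] by (auto simp: dist_commute)
    have pos: "0 < r * (1 + a) * (1 + b)" using r ab by (simp add: mult_pos_pos)
    have "q x - q y = ((infdist x F - infdist y F) * (1 + b) + infdist y F * (b - a)) / (r * (1 + a) * (1 + b))"
    proof -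
      have gen: "i / (r * A) - j / (r * B) = (i * B - j * A) / (r * A * B)" if "0 < A" "0 < B" for i j A B :: real
        using that r by (simp add: field_simps)
      have pos1: "0 < 1 + a" "0 < 1 + b" using ab by auto
      have num: "infdist x F * (1 + b) - infdist y F * (1 + a) =
          (infdist x F - infdist y F) * (1 + b) + infdist y F * (b - a)" by (simp add: algebra_simps)
      show ?thesis unfolding q_def a_def[symmetric] b_def[symmetric] gen[OF pos1] num ..
    qed
    then have "\<bar>q x - q y\<bar> = \<bar>(infdist x F - infdist y F) * (1 + b) + infdist y F * (b - a)\<bar> / (r * (1 + a) * (1 + b))"
      using pos by (simp add: abs_divide)
    also have "\<dots> \<le> (dist x y * (1 + b) + (1 + b) * dist x y) / (r * (1 + a) * (1 + b))"
    proof (rule divide_right_mono)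
      have "\<bar>(infdist x F - infdist y F) * (1 + b)\<bar> \<le> dist x y * (1 + b)"
        using ixy ab by (simp add: abs_mult mult_right_mono)
      moreover have "\<bar>infdist y F * (b - a)\<bar> \<le> (1 + b) * dist x y"
        unfolding abs_mult using iy ab by (intro mult_mono) auto
      ultimately show "\<bar>(infdist x F - infdist y F) * (1 + b) + infdist y F * (b - a)\<bar> \<le>
          dist x y * (1 + b) + (1 + b) * dist x y" by linarith
    qed (use pos in simp)
    also have "\<dots> = 2 * dist x y / (r * (1 + a))"
    proof -
      have "(d * B + B * d) / (r * A * B) = 2 * d / (r * A)" if "0 < A" "0 < B" for d A B :: real
        using that r by (simp add: field_simps)
      from this[of "1 + a" "1 + b" "dist x y"] ab show ?thesis by linarith
    qed
    finally have "b * \<bar>q x - q y\<bar> \<le> b * (2 * dist x y / (r * (1 + a)))" using ab by (intro mult_left_mono)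
    also have "\<dots> = (b / (1 + a)) * (2 / r * dist x y)"
    proof -
      have "b * (2 * d / (r * A)) = (b / A) * (2 / r * d)" if "0 < A" for d A :: real
        using that r by (simp add: field_simps)
      from this[of "1 + a" "dist x y"] ab show ?thesis by linarith
    qed
    also have "\<dots> \<le> 1 * (2 / r * dist x y)" using ab r by (intro mult_right_mono) auto
    finally show ?thesis by (simp add: b_def)
  qed
  fix x y
  have "\<bar>cutoff c F r x - cutoff c F r y\<bar> \<le> \<bar>q x - q y\<bar>" by (auto simp: cutoff_def q_def)
  then have "min (dist x 0) (dist y 0) * \<bar>cutoff c F r x - cutoff c F r y\<bar> \<le> min (dist x 0) (dist y 0) * \<bar>q x - q y\<bar>"
    by (intro mult_left_mono) auto
  also have "\<dots> \<le> 2 / r * dist x y"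
    using main[of x y] main[of y x] by (cases "dist y 0 \<le> dist x 0") (auto simp: min_def dist_commute abs_minus_commute)
  finally show "min (dist x 0) (dist y 0) * \<bar>cutoff c F r x - cutoff c F r y\<bar> \<le> 2 / r * dist x y" .
qed

lemma cutoff_zero: "0 < r \<Longrightarrow> x \<notin> scaled_nbhd F (c * r) \<Longrightarrow> cutoff c F r x = 0"
proof -
  assume r: "0 < r" and "x \<notin> scaled_nbhd F (c * r)"
  then have "c * (r * (1 + dist x 0)) \<le> infdist x F" by (simp add: scaled_nbhd_def mult.assoc)
  moreover have "0 < r * (1 + dist x 0)" using r by (simp add: add_pos_nonneg)
  ultimately have "c \<le> infdist x F / (r * (1 + dist x 0))" by (simp add: pos_le_divide_eq)
  then show ?thesis by (simp add: cutoff_def)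
qed

lemma cutoff_one: "0 < r \<Longrightarrow> infdist x F \<le> (c - 1) * (r * (1 + dist x 0)) \<Longrightarrow> cutoff c F r x = 1"
proof -
  assume r: "0 < r" and le: "infdist x F \<le> (c - 1) * (r * (1 + dist x 0))"
  have "0 < r * (1 + dist x 0)" using r by (simp add: add_pos_nonneg)
  with le have "infdist x F / (r * (1 + dist x 0)) \<le> c - 1" by (simp add: pos_divide_le_eq)
  then show ?thesis by (simp add: cutoff_def)
qed

lemma scaled_nbhd_mono: "F \<noteq> {} \<Longrightarrow> F \<subseteq> G \<Longrightarrow> scaled_nbhd F r \<subseteq> scaled_nbhd G r"
  unfolding scaled_nbhd_def by (rule Collect_mono, rule impI, rule order_trans[OF infdist_mono])

lemma subset_scaled_nbhd: "0 \<le> r \<Longrightarrow> F \<subseteq> scaled_nbhd F r"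
  by (auto simp: scaled_nbhd_def)

lemma closed_scaled_nbhd: "closed (scaled_nbhd F r)"
  unfolding scaled_nbhd_def by (intro closed_Collect_le continuous_intros)

lemma lip_vanish_antimono: "A \<subseteq> B \<Longrightarrow> lip_vanish C B \<subseteq> lip_vanish C A"
  by (auto simp: lip_vanish_def)

lemma lsem_split:
  assumes "\<And>u. u \<in> \<U> \<Longrightarrow> \<exists>v\<in>\<V>. \<exists>w\<in>\<W>. u = (\<lambda>x. v x + w x)"
    and "\<And>v. v \<in> \<V> \<Longrightarrow> C-lipschitz_on UNIV v" and "\<And>w. w \<in> \<W> \<Longrightarrow> D-lipschitz_on UNIV w"
  shows "lsem \<U> \<mu> \<le> lsem \<V> \<mu> + lsem \<W> \<mu>"
proof (rule lsem_least)
  fix u assume "u \<in> \<U>"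
  then obtain v w where vw: "v \<in> \<V>" "w \<in> \<W>" "u = (\<lambda>x. v x + w x)" using assms(1) by blast
  have "ennreal \<bar>blinfun_apply (lip_functional u) \<mu>\<bar> \<le>
      ennreal \<bar>blinfun_apply (lip_functional v) \<mu>\<bar> + ennreal \<bar>blinfun_apply (lip_functional w) \<mu>\<bar>"
    by (simp add: vw(3) lip_functional_add[OF assms(2)[OF vw(1)] assms(3)[OF vw(2)]] blinfun.add_left
        flip: ennreal_plus)
  also have "\<dots> \<le> lsem \<V> \<mu> + lsem \<W> \<mu>" using vw by (intro add_mono lsem_upper)
  finally show "ennreal \<bar>blinfun_apply (lip_functional u) \<mu>\<bar> \<le> lsem \<V> \<mu> + lsem \<W> \<mu>" .
qed

definition lip_small :: "real \<Rightarrow> ('a::metric_space \<Rightarrow> real) set" where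
  "lip_small \<eta> = {u. 1-lipschitz_on UNIV u \<and> (\<forall>x. \<bar>u x\<bar> \<le> \<eta>)}"

lemma finite_separated:
  fixes F :: "'a::metric_space set"
  assumes "finite F"
  obtains s where "0 < s" "\<And>x y. x \<in> F \<Longrightarrow> y \<in> F \<Longrightarrow> x \<noteq> y \<Longrightarrow> s \<le> dist x y"
proof
  let ?D = "insert 1 ((\<lambda>(x, y). dist x y) ` {(x, y) \<in> F \<times> F. x \<noteq> y})"
  have fin: "finite ?D" using assms by (intro finite.insertI finite_imageI finite_subset[OF _ finite_cartesian_product[OF assms assms]]) auto
  then show "0 < Min ?D" by (subst Min_gr_iff) auto
  show "Min ?D \<le> dist x y" if "x \<in> F" "y \<in> F" "x \<noteq> y" for x y
    using that fin by (intro Min_le) auto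
qed

lemma compact_closure_totally_bounded:
  fixes S :: "'a::complete_space set"
  assumes "\<And>e. 0 < e \<Longrightarrow> \<exists>k. finite k \<and> S \<subseteq> (\<Union>x\<in>k. ball x e)"
  shows "compact (closure S)"
proof -
  have "\<exists>k. finite k \<and> closure S \<subseteq> (\<Union>x\<in>k. ball x e)" if e: "0 < e" for e
  proof -
    obtain k where k: "finite k" "S \<subseteq> (\<Union>x\<in>k. ball x (e / 2))" using assms[of "e / 2"] e by auto
    have "(\<Union>x\<in>k. ball x (e / 2)) \<subseteq> (\<Union>x\<in>k. cball x (e / 2))" by (intro UN_mono ball_subset_cball) auto
    with k have "closure S \<subseteq> (\<Union>x\<in>k. cball x (e / 2))"
      by (intro closure_minimal closed_UN) auto
    also have "\<dots> \<subseteq> (\<Union>x\<in>k. ball x e)" using e by (intro UN_mono) (auto simp: subset_iff)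
    finally show ?thesis using k(1) by blast
  qed
  then show ?thesis unfolding compact_eq_totally_bounded by (simp add: complete_eq_closed)
qed

lemma infdist_less_finite:
  assumes "finite F" "F \<noteq> {}" "infdist x F < e"
  obtains p where "p \<in> F" "dist x p < e"
proof -
  have "infdist x F = Min ((\<lambda>p. dist x p) ` F)"
    using assms by (simp add: infdist_notempty cInf_eq_Min)
  with assms show ?thesis using that by (auto simp: Min_less_iff)
qed

lemma ennreal_half_add: "0 \<le> e \<Longrightarrow> ennreal (e / 2) + ennreal (e / 2) = ennreal e"
  by (subst ennreal_plus[symmetric]) auto

lemma ennreal_mult_divide: "0 < C \<Longrightarrow> 0 \<le> e \<Longrightarrow> ennreal C * ennreal (e / C) = ennreal e"
  by (subst ennreal_mult[symmetric]) auto

text \<open>The common setting for weakly null sequences (one-point space) and differences of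
  martingales. \<open>approx\<close> says that each \<open>Y k\<close> is, in mean, nearly carried
  by a finite set. In \<open>null\<close> the classes are tested along an arbitrary subsequence, as
  the humps constructed below occur at sparse indices only.\<close>

locale wuc_null =
  fixes P :: "'p measure" and Y :: "nat \<Rightarrow> 'p \<Rightarrow> 'm::{complete_space, zero} lip_free"
  assumes meas: "\<And>k. Y k \<in> borel_measurable P"
    and norm_finite: "\<And>k. (\<integral>\<^sup>+\<omega>. norm (Y k \<omega>) \<partial>P) < \<infinity>"
    and approx: "\<And>k e. 0 < e \<Longrightarrow> \<exists>F. finite F \<and> 0 \<in> F \<and> (\<integral>\<^sup>+\<omega>. lsem (lip_vanish 1 F) (Y k \<omega>) \<partial>P) \<le> ennreal e"
    and null: "\<And>C \<U> r. wuc C \<U> \<Longrightarrow> 0 \<le> C \<Longrightarrow> strict_mono r \<Longrightarrow>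
      (\<lambda>j. \<integral>\<^sup>+\<omega>. lsem (\<U> j) (Y (r j) \<omega>) \<partial>P) \<longlonglongrightarrow> 0"
begin

definition I :: "('m \<Rightarrow> real) set \<Rightarrow> nat \<Rightarrow> ennreal" where
  "I \<U> k = (\<integral>\<^sup>+\<omega>. lsem \<U> (Y k \<omega>) \<partial>P)"

lemma lsem_measurable: "(\<lambda>\<omega>. lsem \<U> (Y k \<omega>)) \<in> borel_measurable P"
  by (rule measurable_compose[OF meas borel_measurable_sem])

lemma I_mono: "\<U> \<subseteq> \<V> \<Longrightarrow> I \<U> k \<le> I \<V> k"
  unfolding I_def by (intro nn_integral_mono lsem_mono)

lemma I_split:
  assumes "\<And>u. u \<in> \<U> \<Longrightarrow> \<exists>v\<in>\<V>. \<exists>w\<in>\<W>. u = (\<lambda>x. v x + w x)"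
    and "\<And>v. v \<in> \<V> \<Longrightarrow> C-lipschitz_on UNIV v" and "\<And>w. w \<in> \<W> \<Longrightarrow> D-lipschitz_on UNIV w"
  shows "I \<U> k \<le> I \<V> k + I \<W> k"
proof -
  have "I \<U> k \<le> (\<integral>\<^sup>+\<omega>. lsem \<V> (Y k \<omega>) + lsem \<W> (Y k \<omega>) \<partial>P)"
    unfolding I_def by (intro nn_integral_mono lsem_split[OF assms])
  also have "\<dots> = I \<V> k + I \<W> k" unfolding I_def by (intro nn_integral_add lsem_measurable)
  finally show ?thesis .
qed

lemma I_lip_vanish: "0 < C \<Longrightarrow> I (lip_vanish C A) k \<le> ennreal C * I (lip_vanish 1 A) k"
  unfolding I_def by (subst nn_integral_cmult[symmetric, OF lsem_measurable]) (intro nn_integral_mono lsem_lip_vanish_le)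

lemma I_approx: "0 < e \<Longrightarrow> \<exists>F. finite F \<and> 0 \<in> F \<and> I (lip_vanish 1 F) k \<le> ennreal e"
  unfolding I_def by (rule approx)

lemma I_approx_upto:
  assumes "0 < e"
  shows "\<exists>F. finite F \<and> 0 \<in> F \<and> (\<forall>k\<le>m. I (lip_vanish 1 F) k \<le> ennreal e)"
proof -
  have "\<forall>k. \<exists>F. finite F \<and> 0 \<in> F \<and> I (lip_vanish 1 F) k \<le> ennreal e" using I_approx[OF assms] by blast
  then obtain F where F: "\<And>k. finite (F k)" "\<And>k. 0 \<in> F k" "\<And>k. I (lip_vanish 1 (F k)) k \<le> ennreal e" by metis
  have "I (lip_vanish 1 (\<Union>k\<le>m. F k)) k \<le> ennreal e" if "k \<le> m" for k
    using that by (intro order_trans[OF I_mono[OF lip_vanish_antimono[of "F k"]] F(3)[of k]]) auto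
  then show ?thesis using F by (intro exI[of _ "\<Union>k\<le>m. F k"]) auto
qed

text \<open>On a finite set with separation s, a function bounded by \<open>t * s / 2\<close> is
  t-Lipschitz. Extending this restriction leaves a difference that vanishes on the finite set; both
  parts are small in mean.\<close>

lemma I_lip_small:
  assumes e: "0 < e"
  obtains \<eta> where "0 < \<eta>" "\<And>\<eta>'. \<eta>' \<le> \<eta> \<Longrightarrow> I (lip_small \<eta>') k \<le> ennreal e"
proof -
  obtain F where F: "finite F" "0 \<in> F" "I (lip_vanish 1 F) k \<le> ennreal (e / 4)"
    using I_approx[of "e / 4"] e by auto
  obtain s where s: "0 < s" "\<And>x y. x \<in> F \<Longrightarrow> y \<in> F \<Longrightarrow> x \<noteq> y \<Longrightarrow> s \<le> dist x y"
    by (rule finite_separated[OF F(1)]) blast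
  define b where "b = enn2real (\<integral>\<^sup>+\<omega>. norm (Y k \<omega>) \<partial>P)"
  have b: "0 \<le> b" "(\<integral>\<^sup>+\<omega>. norm (Y k \<omega>) \<partial>P) = ennreal b"
    using norm_finite[of k] by (auto simp: b_def)
  \<comment> \<open>The t-Lipschitz part costs at most \<open>t * b \<le> e / 2\<close>; the part
    vanishing on F is 2-Lipschitz and costs 2 times e / 4.\<close>
  define t where "t = min 1 (e / (2 * (1 + b)))"
  have t: "0 < t" "t \<le> 1" "t * b \<le> e / 2"
  proof -
    show "0 < t" "t \<le> 1" using e b by (auto simp: t_def)
    have "t * b \<le> e / (2 * (1 + b)) * (1 + b)" using b e by (intro mult_mono) (auto simp: t_def)
    also have "\<dots> = e / 2"
    proof -
      have "e / (2 * D) * D = e / 2" if "0 < D" for D using that by simp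
      from this[of "1 + b"] b show ?thesis by simp
    qed
    finally show "t * b \<le> e / 2" .
  qed
  define \<eta> where "\<eta> = t * s / 2"
  show ?thesis
  proof (rule that)
    show "0 < \<eta>" using t s by (simp add: \<eta>_def)
    fix \<eta>' assume "\<eta>' \<le> \<eta>"
    have "I (lip_small \<eta>') k \<le> I (lip_vanish 2 F) k + I {w. t-lipschitz_on UNIV w} k"
    proof (rule I_split[where C = 2 and D = t])
      fix u :: "'m \<Rightarrow> real" assume "u \<in> lip_small \<eta>'"
      then have u: "1-lipschitz_on UNIV u" "\<And>x. \<bar>u x\<bar> \<le> \<eta>" using \<open>\<eta>' \<le> \<eta>\<close> by (auto simp: lip_small_def intro: order_trans)
      have "t-lipschitz_on F u"
      proof (rule lipschitz_onI)
        fix x y assume xy: "x \<in> F" "y \<in> F"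
        show "dist (u x) (u y) \<le> t * dist x y"
        proof (cases "x = y")
          case False
          have "dist (u x) (u y) \<le> t * s" using u(2)[of x] u(2)[of y] by (simp add: dist_real_def \<eta>_def)
          also have "\<dots> \<le> t * dist x y" using s(2)[OF xy False] t by (intro mult_left_mono) auto
          finally show ?thesis .
        qed simp
      qed (use t in simp)
      then obtain w where w: "t-lipschitz_on UNIV w" "\<And>x. x \<in> F \<Longrightarrow> w x = u x"
        by (rule lipschitz_extension_real) blast
      have "(1 + t)-lipschitz_on UNIV (\<lambda>x. u x - w x)" by (rule lipschitz_on_diff[OF u(1) w(1)])
      then have "(\<lambda>x. u x - w x) \<in> lip_vanish 2 F"
        using w(2) t by (auto simp: lip_vanish_def intro: lipschitz_on_mono)
      then show "\<exists>v\<in>lip_vanish 2 F. \<exists>w\<in>{w. t-lipschitz_on UNIV w}. u = (\<lambda>x. v x + w x)"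
        using w(1) by (intro bexI[of _ "\<lambda>x. u x - w x"] bexI[of _ w]) auto
    qed (auto simp: lip_vanish_def)
    also have "I (lip_vanish 2 F) k \<le> ennreal 2 * ennreal (e / 4)"
      by (rule order_trans[OF I_lip_vanish]) (use F in \<open>auto intro: mult_left_mono\<close>)
    also have "I {w. t-lipschitz_on UNIV w} k \<le> (\<integral>\<^sup>+\<omega>. ennreal t * norm (Y k \<omega>) \<partial>P)"
      unfolding I_def using t
      by (intro nn_integral_mono) (auto intro!: order_trans[OF lsem_le_norm[of _ t]] simp: ennreal_mult)
    also have "\<dots> = ennreal (t * b)"
      using t b measurable_compose[OF meas[of k] borel_measurable_norm]
      by (subst nn_integral_cmult) (auto simp: ennreal_mult measurable_compose[OF meas[of k]])
    also have "\<dots> \<le> ennreal (e / 2)" using t by (intro ennreal_leI)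
    also have "ennreal 2 * ennreal (e / 4) + ennreal (e / 2) = ennreal e"
      using ennreal_mult_divide[of 2 "e / 2"] ennreal_half_add[of e] e by simp
    finally show "I (lip_small \<eta>') k \<le> ennreal e" by (auto intro: add_mono)
  qed
qed

text \<open>If no finite set works, there are increasing finite sets F n and indices k n such that
  \<open>Y (k n)\<close> is nearly carried by the next set but not by the neighbourhood of F n.
  Cutoffs turn the mass in between into classes with disjoint supports, contradicting
  \<open>null\<close>.\<close>

lemma finite_tight:
  assumes r: "0 < r" and e: "0 < e"
  obtains F where "finite F" "0 \<in> F" "\<And>k. I (lip_vanish 1 (scaled_nbhd F r)) k \<le> ennreal e"
proof -
  have "\<exists>F. finite F \<and> 0 \<in> F \<and> (\<forall>k. I (lip_vanish 1 (scaled_nbhd F r)) k \<le> ennreal e)"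
  proof (rule ccontr)
    assume "\<not> ?thesis"
    then have bad: "\<exists>k. ennreal e < I (lip_vanish 1 (scaled_nbhd F r)) k" if "finite F" "0 \<in> F" for F
      using that by (force simp: not_le)
    define C where "C = 1 * (1 + 2 / r)"
    have C: "1 \<le> C" using r by (simp add: C_def)
    define Q where "Q = (\<lambda>(F, k). finite F \<and> 0 \<in> F \<and> ennreal e < I (lip_vanish 1 (scaled_nbhd F r)) k)"
    define R where "R = (\<lambda>(F :: 'm set, k) (F', k' :: nat). F \<subseteq> F' \<and> k < k' \<and> I (lip_vanish 1 F') k \<le> ennreal (e / (2 * C)))"
    have "\<exists>p. \<forall>n. Q (p n) \<and> R (p n) (p (Suc n))"
    proof (rule dependent_nat_choice)
      show "\<exists>x. Q x" using bad[of "{0}"] by (auto simp: Q_def)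
      fix x n assume "Q x"
      obtain F k where x: "x = (F, k)" by (cases x)
      obtain G where G: "finite G" "0 \<in> G" "\<forall>i\<le>k. I (lip_vanish 1 G) i \<le> ennreal (e / (2 * C))"
        using I_approx_upto[of "e / (2 * C)" k] e C by auto
      define F' where "F' = F \<union> G"
      have F': "finite F'" "0 \<in> F'" "F \<subseteq> F'" using \<open>Q x\<close> G by (auto simp: F'_def Q_def x)
      have small: "I (lip_vanish 1 F') i \<le> ennreal (e / (2 * C))" if "i \<le> k" for i
        by (rule order_trans[OF I_mono[OF lip_vanish_antimono[of G F']]]) (use G(3) that in \<open>auto simp: F'_def\<close>)
      obtain k' where k': "ennreal e < I (lip_vanish 1 (scaled_nbhd F' r)) k'" using bad F' by blast
      \<comment> \<open>The new set nearly carries every Y i with i <= k, so the next bad index must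
        be larger. This makes the indices a subsequence.\<close>
      have "k < k'"
      proof (rule ccontr)
        assume "\<not> k < k'"
        then have "I (lip_vanish 1 (scaled_nbhd F' r)) k' \<le> ennreal (e / (2 * C))"
          using r by (intro order_trans[OF I_mono[OF lip_vanish_antimono[OF subset_scaled_nbhd]] small]) auto
        also have "\<dots> \<le> ennreal e" using e C by (intro ennreal_leI) (simp add: field_simps)
        finally show False using k' by simp
      qed
      then show "\<exists>y. Q y \<and> R x y"
        using F' k' small by (intro exI[of _ "(F', k')"]) (auto simp: Q_def R_def x)
    qed
    then obtain p where p: "\<And>n. Q (p n)" "\<And>n. R (p n) (p (Suc n))" by blast
    define F k where "F n = fst (p n)" and "k n = snd (p n)" for n
    have F: "finite (F n)" "0 \<in> F n" and big: "ennreal e < I (lip_vanish 1 (scaled_nbhd (F n) r)) (k n)" for n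
      using p(1)[of n] by (auto simp: Q_def F_def k_def split: prod.splits)
    have FS: "F n \<subseteq> F (Suc n)" "k n < k (Suc n)" "I (lip_vanish 1 (F (Suc n))) (k n) \<le> ennreal (e / (2 * C))" for n
      using p(2)[of n] by (auto simp: R_def F_def k_def split: prod.splits)
    have Fmono: "F m \<subseteq> F n" if "m \<le> n" for m n using lift_Suc_mono_le[of F] FS(1) that by blast
    have k: "strict_mono k" using FS(2) by (simp add: strict_mono_Suc_iff)
    \<comment> \<open>Members vanish on the neighbourhood of F n and outside that of F (Suc n);
      since the sets increase, different n have disjoint supports.\<close>
    define \<U> where "\<U> n = (\<lambda>u x. cutoff 1 (F (Suc n)) r x * u x) ` lip_vanish 1 (scaled_nbhd (F n) r)" for n
    have zero: "u 0 = 0" if "u \<in> lip_vanish 1 (scaled_nbhd (F n) r)" for u n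
      using that F(2)[of n] subset_scaled_nbhd[of r "F n"] r by (auto simp: lip_vanish_def)
    have Ulip: "C-lipschitz_on UNIV v" if "v \<in> \<U> n" for v n
    proof -
      obtain u where u: "u \<in> lip_vanish 1 (scaled_nbhd (F n) r)" "v = (\<lambda>x. cutoff 1 (F (Suc n)) r x * u x)"
        using \<open>v \<in> \<U> n\<close> unfolding \<U>_def by blast
      show ?thesis unfolding C_def u(2)
        using u(1) zero[OF u(1)] r by (intro tame_mult_lipschitz tame_cutoff F(2)) (auto simp: lip_vanish_def)
    qed
    have wuc: "wuc (2 * C) \<U>"
    proof (rule wuc_disjoint_support)
      have "(\<lambda>_. 0) \<in> lip_vanish 1 (scaled_nbhd (F n) r)" for n
        by (auto simp: lip_vanish_def intro: lipschitz_on_mono[OF lipschitz_on_constant])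
      then show "\<U> j \<noteq> {}" for j unfolding \<U>_def by blast
      fix i j u v x assume ij: "i < j" and u: "u \<in> \<U> i" and v: "v \<in> \<U> j"
      show "u x = 0 \<or> v x = 0"
      proof (cases "x \<in> scaled_nbhd (F (Suc i)) r")
        case True
        then have "x \<in> scaled_nbhd (F j) r"
          using scaled_nbhd_mono[OF _ Fmono[of "Suc i" j], of r] ij F(2)[of "Suc i"] by auto
        then show ?thesis using v by (auto simp: \<U>_def lip_vanish_def)
      next
        case False
        then have "cutoff 1 (F (Suc i)) r x = 0" using cutoff_zero[of r x _ 1] r by simp
        then show ?thesis using u by (auto simp: \<U>_def)
      qed
    qed (rule Ulip)
    \<comment> \<open>The remainder \<open>(1 - \<psi>) * u\<close> vanishes on F (Suc n), which
      nearly carries \<open>Y (k n)\<close>; so half of e survives in \<U> n.\<close>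
    have le: "I (lip_vanish 1 (scaled_nbhd (F n) r)) (k n) \<le> I (\<U> n) (k n) + ennreal (e / 2)" for n
    proof -
      have "I (lip_vanish 1 (scaled_nbhd (F n) r)) (k n) \<le> I (\<U> n) (k n) + I (lip_vanish C (F (Suc n))) (k n)"
      proof (rule I_split[OF _ Ulip[where n = n]])
        fix u assume u: "u \<in> lip_vanish 1 (scaled_nbhd (F n) r)"
        let ?\<psi> = "cutoff 1 (F (Suc n)) r"
        have "C-lipschitz_on UNIV (\<lambda>x. (1 - ?\<psi> x) * u x)" unfolding C_def
          using u zero[OF u] r by (intro tame_mult_lipschitz tame_one_minus tame_cutoff F(2)) (auto simp: lip_vanish_def)
        moreover have "?\<psi> x = 1" if "x \<in> F (Suc n)" for x using that r by (intro cutoff_one) auto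
        ultimately have "(\<lambda>x. (1 - ?\<psi> x) * u x) \<in> lip_vanish C (F (Suc n))" by (auto simp: lip_vanish_def)
        moreover have "(\<lambda>x. ?\<psi> x * u x) \<in> \<U> n" using u by (auto simp: \<U>_def)
        ultimately show "\<exists>v\<in>\<U> n. \<exists>w\<in>lip_vanish C (F (Suc n)). u = (\<lambda>x. v x + w x)"
          by (intro bexI[of _ "\<lambda>x. ?\<psi> x * u x"] bexI[of _ "\<lambda>x. (1 - ?\<psi> x) * u x"]) (auto simp: algebra_simps)
      qed (auto simp: lip_vanish_def)
      also have "I (lip_vanish C (F (Suc n))) (k n) \<le> ennreal C * ennreal (e / (2 * C))"
        using C FS(3)[of n] by (intro order_trans[OF I_lip_vanish] mult_left_mono) auto
      also have "ennreal C * ennreal (e / (2 * C)) = ennreal (e / 2)"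
        using ennreal_mult_divide[of C "e / 2"] C e by simp
      finally show ?thesis by (auto intro: add_mono)
    qed
    have "(\<lambda>n. I (\<U> n) (k n)) \<longlonglongrightarrow> 0" unfolding I_def using C by (intro null[OF wuc _ k]) simp
    from order_tendstoD(2)[OF this, of "ennreal (e / 2)"] e
    obtain n where "I (\<U> n) (k n) < ennreal (e / 2)" by (auto simp: eventually_sequentially)
    then have "I (lip_vanish 1 (scaled_nbhd (F n) r)) (k n) \<le> ennreal (e / 2) + ennreal (e / 2)"
      by (intro order_trans[OF le] add_mono) auto
    also have "\<dots> = ennreal e" using e by (intro ennreal_half_add) simp
    finally show False using big[of n] by simp
  qed
  then show ?thesis using that by blast
qed

end

section \<open>Tightness: localisation on one compact set\<close>

lemma lipschitz_clamp:
  fixes u :: "'a::metric_space \<Rightarrow> real"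
  assumes u: "C-lipschitz_on UNIV u" and \<theta>: "0 \<le> \<theta>"
  shows "C-lipschitz_on UNIV (\<lambda>x. max (- \<theta>) (min \<theta> (u x)))"
    and "C-lipschitz_on UNIV (\<lambda>x. u x - max (- \<theta>) (min \<theta> (u x)))"
proof -
  have C: "0 \<le> C" by (rule lipschitz_on_nonneg[OF u])
  have d: "\<bar>u x - u y\<bar> \<le> C * dist x y" for x y
    using lipschitz_onD[OF u, of x y] by (simp add: dist_real_def)
  show "C-lipschitz_on UNIV (\<lambda>x. max (- \<theta>) (min \<theta> (u x)))"
    "C-lipschitz_on UNIV (\<lambda>x. u x - max (- \<theta>) (min \<theta> (u x)))"
    unfolding lipschitz_on_def dist_real_def using C d \<theta> by (auto intro!: order_trans[OF _ d])
qed

text \<open>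
  Telescoping \<open>w = \<Sum>i\<le>m. (1 - \<psi> i) w\<^sub>i + w\<^sub>m\<^sub>+\<^sub>1\<close>, where \<open>w\<^sub>i\<close> is the product of \<open>w\<close> with the first \<open>i\<close>
  cutoffs.
\<close>

lemma cutoff_telescope:
  fixes w :: "'a::{metric_space, zero} \<Rightarrow> real" and \<psi> :: "nat \<Rightarrow> 'a \<Rightarrow> real"
  assumes w: "1-lipschitz_on UNIV w" "w 0 = 0"
    and \<psi>: "\<And>i. tame (A i) (\<psi> i)" and A: "\<And>i. 0 \<le> A i"
    and one: "\<And>i x. x \<in> N i \<Longrightarrow> \<psi> i x = 1"
    and zero: "\<And>x. w x \<noteq> 0 \<Longrightarrow> \<exists>i\<le>m. \<psi> i x = 0"
  shows "ennreal \<bar>blinfun_apply (lip_functional w) \<mu>\<bar> \<le>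
    (\<Sum>i\<le>m. lsem (lip_vanish (\<Prod>l\<le>i. 1 + A l) (N i)) \<mu>)"
proof -
  \<comment> \<open>By \<open>tame_mult_lipschitz\<close> each further cutoff multiplies the
    Lipschitz constant by 1 + A l. The last product vanishes because some cutoff is 0 wherever w is
    not.\<close>
  define W where "W i x = (\<Prod>l<i. \<psi> l x) * w x" for i x
  have WS: "W (Suc i) = (\<lambda>x. \<psi> i x * W i x)" for i by (auto simp: W_def)
  have W0: "W i 0 = 0" for i by (simp add: W_def w)
  have Wlip: "(\<Prod>l<i. 1 + A l)-lipschitz_on UNIV (W i)" for i
  proof (induction i)
    case 0
    then show ?case using w by (simp add: W_def)
  next
    case (Suc i)
    from tame_mult_lipschitz[OF this W0 \<psi>[of i] A[of i]] show ?case by (simp add: WS)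
  qed
  define V where "V i x = (1 - \<psi> i x) * W i x" for i x
  have Vlip: "(\<Prod>l\<le>i. 1 + A l)-lipschitz_on UNIV (V i)" for i
    using tame_mult_lipschitz[OF Wlip[of i] W0 tame_one_minus[OF \<psi>[of i]] A[of i]]
    by (simp add: V_def[abs_def] lessThan_Suc_atMost[symmetric])
  then have V: "V i \<in> lip_vanish (\<Prod>l\<le>i. 1 + A l) (N i)" for i
    using one by (auto simp: lip_vanish_def V_def)
  have "w x = (\<Sum>i<Suc m. V i x)" for x
  proof -
    have "(\<Sum>i<n. V i x) = w x - W n x" for n
      by (induction n) (auto simp: V_def WS W_def algebra_simps)
    moreover have "W (Suc m) x = 0"
    proof (cases "w x = 0")
      case False
      then have "(\<Prod>l<Suc m. \<psi> l x) = 0" using zero[of x] by (intro prod_zero) auto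
      then show ?thesis unfolding W_def by (simp only: mult_zero_left)
    qed (simp add: W_def)
    ultimately show ?thesis by simp
  qed
  then have weq: "w = (\<lambda>x. \<Sum>i<Suc m. V i x)" by auto
  define C where "C = (\<Prod>l\<le>m. 1 + A l)"
  have Vlip': "C-lipschitz_on UNIV (V i)" if "i < Suc m" for i
    using Vlip[of i]
  proof (rule lipschitz_on_mono)
    show "(\<Prod>l\<le>i. 1 + A l) \<le> C"
      unfolding C_def using that A by (intro prod_mono2) (auto simp: add_increasing2)
  qed simp
  have "\<bar>blinfun_apply (lip_functional w) \<mu>\<bar> = \<bar>\<Sum>i<Suc m. blinfun_apply (lip_functional (V i)) \<mu>\<bar>"
    unfolding weq by (simp only: lip_functional_sum[OF Vlip'] blinfun.sum_left)
  also have "\<dots> \<le> (\<Sum>i<Suc m. \<bar>blinfun_apply (lip_functional (V i)) \<mu>\<bar>)" by (rule sum_abs)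
  finally have "ennreal \<bar>blinfun_apply (lip_functional w) \<mu>\<bar> \<le> (\<Sum>i<Suc m. ennreal \<bar>blinfun_apply (lip_functional (V i)) \<mu>\<bar>)"
    by (simp only: sum_ennreal abs_ge_zero ennreal_leI)
  also have "\<dots> \<le> (\<Sum>i<Suc m. lsem (lip_vanish (\<Prod>l\<le>i. 1 + A l) (N i)) \<mu>)"
    by (intro sum_mono lsem_upper V)
  finally show ?thesis by (simp add: lessThan_Suc_atMost)
qed

text \<open>The first neighbourhood is bounded, which turns the relative radii of the others into
  absolute ones; hence the intersection is totally bounded. The last claim is compactness: points of
  ever more neighbourhoods accumulate, and the accumulation point lies in K.\<close>

lemma scaled_nbhd_Inter_near:
  fixes F :: "nat \<Rightarrow> 'a::{complete_space, zero} set" and r :: "nat \<Rightarrow> real"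
  assumes F: "\<And>i. finite (F i)" "\<And>i. 0 \<in> F i" and r: "\<And>i. 0 < r i" "r 0 \<le> 1 / 2" "r \<longlonglongrightarrow> 0"
  defines "K \<equiv> \<Inter>i. scaled_nbhd (F i) (r i)"
  shows "compact K" and "0 \<in> K"
    and "0 < \<theta> \<Longrightarrow> \<exists>m. \<forall>x. (\<forall>i\<le>m. x \<in> scaled_nbhd (F i) (r i)) \<longrightarrow> infdist x K < \<theta>"
proof -
  let ?N = "\<lambda>i. scaled_nbhd (F i) (r i)"
  show K0: "0 \<in> K" using F r by (auto simp: K_def scaled_nbhd_def less_imp_le)
  obtain R where R: "\<And>p. p \<in> F 0 \<Longrightarrow> dist p 0 \<le> R"
    using finite_imp_bounded[OF F(1)[of 0]] unfolding bounded_any_center[where a = 0]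
    by (auto simp: dist_commute)
  have R0: "0 \<le> R" using R[OF F(2)] by simp
  \<comment> \<open>Because r 0 is at most 1/2, at least half of \<open>dist x 0\<close> remains
    after the radius \<open>r 0 * (1 + dist x 0)\<close> is absorbed.\<close>
  have bd: "dist x 0 \<le> 2 * (1 + R)" if "x \<in> ?N 0" for x
  proof -
    have "infdist x (F 0) \<le> r 0 * (1 + dist x 0)" using that by (simp add: scaled_nbhd_def)
    also have "\<dots> \<le> (1 / 2) * (1 + dist x 0)" using r(2) by (intro mult_right_mono) auto
    also have "\<dots> = 1 / 2 + dist x 0 / 2" by (simp add: add_divide_distrib)
    also have "\<dots> < 1 + dist x 0 / 2" by simp
    finally obtain p where p: "p \<in> F 0" "dist x p < 1 + dist x 0 / 2"
      by (rule infdist_less_finite[OF F(1), rotated]) (use F(2) in auto)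
    then show ?thesis using R[OF p(1)] dist_triangle[of x 0 p] by (simp add: algebra_simps)
  qed
  have tb: "\<exists>i k. finite k \<and> ?N 0 \<inter> ?N i \<subseteq> (\<Union>p\<in>k. ball p e)" if e: "0 < e" for e
  proof -
    have "0 < e / (1 + 2 * (1 + R))" using e R0 by simp
    from order_tendstoD(2)[OF r(3) this] obtain i where i: "r i < e / (1 + 2 * (1 + R))"
      by (auto simp: eventually_sequentially)
    have "x \<in> (\<Union>p\<in>F i. ball p e)" if "x \<in> ?N 0 \<inter> ?N i" for x
    proof -
      have "infdist x (F i) \<le> r i * (1 + dist x 0)" using that by (auto simp: scaled_nbhd_def)
      also have "\<dots> \<le> r i * (1 + 2 * (1 + R))" using bd[of x] that r(1)[of i] by (intro mult_left_mono) auto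
      also have "\<dots> < e" using i R0 by (simp add: pos_less_divide_eq)
      finally obtain p where "p \<in> F i" "dist x p < e"
        by (rule infdist_less_finite[OF F(1), rotated]) (use F(2) in auto)
      then show ?thesis by (auto simp: dist_commute)
    qed
    then show ?thesis using F(1)[of i] by blast
  qed
  have clK: "closed K" unfolding K_def by (intro closed_INT ballI closed_scaled_nbhd)
  have "compact (closure K)"
  proof (rule compact_closure_totally_bounded)
    fix e :: real assume "0 < e"
    from tb[OF this] obtain i k where ik: "finite k" "?N 0 \<inter> ?N i \<subseteq> (\<Union>p\<in>k. ball p e)" by blast
    moreover have "K \<subseteq> ?N 0 \<inter> ?N i" by (auto simp: K_def)
    ultimately show "\<exists>k. finite k \<and> K \<subseteq> (\<Union>p\<in>k. ball p e)" by blast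
  qed
  then show "compact K" using clK by simp
  assume \<theta>: "0 < \<theta>"
  show "\<exists>m. \<forall>x. (\<forall>i\<le>m. x \<in> ?N i) \<longrightarrow> infdist x K < \<theta>"
  proof (rule ccontr)
    assume "\<not> ?thesis"
    then have "\<forall>m. \<exists>x. (\<forall>i\<le>m. x \<in> ?N i) \<and> \<theta> \<le> infdist x K" by (auto simp: not_less)
    then obtain x where x: "\<And>m i. i \<le> m \<Longrightarrow> x m \<in> ?N i" "\<And>m. \<theta> \<le> infdist (x m) K" by metis
    have "compact (closure (range x))"
    proof (rule compact_closure_totally_bounded)
      fix e :: real assume e: "0 < e"
      from tb[OF this] obtain i k where ik: "finite k" "?N 0 \<inter> ?N i \<subseteq> (\<Union>p\<in>k. ball p e)" by blast
      have "x m \<in> (\<Union>p\<in>k \<union> x ` {..<i}. ball p e)" for m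
      proof (cases "m < i")
        case True
        moreover have "x m \<in> ball (x m) e" using e by simp
        ultimately show ?thesis by blast
      next
        case False
        then have "x m \<in> ?N 0 \<inter> ?N i" using x(1) by auto
        then show ?thesis using ik(2) by blast
      qed
      then have "range x \<subseteq> (\<Union>p\<in>k \<union> x ` {..<i}. ball p e)" by blast
      moreover have "finite (k \<union> x ` {..<i})" using ik(1) by simp
      ultimately show "\<exists>k. finite k \<and> range x \<subseteq> (\<Union>p\<in>k. ball p e)" by blast
    qed
    moreover have "\<forall>m. x m \<in> closure (range x)" using closure_subset[of "range x"] by auto
    ultimately obtain l s where s: "strict_mono s" "(x \<circ> s) \<longlonglongrightarrow> l"
      unfolding compact_def by meson
    have "l \<in> ?N i" for i
    proof (rule Lim_in_closed_set[OF closed_scaled_nbhd _ _ s(2)])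
      show "\<forall>\<^sub>F n in sequentially. (x \<circ> s) n \<in> ?N i"
        using eventually_ge_at_top[of i]
        by (rule eventually_mono) (simp add: x(1) order_trans[OF _ seq_suble[OF s(1)]])
    qed simp
    then have "l \<in> K" by (auto simp: K_def)
    have "\<forall>\<^sub>F n in sequentially. dist ((x \<circ> s) n) l < \<theta>" using tendstoD[OF s(2) \<theta>] .
    then obtain n where "dist (x (s n)) l < \<theta>" by (auto simp: eventually_sequentially)
    with infdist_le[OF \<open>l \<in> K\<close>, of "x (s n)"] x(2)[of "s n"] show False by simp
  qed
qed

context wuc_null
begin

text \<open>K is an intersection of scaled neighbourhoods of the finite sets from
  \<open>finite_tight\<close>. A function vanishing on K is clamped at a small height; what exceeds
  that height lives away from K, hence outside one of finitely many neighbourhoods, and is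
  telescoped over their cutoffs.\<close>

lemma tight:
  assumes e: "0 < e"
  obtains K where "compact K" "0 \<in> K" "\<And>k. I (lip_vanish 1 K) k \<le> ennreal e"
proof -
  \<comment> \<open>The exponent i + 2 makes the doubled radii start at 1/2, as
    \<open>scaled_nbhd_Inter_near\<close> requires.\<close>
  define r where "r i = (1 / 2 :: real) ^ (i + 2)" for i
  define A where "A i = 2 / r i" for i
  define C where "C i = (\<Prod>l\<le>i. 1 + A l)" for i
  have r: "0 < r i" for i by (simp add: r_def)
  have A: "0 \<le> A i" for i using r[of i] by (simp add: A_def)
  have C: "0 < C i" for i unfolding C_def using A by (intro prod_pos) (auto intro: add_pos_nonneg)
  \<comment> \<open>The tolerance is divided in advance by \<open>C i\<close>, the Lipschitz
    constant accumulated by the cutoffs up to i; the errors then form a geometric series with sum at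
    most e / 2.\<close>
  have "\<exists>F. finite F \<and> 0 \<in> F \<and> (\<forall>k. I (lip_vanish 1 (scaled_nbhd F (r i))) k \<le> ennreal (e / 2 * (1 / 2) ^ Suc i / C i))" for i
  proof -
    have "0 < e / 2 * (1 / 2) ^ Suc i / C i" using e C[of i] by simp
    from finite_tight[OF r[of i] this] show ?thesis by metis
  qed
  then obtain F where F: "\<And>i. finite (F i)" "\<And>i. 0 \<in> F i"
    "\<And>i k. I (lip_vanish 1 (scaled_nbhd (F i) (r i))) k \<le> ennreal (e / 2 * (1 / 2) ^ Suc i / C i)" by metis
  define K where "K = (\<Inter>i. scaled_nbhd (F i) (2 * r i))"
  have r2: "0 < 2 * r i" "2 * r 0 \<le> 1 / 2" "(\<lambda>i. 2 * r i) \<longlonglongrightarrow> 0" for i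
  proof -
    show "0 < 2 * r i" "2 * r 0 \<le> 1 / 2" using r[of i] by (auto simp: r_def)
    have "(\<lambda>i. (1 / 2) * (1 / 2 :: real) ^ i) \<longlonglongrightarrow> (1 / 2) * 0" by (intro tendsto_intros LIMSEQ_power_zero) auto
    then show "(\<lambda>i. 2 * r i) \<longlonglongrightarrow> 0" by (simp add: r_def power_add)
  qed
  note K = scaled_nbhd_Inter_near[of F "\<lambda>i. 2 * r i", OF F(1,2) r2, folded K_def]
  have "I (lip_vanish 1 K) k \<le> ennreal e" for k
  proof -
    obtain \<eta> where \<eta>: "0 < \<eta>" "\<And>\<eta>'. \<eta>' \<le> \<eta> \<Longrightarrow> I (lip_small \<eta>') k \<le> ennreal (e / 2)"
      using I_lip_small[of "e / 2" k] e by auto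
    obtain m where m: "\<And>x. (\<And>i. i \<le> m \<Longrightarrow> x \<in> scaled_nbhd (F i) (2 * r i)) \<Longrightarrow> infdist x K < \<eta>"
      using K(3)[OF \<eta>(1)] by blast
    let ?V = "\<lambda>i. lip_vanish (C i) (scaled_nbhd (F i) (r i))"
    have "lsem (lip_vanish 1 K) \<mu> \<le> lsem (lip_small \<eta>) \<mu> + (\<Sum>i\<le>m. lsem (?V i) \<mu>)" for \<mu>
    proof (rule lsem_least)
      fix u assume u: "u \<in> lip_vanish 1 K"
      then have ul: "1-lipschitz_on UNIV u" and uK: "\<And>x. x \<in> K \<Longrightarrow> u x = 0" by (auto simp: lip_vanish_def)
      have le: "\<bar>u x\<bar> \<le> infdist x K" for x
      proof -
        have "K \<noteq> {}" using K(2) by auto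
        moreover have "\<bar>u x\<bar> \<le> dist x q" if "q \<in> K" for q
          using lipschitz_onD[OF ul, of x q] uK[OF that] by (simp add: dist_real_def)
        ultimately show ?thesis unfolding infdist_notempty[OF \<open>K \<noteq> {}\<close>] by (intro cINF_greatest) auto
      qed
      define v where "v x = max (- \<eta>) (min \<eta> (u x))" for x
      define w where "w x = u x - v x" for x
      have vl: "1-lipschitz_on UNIV v" and wl: "1-lipschitz_on UNIV w"
        unfolding v_def[abs_def] w_def[abs_def] using \<eta>(1) by (intro lipschitz_clamp[OF ul]; simp)+
      have "ennreal \<bar>blinfun_apply (lip_functional w) \<mu>\<bar> \<le> (\<Sum>i\<le>m. lsem (?V i) \<mu>)"
        unfolding C_def
      proof (rule cutoff_telescope[where \<psi> = "\<lambda>i. cutoff 2 (F i) (r i)"])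
        show "w 0 = 0" using uK[OF K(2)] \<eta>(1) by (simp add: w_def v_def)
        show "tame (A i) (cutoff 2 (F i) (r i))" for i unfolding A_def by (intro tame_cutoff F r)
        show "cutoff 2 (F i) (r i) x = 1" if "x \<in> scaled_nbhd (F i) (r i)" for i x
          using that by (intro cutoff_one r) (simp add: scaled_nbhd_def)
        fix x assume "w x \<noteq> 0"
        then have "\<eta> < \<bar>u x\<bar>" using \<eta>(1) by (auto simp: w_def v_def max_def min_def split: if_splits)
        then have "\<not> infdist x K < \<eta>" using le[of x] by simp
        then obtain i where "i \<le> m" "x \<notin> scaled_nbhd (F i) (2 * r i)" using m by blast
        then show "\<exists>i\<le>m. cutoff 2 (F i) (r i) x = 0" using cutoff_zero[OF r] by blast
      qed (rule wl A)+
      moreover have "v \<in> lip_small \<eta>" using vl \<eta>(1) by (auto simp: lip_small_def v_def)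
      then have "ennreal \<bar>blinfun_apply (lip_functional v) \<mu>\<bar> \<le> lsem (lip_small \<eta>) \<mu>" by (rule lsem_upper)
      moreover have "u = (\<lambda>x. v x + w x)" by (simp add: w_def)
      then have "ennreal \<bar>blinfun_apply (lip_functional u) \<mu>\<bar> \<le>
          ennreal \<bar>blinfun_apply (lip_functional v) \<mu>\<bar> + ennreal \<bar>blinfun_apply (lip_functional w) \<mu>\<bar>"
        by (simp add: lip_functional_add[OF vl wl] blinfun.add_left flip: ennreal_plus)
      ultimately show "ennreal \<bar>blinfun_apply (lip_functional u) \<mu>\<bar> \<le>
          lsem (lip_small \<eta>) \<mu> + (\<Sum>i\<le>m. lsem (?V i) \<mu>)"
        by (meson add_mono order_trans)
    qed
    then have "I (lip_vanish 1 K) k \<le>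
        (\<integral>\<^sup>+\<omega>. lsem (lip_small \<eta>) (Y k \<omega>) + (\<Sum>i\<le>m. lsem (?V i) (Y k \<omega>)) \<partial>P)"
      unfolding I_def by (intro nn_integral_mono)
    also have "\<dots> = I (lip_small \<eta>) k + (\<Sum>i\<le>m. I (?V i) k)"
      unfolding I_def
      by (subst nn_integral_add) (auto intro!: lsem_measurable borel_measurable_sum simp: nn_integral_sum lsem_measurable)
    also have "\<dots> \<le> ennreal (e / 2) + ennreal (e / 2)"
    proof (rule add_mono)
      show "I (lip_small \<eta>) k \<le> ennreal (e / 2)" by (rule \<eta>(2)) simp
      have "(\<Sum>i\<le>m. I (?V i) k) \<le> (\<Sum>i\<le>m. ennreal (e / 2 * (1 / 2) ^ Suc i))"
      proof (rule sum_mono)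
        fix i
        have "I (?V i) k \<le> ennreal (C i) * I (lip_vanish 1 (scaled_nbhd (F i) (r i))) k"
          by (rule I_lip_vanish[OF C])
        also have "\<dots> \<le> ennreal (C i) * ennreal (e / 2 * (1 / 2) ^ Suc i / C i)" by (rule mult_left_mono[OF F(3)]) simp
        also have "\<dots> = ennreal (e / 2 * (1 / 2) ^ Suc i)" using e by (intro ennreal_mult_divide C) simp
        finally show "I (?V i) k \<le> ennreal (e / 2 * (1 / 2) ^ Suc i)" .
      qed
      also have "\<dots> = ennreal (\<Sum>i\<le>m. e / 2 * (1 / 2) ^ Suc i)" using e by (intro sum_ennreal) simp
      also have "(\<Sum>i\<le>m. e / 2 * (1 / 2) ^ Suc i) = e / 2 * (1 - (1 / 2) ^ Suc m)"
        by (induction m) (auto simp: field_simps)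
      also have "\<dots> \<le> e / 2" using e by (intro mult_left_le) auto
      finally show "(\<Sum>i\<le>m. I (?V i) k) \<le> ennreal (e / 2)" by (simp add: ennreal_leI)
    qed
    also have "\<dots> = ennreal e" using e by (intro ennreal_half_add) simp
    finally show ?thesis .
  qed
  with K(1,2) show ?thesis by (rule that)
qed

end

text \<open>Arzela-Ascoli by counting: functions are coded by their rounded values on a finite net
  of K. Only finitely many codes occur, and one representative of each suffices.\<close>

lemma lipschitz_family_net:
  fixes H :: "('a::{metric_space, zero} \<Rightarrow> real) set"
  assumes K: "compact K" and "\<forall>h\<in>H. L-lipschitz_on UNIV h \<and> h 0 = 0"
    and \<zeta>: "0 < \<zeta>" and L: "0 < L"
  obtains G where "finite G" "G \<subseteq> H" "\<And>h. h \<in> H \<Longrightarrow> \<exists>p\<in>G. \<forall>x\<in>K. \<bar>h x - p x\<bar> \<le> \<zeta>"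
proof -
  have H: "\<And>h. h \<in> H \<Longrightarrow> L-lipschitz_on UNIV h" "\<And>h. h \<in> H \<Longrightarrow> h 0 = 0" using assms(2) by auto
  \<comment> \<open>Error budget: \<zeta> / 4 for rounding and \<zeta> / 4 for moving each of the
    two functions from the net point to y.\<close>
  define \<rho> where "\<rho> = \<zeta> / (4 * L)"
  have \<rho>: "0 < \<rho>" using \<zeta> L by (simp add: \<rho>_def)
  obtain X where X: "X \<subseteq> K" "finite X" "K \<subseteq> (\<Union>x\<in>X. ball x \<rho>)"
    using compactE_image[OF K, of K "\<lambda>x. ball x \<rho>"] \<rho> by (metis UN_I centre_in_ball open_ball subsetI)
  define code where "code h = (\<lambda>x\<in>X. \<lfloor>h x / (\<zeta> / 4)\<rfloor>)" for h :: "'a \<Rightarrow> real"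
  have "code h \<in> (\<Pi>\<^sub>E x\<in>X. {- \<lceil>L * dist x 0 / (\<zeta> / 4)\<rceil>..\<lceil>L * dist x 0 / (\<zeta> / 4)\<rceil>})" if "h \<in> H" for h
  proof (rule PiE_I)
    fix x assume "x \<in> X"
    have "\<bar>h x\<bar> \<le> L * dist x 0"
      using lipschitz_onD[OF H(1)[OF that], of x 0] H(2)[OF that] by (simp add: dist_real_def)
    then have "\<bar>h x / (\<zeta> / 4)\<bar> \<le> L * dist x 0 / (\<zeta> / 4)" using \<zeta> by (simp add: abs_divide divide_right_mono)
    then have "- (L * dist x 0 / (\<zeta> / 4)) \<le> h x / (\<zeta> / 4)" "h x / (\<zeta> / 4) \<le> L * dist x 0 / (\<zeta> / 4)"
      by linarith+
    then have "- \<lceil>L * dist x 0 / (\<zeta> / 4)\<rceil> \<le> \<lfloor>h x / (\<zeta> / 4)\<rfloor>" "\<lfloor>h x / (\<zeta> / 4)\<rfloor> \<le> \<lceil>L * dist x 0 / (\<zeta> / 4)\<rceil>"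
      by linarith+
    then show "code h x \<in> {- \<lceil>L * dist x 0 / (\<zeta> / 4)\<rceil>..\<lceil>L * dist x 0 / (\<zeta> / 4)\<rceil>}"
      using \<open>x \<in> X\<close> by (simp add: code_def)
  qed (simp add: code_def)
  then have "code ` H \<subseteq> (\<Pi>\<^sub>E x\<in>X. {- \<lceil>L * dist x 0 / (\<zeta> / 4)\<rceil>..\<lceil>L * dist x 0 / (\<zeta> / 4)\<rceil>})" by blast
  then have fin: "finite (code ` H)" by (rule finite_subset) (intro finite_PiE X, simp)
  show ?thesis
  proof (rule that)
    show "finite (inv_into H code ` code ` H)" using fin by (rule finite_imageI)
    show "inv_into H code ` code ` H \<subseteq> H" by (auto intro: inv_into_into)
    fix h assume h: "h \<in> H"
    define p where "p = inv_into H code (code h)"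
    have p: "p \<in> H" "code p = code h" using h by (auto simp: p_def inv_into_into f_inv_into_f)
    have "\<bar>h y - p y\<bar> \<le> \<zeta>" if "y \<in> K" for y
    proof -
      obtain x where x: "x \<in> X" "dist x y < \<rho>" using X(3) \<open>y \<in> K\<close> by auto
      have "\<lfloor>h x / (\<zeta> / 4)\<rfloor> = \<lfloor>p x / (\<zeta> / 4)\<rfloor>"
        using fun_cong[OF p(2), of x] x(1) by (simp add: code_def)
      then have "\<bar>h x / (\<zeta> / 4) - p x / (\<zeta> / 4)\<bar> < 1" by linarith
      then have "\<bar>(h x - p x) / (\<zeta> / 4)\<bar> < 1" by (simp add: diff_divide_distrib)
      then have "\<bar>h x - p x\<bar> / (\<zeta> / 4) < 1" using \<zeta> by (simp only: abs_divide abs_of_pos zero_less_divide_iff)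
      moreover have z: "0 < \<zeta> / 4" using \<zeta> by simp
      ultimately have "\<bar>h x - p x\<bar> < \<zeta> / 4" by (simp only: pos_divide_less_eq[OF z] mult_1)
      moreover have "L * dist x y \<le> \<zeta> / 4" using x(2) L by (simp add: \<rho>_def field_simps)
      moreover have "\<bar>h x - h y\<bar> \<le> L * dist x y" "\<bar>p x - p y\<bar> \<le> L * dist x y"
        using lipschitz_onD[OF H(1)[OF h], of x y] lipschitz_onD[OF H(1)[OF p(1)], of x y] by (auto simp: dist_real_def)
      ultimately show ?thesis using \<zeta> by linarith
    qed
    then show "\<exists>p\<in>inv_into H code ` code ` H. \<forall>x\<in>K. \<bar>h x - p x\<bar> \<le> \<zeta>"
      using h by (intro bexI[of _ p]) (auto simp: p_def)
  qed
qed

section \<open>Classes of locally flat functions\<close>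

definition flat_class :: "'a::metric_space set \<Rightarrow> real \<Rightarrow> real \<Rightarrow> real \<Rightarrow> ('a \<Rightarrow> real) set" where
  "flat_class K \<epsilon> \<zeta> \<delta> = {u. 1-lipschitz_on UNIV u \<and> (\<forall>x. \<bar>u x\<bar> \<le> \<zeta>) \<and>
    (\<forall>x. \<zeta> \<le> infdist x K \<longrightarrow> u x = 0) \<and>
    (\<forall>x y. infdist x K < \<delta> \<and> infdist y K < \<delta> \<and> dist x y < \<delta> \<longrightarrow> \<bar>u x - u y\<bar> \<le> \<epsilon> * dist x y)}"

text \<open>
  At a given pair of points, the functions of the early classes are flat and those of the late classes
  are small; only one class is in neither situation.
\<close>

lemma wuc_flat_class:
  fixes K :: "'a::metric_space set"
  assumes \<delta>: "\<And>j. 0 < \<delta> j" "\<And>j. \<delta> j \<le> \<zeta> j / 4" and \<zeta>: "\<And>j. \<zeta> (Suc j) \<le> (1 / 2) ^ (j + 3) * \<delta> j"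
  shows "wuc 3 (\<lambda>j. flat_class K ((1 / 2) ^ j) (\<zeta> j) (\<delta> j))"
  unfolding wuc_def
proof (intro conjI allI impI)
  have \<zeta>pos: "0 < \<zeta> j" for j using \<delta>[of j] by simp
  have "(\<lambda>_. 0) \<in> flat_class K ((1 / 2) ^ j) (\<zeta> j) (\<delta> j)" for j
    using \<zeta>pos[of j] by (auto simp: flat_class_def intro: lipschitz_on_mono[OF lipschitz_on_constant])
  then show "flat_class K ((1 / 2) ^ j) (\<zeta> j) (\<delta> j) \<noteq> {}" for j by blast
  have "\<delta> (Suc j) \<le> \<delta> j" for j
  proof -
    note \<zeta>[of j]
    also have "(1 / 2) ^ (j + 3) * \<delta> j \<le> 1 * \<delta> j"
      using \<delta>(1)[of j] by (intro mult_right_mono power_le_one) auto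
    finally have "\<zeta> (Suc j) \<le> 1 * \<delta> j" .
    then show ?thesis using \<delta>(2)[of "Suc j"] \<zeta>pos[of "Suc j"] by simp
  qed
  then have dec: "\<delta> n \<le> \<delta> m" if "m \<le> n" for m n using lift_Suc_antimono_le[of \<delta>] that by blast
  have late: "\<zeta> i \<le> (1 / 2) ^ (i + 2) * \<delta> j" if "j < i" for i j
  proof -
    obtain i' where i': "i = Suc i'" "j \<le> i'" using \<open>j < i\<close> by (cases i) auto
    have "\<zeta> i \<le> (1 / 2) ^ (i' + 3) * \<delta> i'" using \<zeta>[of i'] i' by simp
    also have "\<dots> \<le> (1 / 2) ^ (i' + 3) * \<delta> j" using dec[OF i'(2)] by (intro mult_left_mono) auto
    finally have "\<zeta> i \<le> (1 / 2) ^ (i' + 3) * \<delta> j" .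
    moreover have "i' + 3 = i + 2" by (simp add: i'(1))
    ultimately show ?thesis by (simp only:)
  qed
  fix u :: "nat \<Rightarrow> 'a \<Rightarrow> real" and n :: nat and x y :: 'a
  assume u: "\<forall>j. u j \<in> flat_class K ((1 / 2) ^ j) (\<zeta> j) (\<delta> j)"
  define s where "s = dist x y"
  have s: "0 \<le> s" by (simp add: s_def)
  have lip: "\<bar>u j x - u j y\<bar> \<le> s" for j
    using u lipschitz_onD[of 1 UNIV "u j" x y] by (auto simp: flat_class_def s_def dist_real_def)
  have small: "\<bar>u j z\<bar> \<le> \<zeta> j" for j z using u by (auto simp: flat_class_def)
  have supp: "u j z = 0" if "\<zeta> j \<le> infdist z K" for j z using u that by (auto simp: flat_class_def)
  define good where "good j \<longleftrightarrow> infdist x K < \<delta> j \<and> infdist y K < \<delta> j \<and> s < \<delta> j" for j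
  have flat: "\<bar>u j x - u j y\<bar> \<le> (1 / 2) ^ j * s" if "good j" for j
    using u that by (auto simp: flat_class_def good_def s_def)
  \<comment> \<open>If the pair is not flat at scale j, some distance attached to it is at least
    \<delta> j. Functions of later classes have height and support radius \<zeta> i far below
    \<delta> j, so they contribute a small multiple of that distance.\<close>
  have after_bad: "\<bar>u i x - u i y\<bar> \<le> (1 / 2) ^ i * s" if "\<not> good j" "j < i" for i j
  proof -
    have \<zeta>i: "\<zeta> i \<le> (1 / 2) ^ (i + 2) * \<delta> j" by (rule late[OF that(2)])
    have "(1 / 2) ^ (i + 2) * \<delta> j \<le> 1 / 4 * \<delta> j"
      using \<delta>(1)[of j] by (intro mult_right_mono) (auto simp: power_add power_le_one)
    with \<zeta>i have \<zeta>4: "\<zeta> i \<le> \<delta> j / 4" by simp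
    have far: "\<bar>u i z - u i w\<bar> \<le> (1 / 2) ^ i * dist z w" if "\<delta> j \<le> infdist z K" for z w
    proof (cases "\<zeta> i \<le> infdist w K")
      case True
      moreover have "\<zeta> i \<le> infdist z K" using that \<zeta>4 \<delta>(1)[of j] by linarith
      ultimately show ?thesis by (simp add: supp)
    next
      case False
      then have "\<delta> j / 2 \<le> dist z w"
        using that \<zeta>4 infdist_triangle[of z K w] \<delta>(1)[of j] by linarith
      have "\<bar>u i z - u i w\<bar> \<le> \<zeta> i" using supp[of i z] small[of i w] that \<zeta>4 \<delta>(1)[of j] by auto
      also have "\<dots> \<le> (1 / 2) ^ i * (\<delta> j / 2)"
        using \<zeta>i \<delta>(1)[of j] by (simp add: power_add) (smt (verit) zero_le_power mult_nonneg_nonneg divide_nonneg_nonneg)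
      also have "\<dots> \<le> (1 / 2) ^ i * dist z w" using \<open>\<delta> j / 2 \<le> dist z w\<close> by (intro mult_left_mono) auto
      finally show ?thesis .
    qed
    from \<open>\<not> good j\<close> consider "\<delta> j \<le> infdist x K" | "\<delta> j \<le> infdist y K" | "\<delta> j \<le> s"
      by (auto simp: good_def not_less)
    then show ?thesis
    proof cases
      case 1
      then show ?thesis using far[of x y] by (simp add: s_def)
    next
      case 2
      then show ?thesis using far[of y x] by (simp add: s_def dist_commute abs_minus_commute)
    next
      case 3
      have "\<bar>u i x - u i y\<bar> \<le> 2 * \<zeta> i" using small[of i x] small[of i y] by linarith
      also have "\<dots> \<le> (1 / 2) ^ i * (\<delta> j / 2)" using \<zeta>i by (simp add: power_add)
      also have "\<dots> \<le> (1 / 2) ^ i * s" using 3 \<delta>(1)[of j] by (intro mult_left_mono) auto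
      finally show ?thesis .
    qed
  qed
  \<comment> \<open>The first scale that is not good is the only exception; it costs s by the
    Lipschitz bound. The geometric series adds at most 2 s, whence the constant 3.\<close>
  have "\<exists>j0. \<forall>i. \<bar>u i x - u i y\<bar> \<le> (if i = j0 then s else 0) + (1 / 2) ^ i * s"
  proof (cases "\<forall>j. good j")
    case True
    then show ?thesis using s by (intro exI[of _ 0] allI add_increasing flat) auto
  next
    case False
    define j0 where "j0 = (LEAST j. \<not> good j)"
    have "\<exists>j. \<not> good j" using False by blast
    then have "\<not> good j0" unfolding j0_def by (rule LeastI_ex)
    moreover have "good i" if "i < j0" for i using that not_less_Least unfolding j0_def by blast
    ultimately have "\<bar>u i x - u i y\<bar> \<le> (if i = j0 then s else 0) + (1 / 2) ^ i * s" for i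
      using flat[of i] after_bad[of j0 i] lip[of i] s by (cases i j0 rule: linorder_cases) (auto intro: add_increasing2)
    then show ?thesis by blast
  qed
  then obtain j0 where j0: "\<And>i. \<bar>u i x - u i y\<bar> \<le> (if i = j0 then s else 0) + (1 / 2) ^ i * s" by blast
  have "(\<Sum>i<n. \<bar>u i x - u i y\<bar>) \<le> (\<Sum>i<n. (if i = j0 then s else 0) + (1 / 2) ^ i * s)" by (intro sum_mono j0)
  also have "\<dots> = (\<Sum>i<n. if i = j0 then s else 0) + (\<Sum>i<n. (1 / 2) ^ i) * s"
    by (simp add: sum.distrib sum_distrib_right)
  also have "\<dots> \<le> s + 2 * s"
  proof (rule add_mono)
    show "(\<Sum>i<n. if i = j0 then s else 0) \<le> s" using s by simp
    have "(\<Sum>i<n. (1 / 2 :: real) ^ i) \<le> 2" by (simp add: geometric_sum)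
    then show "(\<Sum>i<n. (1 / 2) ^ i) * s \<le> 2 * s" using s by (rule mult_right_mono)
  qed
  finally show "(\<Sum>j<n. \<bar>u j x - u j y\<bar>) \<le> 3 * dist x y" by (simp add: s_def)
qed

text \<open>The restriction of v to K is extended as a 1-Lipschitz function of the chain distance,
  which is flat near K, and is then truncated to be supported near K. The error is at most \<eta> on
  K, so clamping it at \<eta> leaves a function that vanishes on K.\<close>

lemma flat_decomposition:
  fixes f :: "'m::{complete_space, zero} \<Rightarrow> 'n::metric_space" and v :: "'m \<Rightarrow> real"
  assumes K: "K \<noteq> {}" and \<epsilon>: "0 < \<epsilon>" "\<epsilon> \<le> 1" and \<delta>: "0 < \<delta>" "\<delta> \<le> \<zeta> / 4"
    and \<eta>: "0 \<le> \<eta>" "\<eta> \<le> \<zeta> / 8" and v: "1-lipschitz_on UNIV v"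
    and vK: "\<And>x. x \<in> K \<Longrightarrow> \<bar>v x\<bar> \<le> \<zeta> / 4"
    and chain: "\<And>x y. x \<in> K \<Longrightarrow> y \<in> K \<Longrightarrow> v x \<le> v y + chain_dist (flat_cost K \<epsilon> \<delta>) x y + \<eta>"
  obtains u e1 e2 where "u \<in> flat_class K \<epsilon> \<zeta> \<delta>" "e1 \<in> (\<lambda>u x. 2 * u x) ` lip_small \<eta>" "e2 \<in> lip_vanish 2 K"
    "v = (\<lambda>x. u x + (e1 x + e2 x))"
proof -
  let ?D = "chain_dist (flat_cost K \<epsilon> \<delta>)"
  note fc = flat_cost_bounds[OF \<epsilon>, where K = K and \<delta> = \<delta>]
  obtain u0 where u0: "\<And>x y. \<bar>u0 x - u0 y\<bar> \<le> ?D x y" "\<And>p. p \<in> K \<Longrightarrow> \<bar>u0 p - v p\<bar> \<le> \<eta>"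
    by (rule pseudometric_extension[of ?D K v \<eta>])
      (auto simp: K fc intro: chain_dist_refl chain_dist_sym chain_dist_triangle chain)
  have Dle: "?D x y \<le> flat_cost K \<epsilon> \<delta> x y" for x y by (rule chain_dist_le) (simp_all add: fc)
  have u0lip: "\<bar>u0 x - u0 y\<bar> \<le> dist x y" for x y using u0(1)[of x y] Dle[of x y] fc(3)[of x y] by linarith
  define w where "w x = max 0 (\<zeta> - infdist x K)" for x
  have wlip: "\<bar>w x - w y\<bar> \<le> dist x y" for x y
    using infdist_triangle[of x K y] infdist_triangle[of y K x] by (auto simp: w_def dist_commute)
  define u where "u x = max (- w x) (min (w x) (u0 x))" for x
  have \<zeta>: "0 < \<zeta>" using \<delta> by simp
  have ulip: "1-lipschitz_on UNIV u"
  proof (rule lipschitz_onI)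
    fix x y
    have mm: "\<bar>min a b - min c d\<bar> \<le> max \<bar>a - c\<bar> \<bar>b - d\<bar>" "\<bar>max a b - max c d\<bar> \<le> max \<bar>a - c\<bar> \<bar>b - d\<bar>"
      for a b c d :: real by linarith+
    have "\<bar>u x - u y\<bar> \<le> max \<bar>u0 x - u0 y\<bar> \<bar>w x - w y\<bar>"
      unfolding u_def
    proof (rule order_trans[OF mm(2)], rule max.boundedI)
      show "\<bar>min (w x) (u0 x) - min (w y) (u0 y)\<bar> \<le> max \<bar>u0 x - u0 y\<bar> \<bar>w x - w y\<bar>"
        using mm(1)[of "w x" "u0 x" "w y" "u0 y"] by (simp add: max.commute)
    qed (simp add: abs_minus_commute)
    then show "dist (u x) (u y) \<le> 1 * dist x y" using u0lip[of x y] wlip[of x y] by (simp add: dist_real_def)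
  qed simp
  \<comment> \<open>Within \<delta> of K the truncation is inactive: there u0 is at most \<zeta>/4 +
    \<zeta>/8 + \<zeta>/4, while w is at least 3\<zeta>/4.\<close>
  have near: "u x = u0 x" if "infdist x K < \<delta>" for x
  proof -
    have "\<exists>q\<in>K. dist x q < \<delta>"
    proof (rule ccontr)
      assume "\<not> ?thesis"
      then have "\<delta> \<le> infdist x K" unfolding infdist_notempty[OF K] using K by (intro cINF_greatest) (auto simp: not_less)
      with that show False by simp
    qed
    then obtain q where q: "q \<in> K" "dist x q < \<delta>" by blast
    then have "\<bar>u0 x\<bar> \<le> 3 / 4 * \<zeta>" using vK[OF q(1)] u0(2)[OF q(1)] u0lip[of x q] \<eta> \<delta> by linarith
    moreover have "3 / 4 * \<zeta> \<le> w x" using that \<delta> by (simp add: w_def)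
    ultimately show ?thesis by (auto simp: u_def)
  qed
  have u: "u \<in> flat_class K \<epsilon> \<zeta> \<delta>"
    unfolding flat_class_def
  proof (intro CollectI conjI allI impI ulip)
    show "\<bar>u x\<bar> \<le> \<zeta>" for x using infdist_nonneg[of x K] \<zeta> by (auto simp: u_def w_def)
    show "u x = 0" if "\<zeta> \<le> infdist x K" for x using that by (auto simp: u_def w_def)
    show "\<bar>u x - u y\<bar> \<le> \<epsilon> * dist x y" if "infdist x K < \<delta> \<and> infdist y K < \<delta> \<and> dist x y < \<delta>" for x y
      using that near[of x] near[of y] order_trans[OF u0(1)[of x y] Dle[of x y]] by (simp add: flat_cost_def)
  qed
  define e where "e x = v x - u x" for x
  have elip: "2-lipschitz_on UNIV e" unfolding e_def[abs_def] using lipschitz_on_diff[OF v ulip] by simp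
  have eK: "\<bar>e x\<bar> \<le> \<eta>" if "x \<in> K" for x
    using near[of x] u0(2)[OF that] \<delta>(1) that by (simp add: e_def abs_minus_commute)
  define e1 where "e1 x = max (- \<eta>) (min \<eta> (e x))" for x
  note cl = lipschitz_clamp[OF elip \<eta>(1)]
  have "(\<bar>1 / 2\<bar> * 2)-lipschitz_on UNIV (\<lambda>x. (1 / 2) * e1 x)"
    unfolding e1_def by (intro lipschitz_on_cmult_real cl)
  then have "(\<lambda>x. (1 / 2) * e1 x) \<in> lip_small \<eta>"
    using \<eta>(1) by (auto simp: lip_small_def e1_def)
  then have "e1 \<in> (\<lambda>u x. 2 * u x) ` lip_small \<eta>" by (rule rev_image_eqI) simp
  moreover have "(\<lambda>x. e x - e1 x) \<in> lip_vanish 2 K"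
    unfolding lip_vanish_def e1_def
  proof (intro CollectI conjI ballI cl(2))
    fix x assume "x \<in> K"
    from eK[OF this] have "- \<eta> \<le> e x" "e x \<le> \<eta>" by linarith+
    then show "e x - max (- \<eta>) (min \<eta> (e x)) = 0" by simp
  qed
  moreover have "v = (\<lambda>x. u x + (e1 x + (e x - e1 x)))" by (simp add: e_def)
  ultimately show ?thesis by (rule that[OF u])
qed

context wuc_null
begin

text \<open>If the means do not tend to zero, then at every scale \<zeta> some late Y k is charged
  by a flat class of that scale. Repeating this with rapidly decreasing scales yields a weakly
  unconditionally Cauchy sequence of flat classes that contradicts \<open>null\<close>.\<close>

theorem curve_flat_null:
  fixes f :: "'m \<Rightarrow> 'n::{metric_space, zero}"
  assumes f: "L-lipschitz_on UNIV f" "f 0 = 0" "curve_flat f" and L: "0 < L"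
    and scalar: "\<And>C p. C-lipschitz_on UNIV p \<Longrightarrow>
      (\<lambda>k. \<integral>\<^sup>+\<omega>. \<bar>blinfun_apply (lip_functional p) (Y k \<omega>)\<bar> \<partial>P) \<longlonglongrightarrow> 0"
  shows "(\<lambda>k. \<integral>\<^sup>+\<omega>. norm (blinfun_apply (linearization f) (Y k \<omega>)) \<partial>P) \<longlonglongrightarrow> 0"
proof -
  define H where "H = (\<lambda>g x. g (f x)) ` lip_vanish 1 {0}"
  have H: "L-lipschitz_on UNIV h" "h 0 = 0" "\<bar>h x - h y\<bar> \<le> dist (f x) (f y)" if hH: "h \<in> H" for h x y
  proof -
    obtain g where g: "1-lipschitz_on UNIV g" "g 0 = 0" "h = (\<lambda>x. g (f x))"
      using hH by (auto simp: H_def lip_vanish_def)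
    show "L-lipschitz_on UNIV h"
      using lipschitz_on_compose2[OF f(1) lipschitz_on_subset[OF g(1)]] by (simp add: g(3))
    show "h 0 = 0" using g f(2) by simp
    show "\<bar>h x - h y\<bar> \<le> dist (f x) (f y)"
      using lipschitz_onD[OF g(1), of "f x" "f y"] by (simp add: g(3) dist_real_def)
  qed
  have HB: "\<forall>h\<in>H. L-lipschitz_on UNIV h \<and> h 0 = 0"
  proof
    fix h assume "h \<in> H"
    from H(1,2)[OF this] show "L-lipschitz_on UNIV h \<and> h 0 = 0" ..
  qed
  have norm_H: "ennreal (norm (blinfun_apply (linearization f) \<mu>)) \<le> lsem H \<mu>" for \<mu>
    unfolding ennreal_norm_eq_lsem
  proof (rule lsem_least)
    fix g :: "'n \<Rightarrow> real" assume g: "g \<in> lip_vanish 1 {0}"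
    then have "1-lipschitz_on UNIV g" by (simp add: lip_vanish_def)
    from lip_functional_linearization[OF f(1,2) this, of \<mu>]
    show "ennreal \<bar>blinfun_apply (lip_functional g) (blinfun_apply (linearization f) \<mu>)\<bar> \<le> lsem H \<mu>"
      using g by (auto simp: H_def intro: lsem_upper)
  qed
  have "(\<lambda>k. I H k) \<longlonglongrightarrow> 0"
  proof (rule order_tendstoI)
    fix a :: ennreal assume "0 < a"
    show "\<forall>\<^sub>F k in sequentially. I H k < a"
    proof (rule ccontr)
      assume "\<not> ?thesis"
      then have freq: "\<exists>\<^sub>F k in sequentially. a \<le> I H k" by (simp add: not_eventually not_less)
      obtain c where c: "0 < c" "ennreal c \<le> a"
      proof (cases a)
        case (real r)
        then show ?thesis using \<open>0 < a\<close> by (intro that[of r]) auto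
      qed (rule that[of 1], auto)
      \<comment> \<open>Of the mass c at most c/4 is absorbed by the net and
        \<open>2 * L * (d + d)\<close>, that is c/2, by the two error classes. The remaining c/4
        equals \<open>2 * L * d\<close>, so the flat class must carry at least d.\<close>
      define d where "d = c / (8 * L)"
      have d: "0 < d" using c L by (simp add: d_def)
      obtain K where K: "compact K" "0 \<in> K" and tightK: "\<And>k. I (lip_vanish 1 K) k \<le> ennreal (d / 2)"
        using tight[of "d / 2"] d by auto
      have "K \<noteq> {}" using K by auto
      have step: "\<exists>k \<delta>. k0 < k \<and> 0 < \<delta> \<and> \<delta> \<le> \<zeta> / 4 \<and> ennreal d \<le> I (flat_class K ((1 / 2) ^ n) \<zeta> \<delta>) k"
        if \<zeta>: "0 < \<zeta>" for k0 n :: nat and \<zeta> :: real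
      proof -
        have "0 < L * \<zeta> / 2" using L \<zeta> by simp
        \<comment> \<open>Subtracting the nearest net element makes the remainder at most
          \<open>L * \<zeta> / 2\<close> on K, which is \<zeta> / 4 after division by 2 L. The net
          itself is finite and is handled by the scalar hypothesis.\<close>
        obtain G where G: "finite G" "G \<subseteq> H" "\<And>h. h \<in> H \<Longrightarrow> \<exists>p\<in>G. \<forall>x\<in>K. \<bar>h x - p x\<bar> \<le> L * \<zeta> / 2"
          by (rule lipschitz_family_net[OF K(1) HB \<open>0 < L * \<zeta> / 2\<close> L]) blast
        define A where "A p k = (\<integral>\<^sup>+\<omega>. \<bar>blinfun_apply (lip_functional p) (Y k \<omega>)\<bar> \<partial>P)" for p k
        have "(\<lambda>k. \<Sum>p\<in>G. A p k) \<longlonglongrightarrow> (\<Sum>p\<in>G. 0)"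
          unfolding A_def by (intro tendsto_sum scalar) (use G(2) H(1) in blast)
        then have "\<forall>\<^sub>F k in sequentially. (\<Sum>p\<in>G. A p k) < ennreal (c / 4)"
          using c by (intro order_tendstoD(2)) auto
        from frequently_eventually_frequently[OF freq eventually_conj[OF this eventually_gt_at_top[of k0]]]
        obtain k where k: "(\<Sum>p\<in>G. A p k) < ennreal (c / 4)" "k0 < k" "a \<le> I H k"
          using frequently_ex by blast
        obtain \<eta>0 where \<eta>0: "0 < \<eta>0" "\<And>\<eta>'. \<eta>' \<le> \<eta>0 \<Longrightarrow> I (lip_small \<eta>') k \<le> ennreal (d / 2)"
          using I_lip_small[of "d / 2" k] d by auto
        define \<eta> where "\<eta> = min \<eta>0 (\<zeta> / 8)"
        have \<eta>: "0 < \<eta>" "\<eta> \<le> \<zeta> / 8" "I (lip_small \<eta>) k \<le> ennreal (d / 2)"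
          using \<eta>0 \<zeta> by (auto simp: \<eta>_def)
        have \<epsilon>: "0 < (1 / 2 :: real) ^ n" "(1 / 2 :: real) ^ n \<le> 1" by (auto intro: power_le_one)
        have "0 < L * \<eta>" "0 < \<zeta> / 4" using L \<eta> \<zeta> by auto
        obtain \<delta> where \<delta>: "0 < \<delta>" "\<delta> \<le> \<zeta> / 4" and
          chain: "\<And>x y. x \<in> K \<Longrightarrow> y \<in> K \<Longrightarrow>
            dist (f x) (f y) \<le> L * chain_dist (flat_cost K ((1 / 2) ^ n) \<delta>) x y + L * \<eta>"
          by (rule curve_flat_chain_bound[OF \<epsilon> K(1) \<open>K \<noteq> {}\<close> f(1,3) L \<open>0 < L * \<eta>\<close> \<open>0 < \<zeta> / 4\<close>]) blast
        let ?U = "flat_class K ((1 / 2) ^ n) \<zeta> \<delta>"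
        let ?E1 = "(\<lambda>u x. 2 * u x) ` lip_small \<eta> :: ('m \<Rightarrow> real) set"
        let ?E2 = "lip_vanish 2 K"
        have point: "lsem H \<mu> \<le> (\<Sum>p\<in>G. ennreal \<bar>blinfun_apply (lip_functional p) \<mu>\<bar>) +
            ennreal (2 * L) * (lsem ?U \<mu> + (lsem ?E1 \<mu> + lsem ?E2 \<mu>))" for \<mu>
        proof (rule lsem_least)
          fix h assume h: "h \<in> H"
          then obtain p where p: "p \<in> G" "p \<in> H" "\<And>x. x \<in> K \<Longrightarrow> \<bar>h x - p x\<bar> \<le> L * \<zeta> / 2" using G by blast
          \<comment> \<open>The difference of two L-Lipschitz functions is 2 L-Lipschitz; the same
            factor turns the chain bound for f into the one that \<open>flat_decomposition\<close>
            expects.\<close>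
          define v where "v x = (1 / (2 * L)) * (h x - p x)" for x
          have "(\<bar>1 / (2 * L)\<bar> * (L + L))-lipschitz_on UNIV v"
            unfolding v_def[abs_def] by (intro lipschitz_on_cmult_real lipschitz_on_diff H h p)
          then have vlip: "1-lipschitz_on UNIV v" using L by simp
          obtain u e1 e2 where u: "u \<in> ?U" and e: "e1 \<in> ?E1" "e2 \<in> ?E2" and v: "v = (\<lambda>x. u x + (e1 x + e2 x))"
          proof (rule flat_decomposition[OF \<open>K \<noteq> {}\<close> \<epsilon> \<delta> less_imp_le[OF \<eta>(1)] \<eta>(2) vlip])
            show "\<bar>v x\<bar> \<le> \<zeta> / 4" if "x \<in> K" for x
              using p(3)[OF that] L by (simp add: v_def abs_mult field_simps)
            fix x y assume xy: "x \<in> K" "y \<in> K"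
            have "2 * L * (v x - v y) = (h x - h y) - (p x - p y)" using L by (simp add: v_def field_simps)
            also have "\<dots> \<le> 2 * dist (f x) (f y)" using H(3)[OF h, of x y] H(3)[OF p(2), of x y] by linarith
            also have "\<dots> \<le> 2 * L * (chain_dist (flat_cost K ((1 / 2) ^ n) \<delta>) x y + \<eta>)"
              using chain[OF xy] by (simp add: algebra_simps)
            finally show "v x \<le> v y + chain_dist (flat_cost K ((1 / 2) ^ n) \<delta>) x y + \<eta>" using L by simp
          qed blast
          have lips: "1-lipschitz_on UNIV u" "2-lipschitz_on UNIV e1" "2-lipschitz_on UNIV e2"
          proof -
            show "1-lipschitz_on UNIV u" using u by (simp add: flat_class_def)
            show "2-lipschitz_on UNIV e2" using e(2) by (simp add: lip_vanish_def)
            obtain w where "w \<in> lip_small \<eta>" "e1 = (\<lambda>x. 2 * w x)" using e(1) by blast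
            then show "2-lipschitz_on UNIV e1"
              using lipschitz_on_cmult_real[of 1 UNIV w 2] by (simp add: lip_small_def)
          qed
          have "h = (\<lambda>x. p x + 2 * L * v x)" using L by (auto simp: v_def)
          then have "lip_functional h = lip_functional p + (2 * L) *\<^sub>R lip_functional v"
            using lip_functional_add[OF H(1)[OF p(2)] lipschitz_on_cmult_real[OF vlip, of "2 * L"]]
            by (simp add: lip_functional_cmult[OF vlip])
          also have "lip_functional v = lip_functional u + (lip_functional e1 + lip_functional e2)"
            unfolding v lip_functional_add[OF lips(1) lipschitz_on_add[OF lips(2,3)]]
              lip_functional_add[OF lips(2,3)] ..
          finally have "\<bar>blinfun_apply (lip_functional h) \<mu>\<bar> \<le> \<bar>blinfun_apply (lip_functional p) \<mu>\<bar> +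
              2 * L * (\<bar>blinfun_apply (lip_functional u) \<mu>\<bar> + (\<bar>blinfun_apply (lip_functional e1) \<mu>\<bar> + \<bar>blinfun_apply (lip_functional e2) \<mu>\<bar>))"
            using L by (auto simp: blinfun.add_left blinfun.scaleR_left abs_mult intro!: order_trans[OF abs_triangle_ineq] add_left_mono mult_left_mono)
          then have "ennreal \<bar>blinfun_apply (lip_functional h) \<mu>\<bar> \<le> ennreal \<bar>blinfun_apply (lip_functional p) \<mu>\<bar> +
              ennreal (2 * L) * (ennreal \<bar>blinfun_apply (lip_functional u) \<mu>\<bar> +
                (ennreal \<bar>blinfun_apply (lip_functional e1) \<mu>\<bar> + ennreal \<bar>blinfun_apply (lip_functional e2) \<mu>\<bar>))"
            using L by (subst ennreal_plus[symmetric] ennreal_mult[symmetric], simp, simp)+ (rule ennreal_leI)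
          also have "\<dots> \<le> (\<Sum>p\<in>G. ennreal \<bar>blinfun_apply (lip_functional p) \<mu>\<bar>) +
              ennreal (2 * L) * (lsem ?U \<mu> + (lsem ?E1 \<mu> + lsem ?E2 \<mu>))"
            by (intro add_mono mult_left_mono lsem_upper u e member_le_sum[OF p(1)] G(1)) auto
          finally show "ennreal \<bar>blinfun_apply (lip_functional h) \<mu>\<bar> \<le> \<dots>" .
        qed
        have ms: "(\<lambda>\<omega>. ennreal \<bar>blinfun_apply (lip_functional p) (Y k \<omega>)\<bar>) \<in> borel_measurable P" for p
        proof -
          have "(\<lambda>\<mu>. ennreal \<bar>blinfun_apply (lip_functional p) \<mu>\<bar>) \<in> borel_measurable borel"
            by (intro borel_measurable_continuous_onI continuous_intros continuous_on_ennreal)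
          from measurable_compose[OF meas this] show ?thesis .
        qed
        have "I H k \<le> (\<integral>\<^sup>+\<omega>. (\<Sum>p\<in>G. ennreal \<bar>blinfun_apply (lip_functional p) (Y k \<omega>)\<bar>) +
            ennreal (2 * L) * (lsem ?U (Y k \<omega>) + (lsem ?E1 (Y k \<omega>) + lsem ?E2 (Y k \<omega>))) \<partial>P)"
          unfolding I_def by (intro nn_integral_mono point)
        also have "\<dots> = (\<Sum>p\<in>G. A p k) + ennreal (2 * L) * (I ?U k + (I ?E1 k + I ?E2 k))"
        proof -
          have m1: "(\<lambda>\<omega>. \<Sum>p\<in>G. ennreal \<bar>blinfun_apply (lip_functional p) (Y k \<omega>)\<bar>) \<in> borel_measurable P"
            by (intro borel_measurable_sum ms)
          have m3: "(\<lambda>\<omega>. lsem ?E1 (Y k \<omega>) + lsem ?E2 (Y k \<omega>)) \<in> borel_measurable P"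
            by (intro borel_measurable_add lsem_measurable)
          have m4: "(\<lambda>\<omega>. lsem ?U (Y k \<omega>) + (lsem ?E1 (Y k \<omega>) + lsem ?E2 (Y k \<omega>))) \<in> borel_measurable P"
            by (intro borel_measurable_add lsem_measurable m3)
          have m5: "(\<lambda>\<omega>. ennreal (2 * L) * (lsem ?U (Y k \<omega>) + (lsem ?E1 (Y k \<omega>) + lsem ?E2 (Y k \<omega>)))) \<in> borel_measurable P"
            using m4 by measurable
          show ?thesis
            unfolding I_def A_def
            by (simp only: nn_integral_add[OF m1 m5] nn_integral_cmult[OF m4] nn_integral_add[OF lsem_measurable m3]
                nn_integral_add[OF lsem_measurable lsem_measurable] nn_integral_sum[OF ms])
        qed
        finally have IH: "I H k \<le> (\<Sum>p\<in>G. A p k) + ennreal (2 * L) * (I ?U k + (I ?E1 k + I ?E2 k))" .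
        have IE: "I ?E1 k \<le> ennreal d" "I ?E2 k \<le> ennreal d"
        proof -
          have two: "ennreal 2 * ennreal (d / 2) = ennreal d" using d by (intro ennreal_mult_divide) auto
          have "I ?E1 k \<le> (\<integral>\<^sup>+\<omega>. ennreal 2 * lsem (lip_small \<eta>) (Y k \<omega>) \<partial>P)"
            unfolding I_def by (intro nn_integral_mono lsem_cmult[where D = 1]) (auto simp: lip_small_def)
          also have "\<dots> = ennreal 2 * I (lip_small \<eta>) k" unfolding I_def by (rule nn_integral_cmult[OF lsem_measurable])
          also have "\<dots> \<le> ennreal 2 * ennreal (d / 2)" by (intro mult_left_mono \<eta>(3)) simp
          finally show "I ?E1 k \<le> ennreal d" unfolding two .
          have "I ?E2 k \<le> ennreal 2 * I (lip_vanish 1 K) k" by (rule I_lip_vanish) simp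
          also have "\<dots> \<le> ennreal 2 * ennreal (d / 2)" by (intro mult_left_mono tightK) simp
          finally show "I ?E2 k \<le> ennreal d" unfolding two .
        qed
        have "ennreal d \<le> I ?U k"
        proof (rule ccontr)
          assume "\<not> ?thesis"
          then have "I ?U k < ennreal d" by simp
          then obtain b where b: "0 \<le> b" "b < d" "I ?U k = ennreal b"
            by (cases "I ?U k") (auto simp: ennreal_less_iff)
          have "ennreal c \<le> I H k" using c(2) k(3) by (rule order_trans)
          also note IH
          also have "(\<Sum>p\<in>G. A p k) + ennreal (2 * L) * (I ?U k + (I ?E1 k + I ?E2 k)) \<le>
              ennreal (c / 4) + ennreal (2 * L) * (ennreal b + (ennreal d + ennreal d))"
            using k(1) IE b(3) by (intro add_mono mult_left_mono) auto
          also have "\<dots> = ennreal (c / 4 + 2 * L * (b + (d + d)))"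
          proof -
            have e1: "ennreal d + ennreal d = ennreal (d + d)" by (rule ennreal_plus[symmetric]) (use d in auto)
            have e2: "ennreal b + ennreal (d + d) = ennreal (b + (d + d))"
              by (rule ennreal_plus[symmetric]) (use b d in auto)
            have e3: "ennreal (2 * L) * ennreal (b + (d + d)) = ennreal (2 * L * (b + (d + d)))"
              by (rule ennreal_mult[symmetric]) (use b d L in auto)
            have e4: "ennreal (c / 4) + ennreal (2 * L * (b + (d + d))) = ennreal (c / 4 + 2 * L * (b + (d + d)))"
              by (rule ennreal_plus[symmetric]) (use b c d L in auto)
            show ?thesis unfolding e1 e2 e3 e4 ..
          qed
          finally have "c \<le> c / 4 + 2 * L * (b + (d + d))"
            using b d c L by (subst (asm) ennreal_le_iff) auto
          moreover have "2 * L * b < 2 * L * d" using b L by simp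
          moreover have "8 * (L * d) = c" using L by (simp add: d_def)
          ultimately show False by (simp add: algebra_simps)
        qed
        with k(2) \<delta> show ?thesis by blast
      qed
      define Q where "Q n = (\<lambda>(k :: nat, \<zeta> :: real, \<delta>). 0 < \<delta> \<and> \<delta> \<le> \<zeta> / 4 \<and>
        ennreal d \<le> I (flat_class K ((1 / 2) ^ n) \<zeta> \<delta>) k)" for n :: nat
      define R where "R n = (\<lambda>(k :: nat, \<zeta> :: real, \<delta>) (k', \<zeta>', \<delta>' :: real). k < k' \<and> \<zeta>' \<le> (1 / 2 :: real) ^ (n + 3) * \<delta>)" for n :: nat
      have "\<exists>q. \<forall>n. Q n (q n) \<and> R n (q n) (q (Suc n))"
      proof (rule dependent_nat_choice)
        show "\<exists>x. Q 0 x" using step[of 1 0 0] by (auto simp: Q_def)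
        fix x n assume "Q n x"
        obtain k \<zeta> \<delta> where x: "x = (k, \<zeta>, \<delta>)" by (cases x)
        \<comment> \<open>The next height is chosen as the largest one that
          \<open>wuc_flat_class\<close> permits after \<delta>.\<close>
        have "0 < (1 / 2) ^ (n + 3) * \<delta>" using \<open>Q n x\<close> by (simp add: Q_def x)
        from step[OF this, of k "Suc n"] obtain k' \<delta>' where "k < k'" "0 < \<delta>'" "\<delta>' \<le> (1 / 2) ^ (n + 3) * \<delta> / 4"
          "ennreal d \<le> I (flat_class K ((1 / 2) ^ Suc n) ((1 / 2) ^ (n + 3) * \<delta>) \<delta>') k'" by blast
        then have "Q (Suc n) (k', (1 / 2) ^ (n + 3) * \<delta>, \<delta>') \<and> R n x (k', (1 / 2) ^ (n + 3) * \<delta>, \<delta>')"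
          by (simp only: Q_def R_def x prod.case) simp
        then show "\<exists>y. Q (Suc n) y \<and> R n x y" by blast
      qed
      then obtain q where q: "\<And>n. Q n (q n)" "\<And>n. R n (q n) (q (Suc n))" by blast
      define k \<zeta> \<delta> where "k n = fst (q n)" and "\<zeta> n = fst (snd (q n))" and "\<delta> n = snd (snd (q n))" for n
      have Q: "0 < \<delta> n" "\<delta> n \<le> \<zeta> n / 4" "ennreal d \<le> I (flat_class K ((1 / 2) ^ n) (\<zeta> n) (\<delta> n)) (k n)" for n
        using q(1)[of n] by (auto simp: Q_def k_def \<zeta>_def \<delta>_def split: prod.splits)
      have R: "k n < k (Suc n)" "\<zeta> (Suc n) \<le> (1 / 2) ^ (n + 3) * \<delta> n" for n
        using q(2)[of n] by (auto simp: R_def k_def \<zeta>_def \<delta>_def split: prod.splits)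
      have "strict_mono k" using R(1) by (simp add: strict_mono_Suc_iff)
      from null[OF wuc_flat_class[OF Q(1,2) R(2)] _ this]
      have "(\<lambda>n. I (flat_class K ((1 / 2) ^ n) (\<zeta> n) (\<delta> n)) (k n)) \<longlonglongrightarrow> 0" by (simp add: I_def)
      from order_tendstoD(2)[OF this, of "ennreal d"] d
      obtain n where "I (flat_class K ((1 / 2) ^ n) (\<zeta> n) (\<delta> n)) (k n) < ennreal d"
        by (auto simp: eventually_sequentially)
      with Q(3)[of n] show False by simp
    qed
  qed simp
  then show ?thesis
    by (rule tendsto_sandwich[OF _ _ tendsto_const, rotated 2])
      (auto simp: I_def intro!: always_eventually nn_integral_mono norm_H)
qed

end

section \<open>Weakly null sequences and strong measurability\<close>

text \<open>
  Gliding hump: along a sparse subsequence \<open>q\<close> the functional \<open>\<Sum>l. \<phi> (q l)\<close> evaluated at \<open>y (q i)\<close> is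
  dominated by its \<open>i\<close>-th term.
\<close>

lemma weakly_null_wuc_functionals:
  fixes \<phi> :: "nat \<Rightarrow> 'x::real_normed_vector \<Rightarrow>\<^sub>L real"
  assumes sums: "\<And>n x. (\<Sum>j<n. \<bar>blinfun_apply (\<phi> j) x\<bar>) \<le> C * norm x"
    and y: "\<And>\<psi> :: 'x \<Rightarrow>\<^sub>L real. (\<lambda>n. blinfun_apply \<psi> (y n)) \<longlonglongrightarrow> 0"
  shows "(\<lambda>n. blinfun_apply (\<phi> n) (y n)) \<longlonglongrightarrow> 0"
proof (rule ccontr)
  assume "\<not> ?thesis"
  then obtain e where e: "0 < e" "\<not> (\<forall>\<^sub>F n in sequentially. \<bar>blinfun_apply (\<phi> n) (y n)\<bar> < e)"
    by (auto simp: tendsto_iff)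
  then have freq: "\<exists>\<^sub>F n in sequentially. e \<le> \<bar>blinfun_apply (\<phi> n) (y n)\<bar>" by (simp add: not_eventually not_less)
  have summ: "summable (\<lambda>n. \<bar>blinfun_apply (\<phi> n) x\<bar>)" for x
    by (rule bounded_imp_summable[of _ "C * norm x"])
      (simp_all only: abs_ge_zero lessThan_Suc_atMost[symmetric] sums)
  \<comment> \<open>The next index is so large that the functionals beyond it are negligible at y j,
    the functionals up to j are negligible at the new vector, and the diagonal value is still at
    least e.\<close>
  have big: "\<exists>j'>j. (\<Sum>n. \<bar>blinfun_apply (\<phi> (n + j')) (y j)\<bar>) \<le> e / 4 \<and>
      (\<Sum>n\<le>j. \<bar>blinfun_apply (\<phi> n) (y j')\<bar>) \<le> e / 4 \<and> e \<le> \<bar>blinfun_apply (\<phi> j') (y j')\<bar>" for j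
  proof -
    have e4: "0 < e / 4" using e by simp
    have "(\<lambda>j'. \<Sum>n\<le>j. \<bar>blinfun_apply (\<phi> n) (y j')\<bar>) \<longlonglongrightarrow> (\<Sum>n\<le>j. \<bar>0\<bar>)"
      by (intro tendsto_sum tendsto_rabs y)
    then have ev: "\<forall>\<^sub>F j' in sequentially. (\<Sum>n\<le>j. \<bar>blinfun_apply (\<phi> n) (y j')\<bar>) < e / 4"
      using e4 by (intro order_tendstoD(2)) auto
    obtain N where N: "\<And>m. m \<ge> N \<Longrightarrow> norm (\<Sum>n. \<bar>blinfun_apply (\<phi> (n + m)) (y j)\<bar>) < e / 4"
      using suminf_exist_split[OF e4 summ[of "y j"]] by blast
    from frequently_eventually_frequently[OF freq eventually_conj[OF ev eventually_conj[OF eventually_gt_at_top[of j] eventually_ge_at_top[of N]]]]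
    obtain j' where j': "e \<le> \<bar>blinfun_apply (\<phi> j') (y j')\<bar>" "(\<Sum>n\<le>j. \<bar>blinfun_apply (\<phi> n) (y j')\<bar>) < e / 4" "j < j'" "N \<le> j'"
      using frequently_ex by blast
    have "(\<Sum>n. \<bar>blinfun_apply (\<phi> (n + j')) (y j)\<bar>) \<le> norm (\<Sum>n. \<bar>blinfun_apply (\<phi> (n + j')) (y j)\<bar>)" by simp
    also have "\<dots> \<le> e / 4" using N[OF j'(4)] by simp
    finally show ?thesis using j' by (intro exI[of _ j']) auto
  qed
  \<comment> \<open>All constraints link consecutive indices, so \<open>q 0\<close> is
    unconstrained; this is why only the values at \<open>q (Suc i)\<close> are estimated
    below.\<close>
  have "\<exists>q. \<forall>i. True \<and> (q i < q (Suc i) \<and> (\<Sum>n. \<bar>blinfun_apply (\<phi> (n + q (Suc i))) (y (q i))\<bar>) \<le> e / 4 \<and>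
      (\<Sum>n\<le>q i. \<bar>blinfun_apply (\<phi> n) (y (q (Suc i)))\<bar>) \<le> e / 4 \<and> e \<le> \<bar>blinfun_apply (\<phi> (q (Suc i))) (y (q (Suc i)))\<bar>)"
    by (rule dependent_nat_choice) (use big in auto)
  then obtain q where q: "\<And>i. q i < q (Suc i)" "\<And>i. (\<Sum>n. \<bar>blinfun_apply (\<phi> (n + q (Suc i))) (y (q i))\<bar>) \<le> e / 4"
      "\<And>i. (\<Sum>n\<le>q i. \<bar>blinfun_apply (\<phi> n) (y (q (Suc i)))\<bar>) \<le> e / 4" "\<And>i. e \<le> \<bar>blinfun_apply (\<phi> (q (Suc i))) (y (q (Suc i)))\<bar>"
    by blast
  have qm: "strict_mono q" using q(1) by (simp add: strict_mono_Suc_iff)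
  have sub: "(\<Sum>l\<in>A. \<bar>blinfun_apply (\<phi> (q l)) x\<bar>) \<le> (\<Sum>n\<in>B. \<bar>blinfun_apply (\<phi> n) x\<bar>)"
    if "finite B" "q ` A \<subseteq> B" for A B x
  proof -
    have "(\<Sum>l\<in>A. \<bar>blinfun_apply (\<phi> (q l)) x\<bar>) = (\<Sum>n\<in>q ` A. \<bar>blinfun_apply (\<phi> n) x\<bar>)"
      using strict_mono_imp_inj_on[OF qm] by (subst sum.reindex) (auto simp: inj_on_def)
    also have "\<dots> \<le> (\<Sum>n\<in>B. \<bar>blinfun_apply (\<phi> n) x\<bar>)" using that by (intro sum_mono2) auto
    finally show ?thesis .
  qed
  have part: "(\<Sum>l<n. \<bar>blinfun_apply (\<phi> (q l)) x\<bar>) \<le> C * norm x" for n x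
    by (rule order_trans[OF sub[of "{..<q n}"] sums]) (use strict_monoD[OF qm] in auto)
  have summq: "summable (\<lambda>l. \<bar>blinfun_apply (\<phi> (q l)) x\<bar>)" for x
    by (rule bounded_imp_summable[of _ "C * norm x"])
      (simp_all only: abs_ge_zero lessThan_Suc_atMost[symmetric] part)
  have summq': "summable (\<lambda>l. blinfun_apply (\<phi> (q l)) x)" for x
    using summq[of x] by (rule summable_rabs_cancel)
  define \<psi> where "\<psi> x = (\<Sum>l. blinfun_apply (\<phi> (q l)) x)" for x
  have "bounded_linear \<psi>"
  proof (rule bounded_linear_intro)
    show "\<psi> (x + z) = \<psi> x + \<psi> z" for x z
      using suminf_add[OF summq'[of x] summq'[of z]] by (simp add: \<psi>_def blinfun.add_right)
    show "\<psi> (r *\<^sub>R x) = r *\<^sub>R \<psi> x" for r x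
      using suminf_mult[OF summq'[of x], of r] by (simp add: \<psi>_def blinfun.scaleR_right)
    show "norm (\<psi> x) \<le> norm x * C" for x
    proof -
      have "norm (\<psi> x) \<le> (\<Sum>l. \<bar>blinfun_apply (\<phi> (q l)) x\<bar>)"
        unfolding \<psi>_def real_norm_def by (rule summable_rabs[OF summq])
      also have "\<dots> \<le> C * norm x" by (rule suminf_le_const[OF summq part])
      finally show ?thesis by (simp add: mult.commute)
    qed
  qed
  then have \<psi>: "blinfun_apply (Blinfun \<psi>) = \<psi>" by (rule bounded_linear_Blinfun_apply)
  have large: "e / 2 \<le> \<bar>\<psi> (y (q (Suc i)))\<bar>" for i
  proof -
    let ?a = "\<lambda>l. blinfun_apply (\<phi> (q l)) (y (q (Suc i)))"
    have "\<psi> (y (q (Suc i))) = (\<Sum>l. ?a (l + Suc (Suc i))) + (\<Sum>l<Suc (Suc i). ?a l)"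
      unfolding \<psi>_def by (rule suminf_split_initial_segment[OF summq'])
    also have "(\<Sum>l<Suc (Suc i). ?a l) = (\<Sum>l<Suc i. ?a l) + ?a (Suc i)" by simp
    finally have eq: "\<psi> (y (q (Suc i))) = (\<Sum>l. ?a (l + Suc (Suc i))) + ((\<Sum>l<Suc i. ?a l) + ?a (Suc i))" .
    have "\<bar>\<Sum>l<Suc i. ?a l\<bar> \<le> (\<Sum>l<Suc i. \<bar>?a l\<bar>)" by (rule sum_abs)
    also have "\<dots> \<le> (\<Sum>n\<le>q i. \<bar>blinfun_apply (\<phi> n) (y (q (Suc i)))\<bar>)"
      by (rule sub) (use strict_mono_less_eq[OF qm] in auto)
    also have "\<dots> \<le> e / 4" by (rule q(3))
    finally have head: "\<bar>\<Sum>l<Suc i. ?a l\<bar> \<le> e / 4" .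
    have summt: "summable (\<lambda>l. \<bar>?a (l + Suc (Suc i))\<bar>)"
      using summable_ignore_initial_segment[OF summq[of "y (q (Suc i))"], of "Suc (Suc i)"] by simp
    have "\<bar>\<Sum>l. ?a (l + Suc (Suc i))\<bar> \<le> (\<Sum>l. \<bar>?a (l + Suc (Suc i))\<bar>)" by (rule summable_rabs[OF summt])
    also have "\<dots> \<le> e / 4"
    proof (rule suminf_le_const[OF summt])
      fix n
      let ?Q = "q (Suc (Suc i))"
      have "(\<Sum>l<n. \<bar>?a (l + Suc (Suc i))\<bar>) = (\<Sum>l\<in>{Suc (Suc i)..<n + Suc (Suc i)}. \<bar>?a l\<bar>)"
        using sum.shift_bounds_nat_ivl[of "\<lambda>l. \<bar>?a l\<bar>" 0 "Suc (Suc i)" n] by (simp add: lessThan_atLeast0)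
      also have "\<dots> \<le> (\<Sum>k\<in>{?Q..<q (n + Suc (Suc i)) + ?Q}. \<bar>blinfun_apply (\<phi> k) (y (q (Suc i)))\<bar>)"
      proof (rule sub)
        show "q ` {Suc (Suc i)..<n + Suc (Suc i)} \<subseteq> {?Q..<q (n + Suc (Suc i)) + ?Q}"
        proof
          fix k assume "k \<in> q ` {Suc (Suc i)..<n + Suc (Suc i)}"
          then obtain l where l: "k = q l" "Suc (Suc i) \<le> l" "l < n + Suc (Suc i)" by auto
          have "q l < q (n + Suc (Suc i)) + ?Q" by (rule trans_less_add1[OF strict_monoD[OF qm l(3)]])
          moreover have "?Q \<le> q l" using strict_mono_less_eq[OF qm] l(2) by blast
          ultimately show "k \<in> {?Q..<q (n + Suc (Suc i)) + ?Q}" by (simp add: l(1))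
        qed
      qed simp
      also have "\<dots> = (\<Sum>k<q (n + Suc (Suc i)). \<bar>blinfun_apply (\<phi> (k + ?Q)) (y (q (Suc i)))\<bar>)"
        using sum.shift_bounds_nat_ivl[of "\<lambda>k. \<bar>blinfun_apply (\<phi> k) (y (q (Suc i)))\<bar>" 0 ?Q "q (n + Suc (Suc i))"]
        by (simp add: lessThan_atLeast0)
      also have "\<dots> \<le> (\<Sum>k. \<bar>blinfun_apply (\<phi> (k + ?Q)) (y (q (Suc i)))\<bar>)"
        by (intro sum_le_suminf summable_ignore_initial_segment summ) auto
      also have "\<dots> \<le> e / 4" by (rule q(2))
      finally show "(\<Sum>l<n. \<bar>?a (l + Suc (Suc i))\<bar>) \<le> e / 4" .
    qed
    finally have tail: "\<bar>\<Sum>l. ?a (l + Suc (Suc i))\<bar> \<le> e / 4" .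
    show ?thesis unfolding eq using head tail q(4)[of i] by linarith
  qed
  have "strict_mono (\<lambda>i. q (Suc i))" using strict_monoD[OF qm] by (simp add: strict_mono_def)
  from LIMSEQ_subseq_LIMSEQ[OF y[of "Blinfun \<psi>"] this]
  have "(\<lambda>i. \<bar>\<psi> (y (q (Suc i)))\<bar>) \<longlonglongrightarrow> \<bar>0\<bar>" unfolding \<psi> comp_def by (rule tendsto_rabs)
  then have "e / 2 \<le> \<bar>0\<bar>" by (rule LIMSEQ_le_const) (use large in auto)
  with e show False by simp
qed

lemma sem_almost_attained:
  fixes \<Phi> :: "('x::real_normed_vector \<Rightarrow>\<^sub>L real) set"
  assumes ne: "\<Phi> \<noteq> {}" and bd: "\<And>\<phi>. \<phi> \<in> \<Phi> \<Longrightarrow> norm \<phi> \<le> C" and e: "0 < e"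
  obtains \<phi> where "\<phi> \<in> \<Phi>" "sem \<Phi> x \<le> ennreal (\<bar>blinfun_apply \<phi> x\<bar> + e)"
proof (rule ccontr)
  assume no: "\<not> thesis"
  note attained = that
  have "sem \<Phi> x < top" using le_less_trans[OF sem_le_norm[OF bd] ennreal_less_top] .
  then obtain b where b: "0 \<le> b" "sem \<Phi> x = ennreal b" by (cases "sem \<Phi> x") auto
  have less: "\<bar>blinfun_apply \<phi> x\<bar> + e < b" if "\<phi> \<in> \<Phi>" for \<phi>
  proof -
    have "\<not> sem \<Phi> x \<le> ennreal (\<bar>blinfun_apply \<phi> x\<bar> + e)" using no attained[OF \<open>\<phi> \<in> \<Phi>\<close>] by blast
    then have "ennreal (\<bar>blinfun_apply \<phi> x\<bar> + e) < ennreal b" unfolding b(2) not_le .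
    then show ?thesis using e by (subst (asm) ennreal_less_iff) auto
  qed
  have "sem \<Phi> x \<le> ennreal (b - e)"
    by (rule sem_least, rule ennreal_leI) (use less in fastforce)
  moreover obtain \<phi> where "\<phi> \<in> \<Phi>" using ne by blast
  then have "e < b" using less[of \<phi>] by linarith
  ultimately show False using b e by (simp add: ennreal_le_iff)
qed

text \<open>Near-maximisers chosen from the classes give functionals with uniformly bounded absolute
  sums, to which the gliding hump applies; the slack 1/(j + 1) disappears in the limit.\<close>

lemma weakly_null_lsem:
  fixes y :: "nat \<Rightarrow> 'm::{metric_space, zero} lip_free"
  assumes w: "wuc C \<U>" and C: "0 \<le> C"
    and y: "\<And>\<psi> :: 'm lip_free \<Rightarrow>\<^sub>L real. (\<lambda>n. blinfun_apply \<psi> (y n)) \<longlonglongrightarrow> 0"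
  shows "(\<lambda>j. lsem (\<U> j) (y j)) \<longlonglongrightarrow> 0"
proof -
  have "\<exists>u\<in>\<U> j. lsem (\<U> j) (y j) \<le> ennreal (\<bar>blinfun_apply (lip_functional u) (y j)\<bar> + inverse (real (Suc j)))" for j
  proof -
    have "\<U> j \<noteq> {}" using w by (simp add: wuc_def)
    then have "lip_functional ` \<U> j \<noteq> {}" by blast
    moreover have "norm \<phi> \<le> C" if "\<phi> \<in> lip_functional ` \<U> j" for \<phi>
      using that norm_lip_functional_le[OF wuc_lipschitz[OF w _ C]] by blast
    ultimately obtain \<phi> where "\<phi> \<in> lip_functional ` \<U> j"
      "lsem (\<U> j) (y j) \<le> ennreal (\<bar>blinfun_apply \<phi> (y j)\<bar> + inverse (real (Suc j)))"
      by (rule sem_almost_attained[where e = "inverse (real (Suc j))" and x = "y j"]) auto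
    then show ?thesis by blast
  qed
  then obtain u where u: "\<And>j. u j \<in> \<U> j"
    "\<And>j. lsem (\<U> j) (y j) \<le> ennreal (\<bar>blinfun_apply (lip_functional (u j)) (y j)\<bar> + inverse (real (Suc j)))" by metis
  have "(\<lambda>j. blinfun_apply (lip_functional (u j)) (y j)) \<longlonglongrightarrow> 0"
    by (rule weakly_null_wuc_functionals[where C = C]) (auto intro!: wuc_sum_functional_le[OF w u(1) C] y)
  then have "(\<lambda>j. \<bar>blinfun_apply (lip_functional (u j)) (y j)\<bar> + inverse (real (Suc j))) \<longlonglongrightarrow> 0"
    by (intro tendsto_add_zero LIMSEQ_inverse_real_of_nat tendsto_rabs_zero)
  then have lim: "(\<lambda>j. ennreal (\<bar>blinfun_apply (lip_functional (u j)) (y j)\<bar> + inverse (real (Suc j)))) \<longlonglongrightarrow> ennreal 0"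
    by (rule tendsto_ennrealI)
  show ?thesis
  proof (rule tendsto_sandwich[OF _ _ tendsto_const lim[unfolded ennreal_0]])
    show "\<forall>\<^sub>F j in sequentially. lsem (\<U> j) (y j) \<le> ennreal (\<bar>blinfun_apply (lip_functional (u j)) (y j)\<bar> + inverse (real (Suc j)))"
      by (rule always_eventually, rule allI, rule u(2))
  qed simp
qed

theorem curve_flat_imp_dunford_pettis:
  fixes f :: "'m::{complete_space, zero} \<Rightarrow> 'n::{metric_space, zero}"
  assumes f: "L-lipschitz_on UNIV f" "f 0 = 0" "curve_flat f" and L: "0 < L"
  shows "dunford_pettis (linearization f)"
  unfolding dunford_pettis_def
proof (intro allI impI)
  fix u :: "nat \<Rightarrow> 'm lip_free" and l assume "weakly_convergent_to u l"
  then have weak: "(\<lambda>n. blinfun_apply \<psi> (u n - l)) \<longlonglongrightarrow> 0" for \<psi> :: "'m lip_free \<Rightarrow>\<^sub>L real"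
    by (simp add: weakly_convergent_to_def blinfun.diff_right LIM_zero_iff)
  define y where "y n = u n - l" for n
  \<comment> \<open>Over a one-point space integration is evaluation, so the random null theorem
    becomes the deterministic one.\<close>
  let ?P = "count_space (UNIV :: unit set)"
  have I1: "(\<integral>\<^sup>+\<omega>. g \<omega> \<partial>?P) = g ()" for g by (simp add: nn_integral_count_space_finite UNIV_unit)
  interpret wuc_null ?P "\<lambda>k _. y k"
  proof
    fix k and e :: real assume "0 < e"
    obtain F where "finite F" "0 \<in> F" "lsem (lip_vanish 1 F) (y k) \<le> ennreal e"
      by (rule lip_free_approx_finite[OF \<open>0 < e\<close>, of "y k"])
    then show "\<exists>F. finite F \<and> 0 \<in> F \<and> (\<integral>\<^sup>+\<omega>. lsem (lip_vanish 1 F) (y k) \<partial>?P) \<le> ennreal e"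
      unfolding I1 by blast
  next
    fix C and \<U> :: "nat \<Rightarrow> ('m \<Rightarrow> real) set" and r :: "nat \<Rightarrow> nat" assume w: "wuc C \<U>" "0 \<le> C" and r: "strict_mono r"
    show "(\<lambda>j. \<integral>\<^sup>+\<omega>. lsem (\<U> j) (y (r j)) \<partial>?P) \<longlonglongrightarrow> 0"
      unfolding I1
      by (rule weakly_null_lsem[OF w]) (use LIMSEQ_subseq_LIMSEQ[OF weak r] in \<open>simp add: comp_def y_def\<close>)
  qed (simp_all add: I1)
  have "(\<lambda>k. \<integral>\<^sup>+\<omega>. norm (blinfun_apply (linearization f) (y k)) \<partial>?P) \<longlonglongrightarrow> 0"
  proof (rule curve_flat_null[OF f L])
    fix C and p :: "'m \<Rightarrow> real"
    show "(\<lambda>k. \<integral>\<^sup>+\<omega>. \<bar>blinfun_apply (lip_functional p) (y k)\<bar> \<partial>?P) \<longlonglongrightarrow> 0"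
      unfolding I1 y_def using tendsto_ennrealI[OF tendsto_rabs_zero[OF weak]] by simp
  qed
  then have "(\<lambda>k. ennreal (norm (blinfun_apply (linearization f) (y k)))) \<longlonglongrightarrow> ennreal 0" unfolding I1 by simp
  then have "(\<lambda>k. norm (blinfun_apply (linearization f) (y k))) \<longlonglongrightarrow> 0"
    by (subst (asm) tendsto_ennreal_iff) auto
  then have "(\<lambda>k. blinfun_apply (linearization f) (y k)) \<longlonglongrightarrow> 0" by (rule tendsto_norm_zero_cancel)
  then show "(\<lambda>n. blinfun_apply (linearization f) (u n)) \<longlonglongrightarrow> blinfun_apply (linearization f) l"
    by (simp add: y_def blinfun.diff_right LIM_zero_iff)
qed

section \<open>Strong measurability and Bochner integrals\<close>

text \<open>In a nonseparable space sums of Borel functions need not be Borel. Pointwise limits of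
  simple functions are stable under sums and under multiplication by indicators, and they are
  Borel.\<close>

definition strongly_measurable :: "'p measure \<Rightarrow> ('p \<Rightarrow> 'x::real_normed_vector) \<Rightarrow> bool" where
  "strongly_measurable M f \<longleftrightarrow>
    (\<exists>s. (\<forall>i. simple_function M (s i)) \<and> (\<forall>\<omega>\<in>space M. (\<lambda>i::nat. s i \<omega>) \<longlonglongrightarrow> f \<omega>))"

lemma strongly_measurable_borel:
  assumes "strongly_measurable M f"
  shows "f \<in> borel_measurable M"
proof -
  obtain s where s: "\<And>i. simple_function M (s i)" "\<And>\<omega>. \<omega> \<in> space M \<Longrightarrow> (\<lambda>i. s i \<omega>) \<longlonglongrightarrow> f \<omega>"
    using assms by (auto simp: strongly_measurable_def)
  show ?thesis
    by (rule borel_measurable_LIMSEQ_metric[of s]) (use s in \<open>auto intro: borel_measurable_simple_function\<close>)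
qed

lemma strongly_measurable_add:
  assumes "strongly_measurable M f" "strongly_measurable M g"
  shows "strongly_measurable M (\<lambda>\<omega>. f \<omega> + g \<omega>)"
proof -
  obtain s t where "\<And>i. simple_function M (s i)" "\<And>\<omega>. \<omega> \<in> space M \<Longrightarrow> (\<lambda>i. s i \<omega>) \<longlonglongrightarrow> f \<omega>"
    "\<And>i. simple_function M (t i)" "\<And>\<omega>. \<omega> \<in> space M \<Longrightarrow> (\<lambda>i. t i \<omega>) \<longlonglongrightarrow> g \<omega>"
    using assms unfolding strongly_measurable_def by blast
  then show ?thesis
    unfolding strongly_measurable_def
    by (intro exI[of _ "\<lambda>i \<omega>. s i \<omega> + t i \<omega>"]) (auto intro!: simple_function_compose2[of _ _ _ "(+)"] tendsto_add)
qed

lemma strongly_measurable_diff: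
  assumes "strongly_measurable M f" "strongly_measurable M g"
  shows "strongly_measurable M (\<lambda>\<omega>. f \<omega> - g \<omega>)"
proof -
  obtain s t where "\<And>i. simple_function M (s i)" "\<And>\<omega>. \<omega> \<in> space M \<Longrightarrow> (\<lambda>i. s i \<omega>) \<longlonglongrightarrow> f \<omega>"
    "\<And>i. simple_function M (t i)" "\<And>\<omega>. \<omega> \<in> space M \<Longrightarrow> (\<lambda>i. t i \<omega>) \<longlonglongrightarrow> g \<omega>"
    using assms unfolding strongly_measurable_def by blast
  then show ?thesis
    unfolding strongly_measurable_def
    by (intro exI[of _ "\<lambda>i \<omega>. s i \<omega> - t i \<omega>"]) (auto intro!: simple_function_compose2[of _ _ _ "(-)"] tendsto_diff)
qed

lemma simple_function_indicator_scaleR: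
  assumes "simple_function M s" "A \<in> sets M"
  shows "simple_function M (\<lambda>\<omega>. indicator A \<omega> *\<^sub>R s \<omega>)"
  using simple_function_compose2[OF simple_function_indicator[OF assms(2)] assms(1), of "(*\<^sub>R)"] .

lemma strongly_measurable_indicator:
  assumes "strongly_measurable M f" "A \<in> sets M"
  shows "strongly_measurable M (\<lambda>\<omega>. indicator A \<omega> *\<^sub>R f \<omega>)"
proof -
  obtain s where "\<And>i. simple_function M (s i)" "\<And>\<omega>. \<omega> \<in> space M \<Longrightarrow> (\<lambda>i. s i \<omega>) \<longlonglongrightarrow> f \<omega>"
    using assms by (auto simp: strongly_measurable_def)
  then show ?thesis
    unfolding strongly_measurable_def
    by (intro exI[of _ "\<lambda>i \<omega>. indicator A \<omega> *\<^sub>R s i \<omega>"])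
      (auto intro!: simple_function_indicator_scaleR assms(2) tendsto_scaleR)
qed

lemma simple_function_subalgebra:
  assumes "subalgebra P F" "simple_function F s"
  shows "simple_function P s"
  using assms by (auto simp: simple_function_def subalgebra_def)

lemma strongly_measurable_subalgebra:
  "subalgebra P F \<Longrightarrow> strongly_measurable F f \<Longrightarrow> strongly_measurable P f"
  unfolding strongly_measurable_def using simple_function_subalgebra[of P F]
  by (metis subalgebra_def)

lemma bochner_has_integral_functional:
  fixes \<phi> :: "'x::real_normed_vector \<Rightarrow>\<^sub>L real"
  assumes "bochner_has_integral M f x"
  shows "has_bochner_integral M (\<lambda>\<omega>. blinfun_apply \<phi> (f \<omega>)) (blinfun_apply \<phi> x)"
proof -
  from assms obtain s where f: "f \<in> borel_measurable M"
    and s: "\<And>i. Bochner_Integration.simple_bochner_integrable M (s i)" "(\<lambda>i. \<integral>\<^sup>+\<omega>. norm (f \<omega> - s i \<omega>) \<partial>M) \<longlonglongrightarrow> 0"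
      "(\<lambda>i. Bochner_Integration.simple_bochner_integral M (s i)) \<longlonglongrightarrow> x"
    by (rule bochner_has_integral.cases) blast
  show ?thesis
  proof (rule has_bochner_integral.intros[where s = "\<lambda>i \<omega>. blinfun_apply \<phi> (s i \<omega>)"])
    have "blinfun_apply \<phi> \<in> borel_measurable borel"
      by (intro borel_measurable_continuous_onI continuous_intros)
    then show "(\<lambda>\<omega>. blinfun_apply \<phi> (f \<omega>)) \<in> borel_measurable M" by (rule measurable_compose[OF f])
    show "Bochner_Integration.simple_bochner_integrable M (\<lambda>\<omega>. blinfun_apply \<phi> (s i \<omega>))" for i
      using simple_bochner_integrable_compose2[OF _ s(1)[of i] s(1)[of i], of "\<lambda>a b. blinfun_apply \<phi> a"]
      by (simp add: blinfun.zero_right)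
    have "Bochner_Integration.simple_bochner_integral M (\<lambda>\<omega>. blinfun_apply \<phi> (s i \<omega>)) =
        blinfun_apply \<phi> (Bochner_Integration.simple_bochner_integral M (s i))" for i
      by (rule simple_bochner_integral_linear[OF _ s(1)]) (rule bounded_linear.linear[OF blinfun.bounded_linear_right])
    then show "(\<lambda>i. Bochner_Integration.simple_bochner_integral M (\<lambda>\<omega>. blinfun_apply \<phi> (s i \<omega>))) \<longlonglongrightarrow> blinfun_apply \<phi> x"
      using s(3) by (simp add: tendsto_intros)
    have m: "(\<lambda>\<omega>. ennreal (norm (f \<omega> - s i \<omega>))) \<in> borel_measurable M" for i
      using measurable_norm_diff_simple[OF f] s(1)[of i] by (auto elim!: simple_bochner_integrable.cases)
    show "(\<lambda>i. \<integral>\<^sup>+\<omega>. norm (blinfun_apply \<phi> (f \<omega>) - blinfun_apply \<phi> (s i \<omega>)) \<partial>M) \<longlonglongrightarrow> 0"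
    proof (rule tendsto_sandwich[OF _ _ tendsto_const])
      have "norm (blinfun_apply \<phi> (f \<omega>) - blinfun_apply \<phi> (s i \<omega>)) \<le> norm \<phi> * norm (f \<omega> - s i \<omega>)" for i \<omega>
        using norm_blinfun[of \<phi> "f \<omega> - s i \<omega>"] by (simp add: blinfun.diff_right)
      then show "\<forall>\<^sub>F i in sequentially. (\<integral>\<^sup>+\<omega>. norm (blinfun_apply \<phi> (f \<omega>) - blinfun_apply \<phi> (s i \<omega>)) \<partial>M) \<le>
          ennreal (norm \<phi>) * (\<integral>\<^sup>+\<omega>. norm (f \<omega> - s i \<omega>) \<partial>M)"
        by (intro always_eventually allI) (subst nn_integral_cmult[symmetric, OF m],
            intro nn_integral_mono, simp add: ennreal_mult[symmetric])
      show "(\<lambda>i. ennreal (norm \<phi>) * (\<integral>\<^sup>+\<omega>. norm (f \<omega> - s i \<omega>) \<partial>M)) \<longlonglongrightarrow> 0"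
        using ennreal_tendsto_cmult[OF _ s(2), of "ennreal (norm \<phi>)"] by simp
    qed simp
  qed
qed

text \<open>Simple functions converging in mean with errors below 2^-n converge almost everywhere.
  Replacing X by their limit on the convergence set, and by 0 elsewhere, keeps measurability with
  respect to F and changes X only on a null set.\<close>

lemma bochner_integrable_modification:
  fixes X :: "'p \<Rightarrow> 'x::banach"
  assumes sub: "subalgebra P F" and X: "bochner_integrable (restr_to_subalg P F) X"
  obtains X' where "strongly_measurable F X'" "AE \<omega> in P. X' \<omega> = X \<omega>"
    "\<And>e. 0 < e \<Longrightarrow> \<exists>S. simple_function F S \<and> (\<integral>\<^sup>+\<omega>. norm (X' \<omega> - S \<omega>) \<partial>P) \<le> ennreal e"
proof -
  let ?R = "restr_to_subalg P F"
  obtain x where "bochner_has_integral ?R X x" using X by (auto simp: bochner_integrable_def)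
  then obtain s where XR: "X \<in> borel_measurable ?R"
    and s: "\<And>i. Bochner_Integration.simple_bochner_integrable ?R (s i)" "(\<lambda>i. \<integral>\<^sup>+\<omega>. norm (X \<omega> - s i \<omega>) \<partial>?R) \<longlonglongrightarrow> 0"
    by (rule bochner_has_integral.cases) blast
  have XF: "X \<in> borel_measurable F"
    using XR by (simp add: measurable_cong_sets[OF sets_restr_to_subalg[OF sub] refl])
  have spF: "space F = space P" using sub by (simp add: subalgebra_def)
  have sF: "simple_function F (s i)" for i
    using s(1)[of i] by (auto simp: simple_function_def space_restr_to_subalg sets_restr_to_subalg[OF sub] spF
        elim!: simple_bochner_integrable.cases)
  have mF: "(\<lambda>\<omega>. ennreal (norm (X \<omega> - t \<omega>))) \<in> borel_measurable F" if "simple_function F t" for t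
    using measurable_norm_diff_simple[OF XF that] by simp
  have eqP: "(\<integral>\<^sup>+\<omega>. norm (X \<omega> - s i \<omega>) \<partial>?R) = (\<integral>\<^sup>+\<omega>. norm (X \<omega> - s i \<omega>) \<partial>P)" for i
    by (rule nn_integral_subalgebra2[OF sub mF[OF sF]])
  have "\<exists>i. (\<integral>\<^sup>+\<omega>. norm (X \<omega> - s i \<omega>) \<partial>P) < ennreal ((1 / 2) ^ n)" for n
    using order_tendstoD(2)[OF s(2), of "ennreal ((1 / 2) ^ n)"] unfolding eqP by (auto simp: eventually_sequentially)
  then obtain k where k: "\<And>n. (\<integral>\<^sup>+\<omega>. norm (X \<omega> - s (k n) \<omega>) \<partial>P) < ennreal ((1 / 2) ^ n)" by metis
  define t where "t n = s (k n)" for n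
  have tF: "simple_function F (t n)" for n unfolding t_def by (rule sF)
  have mP: "(\<lambda>\<omega>. ennreal (norm (X \<omega> - t n \<omega>))) \<in> borel_measurable P" for n
    by (rule measurable_from_subalg[OF sub mF[OF tF]])
  have "(\<integral>\<^sup>+\<omega>. (\<Sum>n. ennreal (norm (X \<omega> - t n \<omega>))) \<partial>P) = (\<Sum>n. \<integral>\<^sup>+\<omega>. norm (X \<omega> - t n \<omega>) \<partial>P)"
    by (rule nn_integral_suminf[OF mP])
  also have "\<dots> \<le> (\<Sum>n. ennreal ((1 / 2) ^ n))" by (intro suminf_le less_imp_le) (use k in \<open>auto simp: t_def\<close>)
  also have "\<dots> = ennreal (\<Sum>n. (1 / 2) ^ n)" by (intro suminf_ennreal2) auto
  also have "\<dots> < \<infinity>" by simp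
  finally have fin: "(\<integral>\<^sup>+\<omega>. (\<Sum>n. ennreal (norm (X \<omega> - t n \<omega>))) \<partial>P) < \<infinity>" .
  note mP[measurable]
  have "AE \<omega> in P. (\<Sum>n. ennreal (norm (X \<omega> - t n \<omega>))) \<noteq> \<infinity>"
  proof (rule nn_integral_PInf_AE)
    show "(\<lambda>\<omega>. \<Sum>n. ennreal (norm (X \<omega> - t n \<omega>))) \<in> borel_measurable P" by measurable
    show "(\<integral>\<^sup>+\<omega>. (\<Sum>n. ennreal (norm (X \<omega> - t n \<omega>))) \<partial>P) \<noteq> \<infinity>" using fin by (rule less_imp_neq)
  qed
  then have lim: "AE \<omega> in P. (\<lambda>n. t n \<omega>) \<longlonglongrightarrow> X \<omega>"
  proof (rule AE_mp, intro AE_I2 impI)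
    fix \<omega> assume "(\<Sum>n. ennreal (norm (X \<omega> - t n \<omega>))) \<noteq> \<infinity>"
    then have "summable (\<lambda>n. norm (X \<omega> - t n \<omega>))" by (intro summable_suminf_not_top) auto
    then have "(\<lambda>n. norm (X \<omega> - t n \<omega>)) \<longlonglongrightarrow> 0" by (rule summable_LIMSEQ_zero)
    then have "(\<lambda>n. X \<omega> - t n \<omega>) \<longlonglongrightarrow> 0" by (rule tendsto_norm_zero_cancel)
    from tendsto_diff[OF tendsto_const[of "X \<omega>"] this] show "(\<lambda>n. t n \<omega>) \<longlonglongrightarrow> X \<omega>" by simp
  qed
  \<comment> \<open>The convergence set in the form of the Cauchy criterion: only countable
    quantifiers over norms of differences of simple functions, hence a set of F.\<close>
  define G where "G = {\<omega> \<in> space F. \<forall>m. \<exists>N. \<forall>i. \<forall>j. N \<le> i \<longrightarrow> N \<le> j \<longrightarrow> norm (t i \<omega> - t j \<omega>) < inverse (real (Suc m))}"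
  have "(\<lambda>\<omega>. norm (t i \<omega> - t j \<omega>)) \<in> borel_measurable F" for i j
    using measurable_norm_diff_simple[OF borel_measurable_simple_function[OF tF] tF] .
  note [measurable] = this
  have G: "G \<in> sets F" unfolding G_def by measurable
  have G_iff: "\<omega> \<in> G \<longleftrightarrow> convergent (\<lambda>n. t n \<omega>)" if "\<omega> \<in> space F" for \<omega>
  proof -
    have "\<omega> \<in> G \<longleftrightarrow> Cauchy (\<lambda>n. t n \<omega>)"
    proof
      assume "\<omega> \<in> G"
      show "Cauchy (\<lambda>n. t n \<omega>)"
      proof (rule CauchyI)
        fix e :: real assume "0 < e"
        then obtain m where "inverse (real (Suc m)) < e" using reals_Archimedean by blast
        moreover obtain N where "\<forall>i. \<forall>j. N \<le> i \<longrightarrow> N \<le> j \<longrightarrow> norm (t i \<omega> - t j \<omega>) < inverse (real (Suc m))"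
          using \<open>\<omega> \<in> G\<close> unfolding G_def by blast
        ultimately show "\<exists>M. \<forall>m\<ge>M. \<forall>n\<ge>M. norm (t m \<omega> - t n \<omega>) < e" by (meson less_trans)
      qed
    next
      assume "Cauchy (\<lambda>n. t n \<omega>)"
      then have "\<exists>N. \<forall>i. \<forall>j. N \<le> i \<longrightarrow> N \<le> j \<longrightarrow> norm (t i \<omega> - t j \<omega>) < inverse (real (Suc m))" for m
        using CauchyD[of "\<lambda>n. t n \<omega>" "inverse (real (Suc m))"] by simp
      then show "\<omega> \<in> G" using that unfolding G_def by blast
    qed
    then show ?thesis by (simp add: Cauchy_convergent_iff)
  qed
  define X' where "X' \<omega> = (if \<omega> \<in> G then lim (\<lambda>n. t n \<omega>) else 0)" for \<omega>
  show ?thesis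
  proof (rule that)
    show "strongly_measurable F X'"
      unfolding strongly_measurable_def
    proof (intro exI conjI allI ballI)
      show "simple_function F (\<lambda>\<omega>. indicator G \<omega> *\<^sub>R t i \<omega>)" for i
        by (rule simple_function_indicator_scaleR[OF tF G])
      show "(\<lambda>i. indicator G \<omega> *\<^sub>R t i \<omega>) \<longlonglongrightarrow> X' \<omega>" if "\<omega> \<in> space F" for \<omega>
        using G_iff[OF that] by (auto simp: X'_def convergent_LIMSEQ_iff)
    qed
    show AE: "AE \<omega> in P. X' \<omega> = X \<omega>"
      using lim
    proof (rule AE_mp, intro AE_I2 impI)
      fix \<omega> assume \<omega>: "\<omega> \<in> space P" "(\<lambda>n. t n \<omega>) \<longlonglongrightarrow> X \<omega>"
      then have "\<omega> \<in> G" using G_iff[of \<omega>] by (auto simp: spF convergent_def)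
      then show "X' \<omega> = X \<omega>" using limI[OF \<omega>(2)] by (simp add: X'_def)
    qed
    fix e :: real assume "0 < e"
    then obtain i where i: "(\<integral>\<^sup>+\<omega>. norm (X \<omega> - s i \<omega>) \<partial>P) < ennreal e"
      using order_tendstoD(2)[OF s(2), of "ennreal e"] unfolding eqP by (auto simp: eventually_sequentially)
    have "(\<integral>\<^sup>+\<omega>. norm (X' \<omega> - s i \<omega>) \<partial>P) = (\<integral>\<^sup>+\<omega>. norm (X \<omega> - s i \<omega>) \<partial>P)"
      by (rule nn_integral_cong_AE) (use AE in auto)
    with i sF show "\<exists>S. simple_function F S \<and> (\<integral>\<^sup>+\<omega>. norm (X' \<omega> - S \<omega>) \<partial>P) \<le> ennreal e"
      by (intro exI[of _ "s i"]) auto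
  qed
qed

section \<open>Martingales in the Lipschitz-free space\<close>

text \<open>Doob's inequality by induction on the time: the event splits according to whether level
  a was passed before. The submartingale property enters only as monotonicity of integrals over past
  events, so w may be any \<open>ennreal\<close>-valued process.\<close>

lemma (in prob_space) maximal_inequality:
  fixes w :: "nat \<Rightarrow> 'a \<Rightarrow> ennreal"
  assumes sub: "\<And>n. subalgebra M (F n)" and mono: "\<And>m n. m \<le> n \<Longrightarrow> sets (F m) \<subseteq> sets (F n)"
    and w: "\<And>n. w n \<in> borel_measurable (F n)"
    and le: "\<And>n A. A \<in> sets (F n) \<Longrightarrow> (\<integral>\<^sup>+\<omega>. indicator A \<omega> * w n \<omega> \<partial>M) \<le> (\<integral>\<^sup>+\<omega>. indicator A \<omega> * w (Suc n) \<omega> \<partial>M)"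
  shows "a * emeasure M {\<omega>\<in>space M. \<exists>i\<le>n. a < w i \<omega>} \<le> (\<integral>\<^sup>+\<omega>. w n \<omega> \<partial>M)"
proof -
  define B where "B n = {\<omega>\<in>space M. \<exists>i\<le>n. a < w i \<omega>}" for n
  have sp: "space (F n) = space M" for n using sub[of n] by (simp add: subalgebra_def)
  have single: "{\<omega>\<in>space M. a < w n \<omega>} \<in> sets (F n)" for n
    using borel_measurable_less[OF borel_measurable_const w[of n], of a] by (simp add: sp)
  have B0: "B 0 = {\<omega>\<in>space M. a < w 0 \<omega>}" by (simp add: B_def)
  have BS: "B (Suc n) = B n \<union> ({\<omega>\<in>space M. a < w (Suc n) \<omega>} - B n)" for n by (auto simp: B_def le_Suc_eq)
  have BF: "B n \<in> sets (F n)" for n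
  proof (induction n)
    case (Suc n)
    then have "B n \<in> sets (F (Suc n))" using mono[of n "Suc n"] by auto
    then show ?case unfolding BS using single[of "Suc n"] by blast
  qed (simp add: B0 single)
  have inM: "A \<in> sets M" if "A \<in> sets (F n)" for A n using that sub[of n] by (auto simp: subalgebra_def)
  have wM: "w n \<in> borel_measurable M" for n by (rule measurable_from_subalg[OF sub w])
  have Markov: "a * emeasure M A \<le> (\<integral>\<^sup>+\<omega>. indicator A \<omega> * w n \<omega> \<partial>M)"
    if "A \<in> sets M" "\<And>\<omega>. \<omega> \<in> A \<Longrightarrow> a < w n \<omega>" for A n
  proof -
    have "a * emeasure M A = (\<integral>\<^sup>+\<omega>. a * indicator A \<omega> \<partial>M)" using that by (simp add: nn_integral_cmult_indicator)
    also have "\<dots> \<le> (\<integral>\<^sup>+\<omega>. indicator A \<omega> * w n \<omega> \<partial>M)"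
      by (intro nn_integral_mono) (use that(2) in \<open>auto simp: indicator_def less_imp_le\<close>)
    finally show ?thesis .
  qed
  have "a * emeasure M (B n) \<le> (\<integral>\<^sup>+\<omega>. indicator (B n) \<omega> * w n \<omega> \<partial>M)"
  proof (induction n)
    case 0
    show ?case by (rule Markov[OF inM[OF BF]]) (simp add: B0)
  next
    case (Suc n)
    let ?C = "{\<omega>\<in>space M. a < w (Suc n) \<omega>} - B n"
    have C: "?C \<in> sets M" using inM[OF single[of "Suc n"]] inM[OF BF[of n]] by auto
    have "a * emeasure M (B (Suc n)) = a * emeasure M (B n) + a * emeasure M ?C"
      unfolding BS using inM[OF BF[of n]] C by (subst plus_emeasure[symmetric]) (auto simp: distrib_left)
    also have "\<dots> \<le> (\<integral>\<^sup>+\<omega>. indicator (B n) \<omega> * w (Suc n) \<omega> \<partial>M) + (\<integral>\<^sup>+\<omega>. indicator ?C \<omega> * w (Suc n) \<omega> \<partial>M)"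
      by (intro add_mono order_trans[OF Suc.IH le[OF BF]] Markov C) auto
    also have "\<dots> = (\<integral>\<^sup>+\<omega>. indicator (B n) \<omega> * w (Suc n) \<omega> + indicator ?C \<omega> * w (Suc n) \<omega> \<partial>M)"
      using inM[OF BF[of n]] C wM by (subst nn_integral_add) auto
    also have "\<dots> = (\<integral>\<^sup>+\<omega>. indicator (B (Suc n)) \<omega> * w (Suc n) \<omega> \<partial>M)"
      unfolding BS by (intro nn_integral_cong) (auto simp: indicator_def)
    finally show ?case .
  qed
  also have "\<dots> \<le> (\<integral>\<^sup>+\<omega>. w n \<omega> \<partial>M)" by (intro nn_integral_mono) (auto simp: indicator_def)
  finally show ?thesis by (simp add: B_def)
qed

lemma simple_function_norm_finite:
  fixes S :: "'p \<Rightarrow> 'x::real_normed_vector"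
  assumes "prob_space P" and S: "simple_function P S"
  shows "(\<integral>\<^sup>+\<omega>. norm (S \<omega>) \<partial>P) < \<infinity>"
proof -
  interpret prob_space P by fact
  have fin: "finite (S ` space P)" using S by (rule simple_functionD)
  have "norm (S \<omega>) \<le> (\<Sum>v\<in>S ` space P. norm v)" if "\<omega> \<in> space P" for \<omega>
    using that by (intro member_le_sum fin) auto
  then have "(\<integral>\<^sup>+\<omega>. norm (S \<omega>) \<partial>P) \<le> (\<integral>\<^sup>+\<omega>. ennreal (\<Sum>v\<in>S ` space P. norm v) \<partial>P)"
    by (intro nn_integral_mono ennreal_leI)
  also have "\<dots> < \<infinity>" by (simp add: emeasure_space_1)
  finally show ?thesis .
qed

text \<open>The martingale property is required only after applying functionals. The seminorms
  \<open>sem\<close> are suprema of functionals, so real conditional expectations suffice and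
  vector-valued ones are never formed.\<close>

locale strong_martingale = prob_space P for P :: "'p measure" +
  fixes F :: "nat \<Rightarrow> 'p measure" and X :: "nat \<Rightarrow> 'p \<Rightarrow> 'm::{complete_space, zero} lip_free"
  assumes sub: "\<And>n. subalgebra P (F n)" and mono: "\<And>m n. m \<le> n \<Longrightarrow> sets (F m) \<subseteq> sets (F n)"
    and strong: "\<And>n. strongly_measurable (F n) (X n)"
    and simple_approx: "\<And>n e. 0 < e \<Longrightarrow> \<exists>S. simple_function (F n) S \<and> (\<integral>\<^sup>+\<omega>. norm (X n \<omega> - S \<omega>) \<partial>P) \<le> ennreal e"
    and mart: "\<And>m n A (\<phi> :: 'm lip_free \<Rightarrow>\<^sub>L real). m \<le> n \<Longrightarrow> A \<in> sets (F m) \<Longrightarrow>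
      (\<integral>\<omega>. indicator A \<omega> * blinfun_apply \<phi> (X m \<omega>) \<partial>P) = (\<integral>\<omega>. indicator A \<omega> * blinfun_apply \<phi> (X n \<omega>) \<partial>P)"
begin

lemma space_F: "space (F n) = space P"
  using sub[of n] by (simp add: subalgebra_def)

lemma sets_F: "A \<in> sets (F n) \<Longrightarrow> A \<in> sets P"
  using sub[of n] by (auto simp: subalgebra_def)

lemma strong_P: "strongly_measurable P (X n)"
  by (rule strongly_measurable_subalgebra[OF sub strong])

lemma X_borel: "X n \<in> borel_measurable P"
  by (rule strongly_measurable_borel[OF strong_P])

lemma X_borel_F: "X n \<in> borel_measurable (F n)"
  by (rule strongly_measurable_borel[OF strong])

lemma norm_borel: "(\<lambda>\<omega>. norm (X n \<omega>)) \<in> borel_measurable P"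
  by (rule measurable_compose[OF X_borel]) (intro borel_measurable_continuous_onI continuous_intros)

lemma functional_borel: "(\<lambda>\<omega>. blinfun_apply \<phi> (X n \<omega>)) \<in> borel_measurable P"
  by (rule measurable_compose[OF X_borel]) (intro borel_measurable_continuous_onI continuous_intros)

lemma functional_borel_F: "(\<lambda>\<omega>. blinfun_apply \<phi> (X n \<omega>)) \<in> borel_measurable (F n)"
  by (rule measurable_compose[OF X_borel_F]) (intro borel_measurable_continuous_onI continuous_intros)

lemma sem_borel: "(\<lambda>\<omega>. sem \<Phi> (X n \<omega>)) \<in> borel_measurable P"
  by (rule measurable_compose[OF X_borel borel_measurable_sem])

lemma norm_finite: "(\<integral>\<^sup>+\<omega>. norm (X n \<omega>) \<partial>P) < \<infinity>"
proof -
  obtain S where S: "simple_function (F n) S" "(\<integral>\<^sup>+\<omega>. norm (X n \<omega> - S \<omega>) \<partial>P) \<le> ennreal 1"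
    using simple_approx[of 1 n] by auto
  have SP: "simple_function P S" by (rule simple_function_subalgebra[OF sub S(1)])
  have "(\<integral>\<^sup>+\<omega>. norm (X n \<omega>) \<partial>P) \<le> (\<integral>\<^sup>+\<omega>. ennreal (norm (X n \<omega> - S \<omega>)) + ennreal (norm (S \<omega>)) \<partial>P)"
  proof (rule nn_integral_mono)
    fix \<omega>
    have "norm (X n \<omega>) \<le> norm (X n \<omega> - S \<omega>) + norm (S \<omega>)" using norm_triangle_ineq[of "X n \<omega> - S \<omega>" "S \<omega>"] by simp
    then show "ennreal (norm (X n \<omega>)) \<le> ennreal (norm (X n \<omega> - S \<omega>)) + ennreal (norm (S \<omega>))"
      by (simp flip: ennreal_plus)
  qed
  also have "\<dots> = (\<integral>\<^sup>+\<omega>. norm (X n \<omega> - S \<omega>) \<partial>P) + (\<integral>\<^sup>+\<omega>. norm (S \<omega>) \<partial>P)"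
    using measurable_norm_diff_simple[OF X_borel SP] measurable_norm_diff_simple[OF borel_measurable_simple_function[OF SP] simple_function_const[of P 0]]
    by (intro nn_integral_add) auto
  also have "\<dots> < \<infinity>"
    using le_less_trans[OF S(2)] simple_function_norm_finite[OF prob_space_axioms SP] by (simp add: ennreal_add_less_top)
  finally show ?thesis .
qed

lemma functional_integrable:
  fixes \<phi> :: "'m lip_free \<Rightarrow>\<^sub>L real"
  shows "integrable P (\<lambda>\<omega>. blinfun_apply \<phi> (X n \<omega>))"
proof (rule integrableI_bounded)
  show "(\<lambda>\<omega>. blinfun_apply \<phi> (X n \<omega>)) \<in> borel_measurable P" by (rule functional_borel)
  have "(\<integral>\<^sup>+\<omega>. norm (blinfun_apply \<phi> (X n \<omega>)) \<partial>P) \<le> (\<integral>\<^sup>+\<omega>. ennreal (norm \<phi>) * ennreal (norm (X n \<omega>)) \<partial>P)"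
    using norm_blinfun[of \<phi>] by (intro nn_integral_mono) (simp add: ennreal_mult[symmetric] ennreal_leI)
  also have "\<dots> = ennreal (norm \<phi>) * (\<integral>\<^sup>+\<omega>. norm (X n \<omega>) \<partial>P)"
    using norm_borel[of n] by (intro nn_integral_cmult) simp
  also have "\<dots> < \<infinity>" using norm_finite[of n] by (simp add: ennreal_mult_less_top)
  finally show "(\<integral>\<^sup>+\<omega>. norm (blinfun_apply \<phi> (X n \<omega>)) \<partial>P) < \<infinity>" .
qed

lemma cond_exp:
  assumes "m \<le> n"
  shows "AE \<omega> in P. real_cond_exp P (F m) (\<lambda>\<omega>. blinfun_apply \<phi> (X n \<omega>)) \<omega> = blinfun_apply \<phi> (X m \<omega>)"
proof -
  interpret fs: finite_measure_subalgebra P "F m" by unfold_locales (rule sub)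
  show ?thesis
    by (rule fs.real_cond_exp_charact)
      (use mart[OF assms] in \<open>auto simp: set_lebesgue_integral_def functional_integrable functional_borel_F\<close>)
qed

text \<open>Conditional Jensen inequality for a supremum of functionals. Each single functional is
  dominated almost everywhere, but the null set depends on it; approximating X m by a simple
  function reduces the class to finitely many functionals.\<close>

lemma sem_submartingale:
  assumes \<Phi>: "\<And>\<phi>. \<phi> \<in> \<Phi> \<Longrightarrow> norm \<phi> \<le> C" and mn: "m \<le> n" and A: "A \<in> sets (F m)"
  shows "(\<integral>\<^sup>+\<omega>. indicator A \<omega> * sem \<Phi> (X m \<omega>) \<partial>P) \<le> (\<integral>\<^sup>+\<omega>. indicator A \<omega> * sem \<Phi> (X n \<omega>) \<partial>P)"
proof (cases "\<Phi> = {}")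
  case True
  then show ?thesis by (simp add: sem_def)
next
  case False
  then obtain \<phi>0 where "\<phi>0 \<in> \<Phi>" by blast
  then have C: "0 \<le> C" using \<Phi>[of \<phi>0] norm_ge_zero[of \<phi>0] by linarith
  interpret fs: finite_measure_subalgebra P "F m" by unfold_locales (rule sub)
  define g where "g \<omega> = enn2real (sem \<Phi> (X n \<omega>))" for \<omega>
  have g: "ennreal (g \<omega>) = sem \<Phi> (X n \<omega>)" "0 \<le> g \<omega>" "g \<omega> \<le> C * norm (X n \<omega>)" for \<omega>
  proof -
    have le: "sem \<Phi> (X n \<omega>) \<le> ennreal (C * norm (X n \<omega>))" by (rule sem_le_norm[OF \<Phi>])
    then have "sem \<Phi> (X n \<omega>) < top" by (rule le_less_trans) simp
    then show e: "ennreal (g \<omega>) = sem \<Phi> (X n \<omega>)" by (simp add: g_def)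
    show "0 \<le> g \<omega>" by (simp add: g_def)
    show "g \<omega> \<le> C * norm (X n \<omega>)" using le C unfolding e[symmetric] by (subst (asm) ennreal_le_iff) auto
  qed
  have gm: "g \<in> borel_measurable P" unfolding g_def by (intro borel_measurable_enn2real sem_borel)
  have gi: "integrable P g"
  proof (rule Bochner_Integration.integrable_bound[OF _ gm])
    show "integrable P (\<lambda>\<omega>. C * norm (X n \<omega>))"
      using norm_finite[of n] norm_borel[of n] by (intro integrable_mult_right integrableI_bounded) auto
  qed (use g C in auto)
  define E where "E = real_cond_exp P (F m) g"
  have EAE: "AE \<omega> in P. \<bar>blinfun_apply \<phi> (X m \<omega>)\<bar> \<le> E \<omega>" if "\<phi> \<in> \<Phi>" for \<phi>
  proof -
    have le: "\<bar>blinfun_apply \<phi> (X n \<omega>)\<bar> \<le> g \<omega>" for \<omega>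
      using sem_upper[OF that, of "X n \<omega>"] g(2)[of \<omega>] unfolding g(1)[symmetric] by (subst (asm) ennreal_le_iff) auto
    have "AE \<omega> in P. real_cond_exp P (F m) (\<lambda>\<omega>. blinfun_apply \<psi> (X n \<omega>)) \<omega> \<le> E \<omega>" if "\<psi> \<in> {\<phi>, - \<phi>}" for \<psi>
      unfolding E_def using that le
      by (intro fs.real_cond_exp_mono functional_integrable gi AE_I2) (auto simp: blinfun.minus_left abs_le_iff)
    from this[of \<phi>] this[of "- \<phi>"] cond_exp[OF mn, of \<phi>] cond_exp[OF mn, of "- \<phi>"]
    show ?thesis by (auto simp: blinfun.minus_left)
  qed
  have EP: "AE \<omega> in P. 0 \<le> E \<omega>" using EAE[OF \<open>\<phi>0 \<in> \<Phi>\<close>] by eventually_elim auto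
  have EB: "E \<in> borel_measurable P" "integrable P E" unfolding E_def using gi by (auto intro: fs.real_cond_exp_int)
  have int_ind: "integrable P (\<lambda>\<omega>. indicator A \<omega> * h \<omega>)" if "integrable P h" for h :: "'p \<Rightarrow> real"
    using integrable_mult_indicator[OF sets_F[OF A] that] by simp
  have EA: "(\<integral>\<^sup>+\<omega>. indicator A \<omega> * ennreal (E \<omega>) \<partial>P) = (\<integral>\<^sup>+\<omega>. indicator A \<omega> * sem \<Phi> (X n \<omega>) \<partial>P)"
  proof -
    have "(\<integral>\<^sup>+\<omega>. indicator A \<omega> * ennreal (E \<omega>) \<partial>P) = (\<integral>\<^sup>+\<omega>. ennreal (indicator A \<omega> * E \<omega>) \<partial>P)"
      by (intro nn_integral_cong) (auto simp: indicator_def)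
    also have "\<dots> = ennreal (\<integral>\<omega>. indicator A \<omega> * E \<omega> \<partial>P)"
      using EP EB sets_F[OF A] by (intro nn_integral_eq_integral int_ind) (auto elim!: eventually_mono)
    also have "(\<integral>\<omega>. indicator A \<omega> * E \<omega> \<partial>P) = (\<integral>\<omega>. indicator A \<omega> * g \<omega> \<partial>P)"
      using fs.real_cond_exp_intA[OF gi A] by (simp add: E_def set_lebesgue_integral_def)
    also have "ennreal \<dots> = (\<integral>\<^sup>+\<omega>. ennreal (indicator A \<omega> * g \<omega>) \<partial>P)"
      using g gi sets_F[OF A] by (intro nn_integral_eq_integral[symmetric] int_ind) auto
    also have "\<dots> = (\<integral>\<^sup>+\<omega>. indicator A \<omega> * sem \<Phi> (X n \<omega>) \<partial>P)"
      by (intro nn_integral_cong) (auto simp: indicator_def g(1))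
    finally show ?thesis .
  qed
  show ?thesis
  proof (rule ennreal_le_epsilon)
    fix e :: real assume e: "0 < e"
    \<comment> \<open>The error of the simple approximation enters twice with factor C, once for the
      value and once for the near-maximising functional; the slack of the latter adds one more
      d.\<close>
    define d where "d = e / (2 * C + 1)"
    have d: "0 < d" "(2 * C + 1) * d = e" using e C by (auto simp: d_def)
    obtain S where S: "simple_function (F m) S" "(\<integral>\<^sup>+\<omega>. norm (X m \<omega> - S \<omega>) \<partial>P) \<le> ennreal d"
      using simple_approx[OF d(1)] by blast
    have SP: "simple_function P S" by (rule simple_function_subalgebra[OF sub S(1)])
    have "\<exists>\<phi>\<in>\<Phi>. sem \<Phi> v \<le> ennreal (\<bar>blinfun_apply \<phi> v\<bar> + d)" for v
      using sem_almost_attained[OF False \<Phi> d(1), of v] by blast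
    then obtain \<phi> where \<phi>: "\<And>v. \<phi> v \<in> \<Phi>" "\<And>v. sem \<Phi> v \<le> ennreal (\<bar>blinfun_apply (\<phi> v) v\<bar> + d)" by metis
    have "AE \<omega> in P. \<forall>v\<in>S ` space P. \<bar>blinfun_apply (\<phi> v) (X m \<omega>)\<bar> \<le> E \<omega>"
      by (rule AE_finite_allI[OF simple_functionD(1)[OF SP]]) (intro EAE \<phi>)
    then have AE: "AE \<omega> in P. indicator A \<omega> * sem \<Phi> (X m \<omega>) \<le>
        indicator A \<omega> * ennreal (E \<omega>) + (ennreal (2 * C) * ennreal (norm (X m \<omega> - S \<omega>)) + ennreal d)"
    proof (rule AE_mp, intro AE_I2 impI)
      fix \<omega> assume \<omega>: "\<omega> \<in> space P" "\<forall>v\<in>S ` space P. \<bar>blinfun_apply (\<phi> v) (X m \<omega>)\<bar> \<le> E \<omega>"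
      let ?v = "S \<omega>" and ?x = "X m \<omega>"
      have E\<omega>: "\<bar>blinfun_apply (\<phi> ?v) ?x\<bar> \<le> E \<omega>" using \<omega> by blast
      have "\<bar>blinfun_apply (\<phi> ?v) (?x - ?v)\<bar> \<le> C * norm (?x - ?v)"
        using norm_blinfun[of "\<phi> ?v" "?x - ?v"] mult_right_mono[OF \<Phi>[OF \<phi>(1)[of ?v]] norm_ge_zero[of "?x - ?v"]] by simp
      then have v: "\<bar>blinfun_apply (\<phi> ?v) ?v\<bar> \<le> E \<omega> + C * norm (?x - ?v)"
        using E\<omega> by (simp add: blinfun.diff_right)
      have "sem \<Phi> ?x \<le> sem \<Phi> ?v + sem \<Phi> (?x - ?v)" using sem_add_le[of \<Phi> ?v "?x - ?v"] by simp
      also have "\<dots> \<le> ennreal (\<bar>blinfun_apply (\<phi> ?v) ?v\<bar> + d) + ennreal (C * norm (?x - ?v))"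
        by (intro add_mono \<phi> sem_le_norm[OF \<Phi>])
      also have "\<dots> \<le> ennreal (E \<omega> + (2 * C * norm (?x - ?v) + d))"
      proof (subst ennreal_plus[symmetric])
        show "ennreal (\<bar>blinfun_apply (\<phi> ?v) ?v\<bar> + d + C * norm (?x - ?v)) \<le> ennreal (E \<omega> + (2 * C * norm (?x - ?v) + d))"
          by (rule ennreal_leI) (use v in linarith)
      qed (use C d in auto)
      also have "\<dots> = ennreal (E \<omega>) + (ennreal (2 * C) * ennreal (norm (?x - ?v)) + ennreal d)"
      proof -
        have "ennreal (2 * C) * ennreal (norm (?x - ?v)) = ennreal (2 * C * norm (?x - ?v))"
          by (rule ennreal_mult[symmetric]) (use C in auto)
        moreover have "ennreal (2 * C * norm (?x - ?v)) + ennreal d = ennreal (2 * C * norm (?x - ?v) + d)"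
          by (rule ennreal_plus[symmetric]) (use C d in auto)
        moreover have "ennreal (E \<omega>) + ennreal (2 * C * norm (?x - ?v) + d) = ennreal (E \<omega> + (2 * C * norm (?x - ?v) + d))"
          by (rule ennreal_plus[symmetric]) (use C d E\<omega> in auto)
        ultimately show ?thesis by (simp only:)
      qed
      finally show "indicator A \<omega> * sem \<Phi> ?x \<le>
          indicator A \<omega> * ennreal (E \<omega>) + (ennreal (2 * C) * ennreal (norm (?x - ?v)) + ennreal d)"
        by (auto simp: indicator_def)
    qed
    have m1: "(\<lambda>\<omega>. indicator A \<omega> * ennreal (E \<omega>)) \<in> borel_measurable P" using EB sets_F[OF A] by measurable
    have m2: "(\<lambda>\<omega>. ennreal (norm (X m \<omega> - S \<omega>))) \<in> borel_measurable P"
      using measurable_norm_diff_simple[OF X_borel SP] by simp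
    have "(\<integral>\<^sup>+\<omega>. indicator A \<omega> * sem \<Phi> (X m \<omega>) \<partial>P) \<le>
        (\<integral>\<^sup>+\<omega>. indicator A \<omega> * ennreal (E \<omega>) + (ennreal (2 * C) * ennreal (norm (X m \<omega> - S \<omega>)) + ennreal d) \<partial>P)"
      by (rule nn_integral_mono_AE[OF AE])
    also have "\<dots> = (\<integral>\<^sup>+\<omega>. indicator A \<omega> * sem \<Phi> (X n \<omega>) \<partial>P) +
        (ennreal (2 * C) * (\<integral>\<^sup>+\<omega>. norm (X m \<omega> - S \<omega>) \<partial>P) + ennreal d)"
      using m1 m2 by (simp add: nn_integral_add nn_integral_cmult EA emeasure_space_1)
    also have "\<dots> \<le> (\<integral>\<^sup>+\<omega>. indicator A \<omega> * sem \<Phi> (X n \<omega>) \<partial>P) + ennreal e"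
    proof (rule add_left_mono)
      have "ennreal (2 * C) * (\<integral>\<^sup>+\<omega>. norm (X m \<omega> - S \<omega>) \<partial>P) + ennreal d \<le> ennreal (2 * C) * ennreal d + ennreal d"
        by (intro add_mono mult_left_mono S(2)) auto
      also have "ennreal (2 * C) * ennreal d = ennreal (2 * C * d)" by (rule ennreal_mult[symmetric]) (use C d in auto)
      also have "ennreal (2 * C * d) + ennreal d = ennreal (2 * C * d + d)"
        by (rule ennreal_plus[symmetric]) (use C d in auto)
      also have "2 * C * d + d = e" using d(2) by (simp add: algebra_simps)
      finally show "ennreal (2 * C) * (\<integral>\<^sup>+\<omega>. norm (X m \<omega> - S \<omega>) \<partial>P) + ennreal d \<le> ennreal e" .
    qed
    finally show "(\<integral>\<^sup>+\<omega>. indicator A \<omega> * sem \<Phi> (X m \<omega>) \<partial>P) \<le>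
        (\<integral>\<^sup>+\<omega>. indicator A \<omega> * sem \<Phi> (X n \<omega>) \<partial>P) + ennreal e" .
  qed
qed

lemma sem_mean_mono:
  assumes "\<And>\<phi>. \<phi> \<in> \<Phi> \<Longrightarrow> norm \<phi> \<le> C" and "m \<le> n"
  shows "(\<integral>\<^sup>+\<omega>. sem \<Phi> (X m \<omega>) \<partial>P) \<le> (\<integral>\<^sup>+\<omega>. sem \<Phi> (X n \<omega>) \<partial>P)"
proof -
  have "space P \<in> sets (F m)" using sets.top[of "F m"] by (simp add: space_F)
  from sem_submartingale[OF assms this]
  have "(\<integral>\<^sup>+\<omega>. indicator (space P) \<omega> * sem \<Phi> (X m \<omega>) \<partial>P) \<le> (\<integral>\<^sup>+\<omega>. indicator (space P) \<omega> * sem \<Phi> (X n \<omega>) \<partial>P)" .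
  moreover have "(\<integral>\<^sup>+\<omega>. indicator (space P) \<omega> * h \<omega> \<partial>P) = (\<integral>\<^sup>+\<omega>. h \<omega> \<partial>P)" for h :: "'p \<Rightarrow> ennreal"
    by (intro nn_integral_cong) simp
  ultimately show ?thesis by simp
qed

lemma norm_submartingale:
  assumes "m \<le> n" "A \<in> sets (F m)"
  shows "(\<integral>\<^sup>+\<omega>. indicator A \<omega> * ennreal (norm (X m \<omega>)) \<partial>P) \<le> (\<integral>\<^sup>+\<omega>. indicator A \<omega> * ennreal (norm (X n \<omega>)) \<partial>P)"
  unfolding ennreal_norm_eq_lsem
  by (rule sem_submartingale[OF _ assms, where C = 1]) (auto simp: lip_vanish_def intro: norm_lip_functional_le)

lemma sem_maximal:
  assumes \<Phi>: "\<And>\<phi>. \<phi> \<in> \<Phi> \<Longrightarrow> norm \<phi> \<le> C" and B: "\<And>n. (\<integral>\<^sup>+\<omega>. sem \<Phi> (X n \<omega>) \<partial>P) \<le> B"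
  shows "a * emeasure P {\<omega>\<in>space P. \<exists>i. a < sem \<Phi> (X i \<omega>)} \<le> B"
proof -
  let ?A = "\<lambda>n. {\<omega>\<in>space P. \<exists>i\<le>n. a < sem \<Phi> (X i \<omega>)}"
  have semF: "(\<lambda>\<omega>. sem \<Phi> (X n \<omega>)) \<in> borel_measurable (F n)" for n
    by (rule measurable_compose[OF X_borel_F borel_measurable_sem])
  have le: "a * emeasure P (?A n) \<le> B" for n
    by (rule order_trans[OF maximal_inequality[OF sub mono semF] B]) (auto intro: sem_submartingale[OF \<Phi>])
  have [measurable]: "(\<lambda>\<omega>. sem \<Phi> (X n \<omega>)) \<in> borel_measurable P" for n by (rule sem_borel)
  have "{\<omega>\<in>space P. \<exists>i. a < sem \<Phi> (X i \<omega>)} = (\<Union>n. ?A n)" by auto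
  also have "emeasure P \<dots> = (SUP n. emeasure P (?A n))"
    by (intro SUP_emeasure_incseq[symmetric]) (auto simp: incseq_def intro: order_trans)
  finally have "a * emeasure P {\<omega>\<in>space P. \<exists>i. a < sem \<Phi> (X i \<omega>)} = (SUP n. a * emeasure P (?A n))"
    by (simp add: SUP_mult_left_ennreal)
  also have "\<dots> \<le> B" by (rule SUP_least) (rule le)
  finally show ?thesis .
qed

text \<open>Restarting at time N, so that the maximal inequality controls the oscillation after
  N.\<close>

lemma increments: "strong_martingale P (\<lambda>i. F (N + i)) (\<lambda>i \<omega>. X (N + i) \<omega> - X N \<omega>)"
proof
  fix i e assume "0 < (e :: real)"
  then have "0 < e / 2" by simp
  obtain S where S: "simple_function (F (N + i)) S" "(\<integral>\<^sup>+\<omega>. norm (X (N + i) \<omega> - S \<omega>) \<partial>P) \<le> ennreal (e / 2)"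
    using simple_approx[OF \<open>0 < e / 2\<close>, of "N + i"] by blast
  obtain T where T: "simple_function (F N) T" "(\<integral>\<^sup>+\<omega>. norm (X N \<omega> - T \<omega>) \<partial>P) \<le> ennreal (e / 2)"
    using simple_approx[OF \<open>0 < e / 2\<close>, of N] by blast
  have "subalgebra (F (N + i)) (F N)" using mono[of N "N + i"] by (auto simp: subalgebra_def space_F)
  then have T': "simple_function (F (N + i)) T" using T(1) by (rule simple_function_subalgebra)
  have m: "(\<lambda>\<omega>. ennreal (norm (X n \<omega> - U \<omega>))) \<in> borel_measurable P" if "simple_function (F k) U" for n k U
    using measurable_norm_diff_simple[OF X_borel simple_function_subalgebra[OF sub that]] by simp
  have "(\<integral>\<^sup>+\<omega>. norm (X (N + i) \<omega> - X N \<omega> - (S \<omega> - T \<omega>)) \<partial>P) \<le>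
      (\<integral>\<^sup>+\<omega>. ennreal (norm (X (N + i) \<omega> - S \<omega>)) + ennreal (norm (X N \<omega> - T \<omega>)) \<partial>P)"
  proof (rule nn_integral_mono)
    fix \<omega>
    have "norm (X (N + i) \<omega> - X N \<omega> - (S \<omega> - T \<omega>)) \<le> norm (X (N + i) \<omega> - S \<omega>) + norm (X N \<omega> - T \<omega>)"
      using norm_triangle_ineq4[of "X (N + i) \<omega> - S \<omega>" "X N \<omega> - T \<omega>"] by (simp add: algebra_simps)
    then show "ennreal (norm (X (N + i) \<omega> - X N \<omega> - (S \<omega> - T \<omega>))) \<le>
        ennreal (norm (X (N + i) \<omega> - S \<omega>)) + ennreal (norm (X N \<omega> - T \<omega>))" by (simp flip: ennreal_plus)
  qed
  also have "\<dots> \<le> ennreal (e / 2) + ennreal (e / 2)"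
    by (subst nn_integral_add[OF m[OF S(1)] m[OF T(1)]]) (intro add_mono S T)
  also have "\<dots> = ennreal e" using \<open>0 < e\<close> by (intro ennreal_half_add) simp
  finally show "\<exists>S. simple_function (F (N + i)) S \<and> (\<integral>\<^sup>+\<omega>. norm (X (N + i) \<omega> - X N \<omega> - S \<omega>) \<partial>P) \<le> ennreal e"
    using simple_function_compose2[OF S(1) T', of "(-)"] by (intro exI[of _ "\<lambda>\<omega>. S \<omega> - T \<omega>"]) auto
next
  fix m n A and \<phi> :: "'m lip_free \<Rightarrow>\<^sub>L real"
  assume mn: "m \<le> n" and A: "A \<in> sets (F (N + m))"
  have int: "integrable P (\<lambda>\<omega>. indicator A \<omega> * blinfun_apply \<phi> (X k \<omega>))" for k
    using integrable_mult_indicator[OF sets_F[OF A] functional_integrable[of \<phi> k]] by simp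
  show "(\<integral>\<omega>. indicator A \<omega> * blinfun_apply \<phi> (X (N + m) \<omega> - X N \<omega>) \<partial>P) =
      (\<integral>\<omega>. indicator A \<omega> * blinfun_apply \<phi> (X (N + n) \<omega> - X N \<omega>) \<partial>P)"
    using mart[of "N + m" "N + n" A \<phi>] mn A int
    by (simp add: blinfun.diff_right right_diff_distrib)
next
  fix n
  have "subalgebra (F (N + n)) (F N)" using mono[of N "N + n"] by (auto simp: subalgebra_def space_F)
  then show "strongly_measurable (F (N + n)) (\<lambda>\<omega>. X (N + n) \<omega> - X N \<omega>)"
    by (intro strongly_measurable_diff strong strongly_measurable_subalgebra[OF _ strong])
qed (use sub mono in auto)

end

section \<open>Convergence in mean of dominated martingales\<close>

lemma ennreal_bounded_sums_null:
  fixes a :: "nat \<Rightarrow> ennreal"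
  assumes le: "\<And>J. (\<Sum>j<J. a j) \<le> ennreal K"
  shows "a \<longlonglongrightarrow> 0"
proof -
  have "a j \<le> ennreal K" for j
    using order_trans[OF member_le_sum[of j "{..<Suc j}" a] le[of "Suc j"]] by simp
  then have eq: "a j = ennreal (enn2real (a j))" for j
    by (metis ennreal_enn2real ennreal_less_top le_less_trans)
  have "(\<Sum>j<J. enn2real (a j)) \<le> max K 0" for J
  proof -
    have "ennreal (\<Sum>j<J. enn2real (a j)) = (\<Sum>j<J. a j)"
      by (subst sum_ennreal[symmetric]) (auto simp: eq[symmetric])
    also have "\<dots> \<le> ennreal (max K 0)" by (rule order_trans[OF le]) (auto intro: ennreal_leI)
    finally show ?thesis by (subst (asm) ennreal_le_iff) auto
  qed
  then have "summable (\<lambda>j. enn2real (a j))" by (intro summableI_nonneg_bounded) auto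
  then have "(\<lambda>j. ennreal (enn2real (a j))) \<longlonglongrightarrow> ennreal 0" by (intro tendsto_ennrealI summable_LIMSEQ_zero)
  then show ?thesis by (simp flip: eq)
qed

text \<open>With A and B the two square roots, \<open>(A * B)^2 - (1 + a * b)^2\<close> equals the
  squared increment, and A times the convexity defect is \<open>A * B - (1 + a * b)\<close>. The
  factor (1 + Z)^3 bounds A A B.\<close>

lemma sqrt_convexity:
  fixes a b Z :: real
  assumes a: "\<bar>a\<bar> \<le> Z" and b: "\<bar>b\<bar> \<le> Z"
  shows "(b - a)\<^sup>2 \<le> 2 * (1 + Z) ^ 3 * (sqrt (1 + b\<^sup>2) - sqrt (1 + a\<^sup>2) - a / sqrt (1 + a\<^sup>2) * (b - a))"
proof -
  define A B q where "A = sqrt (1 + a\<^sup>2)" "B = sqrt (1 + b\<^sup>2)" "q = B - A - a / A * (b - a)"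
  have A2: "A * A = 1 + a\<^sup>2" and B2: "B * B = 1 + b\<^sup>2" by (simp_all add: A_B_q_def add_nonneg_nonneg)
  have pos: "1 \<le> A" "1 \<le> B" by (simp_all add: A_B_q_def)
  have le: "A \<le> 1 + Z" "B \<le> 1 + Z"
  proof -
    have "sqrt (1 + x\<^sup>2) \<le> 1 + Z" if "\<bar>x\<bar> \<le> Z" for x
    proof (rule real_le_lsqrt)
      have "x\<^sup>2 \<le> Z\<^sup>2" using that by (metis abs_ge_zero power2_abs power_mono)
      then show "1 + x\<^sup>2 \<le> (1 + Z)\<^sup>2" using that by (simp add: power2_sum)
    qed (use that in auto)
    then show "A \<le> 1 + Z" "B \<le> 1 + Z" using a b by (simp_all add: A_B_q_def)
  qed
  define d where "d = A * B - (1 + a * b)"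
  have qA: "q * A = d"
  proof -
    have "q * A = A * B - A * A - a * (b - a)" using pos by (simp add: A_B_q_def(3) left_diff_distrib)
    then show ?thesis unfolding A2 d_def by (simp add: power2_eq_square algebra_simps)
  qed
  have prod: "d * (A * B + (1 + a * b)) = (b - a)\<^sup>2"
  proof -
    have "d * (A * B + (1 + a * b)) = (A * A) * (B * B) - (1 + a * b)\<^sup>2"
      by (simp add: d_def power2_eq_square algebra_simps)
    also have "\<dots> = (b - a)\<^sup>2" unfolding A2 B2 by (simp add: power2_eq_square algebra_simps)
    finally show ?thesis .
  qed
  have AB: "(1 + a * b)\<^sup>2 \<le> (A * B)\<^sup>2"
  proof -
    have "(A * B)\<^sup>2 = (A * A) * (B * B)" by (simp add: power2_eq_square algebra_simps)
    also have "\<dots> = (1 + a * b)\<^sup>2 + (b - a)\<^sup>2" unfolding A2 B2 by (simp add: power2_eq_square algebra_simps)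
    finally show ?thesis by simp
  qed
  have AB0: "0 \<le> A * B" using pos by simp
  have d0: "0 \<le> d" using abs_le_square_iff[of "1 + a * b" "A * B"] AB AB0 by (simp add: d_def)
  have "(b - a)\<^sup>2 \<le> d * (2 * (A * B))"
    unfolding prod[symmetric] using d0 by (intro mult_left_mono) (auto simp: d_def)
  also have "\<dots> = 2 * (A * A * B) * q" by (simp add: qA[symmetric])
  also have "\<dots> \<le> 2 * ((1 + Z) * (1 + Z) * (1 + Z)) * q"
  proof -
    have "0 \<le> q" using d0 pos qA by (metis mult_le_0_iff not_le less_le_trans zero_less_one order.trans linorder_not_less mult_less_0_iff)
    then show ?thesis using le pos by (intro mult_right_mono mult_left_mono mult_mono) auto
  qed
  finally show ?thesis by (simp add: A_B_q_def power3_eq_cube)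
qed

text \<open>Strict convexity of \<open>sqrt (1 + y\<^sup>2)\<close> replaces the \<open>L\<^sup>2\<close> theory: its means along the
  martingale increase and are bounded, and the defect controls the squared increments.\<close>

lemma dominated_martingale_cauchy:
  fixes y :: "nat \<Rightarrow> 'p \<Rightarrow> real"
  assumes P: "prob_space P" and sub: "\<And>n. subalgebra P (F n)"
    and yF: "\<And>n. y n \<in> borel_measurable (F n)"
    and ce: "\<And>m n. m \<le> n \<Longrightarrow> AE \<omega> in P. real_cond_exp P (F m) (y n) \<omega> = y m \<omega>"
    and Z: "integrable P Z" and yZ: "\<And>n. AE \<omega> in P. \<bar>y n \<omega>\<bar> \<le> Z \<omega>"
    and e: "0 < e"
  shows "\<exists>N. \<forall>n\<ge>N. \<forall>m\<ge>n. (\<integral>\<omega>. \<bar>y m \<omega> - y n \<omega>\<bar> \<partial>P) \<le> e"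
proof -
  interpret prob_space P by fact
  have yP [measurable]: "y n \<in> borel_measurable P" for n by (rule measurable_from_subalg[OF sub yF])
  have ZP [measurable]: "Z \<in> borel_measurable P" using Z by auto
  have yint: "integrable P (y n)" for n
    by (rule Bochner_Integration.integrable_bound[OF Z]) (use yZ[of n] in \<open>auto elim!: eventually_mono\<close>)
  \<comment> \<open>h is the derivative of sqrt (1 + y^2) at y n. It is bounded by 1 and known at
    time n, hence orthogonal to later increments, so the mean of the defect q is the increase of the
    mean of s.\<close>
  define h where "h n \<omega> = y n \<omega> / sqrt (1 + (y n \<omega>)\<^sup>2)" for n \<omega>
  define s where "s n \<omega> = sqrt (1 + (y n \<omega>)\<^sup>2)" for n \<omega>
  define q where "q n m \<omega> = s m \<omega> - s n \<omega> - h n \<omega> * (y m \<omega> - y n \<omega>)" for n m \<omega>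
  have hF: "h n \<in> borel_measurable (F n)" for n unfolding h_def using yF[of n] by measurable
  have hP [measurable]: "h n \<in> borel_measurable P" for n by (rule measurable_from_subalg[OF sub hF])
  have h1: "\<bar>h n \<omega>\<bar> \<le> 1" for n \<omega>
  proof -
    have "\<bar>y n \<omega>\<bar> \<le> sqrt (1 + (y n \<omega>)\<^sup>2)" by (rule real_le_rsqrt) simp
    moreover have "0 < sqrt (1 + (y n \<omega>)\<^sup>2)" by (simp add: add_pos_nonneg)
    ultimately show ?thesis by (simp add: h_def abs_mult divide_le_eq)
  qed
  have s1: "\<bar>s n \<omega>\<bar> \<le> 1 + \<bar>y n \<omega>\<bar>" for n \<omega>
    using sqrt_add_le_add_sqrt[of 1 "(y n \<omega>)\<^sup>2"] by (simp add: s_def add_nonneg_nonneg)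
  have sP [measurable]: "s n \<in> borel_measurable P" for n unfolding s_def by measurable
  have sint: "integrable P (s n)" for n
    by (rule Bochner_Integration.integrable_bound[where f = "\<lambda>\<omega>. 1 + \<bar>y n \<omega>\<bar>"])
      (use s1 yint in \<open>auto intro!: AE_I2 simp: abs_of_nonneg add_nonneg_nonneg\<close>)
  have hy: "integrable P (\<lambda>\<omega>. h n \<omega> * y m \<omega>)" for n m
    by (rule Bochner_Integration.integrable_bound[OF yint[of m]])
      (use h1[of n] in \<open>auto intro!: AE_I2 mult_left_le_one_le simp: abs_mult\<close>)
  have heq: "(\<integral>\<omega>. h n \<omega> * y m \<omega> \<partial>P) = (\<integral>\<omega>. h n \<omega> * y n \<omega> \<partial>P)" if "n \<le> m" for n m
  proof -
    interpret fs: finite_measure_subalgebra P "F n" by unfold_locales (rule sub)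
    have "(\<integral>\<omega>. h n \<omega> * y m \<omega> \<partial>P) = (\<integral>\<omega>. h n \<omega> * real_cond_exp P (F n) (y m) \<omega> \<partial>P)"
      by (rule fs.real_cond_exp_intg(2)[symmetric]) (rule hy hF yP)+
    also have "\<dots> = (\<integral>\<omega>. h n \<omega> * y n \<omega> \<partial>P)"
      using ce[OF that] by (intro integral_cong_AE) (auto elim!: eventually_mono)
    finally show ?thesis .
  qed
  have qint: "integrable P (q n m)" for n m
    unfolding q_def right_diff_distrib by (intro Bochner_Integration.integrable_diff sint hy)
  have qval: "(\<integral>\<omega>. q n m \<omega> \<partial>P) = (\<integral>\<omega>. s m \<omega> \<partial>P) - (\<integral>\<omega>. s n \<omega> \<partial>P)" if "n \<le> m" for n m
    unfolding q_def right_diff_distrib using heq[OF that] sint hy by simp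
  have conv: "(y m \<omega> - y n \<omega>)\<^sup>2 \<le> 2 * (1 + Z \<omega>) ^ 3 * q n m \<omega>" if "\<bar>y m \<omega>\<bar> \<le> Z \<omega>" "\<bar>y n \<omega>\<bar> \<le> Z \<omega>" for n m \<omega>
    unfolding q_def s_def h_def by (rule sqrt_convexity) fact+
  have q0: "0 \<le> q n m \<omega>" if "\<bar>y m \<omega>\<bar> \<le> Z \<omega>" "\<bar>y n \<omega>\<bar> \<le> Z \<omega>" for n m \<omega>
  proof -
    have "0 < 2 * (1 + Z \<omega>) ^ 3" using that(1) by simp
    then show ?thesis using order_trans[OF zero_le_power2 conv[OF that]] by (simp add: zero_le_mult_iff)
  qed
  have AE2: "AE \<omega> in P. \<bar>y m \<omega>\<bar> \<le> Z \<omega> \<and> \<bar>y n \<omega>\<bar> \<le> Z \<omega>" for n m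
    using yZ[of n] yZ[of m] by eventually_elim simp
  define t where "t = e / 4"
  have t: "0 < t" using e by (simp add: t_def)
  \<comment> \<open>Beyond height R the dominating function has small integral; below R the constant
    in the convexity estimate is uniform.\<close>
  obtain R :: real where R: "0 \<le> R" "(\<integral>\<omega>. 2 * Z \<omega> * indicator {\<omega>. R < Z \<omega>} \<omega> \<partial>P) \<le> t"
  proof -
    have "(\<lambda>k. \<integral>\<omega>. 2 * Z \<omega> * indicator {\<omega>. real k < Z \<omega>} \<omega> \<partial>P) \<longlonglongrightarrow> (\<integral>\<omega>. 0 \<partial>P)"
    proof (rule integral_dominated_convergence[where w = "\<lambda>\<omega>. 2 * \<bar>Z \<omega>\<bar>"])
      show "AE \<omega> in P. (\<lambda>k. 2 * Z \<omega> * indicator {\<omega>. real k < Z \<omega>} \<omega>) \<longlonglongrightarrow> 0"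
      proof (rule AE_I2, rule tendsto_eventually)
        fix \<omega>
        obtain k0 :: nat where "Z \<omega> \<le> real k0" using real_arch_simple by blast
        then show "\<forall>\<^sub>F k in sequentially. 2 * Z \<omega> * indicator {\<omega>. real k < Z \<omega>} \<omega> = 0"
          by (intro eventually_sequentiallyI[of k0]) (auto simp: indicator_def)
      qed
      show "AE \<omega> in P. norm (2 * Z \<omega> * indicator {\<omega>. real k < Z \<omega>} \<omega>) \<le> 2 * \<bar>Z \<omega>\<bar>" for k
        by (intro AE_I2) (auto simp: indicator_def abs_mult)
    qed (use Z in auto)
    then have "\<forall>\<^sub>F k in sequentially. (\<integral>\<omega>. 2 * Z \<omega> * indicator {\<omega>. real k < Z \<omega>} \<omega> \<partial>P) < t"
      using t by (intro order_tendstoD(2)) auto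
    then obtain k where "(\<integral>\<omega>. 2 * Z \<omega> * indicator {\<omega>. real k < Z \<omega>} \<omega> \<partial>P) < t" by (auto simp: eventually_sequentially)
    then show ?thesis by (intro that[of "real k"]) auto
  qed
  \<comment> \<open>An increment larger than t is at most its square divided by t, and below height
    R that is at most \<open>D * q\<close>. Smaller increments are covered by the summand t.\<close>
  define D where "D = 2 * (1 + R) ^ 3 / t"
  have D: "0 < D" using R(1) t by (simp add: D_def)
  have Zi: "integrable P (\<lambda>\<omega>. 2 * Z \<omega> * indicator {\<omega>. R < Z \<omega>} \<omega>)"
    by (rule Bochner_Integration.integrable_bound[where f = "\<lambda>\<omega>. 2 * Z \<omega>"]) (use Z in \<open>auto intro!: AE_I2 simp: indicator_def\<close>)
  have bound: "(\<integral>\<omega>. \<bar>y m \<omega> - y n \<omega>\<bar> \<partial>P) \<le> t + D * ((\<integral>\<omega>. s m \<omega> \<partial>P) - (\<integral>\<omega>. s n \<omega> \<partial>P)) + t" if "n \<le> m" for n m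
  proof -
    have "(\<integral>\<omega>. \<bar>y m \<omega> - y n \<omega>\<bar> \<partial>P) \<le> (\<integral>\<omega>. t + D * q n m \<omega> + 2 * Z \<omega> * indicator {\<omega>. R < Z \<omega>} \<omega> \<partial>P)"
    proof (rule integral_mono_AE)
      show "AE \<omega> in P. \<bar>y m \<omega> - y n \<omega>\<bar> \<le> t + D * q n m \<omega> + 2 * Z \<omega> * indicator {\<omega>. R < Z \<omega>} \<omega>"
        using AE2[of m n]
      proof eventually_elim
        fix \<omega> assume "\<bar>y m \<omega>\<bar> \<le> Z \<omega> \<and> \<bar>y n \<omega>\<bar> \<le> Z \<omega>"
        then have le: "\<bar>y m \<omega>\<bar> \<le> Z \<omega>" "\<bar>y n \<omega>\<bar> \<le> Z \<omega>" by auto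
        show "\<bar>y m \<omega> - y n \<omega>\<bar> \<le> t + D * q n m \<omega> + 2 * Z \<omega> * indicator {\<omega>. R < Z \<omega>} \<omega>"
        proof (cases "R < Z \<omega>")
          case True
          have "\<bar>y m \<omega> - y n \<omega>\<bar> \<le> 2 * Z \<omega>" using le by linarith
          moreover have "0 \<le> D * q n m \<omega>" using D q0[OF le] by simp
          ultimately show ?thesis using True t by (simp add: indicator_def)
        next
          case False
          let ?d = "\<bar>y m \<omega> - y n \<omega>\<bar>"
          have "?d * ?d = (y m \<omega> - y n \<omega>)\<^sup>2" by (simp add: power2_eq_square)
          also have "\<dots> \<le> 2 * (1 + Z \<omega>) ^ 3 * q n m \<omega>" by (rule conv[OF le])
          also have "\<dots> \<le> 2 * (1 + R) ^ 3 * q n m \<omega>"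
            using False le q0[OF le] by (intro mult_right_mono mult_left_mono power_mono) auto
          also have "\<dots> = t * (D * q n m \<omega>)" using t by (simp add: D_def)
          finally have dd: "?d * ?d \<le> t * (D * q n m \<omega>)" .
          have "?d \<le> t + D * q n m \<omega>"
          proof (cases "?d \<le> t")
            case True
            then show ?thesis using D q0[OF le] by (simp add: add_increasing2)
          next
            case False
            then have "t * ?d \<le> ?d * ?d" by (intro mult_right_mono) auto
            with dd have "t * ?d \<le> t * (D * q n m \<omega>)" by linarith
            then have "?d \<le> D * q n m \<omega>" using t by simp
            then show ?thesis using t by linarith
          qed
          then show ?thesis using False by (simp add: indicator_def)
        qed
      qed
    qed (use yint qint Zi in auto)
    also have "\<dots> = t + D * (\<integral>\<omega>. q n m \<omega> \<partial>P) + (\<integral>\<omega>. 2 * Z \<omega> * indicator {\<omega>. R < Z \<omega>} \<omega> \<partial>P)"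
    proof -
      have "integrable P (\<lambda>\<omega>. t + D * q n m \<omega>)" using qint by auto
      from Bochner_Integration.integral_add[OF this Zi] show ?thesis using qint by (simp add: prob_space)
    qed
    finally show ?thesis using R(2) qval[OF that] by simp
  qed
  define S where "S n = (\<integral>\<omega>. s n \<omega> \<partial>P)" for n
  have "incseq S"
  proof (rule incseq_SucI)
    fix n
    have "AE \<omega> in P. 0 \<le> q n (Suc n) \<omega>" using AE2[of "Suc n" n] by eventually_elim (auto intro: q0)
    then have "0 \<le> (\<integral>\<omega>. q n (Suc n) \<omega> \<partial>P)" by (rule integral_nonneg_AE)
    then show "S n \<le> S (Suc n)" using qval[of n "Suc n"] by (simp add: S_def)
  qed
  moreover have "S n \<le> 1 + (\<integral>\<omega>. Z \<omega> \<partial>P)" for n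
  proof -
    have "S n \<le> (\<integral>\<omega>. 1 + Z \<omega> \<partial>P)"
      unfolding S_def
    proof (rule integral_mono_AE)
      show "AE \<omega> in P. s n \<omega> \<le> 1 + Z \<omega>" using yZ[of n]
      proof eventually_elim
        fix \<omega> assume "\<bar>y n \<omega>\<bar> \<le> Z \<omega>"
        then show "s n \<omega> \<le> 1 + Z \<omega>" using s1[of n \<omega>] by linarith
      qed
    qed (use sint Z in auto)
    then show ?thesis using Z by (simp add: prob_space)
  qed
  ultimately obtain l where l: "S \<longlonglongrightarrow> l" "\<And>n. S n \<le> l"
    using incseq_convergent[of S "1 + (\<integral>\<omega>. Z \<omega> \<partial>P)"] by blast
  have "0 < t / D" using t D by simp
  then obtain N where N: "\<And>n. n \<ge> N \<Longrightarrow> \<bar>S n - l\<bar> < t / D"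
    using l(1) by (auto simp: lim_sequentially dist_real_def)
  show ?thesis
  proof (intro exI[of _ N] allI impI)
    fix n m assume n: "N \<le> n" "n \<le> m"
    have "S m - S n \<le> t / D" using N[OF n(1)] l(2)[of m] by linarith
    then have "D * (S m - S n) \<le> t" using D by (simp add: field_simps)
    then show "(\<integral>\<omega>. \<bar>y m \<omega> - y n \<omega>\<bar> \<partial>P) \<le> e" using bound[OF n(2)] e by (simp add: S_def t_def)
  qed
qed


context strong_martingale
begin

text \<open>Means of seminorms increase along the martingale, so the first J terms can all be moved
  to one late time N. There the wuc property bounds their sum by C times the mean norm,
  independently of J.\<close>

lemma wuc_lsem_null:
  assumes B: "\<And>n. (\<integral>\<^sup>+\<omega>. norm (X n \<omega>) \<partial>P) \<le> ennreal B" and w: "wuc C \<U>" and C: "0 \<le> C"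
  shows "(\<lambda>j. \<integral>\<^sup>+\<omega>. lsem (\<U> j) (X (r j) \<omega>) \<partial>P) \<longlonglongrightarrow> 0"
proof (rule ennreal_bounded_sums_null)
  fix J
  define N where "N = (\<Sum>j<J. r j)"
  have rN: "r j \<le> N" if "j < J" for j unfolding N_def by (rule member_le_sum) (use that in auto)
  have "(\<Sum>j<J. \<integral>\<^sup>+\<omega>. lsem (\<U> j) (X (r j) \<omega>) \<partial>P) \<le> (\<Sum>j<J. \<integral>\<^sup>+\<omega>. lsem (\<U> j) (X N \<omega>) \<partial>P)"
  proof (rule sum_mono)
    fix j assume j: "j \<in> {..<J}"
    have "norm \<phi> \<le> C" if "\<phi> \<in> lip_functional ` \<U> j" for \<phi>
      using that norm_lip_functional_le[OF wuc_lipschitz[OF w _ C]] by blast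
    then show "(\<integral>\<^sup>+\<omega>. lsem (\<U> j) (X (r j) \<omega>) \<partial>P) \<le> (\<integral>\<^sup>+\<omega>. lsem (\<U> j) (X N \<omega>) \<partial>P)"
      by (rule sem_mean_mono[where C = C]) (use rN j in auto)
  qed
  also have "\<dots> = (\<integral>\<^sup>+\<omega>. (\<Sum>j<J. lsem (\<U> j) (X N \<omega>)) \<partial>P)"
    by (rule nn_integral_sum[symmetric]) (rule sem_borel)
  also have "\<dots> \<le> (\<integral>\<^sup>+\<omega>. ennreal C * ennreal (norm (X N \<omega>)) \<partial>P)"
    using C by (intro nn_integral_mono order_trans[OF wuc_sum_lsem_le[OF w C]]) (simp add: ennreal_mult)
  also have "\<dots> = ennreal C * (\<integral>\<^sup>+\<omega>. norm (X N \<omega>) \<partial>P)"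
    using norm_borel[of N] by (intro nn_integral_cmult) simp
  also have "\<dots> \<le> ennreal C * ennreal (max B 0)"
    by (intro mult_left_mono order_trans[OF B]) (auto intro: ennreal_leI)
  also have "\<dots> = ennreal (C * max B 0)" by (rule ennreal_mult[symmetric]) (use C in auto)
  finally show "(\<Sum>j<J. \<integral>\<^sup>+\<omega>. lsem (\<U> j) (X (r j) \<omega>) \<partial>P) \<le> ennreal (C * max B 0)" .
qed

text \<open>A simple function takes finitely many values, each nearly carried by a finite set; the
  union of these sets serves X n.\<close>

lemma lsem_vanish_approx:
  assumes "0 < e"
  shows "\<exists>A. finite A \<and> 0 \<in> A \<and> (\<integral>\<^sup>+\<omega>. lsem (lip_vanish 1 A) (X n \<omega>) \<partial>P) \<le> ennreal e"
proof -
  have e2: "0 < e / 2" using assms by simp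
  obtain S where S: "simple_function (F n) S" "(\<integral>\<^sup>+\<omega>. norm (X n \<omega> - S \<omega>) \<partial>P) \<le> ennreal (e / 2)"
    using simple_approx[OF e2, of n] by blast
  have SP: "simple_function P S" by (rule simple_function_subalgebra[OF sub S(1)])
  have "\<exists>A. finite A \<and> 0 \<in> A \<and> lsem (lip_vanish 1 A) v \<le> ennreal (e / 2)" for v :: "'m lip_free"
    using lip_free_approx_finite[OF e2, of v] by blast
  then obtain A where A: "\<And>v :: 'm lip_free. finite (A v)" "\<And>v. 0 \<in> A v" "\<And>v. lsem (lip_vanish 1 (A v)) v \<le> ennreal (e / 2)"
    by metis
  let ?A = "insert 0 (\<Union>v\<in>S ` space P. A v)"
  have "(\<integral>\<^sup>+\<omega>. lsem (lip_vanish 1 ?A) (X n \<omega>) \<partial>P) \<le> (\<integral>\<^sup>+\<omega>. ennreal (e / 2) + ennreal (norm (X n \<omega> - S \<omega>)) \<partial>P)"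
  proof (rule nn_integral_mono)
    fix \<omega> assume \<omega>: "\<omega> \<in> space P"
    have "lsem (lip_vanish 1 ?A) (X n \<omega>) \<le> lsem (lip_vanish 1 ?A) (S \<omega>) + lsem (lip_vanish 1 ?A) (X n \<omega> - S \<omega>)"
      using sem_add_le[of _ "S \<omega>" "X n \<omega> - S \<omega>"] by simp
    also have "\<dots> \<le> ennreal (e / 2) + ennreal (1 * norm (X n \<omega> - S \<omega>))"
    proof (rule add_mono)
      have "lip_vanish 1 ?A \<subseteq> lip_vanish 1 (A (S \<omega>))" using \<omega> by (intro lip_vanish_antimono) auto
      then show "lsem (lip_vanish 1 ?A) (S \<omega>) \<le> ennreal (e / 2)" by (rule order_trans[OF lsem_mono A(3)])
      show "lsem (lip_vanish 1 ?A) (X n \<omega> - S \<omega>) \<le> ennreal (1 * norm (X n \<omega> - S \<omega>))"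
        by (rule lsem_le_norm) (simp add: lip_vanish_def)
    qed
    finally show "lsem (lip_vanish 1 ?A) (X n \<omega>) \<le> ennreal (e / 2) + ennreal (norm (X n \<omega> - S \<omega>))" by simp
  qed
  also have "\<dots> = ennreal (e / 2) + (\<integral>\<^sup>+\<omega>. norm (X n \<omega> - S \<omega>) \<partial>P)"
    using measurable_norm_diff_simple[OF X_borel SP, of n] by (subst nn_integral_add) (auto simp: emeasure_space_1)
  also have "\<dots> \<le> ennreal (e / 2) + ennreal (e / 2)" by (intro add_left_mono S)
  also have "\<dots> = ennreal e" using assms by (intro ennreal_half_add) simp
  finally have le: "(\<integral>\<^sup>+\<omega>. lsem (lip_vanish 1 ?A) (X n \<omega>) \<partial>P) \<le> ennreal e" .
  have "finite (\<Union>v\<in>S ` space P. A v)" by (rule finite_UN_I[OF simple_functionD(1)[OF SP] A(1)])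
  then show ?thesis by (intro exI[of _ ?A] conjI le) blast+
qed

text \<open>Each of the two terms is null by itself along any sequence of times. Differences are
  needed only because the scalar hypothesis of \<open>curve_flat_null\<close> fails for the
  martingale itself.\<close>

lemma wuc_null_differences:
  assumes B: "\<And>n. (\<integral>\<^sup>+\<omega>. norm (X n \<omega>) \<partial>P) \<le> ennreal B"
  shows "wuc_null P (\<lambda>k \<omega>. X (a k) \<omega> - X (b k) \<omega>)"
proof
  fix k
  have "strongly_measurable P (\<lambda>\<omega>. X (a k) \<omega> - X (b k) \<omega>)" by (intro strongly_measurable_diff strong_P)
  then show "(\<lambda>\<omega>. X (a k) \<omega> - X (b k) \<omega>) \<in> borel_measurable P" by (rule strongly_measurable_borel)
  have m: "(\<lambda>\<omega>. ennreal (norm (X n \<omega>))) \<in> borel_measurable P" for n using norm_borel[of n] by simp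
  have "(\<integral>\<^sup>+\<omega>. norm (X (a k) \<omega> - X (b k) \<omega>) \<partial>P) \<le> (\<integral>\<^sup>+\<omega>. ennreal (norm (X (a k) \<omega>)) + ennreal (norm (X (b k) \<omega>)) \<partial>P)"
    by (intro nn_integral_mono) (simp add: norm_triangle_ineq4 flip: ennreal_plus)
  also have "\<dots> = (\<integral>\<^sup>+\<omega>. norm (X (a k) \<omega>) \<partial>P) + (\<integral>\<^sup>+\<omega>. norm (X (b k) \<omega>) \<partial>P)" by (rule nn_integral_add[OF m m])
  also have "\<dots> < \<infinity>" using norm_finite[of "a k"] norm_finite[of "b k"] by (simp add: ennreal_add_less_top)
  finally show "(\<integral>\<^sup>+\<omega>. norm (X (a k) \<omega> - X (b k) \<omega>) \<partial>P) < \<infinity>" .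
next
  fix k and e :: real assume e: "0 < e"
  then have e2: "0 < e / 2" by simp
  obtain A where A: "finite A" "0 \<in> A" "(\<integral>\<^sup>+\<omega>. lsem (lip_vanish 1 A) (X (a k) \<omega>) \<partial>P) \<le> ennreal (e / 2)"
    using lsem_vanish_approx[OF e2] by blast
  obtain A' where A': "finite A'" "0 \<in> A'" "(\<integral>\<^sup>+\<omega>. lsem (lip_vanish 1 A') (X (b k) \<omega>) \<partial>P) \<le> ennreal (e / 2)"
    using lsem_vanish_approx[OF e2] by blast
  have "(\<integral>\<^sup>+\<omega>. lsem (lip_vanish 1 (A \<union> A')) (X (a k) \<omega> - X (b k) \<omega>) \<partial>P) \<le>
      (\<integral>\<^sup>+\<omega>. lsem (lip_vanish 1 A) (X (a k) \<omega>) + lsem (lip_vanish 1 A') (X (b k) \<omega>) \<partial>P)"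
    by (intro nn_integral_mono order_trans[OF sem_diff_le] add_mono lsem_mono lip_vanish_antimono) auto
  also have "\<dots> = (\<integral>\<^sup>+\<omega>. lsem (lip_vanish 1 A) (X (a k) \<omega>) \<partial>P) + (\<integral>\<^sup>+\<omega>. lsem (lip_vanish 1 A') (X (b k) \<omega>) \<partial>P)"
    by (rule nn_integral_add[OF sem_borel sem_borel])
  also have "\<dots> \<le> ennreal (e / 2) + ennreal (e / 2)" by (intro add_mono A A')
  also have "\<dots> = ennreal e" using e by (intro ennreal_half_add) simp
  finally show "\<exists>A. finite A \<and> 0 \<in> A \<and> (\<integral>\<^sup>+\<omega>. lsem (lip_vanish 1 A) (X (a k) \<omega> - X (b k) \<omega>) \<partial>P) \<le> ennreal e"
    using A A' by (intro exI[of _ "A \<union> A'"]) auto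
next
  fix C :: real and \<U> :: "nat \<Rightarrow> ('m \<Rightarrow> real) set" and r :: "nat \<Rightarrow> nat"
  assume w: "wuc C \<U>" "0 \<le> C"
  have le: "(\<integral>\<^sup>+\<omega>. lsem (\<U> j) (X (a (r j)) \<omega> - X (b (r j)) \<omega>) \<partial>P) \<le>
      (\<integral>\<^sup>+\<omega>. lsem (\<U> j) (X (a (r j)) \<omega>) \<partial>P) + (\<integral>\<^sup>+\<omega>. lsem (\<U> j) (X (b (r j)) \<omega>) \<partial>P)" for j
    unfolding nn_integral_add[OF sem_borel sem_borel, symmetric] by (intro nn_integral_mono sem_diff_le)
  have lim: "(\<lambda>j. (\<integral>\<^sup>+\<omega>. lsem (\<U> j) (X (a (r j)) \<omega>) \<partial>P) + (\<integral>\<^sup>+\<omega>. lsem (\<U> j) (X (b (r j)) \<omega>) \<partial>P)) \<longlonglongrightarrow> 0"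
    using tendsto_add[OF wuc_lsem_null[OF B w, of "\<lambda>j. a (r j)"] wuc_lsem_null[OF B w, of "\<lambda>j. b (r j)"]] by simp
  show "(\<lambda>j. \<integral>\<^sup>+\<omega>. lsem (\<U> j) (X (a (r j)) \<omega> - X (b (r j)) \<omega>) \<partial>P) \<longlonglongrightarrow> 0"
    by (rule tendsto_sandwich[OF _ _ tendsto_const lim]) (simp, rule always_eventually, rule allI, rule le)
qed

text \<open>Otherwise suitable increments stay large in mean, against
  \<open>curve_flat_null\<close>. The domination by Z gives its scalar hypothesis through
  \<open>dominated_martingale_cauchy\<close>.\<close>

lemma linearization_L1_cauchy:
  fixes f :: "'m \<Rightarrow> 'n::{metric_space, zero}"
  assumes f: "L-lipschitz_on UNIV f" "f 0 = 0" "curve_flat f" and L: "0 < L"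
    and Z: "integrable P Z" and XZ: "\<And>n. AE \<omega> in P. norm (X n \<omega>) \<le> Z \<omega>" and e: "0 < e"
  shows "\<exists>N. \<forall>m\<ge>N. (\<integral>\<^sup>+\<omega>. norm (blinfun_apply (linearization f) (X m \<omega> - X N \<omega>)) \<partial>P) \<le> ennreal e"
proof (rule ccontr)
  assume "\<not> ?thesis"
  then have "\<forall>N. \<exists>m\<ge>N. ennreal e < (\<integral>\<^sup>+\<omega>. norm (blinfun_apply (linearization f) (X m \<omega> - X N \<omega>)) \<partial>P)"
    by (auto simp: not_le)
  then obtain a where a: "\<And>N. N \<le> a N" "\<And>N. ennreal e < (\<integral>\<^sup>+\<omega>. norm (blinfun_apply (linearization f) (X (a N) \<omega> - X N \<omega>)) \<partial>P)"
    by metis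
  have B: "(\<integral>\<^sup>+\<omega>. norm (X n \<omega>) \<partial>P) \<le> ennreal (\<integral>\<omega>. \<bar>Z \<omega>\<bar> \<partial>P)" for n
  proof -
    have "(\<integral>\<^sup>+\<omega>. norm (X n \<omega>) \<partial>P) \<le> (\<integral>\<^sup>+\<omega>. ennreal \<bar>Z \<omega>\<bar> \<partial>P)"
    proof (rule nn_integral_mono_AE)
      show "AE \<omega> in P. ennreal (norm (X n \<omega>)) \<le> ennreal \<bar>Z \<omega>\<bar>"
        using XZ[of n] by eventually_elim (auto intro!: ennreal_leI)
    qed
    also have "\<dots> = ennreal (\<integral>\<omega>. \<bar>Z \<omega>\<bar> \<partial>P)" using Z by (intro nn_integral_eq_integral) auto
    finally show ?thesis .
  qed
  interpret Y: wuc_null P "\<lambda>k \<omega>. X (a k) \<omega> - X k \<omega>" by (rule wuc_null_differences[OF B])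
  have "(\<lambda>k. \<integral>\<^sup>+\<omega>. norm (blinfun_apply (linearization f) (X (a k) \<omega> - X k \<omega>)) \<partial>P) \<longlonglongrightarrow> 0"
  proof (rule Y.curve_flat_null[OF f L])
    fix C and p :: "'m \<Rightarrow> real" assume p: "C-lipschitz_on UNIV p"
    let ?\<phi> = "lip_functional p"
    have C: "0 \<le> C" by (rule lipschitz_on_nonneg[OF p])
    have CZ: "integrable P (\<lambda>\<omega>. C * Z \<omega>)" using Z by simp
    have yZ: "AE \<omega> in P. \<bar>blinfun_apply ?\<phi> (X n \<omega>)\<bar> \<le> C * Z \<omega>" for n
      using XZ[of n]
    proof eventually_elim
      fix \<omega> assume "norm (X n \<omega>) \<le> Z \<omega>"
      then show "\<bar>blinfun_apply ?\<phi> (X n \<omega>)\<bar> \<le> C * Z \<omega>"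
        using abs_lip_functional_le[OF p, of "X n \<omega>"] mult_left_mono[OF _ C] by (meson order_trans)
    qed
    have cauchy: "\<exists>N. \<forall>n\<ge>N. \<forall>m\<ge>n. (\<integral>\<omega>. \<bar>blinfun_apply ?\<phi> (X m \<omega>) - blinfun_apply ?\<phi> (X n \<omega>)\<bar> \<partial>P) \<le> d" if "0 < d" for d
      by (rule dominated_martingale_cauchy[OF prob_space_axioms sub functional_borel_F cond_exp CZ yZ that])
    have eq: "(\<integral>\<^sup>+\<omega>. \<bar>blinfun_apply ?\<phi> (X (a k) \<omega> - X k \<omega>)\<bar> \<partial>P) =
        ennreal (\<integral>\<omega>. \<bar>blinfun_apply ?\<phi> (X (a k) \<omega>) - blinfun_apply ?\<phi> (X k \<omega>)\<bar> \<partial>P)" for k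
      unfolding blinfun.diff_right
      by (intro nn_integral_eq_integral integrable_abs Bochner_Integration.integrable_diff functional_integrable) auto
    have "(\<lambda>k. \<integral>\<omega>. \<bar>blinfun_apply ?\<phi> (X (a k) \<omega>) - blinfun_apply ?\<phi> (X k \<omega>)\<bar> \<partial>P) \<longlonglongrightarrow> 0"
    proof (rule LIMSEQ_I)
      fix d :: real assume d: "0 < d"
      then have "0 < d / 2" by simp
      then obtain N where N: "\<And>n m. n \<ge> N \<Longrightarrow> m \<ge> n \<Longrightarrow> (\<integral>\<omega>. \<bar>blinfun_apply ?\<phi> (X m \<omega>) - blinfun_apply ?\<phi> (X n \<omega>)\<bar> \<partial>P) \<le> d / 2"
        using cauchy by blast
      show "\<exists>no. \<forall>n\<ge>no. norm ((\<integral>\<omega>. \<bar>blinfun_apply ?\<phi> (X (a n) \<omega>) - blinfun_apply ?\<phi> (X n \<omega>)\<bar> \<partial>P) - 0) < d"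
      proof (intro exI[of _ N] allI impI)
        fix n assume "N \<le> n"
        from N[OF this a(1)] d
        show "norm ((\<integral>\<omega>. \<bar>blinfun_apply ?\<phi> (X (a n) \<omega>) - blinfun_apply ?\<phi> (X n \<omega>)\<bar> \<partial>P) - 0) < d"
          by (simp add: abs_of_nonneg)
      qed
    qed
    then have "(\<lambda>k. ennreal (\<integral>\<omega>. \<bar>blinfun_apply ?\<phi> (X (a k) \<omega>) - blinfun_apply ?\<phi> (X k \<omega>)\<bar> \<partial>P)) \<longlonglongrightarrow> ennreal 0"
      by (rule tendsto_ennrealI)
    then show "(\<lambda>k. \<integral>\<^sup>+\<omega>. \<bar>blinfun_apply ?\<phi> (X (a k) \<omega> - X k \<omega>)\<bar> \<partial>P) \<longlonglongrightarrow> 0" unfolding eq by simp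
  qed
  then have "\<forall>\<^sub>F k in sequentially. (\<integral>\<^sup>+\<omega>. norm (blinfun_apply (linearization f) (X (a k) \<omega> - X k \<omega>)) \<partial>P) < ennreal e"
    using e by (intro order_tendstoD(2)) auto
  then obtain k where "(\<integral>\<^sup>+\<omega>. norm (blinfun_apply (linearization f) (X (a k) \<omega> - X k \<omega>)) \<partial>P) < ennreal e"
    by (auto simp: eventually_sequentially)
  with a(2)[of k] show False by (meson less_asym)
qed

lemma sem_linearization:
  fixes f :: "'m \<Rightarrow> 'n::{metric_space, zero}"
  shows "sem ((\<lambda>\<psi>. \<psi> o\<^sub>L linearization f) ` lip_functional ` lip_vanish 1 {0}) x = ennreal (norm (blinfun_apply (linearization f) x))"
  unfolding ennreal_norm_eq_lsem sem_def by (simp add: image_image)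

text \<open>Convergence in mean gives an N after which the increments are small in mean; the maximal
  inequality for the restarted martingale makes them small simultaneously, outside a set of small
  probability.\<close>

lemma linearization_convergent:
  fixes f :: "'m \<Rightarrow> 'n::{metric_space, zero}"
  assumes f: "L-lipschitz_on UNIV f" "f 0 = 0" "curve_flat f" and L: "0 < L"
    and Z: "integrable P Z" and XZ: "\<And>n. AE \<omega> in P. norm (X n \<omega>) \<le> Z \<omega>"
  shows "AE \<omega> in P. convergent (\<lambda>n. blinfun_apply (linearization f) (X n \<omega>))"
proof -
  let ?T = "linearization f"
  let ?\<Phi> = "(\<lambda>\<psi>. \<psi> o\<^sub>L ?T) ` lip_functional ` lip_vanish 1 {0}"
  have \<Phi>: "norm \<phi> \<le> norm ?T" if \<phi>: "\<phi> \<in> ?\<Phi>" for \<phi>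
  proof -
    obtain u where u: "u \<in> lip_vanish 1 {0}" "\<phi> = lip_functional u o\<^sub>L ?T" using \<phi> by blast
    have "norm (lip_functional u) \<le> 1" using u(1) by (intro norm_lip_functional_le) (simp add: lip_vanish_def)
    then show ?thesis using norm_blinfun_compose[of "lip_functional u" ?T] mult_right_mono[OF _ norm_ge_zero[of ?T]]
      unfolding u(2) by fastforce
  qed
  have AEd: "AE \<omega> in P. \<exists>N. \<forall>i. norm (blinfun_apply ?T (X (N + i) \<omega> - X N \<omega>)) \<le> d" if d: "0 < d" for d :: real
  proof -
    let ?A = "\<lambda>N. {\<omega>\<in>space P. \<exists>i. ennreal d < sem ?\<Phi> (X (N + i) \<omega> - X N \<omega>)}"
    have meas: "?A N \<in> sets P" for N
    proof -
      interpret I: strong_martingale P "\<lambda>i. F (N + i)" "\<lambda>i \<omega>. X (N + i) \<omega> - X N \<omega>" by (rule increments)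
      have [measurable]: "(\<lambda>\<omega>. sem ?\<Phi> (X (N + i) \<omega> - X N \<omega>)) \<in> borel_measurable P" for i by (rule I.sem_borel)
      show ?thesis by measurable
    qed
    \<comment> \<open>The event that the oscillation exceeds d after every N. With positive
      probability p, the choice e = d p / 2 contradicts the maximal inequality.\<close>
    have "emeasure P (\<Inter>N. ?A N) = 0"
    proof (rule ccontr)
      assume "emeasure P (\<Inter>N. ?A N) \<noteq> 0"
      then have p: "0 < measure P (\<Inter>N. ?A N)" by (simp add: emeasure_eq_measure zero_less_measure_iff)
      define e where "e = d * measure P (\<Inter>N. ?A N) / 2"
      have e: "0 < e" using d p by (simp add: e_def)
      obtain N where N: "\<And>m. m \<ge> N \<Longrightarrow> (\<integral>\<^sup>+\<omega>. norm (blinfun_apply ?T (X m \<omega> - X N \<omega>)) \<partial>P) \<le> ennreal e"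
        using linearization_L1_cauchy[OF f L Z XZ e] by blast
      interpret I: strong_martingale P "\<lambda>i. F (N + i)" "\<lambda>i \<omega>. X (N + i) \<omega> - X N \<omega>" by (rule increments)
      have "ennreal d * emeasure P (?A N) \<le> ennreal e"
        by (rule I.sem_maximal[OF \<Phi>]) (use N[of "N + _"] in \<open>auto simp: sem_linearization\<close>)
      moreover have "emeasure P (\<Inter>N. ?A N) \<le> emeasure P (?A N)" by (intro emeasure_mono meas) auto
      ultimately have "ennreal d * emeasure P (\<Inter>N. ?A N) \<le> ennreal e"
        by (meson mult_left_mono order_trans zero_le)
      then have "ennreal (d * measure P (\<Inter>N. ?A N)) \<le> ennreal e"
        using d by (simp add: emeasure_eq_measure ennreal_mult)
      then have "d * measure P (\<Inter>N. ?A N) \<le> e" using e by (subst (asm) ennreal_le_iff) auto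
      then show False using e by (simp add: e_def)
    qed
    then have "(\<Inter>N. ?A N) \<in> null_sets P" using meas by (intro null_setsI) auto
    then show ?thesis
    proof (rule AE_I')
      show "{\<omega> \<in> space P. \<not> (\<exists>N. \<forall>i. norm (blinfun_apply ?T (X (N + i) \<omega> - X N \<omega>)) \<le> d)} \<subseteq> (\<Inter>N. ?A N)"
        using d by (auto simp: sem_linearization not_le ennreal_less_iff)
    qed
  qed
  have "AE \<omega> in P. \<forall>k. \<exists>N. \<forall>i. norm (blinfun_apply ?T (X (N + i) \<omega> - X N \<omega>)) \<le> inverse (real (Suc k))"
    unfolding AE_all_countable by (intro allI AEd) simp
  then show ?thesis
  proof eventually_elim
    fix \<omega> assume c: "\<forall>k. \<exists>N. \<forall>i. norm (blinfun_apply ?T (X (N + i) \<omega> - X N \<omega>)) \<le> inverse (real (Suc k))"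
    have "Cauchy (\<lambda>n. blinfun_apply ?T (X n \<omega>))"
    proof (rule metric_CauchyI)
      fix d :: real assume d: "0 < d"
      then have "0 < d / 2" by simp
      then obtain k where k: "inverse (real (Suc k)) < d / 2" using reals_Archimedean by blast
      from c obtain N where N: "\<And>i. norm (blinfun_apply ?T (X (N + i) \<omega> - X N \<omega>)) \<le> inverse (real (Suc k))" by blast
      have close: "dist (blinfun_apply ?T (X n \<omega>)) (blinfun_apply ?T (X N \<omega>)) < d / 2" if "n \<ge> N" for n
        using N[of "n - N"] k that by (simp add: dist_norm blinfun.diff_right)
      show "\<exists>M. \<forall>m\<ge>M. \<forall>n\<ge>M. dist (blinfun_apply ?T (X m \<omega>)) (blinfun_apply ?T (X n \<omega>)) < d"
        using dist_triangle_half_l close by (metis dist_commute)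
    qed
    then show "convergent (\<lambda>n. blinfun_apply ?T (X n \<omega>))" by (rule Cauchy_convergent)
  qed
qed


section \<open>Stopping when the norm exceeds a level\<close>

definition small_upto :: "real \<Rightarrow> nat \<Rightarrow> 'p set" where
  "small_upto l n = {\<omega>\<in>space P. \<forall>i\<le>n. norm (X i \<omega>) \<le> l}"

text \<open>The increment from n to n + 1 is added as long as all norms up to n are at most l. The
  process is frozen at the first value above l, so that one overshoot is retained; it has no a
  priori bound.\<close>

primrec stopped :: "real \<Rightarrow> nat \<Rightarrow> 'p \<Rightarrow> 'm lip_free" where
  "stopped l 0 = X 0"
| "stopped l (Suc n) = (\<lambda>\<omega>. stopped l n \<omega> + indicator (small_upto l n) \<omega> *\<^sub>R (X (Suc n) \<omega> - X n \<omega>))"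

lemma subalgebra_mono: "m \<le> n \<Longrightarrow> subalgebra (F n) (F m)"
  using mono[of m n] by (auto simp: subalgebra_def space_F)

lemma small_upto_sets: "small_upto l n \<in> sets (F n)"
proof -
  have m: "(\<lambda>\<omega>. norm (X i \<omega>)) \<in> borel_measurable (F n)" if "i \<le> n" for i
  proof (rule measurable_from_subalg[OF subalgebra_mono[OF that]])
    show "(\<lambda>\<omega>. norm (X i \<omega>)) \<in> borel_measurable (F i)"
      by (rule measurable_compose[OF X_borel_F]) (intro borel_measurable_continuous_onI continuous_intros)
  qed
  have "{\<omega>\<in>space (F n). norm (X i \<omega>) \<le> l} \<in> sets (F n)" if "i \<le> n" for i
    using m[OF that] by measurable
  then have "(\<Inter>i\<in>{..n}. {\<omega>\<in>space (F n). norm (X i \<omega>) \<le> l}) \<in> sets (F n)" by (intro sets.finite_INT) auto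
  moreover have "(\<Inter>i\<in>{..n}. {\<omega>\<in>space (F n). norm (X i \<omega>) \<le> l}) = small_upto l n"
    by (auto simp: small_upto_def space_F)
  ultimately show ?thesis by simp
qed

lemma stopped_strong: "strongly_measurable (F n) (stopped l n)"
proof (induction n)
  case (Suc n)
  have le: "n \<le> Suc n" by simp
  have "small_upto l n \<in> sets (F (Suc n))" using small_upto_sets mono[OF le] by blast
  then show ?case
    unfolding stopped.simps
    by (intro strongly_measurable_add strongly_measurable_indicator strongly_measurable_diff strong
        strongly_measurable_subalgebra[OF subalgebra_mono[OF le]] Suc.IH)
qed (simp add: strong)

lemma stopped_approx:
  "0 < e \<Longrightarrow> \<exists>S. simple_function (F n) S \<and> (\<integral>\<^sup>+\<omega>. norm (stopped l n \<omega> - S \<omega>) \<partial>P) \<le> ennreal e"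
proof (induction n arbitrary: e)
  case 0
  then show ?case using simple_approx[of e 0] by simp
next
  case (Suc n)
  have le: "n \<le> Suc n" by simp
  have e2: "0 < e / 2" and e4: "0 < e / 2 / 2" using Suc.prems by simp_all
  obtain S where S: "simple_function (F n) S" "(\<integral>\<^sup>+\<omega>. norm (stopped l n \<omega> - S \<omega>) \<partial>P) \<le> ennreal (e / 2)"
    using Suc.IH[OF e2] by blast
  obtain T where T: "simple_function (F (Suc n)) T" "(\<integral>\<^sup>+\<omega>. norm (X (Suc n) \<omega> - T \<omega>) \<partial>P) \<le> ennreal (e / 2 / 2)"
    using simple_approx[OF e4, of "Suc n"] by blast
  obtain U where U: "simple_function (F n) U" "(\<integral>\<^sup>+\<omega>. norm (X n \<omega> - U \<omega>) \<partial>P) \<le> ennreal (e / 2 / 2)"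
    using simple_approx[OF e4, of n] by blast
  let ?E = "small_upto l n"
  have E: "?E \<in> sets (F (Suc n))" using small_upto_sets mono[OF le] by blast
  let ?S = "\<lambda>\<omega>. S \<omega> + indicator ?E \<omega> *\<^sub>R (T \<omega> - U \<omega>)"
  have simple: "simple_function (F (Suc n)) ?S"
    by (intro simple_function_compose2[of _ _ _ "(+)"] simple_function_indicator_scaleR[OF _ E]
        simple_function_compose2[of _ _ _ "(-)"] T(1) simple_function_subalgebra[OF subalgebra_mono[OF le]] S(1) U(1))
  have m: "(\<lambda>\<omega>. ennreal (norm (g \<omega> - V \<omega>))) \<in> borel_measurable P"
    if "strongly_measurable (F k) g" "simple_function (F j) V" for g V k j
    using measurable_norm_diff_simple[OF strongly_measurable_borel[OF strongly_measurable_subalgebra[OF sub that(1)]]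
      simple_function_subalgebra[OF sub that(2)]] by simp
  have "(\<integral>\<^sup>+\<omega>. norm (stopped l (Suc n) \<omega> - ?S \<omega>) \<partial>P) \<le>
      (\<integral>\<^sup>+\<omega>. ennreal (norm (stopped l n \<omega> - S \<omega>)) + (ennreal (norm (X (Suc n) \<omega> - T \<omega>)) + ennreal (norm (X n \<omega> - U \<omega>))) \<partial>P)"
  proof (rule nn_integral_mono)
    fix \<omega>
    let ?i = "indicator ?E \<omega> :: real"
    have "stopped l (Suc n) \<omega> - ?S \<omega> = (stopped l n \<omega> - S \<omega>) + ?i *\<^sub>R ((X (Suc n) \<omega> - T \<omega>) - (X n \<omega> - U \<omega>))"
      by (simp add: scaleR_diff_right)
    also have "norm \<dots> \<le> norm (stopped l n \<omega> - S \<omega>) + norm ((X (Suc n) \<omega> - T \<omega>) - (X n \<omega> - U \<omega>))"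
      by (rule order_trans[OF norm_triangle_ineq]) (simp add: indicator_def)
    also have "\<dots> \<le> norm (stopped l n \<omega> - S \<omega>) + (norm (X (Suc n) \<omega> - T \<omega>) + norm (X n \<omega> - U \<omega>))"
      by (intro add_left_mono norm_triangle_ineq4)
    finally show "ennreal (norm (stopped l (Suc n) \<omega> - ?S \<omega>)) \<le>
        ennreal (norm (stopped l n \<omega> - S \<omega>)) + (ennreal (norm (X (Suc n) \<omega> - T \<omega>)) + ennreal (norm (X n \<omega> - U \<omega>)))"
      by (subst ennreal_plus[symmetric], simp, simp)+ (rule ennreal_leI)
  qed
  also have "\<dots> = (\<integral>\<^sup>+\<omega>. norm (stopped l n \<omega> - S \<omega>) \<partial>P) + ((\<integral>\<^sup>+\<omega>. norm (X (Suc n) \<omega> - T \<omega>) \<partial>P) + (\<integral>\<^sup>+\<omega>. norm (X n \<omega> - U \<omega>) \<partial>P))"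
    using m[OF stopped_strong S(1)] m[OF strong T(1)] m[OF strong U(1)] by (simp add: nn_integral_add)
  also have "\<dots> \<le> ennreal (e / 2) + (ennreal (e / 2 / 2) + ennreal (e / 2 / 2))" by (intro add_mono S T U)
  also have "\<dots> = ennreal e" using Suc.prems by (subst ennreal_half_add, simp)+ simp
  finally show ?case using simple by blast
qed

lemma stopped_functional:
  fixes \<phi> :: "'m lip_free \<Rightarrow>\<^sub>L real"
  shows "blinfun_apply \<phi> (stopped l (Suc n) \<omega>) = blinfun_apply \<phi> (stopped l n \<omega>) +
    (indicator (small_upto l n) \<omega> * blinfun_apply \<phi> (X (Suc n) \<omega>) - indicator (small_upto l n) \<omega> * blinfun_apply \<phi> (X n \<omega>))"
  by (simp add: blinfun.add_right blinfun.scaleR_right blinfun.diff_right right_diff_distrib)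

lemma stopped_functional_integrable:
  fixes \<phi> :: "'m lip_free \<Rightarrow>\<^sub>L real"
  shows "integrable P (\<lambda>\<omega>. blinfun_apply \<phi> (stopped l n \<omega>))"
proof (induction n)
  case (Suc n)
  have "integrable P (\<lambda>\<omega>. indicator (small_upto l n) \<omega> * blinfun_apply \<phi> (X k \<omega>))" for k
    using integrable_mult_indicator[OF sets_F[OF small_upto_sets] functional_integrable[of \<phi> k]] by simp
  then show ?case unfolding stopped_functional
    by (intro Bochner_Integration.integrable_add Bochner_Integration.integrable_diff Suc.IH)
qed (simp add: functional_integrable)

lemma stopped_strong_martingale: "strong_martingale P F (stopped l)"
proof
  fix m n A and \<phi> :: "'m lip_free \<Rightarrow>\<^sub>L real"
  assume mn: "m \<le> n" and A: "A \<in> sets (F m)"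
  show "(\<integral>\<omega>. indicator A \<omega> * blinfun_apply \<phi> (stopped l m \<omega>) \<partial>P) = (\<integral>\<omega>. indicator A \<omega> * blinfun_apply \<phi> (stopped l n \<omega>) \<partial>P)"
    using mn
  proof (induction n rule: dec_induct)
    case (step n)
    let ?B = "A \<inter> small_upto l n"
    have AF: "A \<in> sets (F n)" using A mono[OF step.hyps(1)] by blast
    have B: "?B \<in> sets (F n)" using AF small_upto_sets by blast
    have iA: "integrable P (\<lambda>\<omega>. indicator A \<omega> * blinfun_apply \<phi> (stopped l n \<omega>))"
      using integrable_mult_indicator[OF sets_F[OF AF] stopped_functional_integrable[of \<phi> l n]] by simp
    have iB: "integrable P (\<lambda>\<omega>. indicator ?B \<omega> * blinfun_apply \<phi> (X k \<omega>))" for k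
      using integrable_mult_indicator[OF sets_F[OF B] functional_integrable[of \<phi> k]] by simp
    have "indicator A \<omega> * blinfun_apply \<phi> (stopped l (Suc n) \<omega>) = indicator A \<omega> * blinfun_apply \<phi> (stopped l n \<omega>) +
        (indicator ?B \<omega> * blinfun_apply \<phi> (X (Suc n) \<omega>) - indicator ?B \<omega> * blinfun_apply \<phi> (X n \<omega>))" for \<omega>
      unfolding stopped_functional by (simp add: indicator_def)
    then have "(\<integral>\<omega>. indicator A \<omega> * blinfun_apply \<phi> (stopped l (Suc n) \<omega>) \<partial>P) =
        (\<integral>\<omega>. indicator A \<omega> * blinfun_apply \<phi> (stopped l n \<omega>) \<partial>P) +
        ((\<integral>\<omega>. indicator ?B \<omega> * blinfun_apply \<phi> (X (Suc n) \<omega>) \<partial>P) - (\<integral>\<omega>. indicator ?B \<omega> * blinfun_apply \<phi> (X n \<omega>) \<partial>P))"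
      using iA iB by (simp del: stopped.simps)
    also have "\<dots> = (\<integral>\<omega>. indicator A \<omega> * blinfun_apply \<phi> (stopped l n \<omega>) \<partial>P)"
      using mart[of n "Suc n" ?B \<phi>] B by simp
    finally show ?case using step.IH by simp
  qed simp
next
  fix n and e :: real assume "0 < e"
  then show "\<exists>S. simple_function (F n) S \<and> (\<integral>\<^sup>+\<omega>. norm (stopped l n \<omega> - S \<omega>) \<partial>P) \<le> ennreal e"
    by (rule stopped_approx)
qed (auto intro: sub stopped_strong dest: mono)

lemma stopped_eq: "\<omega> \<in> small_upto l n \<Longrightarrow> stopped l (Suc n) \<omega> = X (Suc n) \<omega>"
proof (induction n)
  case 0
  then show ?case by simp
next
  case (Suc n)
  then have "\<omega> \<in> small_upto l n" by (auto simp: small_upto_def)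
  then show ?case using Suc by (simp add: Suc.IH[simplified])
qed

text \<open>Before freezing the norm is at most l, and from then on the process is constant and
  equal to its value at n.\<close>

lemma stopped_norm_le:
  assumes "0 \<le> l" "\<omega> \<in> space P" "i \<le> n"
  shows "norm (stopped l i \<omega>) \<le> l + norm (stopped l n \<omega>)"
  using assms(3)
proof (induction n arbitrary: i)
  case 0
  then show ?case using assms(1) by simp
next
  case (Suc n)
  show ?case
  proof (cases "\<omega> \<in> small_upto l n")
    case True
    show ?thesis
    proof (cases i)
      case 0
      have "norm (X 0 \<omega>) \<le> l" using True by (auto simp: small_upto_def)
      then show ?thesis using norm_ge_zero[of "stopped l (Suc n) \<omega>"] unfolding 0 stopped.simps(1) by linarith
    next
      case (Suc j)
      show ?thesis
      proof (cases "i = Suc n")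
        case False
        then have j: "i \<le> n" using Suc.prems by simp
        then have "\<omega> \<in> small_upto l j" using True Suc by (auto simp: small_upto_def)
        then have "stopped l i \<omega> = X i \<omega>" unfolding Suc by (rule stopped_eq)
        moreover have "norm (X i \<omega>) \<le> l" using True j by (auto simp: small_upto_def)
        ultimately have "norm (stopped l i \<omega>) \<le> l" by (simp only:)
        then show ?thesis using norm_ge_zero[of "stopped l (Suc n) \<omega>"] by linarith
      qed (use assms(1) in simp)
    qed
  next
    case False
    then have eq: "stopped l (Suc n) \<omega> = stopped l n \<omega>" by simp
    show ?thesis
    proof (cases "i = Suc n")
      case False
      then show ?thesis unfolding eq using Suc by simp
    qed (use assms(1) in simp)
  qed
qed

lemma stopped_norm_borel: "(\<lambda>\<omega>. ennreal (norm (stopped l n \<omega>))) \<in> borel_measurable P"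
proof -
  interpret S: strong_martingale P F "stopped l" by (rule stopped_strong_martingale)
  show ?thesis using S.norm_borel[of n] by simp
qed

lemma stopped_mean_le_on:
  assumes "D \<in> sets P" "space P - small_upto l n \<subseteq> D"
  shows "(\<integral>\<^sup>+\<omega>. indicator D \<omega> * ennreal (norm (stopped l (Suc n) \<omega>)) \<partial>P) \<le>
    (\<integral>\<^sup>+\<omega>. indicator D \<omega> * ennreal (norm (X (Suc n) \<omega>)) \<partial>P)"
  using assms
proof (induction n arbitrary: D)
  have key: "(\<integral>\<^sup>+\<omega>. indicator D \<omega> * ennreal (norm (stopped l (Suc n) \<omega>)) \<partial>P) \<le>
      (\<integral>\<^sup>+\<omega>. indicator D \<omega> * ennreal (norm (X (Suc n) \<omega>)) \<partial>P)"
    if D: "D \<in> sets P" "space P - small_upto l n \<subseteq> D"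
      and le: "(\<integral>\<^sup>+\<omega>. indicator (space P - small_upto l n) \<omega> * ennreal (norm (stopped l n \<omega>)) \<partial>P) \<le>
        (\<integral>\<^sup>+\<omega>. indicator (space P - small_upto l n) \<omega> * ennreal (norm (X n \<omega>)) \<partial>P)" for D n
  proof -
    let ?E = "small_upto l n"
    let ?C = "space P - ?E"
    have CF: "?C \<in> sets (F n)" using sets.compl_sets[OF small_upto_sets[of l n]] by (simp add: space_F)
    have CP: "?C \<in> sets P" by (rule sets_F[OF CF])
    have DE: "D \<inter> ?E \<in> sets P" using D(1) sets_F[OF small_upto_sets] by blast
    have split: "(\<integral>\<^sup>+\<omega>. indicator D \<omega> * g \<omega> \<partial>P) = (\<integral>\<^sup>+\<omega>. indicator ?C \<omega> * g \<omega> \<partial>P) + (\<integral>\<^sup>+\<omega>. indicator (D \<inter> ?E) \<omega> * g \<omega> \<partial>P)"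
      if g: "g \<in> borel_measurable P" for g :: "'p \<Rightarrow> ennreal"
    proof -
      have ind: "(\<lambda>\<omega>. indicator S \<omega> * g \<omega>) \<in> borel_measurable P" if "S \<in> sets P" for S
        using g that by measurable
      have "(\<integral>\<^sup>+\<omega>. indicator D \<omega> * g \<omega> \<partial>P) = (\<integral>\<^sup>+\<omega>. indicator ?C \<omega> * g \<omega> + indicator (D \<inter> ?E) \<omega> * g \<omega> \<partial>P)"
        using D(2) by (intro nn_integral_cong) (auto simp: indicator_def)
      also have "\<dots> = (\<integral>\<^sup>+\<omega>. indicator ?C \<omega> * g \<omega> \<partial>P) + (\<integral>\<^sup>+\<omega>. indicator (D \<inter> ?E) \<omega> * g \<omega> \<partial>P)"
        by (rule nn_integral_add) (rule ind[OF CP] ind[OF DE])+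
      finally show ?thesis .
    qed
    have "(\<integral>\<^sup>+\<omega>. indicator ?C \<omega> * ennreal (norm (stopped l (Suc n) \<omega>)) \<partial>P) =
        (\<integral>\<^sup>+\<omega>. indicator ?C \<omega> * ennreal (norm (stopped l n \<omega>)) \<partial>P)"
      by (intro nn_integral_cong) (auto simp: indicator_def)
    also have "\<dots> \<le> (\<integral>\<^sup>+\<omega>. indicator ?C \<omega> * ennreal (norm (X n \<omega>)) \<partial>P)" by (rule le)
    also have "\<dots> \<le> (\<integral>\<^sup>+\<omega>. indicator ?C \<omega> * ennreal (norm (X (Suc n) \<omega>)) \<partial>P)"
      by (rule norm_submartingale[OF _ CF]) simp
    finally have 1: "(\<integral>\<^sup>+\<omega>. indicator ?C \<omega> * ennreal (norm (stopped l (Suc n) \<omega>)) \<partial>P) \<le>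
        (\<integral>\<^sup>+\<omega>. indicator ?C \<omega> * ennreal (norm (X (Suc n) \<omega>)) \<partial>P)" .
    have 2: "(\<integral>\<^sup>+\<omega>. indicator (D \<inter> ?E) \<omega> * ennreal (norm (stopped l (Suc n) \<omega>)) \<partial>P) =
        (\<integral>\<^sup>+\<omega>. indicator (D \<inter> ?E) \<omega> * ennreal (norm (X (Suc n) \<omega>)) \<partial>P)"
    proof (rule nn_integral_cong)
      fix \<omega>
      show "indicator (D \<inter> ?E) \<omega> * ennreal (norm (stopped l (Suc n) \<omega>)) = indicator (D \<inter> ?E) \<omega> * ennreal (norm (X (Suc n) \<omega>))"
        using stopped_eq[of \<omega> l n] by (cases "\<omega> \<in> ?E") (simp_all del: stopped.simps)
    qed
    have m: "(\<lambda>\<omega>. ennreal (norm (X (Suc n) \<omega>))) \<in> borel_measurable P" using norm_borel by simp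
    show ?thesis unfolding split[OF stopped_norm_borel] split[OF m] 2 by (rule add_right_mono[OF 1])
  qed
  { case 0
    show ?case by (rule key[OF 0]) simp
  next
    case (Suc n)
    let ?C = "space P - small_upto l (Suc n)"
    have CF: "?C \<in> sets (F (Suc n))" using sets.compl_sets[OF small_upto_sets[of l "Suc n"]] by (simp add: space_F)
    show ?case
      by (rule key[OF Suc.prems], rule Suc.IH[OF sets_F[OF CF]]) (auto simp: small_upto_def)
  }
qed

lemma stopped_mean_le: "(\<integral>\<^sup>+\<omega>. norm (stopped l n \<omega>) \<partial>P) \<le> (\<integral>\<^sup>+\<omega>. norm (X n \<omega>) \<partial>P)"
proof (cases n)
  case (Suc k)
  have "(\<integral>\<^sup>+\<omega>. indicator (space P) \<omega> * h \<omega> \<partial>P) = (\<integral>\<^sup>+\<omega>. h \<omega> \<partial>P)" for h :: "'p \<Rightarrow> ennreal"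
    by (intro nn_integral_cong) simp
  then show ?thesis using stopped_mean_le_on[of "space P" l k] unfolding Suc by (simp del: stopped.simps)
qed simp

text \<open>By \<open>stopped_norm_le\<close> the running maximum up to n is at most l plus the
  final norm, whose mean is at most B. Monotone convergence makes the full supremum
  integrable.\<close>

lemma stopped_dominated:
  assumes B: "\<And>n. (\<integral>\<^sup>+\<omega>. norm (X n \<omega>) \<partial>P) \<le> ennreal B" and l: "0 \<le> l"
  obtains Z where "integrable P Z" "\<And>n. AE \<omega> in P. norm (stopped l n \<omega>) \<le> Z \<omega>"
proof -
  define g where "g n \<omega> = (SUP i\<in>{..n}. ennreal (norm (stopped l i \<omega>)))" for n \<omega>
  define W where "W \<omega> = (SUP n. g n \<omega>)" for \<omega>
  have gm: "g n \<in> borel_measurable P" for n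
    unfolding g_def by (intro borel_measurable_SUP stopped_norm_borel) simp
  have Wm: "W \<in> borel_measurable P" unfolding W_def by (intro borel_measurable_SUP gm) simp
  have "incseq g" unfolding g_def by (auto simp: incseq_def le_fun_def intro!: SUP_subset_mono)
  then have "(\<integral>\<^sup>+\<omega>. W \<omega> \<partial>P) = (SUP n. \<integral>\<^sup>+\<omega>. g n \<omega> \<partial>P)"
    unfolding W_def by (rule nn_integral_monotone_convergence_SUP) (rule gm)
  also have "\<dots> \<le> ennreal l + ennreal B"
  proof (rule SUP_least)
    fix n
    have "(\<integral>\<^sup>+\<omega>. g n \<omega> \<partial>P) \<le> (\<integral>\<^sup>+\<omega>. ennreal l + ennreal (norm (stopped l n \<omega>)) \<partial>P)"
    proof (rule nn_integral_mono)
      fix \<omega> assume \<omega>: "\<omega> \<in> space P"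
      have "ennreal l + ennreal (norm (stopped l n \<omega>)) = ennreal (l + norm (stopped l n \<omega>))"
        using l by (intro ennreal_plus[symmetric]) auto
      then show "g n \<omega> \<le> ennreal l + ennreal (norm (stopped l n \<omega>))"
        unfolding g_def by (intro SUP_least) (simp only: ennreal_leI[OF stopped_norm_le[OF l \<omega>]] atMost_iff)
    qed
    also have "\<dots> = ennreal l + (\<integral>\<^sup>+\<omega>. norm (stopped l n \<omega>) \<partial>P)"
      by (subst nn_integral_add[OF _ stopped_norm_borel]) (auto simp: emeasure_space_1)
    also have "\<dots> \<le> ennreal l + ennreal B" by (intro add_left_mono order_trans[OF stopped_mean_le B])
    finally show "(\<integral>\<^sup>+\<omega>. g n \<omega> \<partial>P) \<le> ennreal l + ennreal B" .
  qed
  also have "\<dots> < \<infinity>" by (simp add: ennreal_add_less_top)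
  finally have fin: "(\<integral>\<^sup>+\<omega>. W \<omega> \<partial>P) < \<infinity>" .
  have AEfin: "AE \<omega> in P. W \<omega> \<noteq> \<infinity>" by (rule nn_integral_PInf_AE[OF Wm]) (use fin in auto)
  show ?thesis
  proof (rule that[of "\<lambda>\<omega>. enn2real (W \<omega>)"])
    show "integrable P (\<lambda>\<omega>. enn2real (W \<omega>))"
    proof (rule integrableI_bounded)
      show "(\<lambda>\<omega>. enn2real (W \<omega>)) \<in> borel_measurable P" using Wm by measurable
      have "(\<integral>\<^sup>+\<omega>. ennreal (norm (enn2real (W \<omega>))) \<partial>P) \<le> (\<integral>\<^sup>+\<omega>. W \<omega> \<partial>P)"
        by (intro nn_integral_mono) (auto simp: ennreal_enn2real_if)
      then show "(\<integral>\<^sup>+\<omega>. ennreal (norm (enn2real (W \<omega>))) \<partial>P) < \<infinity>" using fin by (rule le_less_trans)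
    qed
    show "AE \<omega> in P. norm (stopped l n \<omega>) \<le> enn2real (W \<omega>)" for n
      using AEfin
    proof eventually_elim
      fix \<omega> assume f: "W \<omega> \<noteq> \<infinity>"
      have "ennreal (norm (stopped l n \<omega>)) \<le> g n \<omega>" unfolding g_def by (rule SUP_upper) simp
      also have "\<dots> \<le> W \<omega>" unfolding W_def by (rule SUP_upper) simp
      also have "\<dots> = ennreal (enn2real (W \<omega>))" using f by (simp add: less_top)
      finally show "norm (stopped l n \<omega>) \<le> enn2real (W \<omega>)" by (subst (asm) ennreal_le_iff) auto
    qed
  qed
qed

lemma almost_surely_bounded:
  assumes B: "\<And>n. (\<integral>\<^sup>+\<omega>. norm (X n \<omega>) \<partial>P) \<le> ennreal B"
  shows "AE \<omega> in P. \<exists>k::nat. \<forall>n. norm (X n \<omega>) \<le> real k"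
proof -
  let ?A = "\<lambda>k::nat. {\<omega>\<in>space P. \<exists>n. ennreal (real k) < lsem (lip_vanish 1 {0}) (X n \<omega>)}"
  have [measurable]: "(\<lambda>\<omega>. lsem (lip_vanish 1 {0}) (X n \<omega>)) \<in> borel_measurable P" for n by (rule sem_borel)
  have meas: "?A k \<in> sets P" for k by measurable
  have le: "ennreal (real k) * emeasure P (?A k) \<le> ennreal B" for k
    by (rule sem_maximal[where C = 1])
      (use B in \<open>auto simp: lip_vanish_def ennreal_norm_eq_lsem intro: norm_lip_functional_le\<close>)
  have "measure P (\<Inter>k. ?A k) = 0"
  proof (rule ccontr)
    assume "measure P (\<Inter>k. ?A k) \<noteq> 0"
    then have p: "0 < measure P (\<Inter>k. ?A k)" by (simp add: zero_less_measure_iff)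
    then obtain k :: nat where k: "max B 0 < real k * measure P (\<Inter>k. ?A k)"
      using reals_Archimedean3 by blast
    have "ennreal (real k * measure P (\<Inter>k. ?A k)) = ennreal (real k) * emeasure P (\<Inter>k. ?A k)"
      by (simp add: emeasure_eq_measure ennreal_mult)
    also have "\<dots> \<le> ennreal (real k) * emeasure P (?A k)" by (intro mult_left_mono emeasure_mono meas) auto
    also have "\<dots> \<le> ennreal (max B 0)" by (rule order_trans[OF le]) (auto intro: ennreal_leI)
    finally have "real k * measure P (\<Inter>k. ?A k) \<le> max B 0" by (subst (asm) ennreal_le_iff) auto
    with k show False by linarith
  qed
  then have "(\<Inter>k. ?A k) \<in> null_sets P" using meas by (intro null_setsI) (auto simp: emeasure_eq_measure)
  then show ?thesis
  proof (rule AE_I')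
    show "{\<omega> \<in> space P. \<not> (\<exists>k::nat. \<forall>n. norm (X n \<omega>) \<le> real k)} \<subseteq> (\<Inter>k. ?A k)"
      by (auto simp: ennreal_norm_eq_lsem[symmetric] not_le ennreal_less_iff)
  qed
qed

text \<open>Almost every path is bounded by some integer k, and on such a path stopping at level k
  changes nothing; countably many levels suffice.\<close>

lemma linearization_convergent_L1_bounded:
  fixes f :: "'m \<Rightarrow> 'n::{metric_space, zero}"
  assumes f: "L-lipschitz_on UNIV f" "f 0 = 0" "curve_flat f" and L: "0 < L"
    and B: "\<And>n. (\<integral>\<^sup>+\<omega>. norm (X n \<omega>) \<partial>P) \<le> ennreal B"
  shows "AE \<omega> in P. convergent (\<lambda>n. blinfun_apply (linearization f) (X n \<omega>))"
proof -
  have "AE \<omega> in P. convergent (\<lambda>n. blinfun_apply (linearization f) (stopped (real k) n \<omega>))" for k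
  proof -
    interpret S: strong_martingale P F "stopped (real k)" by (rule stopped_strong_martingale)
    obtain Z where Z: "integrable P Z" "\<And>n. AE \<omega> in P. norm (stopped (real k) n \<omega>) \<le> Z \<omega>"
      using stopped_dominated[OF B, of "real k"] by auto
    show ?thesis by (rule S.linearization_convergent[OF f L Z])
  qed
  then have "AE \<omega> in P. \<forall>k. convergent (\<lambda>n. blinfun_apply (linearization f) (stopped (real k) n \<omega>))"
    unfolding AE_all_countable by blast
  with almost_surely_bounded[OF B] AE_space show ?thesis
  proof eventually_elim
    fix \<omega> assume "\<exists>k::nat. \<forall>n. norm (X n \<omega>) \<le> real k" and \<omega>: "\<omega> \<in> space P"
      and c: "\<forall>k. convergent (\<lambda>n. blinfun_apply (linearization f) (stopped (real k) n \<omega>))"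
    then obtain k :: nat where k: "\<And>n. norm (X n \<omega>) \<le> real k" by blast
    have "stopped (real k) n \<omega> = X n \<omega>" for n
      using stopped_eq[of \<omega> "real k"] k \<omega> by (cases n) (auto simp: small_upto_def simp del: stopped.simps(2))
    then show "convergent (\<lambda>n. blinfun_apply (linearization f) (X n \<omega>))" using c[rule_format, of k] by simp
  qed
qed

end

theorem curve_flat_imp_radon_nikodym:
  fixes f :: "'m::{complete_space, zero} \<Rightarrow> 'n::{metric_space, zero}"
  assumes f: "L-lipschitz_on UNIV f" "f 0 = 0" "curve_flat f" and L: "0 < L"
  shows "radon_nikodym (linearization f)"
  unfolding radon_nikodym_def radon_nikodym_on_def
proof (intro allI impI)
  fix P :: "(nat \<Rightarrow> 'm lip_free) measure" and F and X :: "nat \<Rightarrow> (nat \<Rightarrow> 'm lip_free) \<Rightarrow> 'm lip_free"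
  assume P: "prob_space P" and mart: "bochner_martingale P F X" and bounded: "L1_bounded P X"
  interpret prob_space P by fact
  have sub: "\<And>n. subalgebra P (F n)" and mono: "\<And>m n. m \<le> n \<Longrightarrow> sets (F m) \<subseteq> sets (F n)"
    and bi: "\<And>n. bochner_integrable (restr_to_subalg P (F n)) (X n)"
    and int: "\<And>m n A. m \<le> n \<Longrightarrow> A \<in> sets (F m) \<Longrightarrow> \<exists>x. bochner_has_integral P (\<lambda>\<omega>. indicator A \<omega> *\<^sub>R X m \<omega>) x \<and>
      bochner_has_integral P (\<lambda>\<omega>. indicator A \<omega> *\<^sub>R X n \<omega>) x"
    using mart unfolding bochner_martingale_def by blast+
  \<comment> \<open>Modifying each X n on a null set leaves its means, its integrals over events and
    almost sure convergence unchanged.\<close>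
  have "\<exists>X'. strongly_measurable (F n) X' \<and> (AE \<omega> in P. X' \<omega> = X n \<omega>) \<and>
      (\<forall>e>0. \<exists>S. simple_function (F n) S \<and> (\<integral>\<^sup>+\<omega>. norm (X' \<omega> - S \<omega>) \<partial>P) \<le> ennreal e)" for n
    by (rule bochner_integrable_modification[OF sub bi]) blast
  then have "\<exists>X'. \<forall>n. strongly_measurable (F n) (X' n) \<and> (AE \<omega> in P. X' n \<omega> = X n \<omega>) \<and>
      (\<forall>e>0. \<exists>S. simple_function (F n) S \<and> (\<integral>\<^sup>+\<omega>. norm (X' n \<omega> - S \<omega>) \<partial>P) \<le> ennreal e)"
    by (intro choice allI)
  then obtain X' where X': "\<And>n. strongly_measurable (F n) (X' n)" "\<And>n. AE \<omega> in P. X' n \<omega> = X n \<omega>"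
    "\<And>n e. e > 0 \<Longrightarrow> \<exists>S. simple_function (F n) S \<and> (\<integral>\<^sup>+\<omega>. norm (X' n \<omega> - S \<omega>) \<partial>P) \<le> ennreal e"
    by blast
  interpret M: strong_martingale P F X'
  proof
    fix m n A and \<phi> :: "'m lip_free \<Rightarrow>\<^sub>L real"
    assume mn: "m \<le> n" and A: "A \<in> sets (F m)"
    obtain x where x: "bochner_has_integral P (\<lambda>\<omega>. indicator A \<omega> *\<^sub>R X m \<omega>) x"
      "bochner_has_integral P (\<lambda>\<omega>. indicator A \<omega> *\<^sub>R X n \<omega>) x" using int[OF mn A] by blast
    have AP: "A \<in> sets P" using A sub[of m] by (auto simp: subalgebra_def)
    have "(\<integral>\<omega>. indicator A \<omega> * blinfun_apply \<phi> (X' k \<omega>) \<partial>P) = blinfun_apply \<phi> x"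
      if "bochner_has_integral P (\<lambda>\<omega>. indicator A \<omega> *\<^sub>R X k \<omega>) x" for k
    proof -
      have hb: "has_bochner_integral P (\<lambda>\<omega>. indicator A \<omega> * blinfun_apply \<phi> (X k \<omega>)) (blinfun_apply \<phi> x)"
        using bochner_has_integral_functional[OF that, of \<phi>] by (simp add: blinfun.scaleR_right)
      have "X' k \<in> borel_measurable P"
        by (rule strongly_measurable_borel[OF strongly_measurable_subalgebra[OF sub X'(1)]])
      then have m: "(\<lambda>\<omega>. blinfun_apply \<phi> (X' k \<omega>)) \<in> borel_measurable P"
        by (rule measurable_compose) (intro borel_measurable_continuous_onI continuous_intros)
      have "(\<integral>\<omega>. indicator A \<omega> * blinfun_apply \<phi> (X' k \<omega>) \<partial>P) = (\<integral>\<omega>. indicator A \<omega> * blinfun_apply \<phi> (X k \<omega>) \<partial>P)"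
      proof (rule integral_cong_AE)
        show "(\<lambda>\<omega>. indicator A \<omega> * blinfun_apply \<phi> (X' k \<omega>)) \<in> borel_measurable P" using AP m by measurable
        show "(\<lambda>\<omega>. indicator A \<omega> * blinfun_apply \<phi> (X k \<omega>)) \<in> borel_measurable P"
          using hb by (auto simp: has_bochner_integral_iff)
        show "AE \<omega> in P. indicator A \<omega> * blinfun_apply \<phi> (X' k \<omega>) = indicator A \<omega> * blinfun_apply \<phi> (X k \<omega>)"
          using X'(2)[of k] by eventually_elim simp
      qed
      then show ?thesis using hb by (simp add: has_bochner_integral_integral_eq)
    qed
    then show "(\<integral>\<omega>. indicator A \<omega> * blinfun_apply \<phi> (X' m \<omega>) \<partial>P) = (\<integral>\<omega>. indicator A \<omega> * blinfun_apply \<phi> (X' n \<omega>) \<partial>P)"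
      using x by simp
  next
    fix n and e :: real assume "0 < e"
    then show "\<exists>S. simple_function (F n) S \<and> (\<integral>\<^sup>+\<omega>. norm (X' n \<omega> - S \<omega>) \<partial>P) \<le> ennreal e" by (rule X'(3))
  qed (auto intro: sub X' dest: mono)
  obtain B where B: "\<And>n. (\<integral>\<^sup>+\<omega>. norm (X n \<omega>) \<partial>P) \<le> ennreal B" using bounded unfolding L1_bounded_def by blast
  have "(\<integral>\<^sup>+\<omega>. norm (X' n \<omega>) \<partial>P) \<le> ennreal B" for n
  proof -
    have "(\<integral>\<^sup>+\<omega>. norm (X' n \<omega>) \<partial>P) = (\<integral>\<^sup>+\<omega>. norm (X n \<omega>) \<partial>P)"
      using X'(2)[of n] by (intro nn_integral_cong_AE) (auto elim!: eventually_mono)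
    then show ?thesis using B by simp
  qed
  from M.linearization_convergent_L1_bounded[OF f L this]
  have "AE \<omega> in P. convergent (\<lambda>n. blinfun_apply (linearization f) (X' n \<omega>))" .
  moreover have "AE \<omega> in P. \<forall>n. X' n \<omega> = X n \<omega>" unfolding AE_all_countable using X'(2) by blast
  ultimately show "AE \<omega> in P. convergent (\<lambda>n. blinfun_apply (linearization f) (X n \<omega>))"
    by eventually_elim simp
qed

section \<open>Operators fixing a copy of \<open>L\<^sub>1\<close>\<close>

abbreviation unit_interval :: "real measure" where "unit_interval \<equiv> lebesgue_on {0..1}"

text \<open>Half-open cells: those with k < 2^n partition the half-open unit interval, and only the
  null point 1 is left out.\<close>

definition dyadic :: "nat \<Rightarrow> nat \<Rightarrow> real set" where
  "dyadic n k = {real k / 2 ^ n..<real (Suc k) / 2 ^ n}"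

definition step :: "nat \<Rightarrow> (nat \<Rightarrow> real) \<Rightarrow> real \<Rightarrow> real" where
  "step n c x = (\<Sum>k<2 ^ n. c k * indicator (dyadic n k) x)"

definition L1step :: "nat \<Rightarrow> (nat \<Rightarrow> real) \<Rightarrow> L1" where
  "L1step n c = abs_L1 (step n c)"

lemma mem_dyadic: "x \<in> dyadic n k \<longleftrightarrow> 0 \<le> x \<and> nat \<lfloor>2 ^ n * x\<rfloor> = k"
proof -
  have "x \<in> dyadic n k \<longleftrightarrow> real k \<le> 2 ^ n * x \<and> 2 ^ n * x < real k + 1"
    by (auto simp: dyadic_def field_simps)
  also have "\<dots> \<longleftrightarrow> \<lfloor>2 ^ n * x\<rfloor> = int k" by (auto simp: floor_eq_iff)
  also have "\<dots> \<longleftrightarrow> 0 \<le> x \<and> nat \<lfloor>2 ^ n * x\<rfloor> = k"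
  proof -
    have "0 \<le> x \<longleftrightarrow> 0 \<le> \<lfloor>2 ^ n * x\<rfloor>" using mult_le_cancel_left_pos[of "2 ^ n" 0 x] by simp
    then show ?thesis by (metis nat_0_le nat_int of_nat_0_le_iff)
  qed
  finally show ?thesis .
qed

lemma dyadic_subset: "k < 2 ^ n \<Longrightarrow> dyadic n k \<subseteq> {0..<1}"
proof -
  assume "k < 2 ^ n"
  then have "real (Suc k) \<le> real (2 ^ n)" by (intro of_nat_mono) simp
  then have "real (Suc k) / 2 ^ n \<le> 1" by simp
  moreover have "0 \<le> real k / 2 ^ n" by simp
  ultimately show ?thesis unfolding dyadic_def by (auto intro: order_trans less_le_trans)
qed

lemma dyadic_sets [measurable]: "dyadic n k \<in> sets lebesgue"
  by (simp add: dyadic_def)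

lemma measure_dyadic: "k < 2 ^ n \<Longrightarrow> measure unit_interval (dyadic n k) = 1 / 2 ^ n"
proof -
  assume k: "k < 2 ^ n"
  have "measure unit_interval (dyadic n k) = measure lebesgue (dyadic n k)"
    using dyadic_subset[OF k] by (intro measure_restrict_space) auto
  also have "\<dots> = real (Suc k) / 2 ^ n - real k / 2 ^ n"
    unfolding dyadic_def by (simp add: divide_right_mono)
  also have "\<dots> = 1 / 2 ^ n" by (simp add: diff_divide_distrib[symmetric])
  finally show ?thesis .
qed

lemma prob_space_unit_interval: "prob_space unit_interval"
  by (rule prob_spaceI) (simp add: emeasure_restrict_space space_restrict_space)

lemma dyadic_in_unit: "k < 2 ^ n \<Longrightarrow> dyadic n k \<in> sets unit_interval"
  using dyadic_subset[of k n] by (auto simp: sets_restrict_space_iff)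

lemma integrable_indicator_dyadic: "k < 2 ^ n \<Longrightarrow> integrable unit_interval (indicator (dyadic n k) :: real \<Rightarrow> real)"
proof -
  assume k: "k < 2 ^ n"
  interpret prob_space unit_interval by (rule prob_space_unit_interval)
  show ?thesis using dyadic_in_unit[OF k] emeasure_finite[of "dyadic n k"]
    by (intro integrable_real_indicator) (simp_all only: less_top infinity_ennreal_def not_False_eq_True)
qed

lemma integrable_step: "integrable unit_interval (step n c)"
  unfolding step_def[abs_def]
  by (intro Bochner_Integration.integrable_sum integrable_mult_right integrable_indicator_dyadic) simp

lemma integral_step: "(\<integral>x. step n c x \<partial>unit_interval) = (\<Sum>k<2 ^ n. c k / 2 ^ n)"
proof -
  have "(\<integral>x. step n c x \<partial>unit_interval) = (\<Sum>k<2 ^ n. \<integral>x. c k * indicator (dyadic n k) x \<partial>unit_interval)"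
    unfolding step_def by (intro Bochner_Integration.integral_sum integrable_mult_right integrable_indicator_dyadic) simp
  also have "\<dots> = (\<Sum>k<2 ^ n. c k / 2 ^ n)"
  proof (rule sum.cong)
    fix k assume "k \<in> {..<2 ^ n :: nat}"
    then have k: "k < 2 ^ n" by simp
    have "dyadic n k \<inter> {0..1} = dyadic n k" using dyadic_subset[OF k] by auto
    then show "(\<integral>x. c k * indicator (dyadic n k) x \<partial>unit_interval) = c k / 2 ^ n"
      using measure_dyadic[OF k] by (simp add: space_restrict_space)
  qed simp
  finally show ?thesis .
qed

lemma step_eq:
  assumes "x \<in> dyadic n j" "j < 2 ^ n"
  shows "step n c x = c j"
proof -
  have "indicator (dyadic n k) x = (if k = j then 1 else 0 :: real)" for k
    using assms(1) by (auto simp: mem_dyadic indicator_def)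
  then have "step n c x = (\<Sum>k<2 ^ n. if k = j then c k else 0)"
    unfolding step_def by (intro sum.cong) auto
  then show ?thesis using assms(2) by simp
qed

lemma step_outside: "(\<And>j. j < 2 ^ n \<Longrightarrow> x \<notin> dyadic n j) \<Longrightarrow> step n c x = 0"
  unfolding step_def by (intro sum.neutral) auto

lemma step_abs: "\<bar>step n c x\<bar> = step n (\<lambda>k. \<bar>c k\<bar>) x"
  by (cases "\<exists>j<2 ^ n. x \<in> dyadic n j") (auto simp: step_eq step_outside)

lemma L1_rel_step: "L1_rel (step n c) (step n c)"
  by (simp add: L1_rel_def integrable_step)

lemma norm_L1step: "norm (L1step n c) = (\<Sum>k<2 ^ n. \<bar>c k\<bar> / 2 ^ n)"
  unfolding L1step_def norm_L1.abs_eq[OF L1_rel_step] step_abs integral_step ..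

lemma L1step_add: "L1step n c + L1step n d = L1step n (\<lambda>k. c k + d k)"
proof -
  have "(\<lambda>x. step n c x + step n d x) = step n (\<lambda>k. c k + d k)"
    by (rule ext) (simp only: step_def sum.distrib[symmetric] distrib_right)
  then show ?thesis unfolding L1step_def by (simp add: plus_L1.abs_eq[OF L1_rel_step L1_rel_step])
qed

lemma L1step_scaleR: "r *\<^sub>R L1step n c = L1step n (\<lambda>k. r * c k)"
proof -
  have "(\<lambda>x. r * step n c x) = step n (\<lambda>k. r * c k)"
    by (rule ext) (simp only: step_def sum_distrib_left mult.assoc)
  then show ?thesis unfolding L1step_def by (simp add: scaleR_L1.abs_eq[OF L1_rel_step])
qed

lemma L1step_diff: "L1step n c - L1step n d = L1step n (\<lambda>k. c k - d k)"
  using L1step_add[of n c "\<lambda>k. -1 * d k"] L1step_scaleR[of "-1" n d]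
  by (simp only: scaleR_minus1_left diff_conv_add_uminus mult_minus1)

lemma sum_double: "(\<Sum>k<2 * N. f k) = (\<Sum>k<N. f (2 * k) + f (Suc (2 * k)))" for f :: "nat \<Rightarrow> 'a::comm_monoid_add"
  by (induction N) (auto simp: algebra_simps)

lemma dyadic_split: "indicator (dyadic n k) x = (indicator (dyadic (Suc n) (2 * k)) x + indicator (dyadic (Suc n) (Suc (2 * k))) x :: real)"
proof -
  have "real (2 * k) / 2 ^ Suc n = real k / 2 ^ n" "real (Suc (Suc (2 * k))) / 2 ^ Suc n = real (Suc k) / 2 ^ n"
    by (simp_all add: field_simps)
  moreover have "real k / 2 ^ n \<le> real (Suc (2 * k)) / 2 ^ Suc n" "real (Suc (2 * k)) / 2 ^ Suc n \<le> real (Suc k) / 2 ^ n"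
    by (simp_all add: field_simps)
  ultimately show ?thesis unfolding dyadic_def by (auto simp: indicator_def)
qed

lemma L1step_refine: "L1step (Suc n) (\<lambda>k. c (k div 2)) = L1step n c"
proof -
  have "step (Suc n) (\<lambda>k. c (k div 2)) x = step n c x" for x
  proof -
    have "step (Suc n) (\<lambda>k. c (k div 2)) x =
        (\<Sum>k<2 * 2 ^ n. c (k div 2) * indicator (dyadic (Suc n) k) x)" by (simp add: step_def)
    also have "\<dots> = (\<Sum>k<2 ^ n. c k * indicator (dyadic n k) x)"
      unfolding sum_double by (intro sum.cong refl) (simp add: dyadic_split[of n] distrib_left)
    finally show ?thesis by (simp add: step_def)
  qed
  then show ?thesis unfolding L1step_def by presburger
qed

lemma L1step_refine_le:
  assumes "m \<le> n"
  shows "L1step n (\<lambda>k. c (k div 2 ^ (n - m))) = L1step m c"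
  using assms
proof (induction n rule: dec_induct)
  case (step n)
  have "L1step (Suc n) (\<lambda>k. c (k div 2 ^ (Suc n - m))) = L1step (Suc n) (\<lambda>k. (\<lambda>j. c (j div 2 ^ (n - m))) (k div 2))"
    using step(1) by (simp add: Suc_diff_le div_mult2_eq[symmetric])
  also have "\<dots> = L1step n (\<lambda>j. c (j div 2 ^ (n - m)))" by (rule L1step_refine)
  finally show ?case using step by simp
qed simp

section \<open>Rademacher functions are weakly null\<close>

text \<open>The \<open>i\<close>-th Rademacher function is the step function \<open>(-1) ^ k\<close> of level \<open>i + 1\<close>.\<close>

definition rademacher :: "nat \<Rightarrow> L1" where
  "rademacher i = L1step (Suc i) (\<lambda>k. (- 1) ^ k)"

lemma norm_rademacher: "norm (rademacher i) = 1"
  by (simp add: rademacher_def norm_L1step power_abs)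

text \<open>Passing to the next level replaces a coefficient c by the pair c + a, c - a, whose
  squares add up to twice the sum of the squares: orthogonality expressed by coefficients.\<close>

lemma rademacher_sum:
  "\<exists>c. (\<Sum>i<N. a i *\<^sub>R rademacher i) = L1step N c \<and> (\<Sum>k<2 ^ N. (c k)\<^sup>2) = 2 ^ N * (\<Sum>i<N. (a i)\<^sup>2)"
proof (induction N)
  case 0
  have "L1step 0 (\<lambda>_. 0) = 0" using L1step_scaleR[of 0 0 "\<lambda>_. 0"] by simp
  then show ?case by (intro exI[of _ "\<lambda>_. 0"]) simp
next
  case (Suc N)
  then obtain c where c: "(\<Sum>i<N. a i *\<^sub>R rademacher i) = L1step N c" "(\<Sum>k<2 ^ N. (c k)\<^sup>2) = 2 ^ N * (\<Sum>i<N. (a i)\<^sup>2)" by blast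
  let ?d = "\<lambda>k. c (k div 2) + a N * (- 1) ^ k"
  have "(\<Sum>i<Suc N. a i *\<^sub>R rademacher i) = L1step (Suc N) ?d"
    by (simp only: sum.lessThan_Suc c(1) L1step_refine[of N c, symmetric])
      (simp only: rademacher_def L1step_scaleR L1step_add)
  moreover have "(\<Sum>k<2 ^ Suc N. (?d k)\<^sup>2) = 2 ^ Suc N * (\<Sum>i<Suc N. (a i)\<^sup>2)"
  proof -
    have "(\<Sum>k<2 ^ Suc N. (?d k)\<^sup>2) = (\<Sum>k<2 ^ N. (c k + a N)\<^sup>2 + (c k - a N)\<^sup>2)"
      using sum_double[of "\<lambda>k. (?d k)\<^sup>2" "2 ^ N"] by (simp add: power_mult)
    also have "\<dots> = (\<Sum>k<2 ^ N. 2 * (c k)\<^sup>2 + 2 * (a N)\<^sup>2)"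
      by (intro sum.cong refl) (simp add: power2_eq_square algebra_simps)
    also have "\<dots> = 2 * (\<Sum>k<2 ^ N. (c k)\<^sup>2) + 2 ^ N * (2 * (a N)\<^sup>2)" by (simp add: sum.distrib sum_distrib_left)
    finally show ?thesis by (simp add: c(2) algebra_simps)
  qed
  ultimately show ?case by blast
qed

text \<open>On a probability space the mean of the absolute value is at most the quadratic
  mean.\<close>

lemma norm_rademacher_sum_le: "norm (\<Sum>i<N. a i *\<^sub>R rademacher i) \<le> sqrt (\<Sum>i<N. (a i)\<^sup>2)"
proof -
  obtain c where c: "(\<Sum>i<N. a i *\<^sub>R rademacher i) = L1step N c" "(\<Sum>k<2 ^ N. (c k)\<^sup>2) = 2 ^ N * (\<Sum>i<N. (a i)\<^sup>2)"
    using rademacher_sum by blast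
  have "(\<Sum>k<2 ^ N. \<bar>c k\<bar> * 1)\<^sup>2 \<le> (\<Sum>k<2 ^ N. \<bar>c k\<bar>\<^sup>2) * (\<Sum>k<2 ^ N :: nat. 1\<^sup>2)"
    by (rule Cauchy_Schwarz_ineq_sum)
  also have "\<dots> = (2 ^ N)\<^sup>2 * (\<Sum>i<N. (a i)\<^sup>2)"
    by (simp only: power2_abs c(2)) (simp add: power2_eq_square[of "2 ^ N"])
  finally have "(\<Sum>k<2 ^ N. \<bar>c k\<bar>) \<le> sqrt ((2 ^ N)\<^sup>2 * (\<Sum>i<N. (a i)\<^sup>2))"
    using real_le_rsqrt by simp
  then have "(\<Sum>k<2 ^ N. \<bar>c k\<bar>) \<le> sqrt (\<Sum>i<N. (a i)\<^sup>2) * 2 ^ N"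
    by (simp add: real_sqrt_mult mult.commute)
  then show ?thesis unfolding c(1) norm_L1step sum_divide_distrib[symmetric]
    by (simp only: pos_divide_le_eq zero_less_power zero_less_numeral)
qed

text \<open>Bessel's inequality: testing \<phi> on the combination with its own values as
  coefficients shows that these values are square summable.\<close>

lemma rademacher_weakly_null:
  fixes \<phi> :: "L1 \<Rightarrow>\<^sub>L real"
  shows "(\<lambda>i. blinfun_apply \<phi> (rademacher i)) \<longlonglongrightarrow> 0"
proof -
  let ?a = "\<lambda>i. blinfun_apply \<phi> (rademacher i)"
  have "(\<Sum>i<N. (?a i)\<^sup>2) \<le> (norm \<phi>)\<^sup>2" for N
  proof -
    define s where "s = (\<Sum>i<N. (?a i)\<^sup>2)"
    have s0: "0 \<le> s" unfolding s_def by (intro sum_nonneg) simp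
    have "s = blinfun_apply \<phi> (\<Sum>i<N. ?a i *\<^sub>R rademacher i)"
      by (simp add: s_def blinfun.sum_right blinfun.scaleR_right power2_eq_square)
    also have "\<dots> \<le> norm \<phi> * norm (\<Sum>i<N. ?a i *\<^sub>R rademacher i)"
      using norm_blinfun[of \<phi> "\<Sum>i<N. ?a i *\<^sub>R rademacher i"] by simp
    also have "\<dots> \<le> norm \<phi> * sqrt s" unfolding s_def by (intro mult_left_mono norm_rademacher_sum_le) simp
    finally have le: "sqrt s * sqrt s \<le> norm \<phi> * sqrt s" using s0 by simp
    have "sqrt s \<le> norm \<phi>"
    proof (cases "s = 0")
      case False
      then have "0 < sqrt s" using s0 by simp
      with le show ?thesis by (rule mult_right_le_imp_le)
    qed simp
    then show ?thesis unfolding s_def by (rule sqrt_le_D)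
  qed
  then have "summable (\<lambda>i. (?a i)\<^sup>2)"
    by (intro bounded_imp_summable[of _ "(norm \<phi>)\<^sup>2"]) (simp_all only: zero_le_power2 lessThan_Suc_atMost[symmetric])
  then have "(\<lambda>i. sqrt ((?a i)\<^sup>2)) \<longlonglongrightarrow> sqrt 0" by (intro tendsto_real_sqrt summable_LIMSEQ_zero)
  then show ?thesis by (simp add: tendsto_rabs_zero_iff)
qed

lemma fixes_copy_lower_bound:
  assumes "fixes_copy_of_L1 T"
  obtains J :: "L1 \<Rightarrow>\<^sub>L 'x::banach" and c where "0 < c" "\<And>\<phi>. c * norm \<phi> \<le> norm (blinfun_apply T (blinfun_apply J \<phi>))"
proof -
  obtain Z and J :: "L1 \<Rightarrow>\<^sub>L 'x" where J: "isomorphic_embedding_on UNIV J" "range (blinfun_apply J) = Z" "isomorphic_embedding_on Z T"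
    using assms unfolding fixes_copy_of_L1_def by blast
  obtain a where a: "0 < a" "\<And>\<phi>. a * norm \<phi> \<le> norm (blinfun_apply J \<phi>)"
    using J(1) unfolding isomorphic_embedding_on_def by blast
  obtain b where b: "0 < b" "\<And>z. z \<in> Z \<Longrightarrow> b * norm z \<le> norm (blinfun_apply T z)"
    using J(3) unfolding isomorphic_embedding_on_def by blast
  have "b * a * norm \<phi> \<le> norm (blinfun_apply T (blinfun_apply J \<phi>))" for \<phi>
    using order_trans[OF mult_left_mono[OF a(2)[of \<phi>] less_imp_le[OF b(1)]] b(2)[of "blinfun_apply J \<phi>"]] J(2)
    by (auto simp: mult.assoc)
  with a(1) b(1) show ?thesis by (intro that[of "b * a"]) auto
qed

theorem dunford_pettis_imp_not_fixes_L1: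
  fixes T :: "'x::banach \<Rightarrow>\<^sub>L 'y::banach"
  assumes "dunford_pettis T"
  shows "\<not> fixes_copy_of_L1 T"
proof
  assume "fixes_copy_of_L1 T"
  then obtain J :: "L1 \<Rightarrow>\<^sub>L 'x" and c where c: "0 < c" "\<And>\<phi>. c * norm \<phi> \<le> norm (blinfun_apply T (blinfun_apply J \<phi>))"
    by (rule fixes_copy_lower_bound) blast
  have "weakly_convergent_to (\<lambda>i. blinfun_apply J (rademacher i)) 0"
    unfolding weakly_convergent_to_def
  proof
    fix \<psi> :: "'x \<Rightarrow>\<^sub>L real"
    show "(\<lambda>i. blinfun_apply \<psi> (blinfun_apply J (rademacher i))) \<longlonglongrightarrow> blinfun_apply \<psi> 0"
      using rademacher_weakly_null[of "\<psi> o\<^sub>L J"] by (simp add: blinfun.zero_right)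
  qed
  then have "(\<lambda>i. blinfun_apply T (blinfun_apply J (rademacher i))) \<longlonglongrightarrow> blinfun_apply T 0"
    using assms unfolding dunford_pettis_def by blast
  then have "(\<lambda>i. norm (blinfun_apply T (blinfun_apply J (rademacher i)))) \<longlonglongrightarrow> 0"
    by (simp add: blinfun.zero_right tendsto_norm_zero)
  moreover have "c \<le> norm (blinfun_apply T (blinfun_apply J (rademacher i)))" for i
    using c(2)[of "rademacher i"] by (simp add: norm_rademacher)
  ultimately have "c \<le> 0" by (intro LIMSEQ_le_const) auto
  with c(1) show False by simp
qed

section \<open>The dyadic martingale\<close>

definition dyadic_index :: "nat \<Rightarrow> real \<Rightarrow> nat" where
  "dyadic_index n x = nat \<lfloor>2 ^ n * x\<rfloor>"

lemma dyadic_index_measurable: "dyadic_index n \<in> measurable unit_interval (count_space UNIV)"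
proof -
  have "(\<lambda>x :: real. nat \<lfloor>2 ^ n * x\<rfloor>) \<in> measurable borel (count_space UNIV)" by measurable
  then have "dyadic_index n \<in> measurable lebesgue (count_space UNIV)"
    unfolding dyadic_index_def[abs_def] by (intro measurable_completion) simp
  then show ?thesis by (rule measurable_restrict_space1)
qed

lemma dyadic_index_Suc: "dyadic_index (Suc n) x div 2 = dyadic_index n x"
proof -
  have "\<lfloor>2 ^ Suc n * x\<rfloor> div 2 = \<lfloor>2 ^ n * x\<rfloor>"
    using floor_divide_real_eq_div[of 2 "2 ^ Suc n * x"] by simp
  then show ?thesis unfolding dyadic_index_def by (metis nat_div_distrib' nat_numeral zero_le_numeral)
qed

lemma dyadic_index_less: "0 \<le> x \<Longrightarrow> x < 1 \<Longrightarrow> dyadic_index n x < 2 ^ n"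
proof -
  assume x: "0 \<le> x" "x < 1"
  then have "2 ^ n * x < 2 ^ n" by simp
  then have "\<lfloor>2 ^ n * x\<rfloor> < 2 ^ n" by (simp add: floor_less_iff)
  then show ?thesis using x by (simp add: dyadic_index_def nat_less_iff)
qed

theorem radon_nikodym_imp_not_fixes_L1:
  fixes T :: "'x::banach \<Rightarrow>\<^sub>L 'y::banach"
  assumes "radon_nikodym T"
  shows "\<not> fixes_copy_of_L1 T"
proof
  assume "fixes_copy_of_L1 T"
  then obtain J :: "L1 \<Rightarrow>\<^sub>L 'x" and c where c: "0 < c" "\<And>\<phi>. c * norm \<phi> \<le> norm (blinfun_apply T (blinfun_apply J \<phi>))"
    by (rule fixes_copy_lower_bound) blast
  let ?P = unit_interval
  interpret prob_space ?P by (rule prob_space_unit_interval)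
  \<comment> \<open>The indicator of a cell, normalised to norm 1. The index 2^n, which occurs only
    at the point 1, selects no coefficient and yields 0.\<close>
  define e where "e n k = L1step n (\<lambda>j. if j = k then 2 ^ n else 0)" for n k
  define X where "X n \<omega> = blinfun_apply J (e n (dyadic_index n \<omega>))" for n \<omega>
  define F where "F n = vimage_algebra {0..1} (dyadic_index n) (count_space UNIV)" for n
  have sp: "space ?P = {0..1}" by (simp add: space_restrict_space)
  have spF: "space (F n) = {0..1}" for n by (simp add: F_def)
  have F_iff: "A \<in> sets (F n) \<longleftrightarrow> (\<exists>S. A = dyadic_index n -` S \<inter> {0..1})" for A n
    by (auto simp: F_def sets_vimage_algebra2)
  have sub: "subalgebra ?P (F n)" for n
  proof -
    have "dyadic_index n -` S \<inter> {0..1} \<in> sets ?P" for S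
      using measurable_sets[OF dyadic_index_measurable, of S n] by (simp add: sp)
    then show ?thesis unfolding subalgebra_def using F_iff sp spF by auto
  qed
  have mono: "sets (F m) \<subseteq> sets (F n)" if "m \<le> n" for m n
    using that
  proof (induction n rule: dec_induct)
    case (step n)
    have "dyadic_index n -` S \<inter> {0..1} = dyadic_index (Suc n) -` {k. k div 2 \<in> S} \<inter> {0..1}" for S
      by (auto simp: dyadic_index_Suc)
    then have "sets (F n) \<subseteq> sets (F (Suc n))"
      by (intro subsetI) (simp only: F_iff, elim exE, simp only:, rule exI, rule refl)
    with step.IH show ?case by (rule order_trans)
  qed simp
  have range: "dyadic_index n \<omega> \<in> {..2 ^ n}" if "\<omega> \<in> {0..1}" for n \<omega>
  proof (cases "\<omega> = 1")
    case True
    then show ?thesis by (simp add: dyadic_index_def nat_power_eq)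
  next
    case False
    then show ?thesis using dyadic_index_less[of \<omega> n] that by auto
  qed
  have simple: "simple_function (F n) (\<lambda>\<omega>. g (dyadic_index n \<omega>))" for n and g :: "nat \<Rightarrow> 'z"
    unfolding simple_function_def spF
  proof (intro conjI ballI)
    have "(\<lambda>\<omega>. g (dyadic_index n \<omega>)) ` {0..1} \<subseteq> g ` {..2 ^ n}" using range by blast
    then show "finite ((\<lambda>\<omega>. g (dyadic_index n \<omega>)) ` {0..1})" by (rule finite_subset) simp
    show "(\<lambda>\<omega>. g (dyadic_index n \<omega>)) -` {y} \<inter> {0..1} \<in> sets (F n)" for y
      unfolding F_iff by (intro exI[of _ "g -` {y}"]) auto
  qed
  have simpleP: "simple_function ?P (\<lambda>\<omega>. g (dyadic_index n \<omega>))" for n and g :: "nat \<Rightarrow> 'z"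
    using simple[of n g] sub[of n] by (auto simp: simple_function_def subalgebra_def)
  have bhi: "bochner_has_integral M h (Bochner_Integration.simple_bochner_integral M h)"
    if "simple_function M h" "finite_measure M" for M and h :: "real \<Rightarrow> 'x"
  proof (rule bochner_has_integral.intros[where s = "\<lambda>_. h"])
    interpret M: finite_measure M by fact
    show "Bochner_Integration.simple_bochner_integrable M h"
      using that(1) by (intro simple_bochner_integrable.intros) auto
  qed (use that(1) in \<open>auto intro: borel_measurable_simple_function\<close>)
  \<comment> \<open>The integral of X n over the union of the cells with index in S is J of the
    indicator of that union. It depends on the set and not on the level, which is the martingale
    property.\<close>
  have val: "Bochner_Integration.simple_bochner_integral ?P (\<lambda>\<omega>. indicator (dyadic_index n -` S \<inter> {0..1}) \<omega> *\<^sub>R X n \<omega>) =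
      blinfun_apply J (L1step n (indicator S))" for n S
  proof -
    let ?h = "\<lambda>\<omega>. indicator (dyadic_index n -` S \<inter> {0..1}) \<omega> *\<^sub>R X n \<omega>"
    let ?v = "\<lambda>k. indicator S k *\<^sub>R blinfun_apply J (e n k)"
    have hv: "?h \<omega> = ?v (dyadic_index n \<omega>)" if "\<omega> \<in> {0..1}" for \<omega>
      using that by (auto simp: indicator_def X_def)
    have "simple_function ?P ?h"
      using simpleP[of ?v n] hv by (subst simple_function_cong[of ?P ?h "\<lambda>\<omega>. ?v (dyadic_index n \<omega>)"]) (auto simp: sp)
    then have "Bochner_Integration.simple_bochner_integral ?P ?h =
        (\<Sum>y\<in>dyadic_index n ` space ?P. measure ?P {x \<in> space ?P. dyadic_index n x = y} *\<^sub>R ?v y)"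
      using simpleP[of "\<lambda>k. k" n] hv
      by (intro simple_bochner_integral_partition simple_bochner_integrable.intros) (auto simp: sp)
    also have "\<dots> = (\<Sum>k\<in>{..2 ^ n}. measure ?P {x \<in> space ?P. dyadic_index n x = k} *\<^sub>R ?v k)"
    proof (rule sum.mono_neutral_left)
      show "\<forall>k\<in>{..2 ^ n} - dyadic_index n ` space ?P. measure ?P {x \<in> space ?P. dyadic_index n x = k} *\<^sub>R ?v k = 0"
      proof
        fix k assume "k \<in> {..2 ^ n} - dyadic_index n ` space ?P"
        then have "{x \<in> space ?P. dyadic_index n x = k} = {}" by auto
        then show "measure ?P {x \<in> space ?P. dyadic_index n x = k} *\<^sub>R ?v k = 0" by (simp only: measure_empty) simp
      qed
    qed (use range in \<open>auto simp: sp\<close>)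
    also have "{..2 ^ n} = insert (2 ^ n) {..<2 ^ n :: nat}" by auto
    also have "(\<Sum>k\<in>insert (2 ^ n) {..<2 ^ n}. measure ?P {x \<in> space ?P. dyadic_index n x = k} *\<^sub>R ?v k) =
        (\<Sum>k<2 ^ n. measure ?P {x \<in> space ?P. dyadic_index n x = k} *\<^sub>R ?v k)"
    proof -
      have "x = 1" if "x \<in> {0..1}" "dyadic_index n x = 2 ^ n" for x
        using dyadic_index_less[of x n] that by fastforce
      then have "{x \<in> space ?P. dyadic_index n x = 2 ^ n} \<subseteq> {1}" by (auto simp: sp)
      then have "measure ?P {x \<in> space ?P. dyadic_index n x = 2 ^ n} \<le> measure ?P {1}"
        by (intro finite_measure_mono) (auto simp: sets_restrict_space_iff)
      also have "\<dots> = 0" by (subst measure_restrict_space) auto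
      finally have "measure ?P {x \<in> space ?P. dyadic_index n x = 2 ^ n} = 0" by (simp add: measure_le_0_iff)
      then show ?thesis by simp
    qed
    also have "\<dots> = (\<Sum>k<2 ^ n. blinfun_apply J (L1step n (\<lambda>j. if j = k then indicator S k else 0)))"
    proof (rule sum.cong)
      fix k assume "k \<in> {..<2 ^ n :: nat}"
      then have k: "k < 2 ^ n" by simp
      have "{x \<in> space ?P. dyadic_index n x = k} = dyadic n k"
        using dyadic_subset[OF k] by (auto simp: sp mem_dyadic dyadic_index_def)
      then have "measure ?P {x \<in> space ?P. dyadic_index n x = k} = 1 / 2 ^ n" using measure_dyadic[OF k] by simp
      moreover have "(\<lambda>j. 1 / 2 ^ n * (indicator S k * (if j = k then 2 ^ n else 0))) = (\<lambda>j. if j = k then indicator S k else 0 :: real)"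
        by auto
      then have "(1 / 2 ^ n) *\<^sub>R (indicator S k *\<^sub>R e n k) = L1step n (\<lambda>j. if j = k then indicator S k else 0)"
        unfolding e_def L1step_scaleR by simp
      ultimately show "measure ?P {x \<in> space ?P. dyadic_index n x = k} *\<^sub>R ?v k =
          blinfun_apply J (L1step n (\<lambda>j. if j = k then indicator S k else 0))"
        by (metis blinfun.scaleR_right)
    qed simp
    also have "\<dots> = blinfun_apply J (L1step n (indicator S))"
    proof -
      have "(\<Sum>k<N. L1step n (\<lambda>j. if j = k then indicator S k else 0)) = L1step n (\<lambda>j. if j < N then indicator S j else 0)" for N
      proof (induction N)
        case 0
        show ?case using L1step_scaleR[of 0 n "\<lambda>_. 0"] by simp
      next
        case (Suc N)
        have "(\<lambda>j. (if j < N then indicator S j else 0) + (if j = N then indicator S N else 0)) =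
            (\<lambda>j. if j < Suc N then indicator S j else 0 :: real)" by (auto simp: less_Suc_eq)
        then show ?case by (simp add: Suc L1step_add)
      qed
      moreover have "step n (\<lambda>j. if j < 2 ^ n then indicator S j else 0) = step n (indicator S)"
        unfolding step_def by (intro ext sum.cong) auto
      ultimately show ?thesis by (simp add: blinfun.sum_right[symmetric] L1step_def)
    qed
    finally show ?thesis .
  qed
  have "bochner_martingale ?P F X"
    unfolding bochner_martingale_def
  proof (intro conjI allI impI ballI sub mono)
    fix n
    show "bochner_integrable (restr_to_subalg ?P (F n)) (X n)"
      unfolding bochner_integrable_def
    proof (rule exI, rule bhi)
      show "simple_function (restr_to_subalg ?P (F n)) (X n)"
        using simple[of n "\<lambda>k. blinfun_apply J (e n k)"]
        by (simp add: simple_function_def X_def[abs_def] space_restr_to_subalg sets_restr_to_subalg[OF sub] spF sp)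
      show "finite_measure (restr_to_subalg ?P (F n))" by (rule finite_measure_restr_to_subalg[OF sub]) unfold_locales
    qed
  next
    fix m n A assume mn: "m \<le> n" and "A \<in> sets (F m)"
    then obtain S where A: "A = dyadic_index m -` S \<inter> {0..1}" using F_iff by blast
    have idx: "dyadic_index n \<omega> div 2 ^ (n - m) = dyadic_index m \<omega>" for \<omega>
      using mn
    proof (induction n rule: dec_induct)
      case (step n)
      then have "dyadic_index (Suc n) \<omega> div 2 ^ (Suc n - m) = (dyadic_index (Suc n) \<omega> div 2) div 2 ^ (n - m)"
        by (simp add: Suc_diff_le div_mult2_eq)
      then show ?case using step by (simp add: dyadic_index_Suc)
    qed simp
    have A': "A = dyadic_index n -` {k. k div 2 ^ (n - m) \<in> S} \<inter> {0..1}" by (auto simp: A idx)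
    have si: "simple_function ?P (\<lambda>\<omega>. indicator (dyadic_index l -` R \<inter> {0..1}) \<omega> *\<^sub>R X l \<omega>)" for l R
      using simpleP[of "\<lambda>k. indicator R k *\<^sub>R blinfun_apply J (e l k)" l]
      by (rule simple_function_cong[THEN iffD1, rotated]) (auto simp: sp X_def indicator_def)
    have fin: "finite_measure ?P" by unfold_locales
    show "\<exists>x. bochner_has_integral ?P (\<lambda>\<omega>. indicator A \<omega> *\<^sub>R X m \<omega>) x \<and>
        bochner_has_integral ?P (\<lambda>\<omega>. indicator A \<omega> *\<^sub>R X n \<omega>) x"
    proof (intro exI conjI)
      show "bochner_has_integral ?P (\<lambda>\<omega>. indicator A \<omega> *\<^sub>R X m \<omega>) (blinfun_apply J (L1step m (indicator S)))"
        using bhi[OF si fin, of m S] unfolding A val .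
      have "(indicator {k. k div 2 ^ (n - m) \<in> S} :: nat \<Rightarrow> real) = (\<lambda>k. indicator S (k div 2 ^ (n - m)))"
        by (auto simp: indicator_def)
      then have "L1step n (indicator {k. k div 2 ^ (n - m) \<in> S}) = L1step m (indicator S)"
        using L1step_refine_le[OF mn, of "indicator S"] by simp
      then show "bochner_has_integral ?P (\<lambda>\<omega>. indicator A \<omega> *\<^sub>R X n \<omega>) (blinfun_apply J (L1step m (indicator S)))"
        using bhi[OF si fin, of n "{k. k div 2 ^ (n - m) \<in> S}"] unfolding A' val by simp
    qed
  qed
  moreover have "L1_bounded ?P X"
    unfolding L1_bounded_def
  proof (intro exI allI)
    fix n
    have ne: "norm (e n k) \<le> 1" for k
    proof -
      have "(\<Sum>j<2 ^ n. \<bar>if j = k then 2 ^ n else 0 :: real\<bar> / 2 ^ n) = (\<Sum>j<2 ^ n. if j = k then 1 else 0)"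
        by (intro sum.cong) auto
      then show ?thesis by (simp add: e_def norm_L1step)
    qed
    have "norm (X n \<omega>) \<le> norm J" for \<omega>
      using norm_blinfun[of J "e n (dyadic_index n \<omega>)"] mult_left_mono[OF ne[of "dyadic_index n \<omega>"] norm_ge_zero[of J]]
      by (simp add: X_def)
    then have "(\<integral>\<^sup>+\<omega>. norm (X n \<omega>) \<partial>?P) \<le> (\<integral>\<^sup>+\<omega>. ennreal (norm J) \<partial>?P)" by (intro nn_integral_mono ennreal_leI)
    then show "(\<integral>\<^sup>+\<omega>. norm (X n \<omega>) \<partial>?P) \<le> ennreal (norm J)"
      using emeasure_space_1 by (simp add: sp)
  qed
  ultimately have conv: "AE \<omega> in ?P. convergent (\<lambda>n. blinfun_apply T (X n \<omega>))"
    using radon_nikodym_all_types[OF assms, where 'p = real] prob_space_axioms unfolding radon_nikodym_on_def by blast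
  have "AE \<omega> in ?P. \<omega> \<noteq> 1"
    by (rule AE_I[of _ _ "{1}"]) (auto simp: emeasure_restrict_space sets_restrict_space_iff)
  with conv have "AE \<omega> in ?P. convergent (\<lambda>n. blinfun_apply T (X n \<omega>)) \<and> \<omega> \<noteq> 1" by eventually_elim simp
  moreover have "AE \<omega> in ?P. \<omega> \<in> {0..1}" using AE_space[of ?P] by (simp only: sp)
  ultimately have AE1: "AE \<omega> in ?P. \<omega> \<in> {0..1} \<and> \<omega> \<noteq> 1 \<and> convergent (\<lambda>n. blinfun_apply T (X n \<omega>))"
    by eventually_elim blast
  obtain \<omega> where \<omega>: "\<omega> \<in> {0..1}" "\<omega> \<noteq> 1" "convergent (\<lambda>n. blinfun_apply T (X n \<omega>))"
  proof -
    have "\<exists>\<omega>. \<omega> \<in> {0..1} \<and> \<omega> \<noteq> 1 \<and> convergent (\<lambda>n. blinfun_apply T (X n \<omega>))"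
    proof (rule ccontr)
      assume no: "\<not> ?thesis"
      from AE1 have "AE \<omega> in ?P. False" by eventually_elim (use no in blast)
      then show False by simp
    qed
    then show ?thesis using that by blast
  qed
  \<comment> \<open>Normalised indicators of a cell and of the cell around it are at distance 1:
    their difference has modulus 2^n on both halves of the larger cell. So the images under T never
    become close.\<close>
  have gap: "c \<le> norm (blinfun_apply T (X (Suc n) \<omega>) - blinfun_apply T (X n \<omega>))" for n
  proof -
    define k where "k = dyadic_index (Suc n) \<omega>"
    have k: "k < 2 ^ Suc n" "k div 2 = dyadic_index n \<omega>"
      using dyadic_index_less[of \<omega> "Suc n"] \<omega> by (auto simp: k_def dyadic_index_Suc)
    have "e n (k div 2) = L1step (Suc n) (\<lambda>j. if j div 2 = k div 2 then 2 ^ n else 0)"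
      unfolding e_def by (subst L1step_refine[symmetric]) simp
    then have "e (Suc n) k - e n (k div 2) =
        L1step (Suc n) (\<lambda>j. (if j = k then 2 ^ Suc n else 0) - (if j div 2 = k div 2 then 2 ^ n else 0))"
      by (simp add: e_def L1step_diff)
    then have "norm (e (Suc n) k - e n (k div 2)) =
        (\<Sum>j<2 ^ Suc n. \<bar>(if j = k then 2 ^ Suc n else 0) - (if j div 2 = k div 2 then 2 ^ n else 0)\<bar> / 2 ^ Suc n)"
      by (simp add: norm_L1step)
    also have "\<dots> = (\<Sum>j<2 ^ Suc n. if j div 2 = k div 2 then 1 / 2 else 0)"
      by (intro sum.cong) auto
    also have "\<dots> = (\<Sum>i<2 ^ n. if i = k div 2 then 1 else 0 :: real)"
      unfolding power_Suc sum_double by (intro sum.cong) auto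
    also have "\<dots> = 1" using k(1) by (simp add: less_mult_imp_div_less mult.commute)
    finally have "norm (e (Suc n) k - e n (k div 2)) = 1" .
    with c(2)[of "e (Suc n) k - e n (k div 2)"]
    show ?thesis by (simp add: X_def k_def[symmetric] k(2)[symmetric] blinfun.diff_right)
  qed
  obtain l where l: "(\<lambda>n. blinfun_apply T (X n \<omega>)) \<longlonglongrightarrow> l" using \<omega>(3) by (auto simp: convergent_def)
  have "(\<lambda>n. norm (blinfun_apply T (X (Suc n) \<omega>) - blinfun_apply T (X n \<omega>))) \<longlonglongrightarrow> norm (l - l)"
    by (intro tendsto_intros l LIMSEQ_Suc[OF l])
  then have "c \<le> norm (l - l)" by (rule LIMSEQ_le_const) (use gap in auto)
  with c(1) show False by simp
qed

section \<open>Density of step functions\<close>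

lemma norm_abs_L1_diff:
  assumes "integrable unit_interval f" "integrable unit_interval g"
  shows "norm (abs_L1 f - abs_L1 g) = (\<integral>x. \<bar>f x - g x\<bar> \<partial>unit_interval)"
proof -
  have "L1_rel f f" "L1_rel g g" "L1_rel (\<lambda>x. f x - g x) (\<lambda>x. f x - g x)"
    using assms by (simp_all add: L1_rel_def)
  then show ?thesis by (simp add: minus_L1.abs_eq norm_L1.abs_eq)
qed

lemma L1step_add_levels: "\<exists>l e. L1step n c + L1step m d = L1step l e"
proof -
  have "L1step n c = L1step (max n m) (\<lambda>k. c (k div 2 ^ (max n m - n)))"
    by (rule L1step_refine_le[symmetric]) simp
  moreover have "L1step m d = L1step (max n m) (\<lambda>k. d (k div 2 ^ (max n m - m)))"
    by (rule L1step_refine_le[symmetric]) simp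
  ultimately have "L1step n c + L1step m d =
      L1step (max n m) (\<lambda>k. c (k div 2 ^ (max n m - n)) + d (k div 2 ^ (max n m - m)))"
    by (simp add: L1step_add)
  then show ?thesis by blast
qed

text \<open>A point of an open set has its whole dyadic cell inside the set from some level on;
  dominated convergence does the rest.\<close>

lemma indicator_open_approx_step:
  assumes U: "open U"
  shows "(\<lambda>n. \<integral>x. \<bar>indicator U x * c - step n (\<lambda>k. if dyadic n k \<subseteq> U then c else 0) x\<bar> \<partial>unit_interval) \<longlonglongrightarrow> 0"
proof -
  interpret prob_space unit_interval by (rule prob_space_unit_interval)
  let ?s = "\<lambda>n. step n (\<lambda>k. if dyadic n k \<subseteq> U then c else 0)"
  have Um: "indicator U \<in> borel_measurable unit_interval"
    by (rule measurable_restrict_space1, rule measurable_completion) (use U in auto)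
  have sm: "?s n \<in> borel_measurable unit_interval" for n using integrable_step by auto
  have sval: "?s n x = (if dyadic n (dyadic_index n x) \<subseteq> U then c else 0)" if "x \<in> {0..<1}" for n x
    by (rule step_eq) (use that in \<open>auto simp: mem_dyadic dyadic_index_less, simp add: dyadic_index_def\<close>)
  have AE: "AE x in unit_interval. x \<in> {0..<1}"
  proof -
    have "AE x in unit_interval. x \<noteq> 1"
      by (rule AE_I[of _ _ "{1}"]) (auto simp: emeasure_restrict_space sets_restrict_space_iff)
    moreover have "AE x in unit_interval. x \<in> {0..1}" using AE_space[of unit_interval] by (simp add: space_restrict_space)
    ultimately show ?thesis by eventually_elim auto
  qed
  have "(\<lambda>n. \<integral>x. \<bar>indicator U x * c - ?s n x\<bar> \<partial>unit_interval) \<longlonglongrightarrow> (\<integral>x. 0 \<partial>unit_interval)"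
  proof (rule integral_dominated_convergence[where w = "\<lambda>_. 2 * \<bar>c\<bar>"])
    show "AE x in unit_interval. (\<lambda>n. \<bar>indicator U x * c - ?s n x\<bar>) \<longlonglongrightarrow> 0"
      using AE
    proof eventually_elim
      fix x :: real assume x: "x \<in> {0..<1}"
      have mem: "x \<in> dyadic n (dyadic_index n x)" for n using x by (simp add: mem_dyadic dyadic_index_def)
      have "\<forall>\<^sub>F n in sequentially. \<bar>indicator U x * c - ?s n x\<bar> = 0"
      proof (cases "x \<in> U")
        case False
        then have "\<not> dyadic n (dyadic_index n x) \<subseteq> U" for n using mem by blast
        then show ?thesis using False sval[OF x] by simp
      next
        case True
        then obtain r where r: "0 < r" "ball x r \<subseteq> U" using U openE by blast
        have "(\<lambda>n. (1 / 2 :: real) ^ n) \<longlonglongrightarrow> 0" by (rule LIMSEQ_power_zero) simp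
        then have "\<forall>\<^sub>F n in sequentially. (1 / 2 :: real) ^ n < r" using r(1) by (rule order_tendstoD)
        then show ?thesis
        proof eventually_elim
          fix n assume n: "(1 / 2 :: real) ^ n < r"
          have "dyadic n (dyadic_index n x) \<subseteq> ball x r"
          proof
            fix z assume z: "z \<in> dyadic n (dyadic_index n x)"
            have "real (Suc k) / 2 ^ n = real k / 2 ^ n + (1 / 2) ^ n" for k
              by (simp add: add_divide_distrib power_divide)
            then have "\<bar>x - z\<bar> < (1 / 2) ^ n" using z mem[of n] unfolding dyadic_def by (simp only: atLeastLessThan_iff) linarith
            then show "z \<in> ball x r" using n by (simp add: dist_real_def)
          qed
          then show "\<bar>indicator U x * c - ?s n x\<bar> = 0" using r(2) True sval[OF x] by simp
        qed
      qed
      then show "(\<lambda>n. \<bar>indicator U x * c - ?s n x\<bar>) \<longlonglongrightarrow> 0" by (rule tendsto_eventually)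
    qed
    show "AE x in unit_interval. norm \<bar>indicator U x * c - ?s n x\<bar> \<le> 2 * \<bar>c\<bar>" for n
      using AE
    proof eventually_elim
      fix x :: real assume "x \<in> {0..<1}"
      from sval[OF this] show "norm \<bar>indicator U x * c - ?s n x\<bar> \<le> 2 * \<bar>c\<bar>" by (auto simp: indicator_def)
    qed
    show "(\<lambda>x. \<bar>indicator U x * c - ?s n x\<bar>) \<in> borel_measurable unit_interval" for n
      using Um sm by measurable
  qed simp_all
  then show ?thesis by simp
qed

text \<open>Outer regularity reduces measurable sets to open ones; linearity and dominated
  convergence pass to integrable functions.\<close>

lemma integrable_approx_L1step:
  assumes "integrable unit_interval f" "0 < e"
  shows "\<exists>n c. norm (abs_L1 f - L1step n c) < e"
  using assms
proof (induction arbitrary: e rule: integrable_induct)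
  case (base A c)
  interpret prob_space unit_interval by (rule prob_space_unit_interval)
  have A: "A \<in> sets lebesgue" "A \<subseteq> {0..1}" using base(1) by (auto simp: sets_restrict_space_iff)
  define e' where "e' = e / (2 * (\<bar>c\<bar> + 1))"
  have e': "0 < e'" "\<bar>c\<bar> * e' < e / 2"
  proof -
    show p: "0 < e'" using base by (simp add: e'_def add_nonneg_pos)
    have "(\<bar>c\<bar> + 1) * e' = e / 2" unfolding e'_def by (simp add: divide_simps)
    then show "\<bar>c\<bar> * e' < e / 2" using p by (simp add: distrib_right)
  qed
  obtain U where U: "open U" "A \<subseteq> U" "U - A \<in> lmeasurable" "emeasure lebesgue (U - A) < ennreal e'"
    using sets_lebesgue_outer_open[OF A(1) e'(1)] by blast
  have Us: "U \<inter> {0..1} \<in> sets unit_interval" using U(1) by (auto simp: sets_restrict_space_iff)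
  have iA: "integrable unit_interval (indicator A :: real \<Rightarrow> real)"
    using base(1,2) by (intro integrable_real_indicator) auto
  have iU: "integrable unit_interval (\<lambda>x. indicator U x :: real)"
  proof -
    have "integrable unit_interval (indicator (U \<inter> {0..1}) :: real \<Rightarrow> real)"
      using Us emeasure_finite[of "U \<inter> {0..1}"] by (intro integrable_real_indicator) (simp_all only: less_top infinity_ennreal_def not_False_eq_True)
    then show ?thesis
      by (rule Bochner_Integration.integrable_cong[THEN iffD1, OF refl, rotated]) (auto simp: space_restrict_space indicator_def)
  qed
  obtain n where n: "(\<integral>x. \<bar>indicator U x * c - step n (\<lambda>k. if dyadic n k \<subseteq> U then c else 0) x\<bar> \<partial>unit_interval) < e / 2"
    using order_tendstoD(2)[OF indicator_open_approx_step[OF U(1), of c], of "e / 2"] base by (auto simp: eventually_sequentially)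
  let ?s = "step n (\<lambda>k. if dyadic n k \<subseteq> U then c else 0)"
  have "norm (abs_L1 (\<lambda>x. indicator A x *\<^sub>R c) - L1step n (\<lambda>k. if dyadic n k \<subseteq> U then c else 0)) =
      (\<integral>x. \<bar>indicator A x * c - ?s x\<bar> \<partial>unit_interval)"
    unfolding L1step_def using iA by (subst norm_abs_L1_diff) (auto simp: integrable_step)
  also have "\<dots> \<le> (\<integral>x. \<bar>c\<bar> * (indicator U x - indicator A x) + \<bar>indicator U x * c - ?s x\<bar> \<partial>unit_interval)"
  proof (rule integral_mono)
    fix x
    show "\<bar>indicator A x * c - ?s x\<bar> \<le> \<bar>c\<bar> * (indicator U x - indicator A x) + \<bar>indicator U x * c - ?s x\<bar>"
      using U(2) by (cases "x \<in> A"; cases "x \<in> U") auto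
  qed (use iA iU integrable_step in auto)
  also have "\<dots> = \<bar>c\<bar> * ((\<integral>x. indicator U x \<partial>unit_interval) - (\<integral>x. indicator A x \<partial>unit_interval)) +
      (\<integral>x. \<bar>indicator U x * c - ?s x\<bar> \<partial>unit_interval)"
  proof -
    have 1: "integrable unit_interval (\<lambda>x. \<bar>c\<bar> * (indicator U x - indicator A x))" using iA iU by auto
    have 2: "integrable unit_interval (\<lambda>x. \<bar>indicator U x * c - ?s x\<bar>)" using iU integrable_step by auto
    show ?thesis using Bochner_Integration.integral_add[OF 1 2] iA iU by simp
  qed
  also have "\<dots> < \<bar>c\<bar> * e' + e / 2"
  proof -
    have "(\<integral>x. indicat_real U x \<partial>unit_interval) - (\<integral>x. indicat_real A x \<partial>unit_interval) = (\<integral>x. indicat_real U x - indicat_real A x \<partial>unit_interval)"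
      using iA iU by simp
    also have "\<dots> = (\<integral>x. indicat_real ((U - A) \<inter> {0..1}) x \<partial>unit_interval)"
      using U(2) by (intro Bochner_Integration.integral_cong) (auto simp: indicator_def space_restrict_space)
    also have "\<dots> = measure unit_interval ((U - A) \<inter> {0..1})" by (simp add: space_restrict_space Int_assoc)
    also have "\<dots> = measure lebesgue ((U - A) \<inter> {0..1})" using U(3) by (intro measure_restrict_space) auto
    also have "\<dots> \<le> measure lebesgue (U - A)" using U(3) by (intro measure_mono_fmeasurable) auto
    also have "\<dots> \<le> e'" using U(3,4) e'(1) by (simp add: emeasure_eq_measure2 ennreal_less_iff)
    finally have "\<bar>c\<bar> * ((\<integral>x. indicat_real U x \<partial>unit_interval) - (\<integral>x. indicat_real A x \<partial>unit_interval)) \<le> \<bar>c\<bar> * e'"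
      by (rule mult_left_mono) simp
    with n show ?thesis by linarith
  qed
  also have "\<dots> < e" using e'(2) by linarith
  finally show ?case by blast
next
  case (add f g)
  have e2: "0 < e / 2" using add.prems by simp
  obtain n c where c: "norm (abs_L1 f - L1step n c) < e / 2" using add.IH(1)[OF e2] by blast
  obtain m d where d: "norm (abs_L1 g - L1step m d) < e / 2" using add.IH(2)[OF e2] by blast
  obtain l h where h: "L1step n c + L1step m d = L1step l h" using L1step_add_levels by blast
  have "abs_L1 (\<lambda>x. f x + g x) = abs_L1 f + abs_L1 g"
    using add.hyps by (simp add: plus_L1.abs_eq L1_rel_def)
  then have "abs_L1 (\<lambda>x. f x + g x) - L1step l h = (abs_L1 f - L1step n c) + (abs_L1 g - L1step m d)"
    unfolding h[symmetric] by simp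
  then have "norm (abs_L1 (\<lambda>x. f x + g x) - L1step l h) < e"
    using norm_triangle_ineq[of "abs_L1 f - L1step n c" "abs_L1 g - L1step m d"] c d by simp
  then show ?case by blast
next
  case (lim f s)
  have "(\<lambda>i. \<integral>x. \<bar>f x - s i x\<bar> \<partial>unit_interval) \<longlonglongrightarrow> (\<integral>x. 0 \<partial>unit_interval)"
  proof (rule integral_dominated_convergence[where w = "\<lambda>x. 3 * \<bar>f x\<bar>"])
    show "AE x in unit_interval. (\<lambda>i. \<bar>f x - s i x\<bar>) \<longlonglongrightarrow> 0"
    proof (rule AE_I2)
      fix x assume "x \<in> space unit_interval"
      then have "(\<lambda>i. \<bar>f x - s i x\<bar>) \<longlonglongrightarrow> \<bar>f x - f x\<bar>" by (intro tendsto_intros lim.hyps)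
      then show "(\<lambda>i. \<bar>f x - s i x\<bar>) \<longlonglongrightarrow> 0" by simp
    qed
    show "AE x in unit_interval. norm \<bar>f x - s i x\<bar> \<le> 3 * \<bar>f x\<bar>" for i
    proof (rule AE_I2)
      fix x assume "x \<in> space unit_interval"
      then have "\<bar>s i x\<bar> \<le> 2 * \<bar>f x\<bar>" using lim.hyps by fastforce
      then show "norm \<bar>f x - s i x\<bar> \<le> 3 * \<bar>f x\<bar>" by simp
    qed
  qed (use lim.hyps in auto)
  then have "\<forall>\<^sub>F i in sequentially. (\<integral>x. \<bar>f x - s i x\<bar> \<partial>unit_interval) < e / 2"
    using lim.prems by (intro order_tendstoD(2)) auto
  then obtain i where i: "norm (abs_L1 f - abs_L1 (s i)) < e / 2"
    using lim.hyps by (auto simp: eventually_sequentially norm_abs_L1_diff)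
  have "0 < e / 2" using lim.prems by simp
  then obtain n c where c: "norm (abs_L1 (s i) - L1step n c) < e / 2" using lim.IH by blast
  have "norm (abs_L1 f - L1step n c) < e"
    using norm_triangle_ineq[of "abs_L1 f - abs_L1 (s i)" "abs_L1 (s i) - L1step n c"] i c by simp
  then show ?case by blast
qed

lemma L1step_dense:
  fixes z :: L1
  assumes "0 < e"
  obtains n c where "norm (z - L1step n c) < e"
proof -
  have "L1_rel (rep_L1 z) (rep_L1 z)" by (rule Quotient3_rel_rep[OF Quotient3_L1, THEN iffD2, OF refl])
  then have "integrable unit_interval (rep_L1 z)" by (simp add: L1_rel_def)
  from integrable_approx_L1step[OF this assms] show ?thesis
    using that by (auto simp: Quotient3_abs_rep[OF Quotient3_L1])
qed

section \<open>Integration against a Lipschitz path\<close>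

lemma dyadic_inter_sets: "dyadic n k \<inter> {0..1} \<in> sets unit_interval"
  using dyadic_sets[of n k] by (auto simp: sets_restrict_space_iff)

lemma integrable_times_dyadic:
  fixes f :: "real \<Rightarrow> real"
  shows "integrable unit_interval f \<Longrightarrow> integrable unit_interval (\<lambda>x. indicator (dyadic n k \<inter> {0..1}) x * f x)"
  using integrable_mult_indicator[OF dyadic_inter_sets, of f n k] by simp

lift_definition dyadic_integral :: "nat \<Rightarrow> nat \<Rightarrow> L1 \<Rightarrow> real" is
  "\<lambda>n k f. \<integral>x. indicator (dyadic n k \<inter> {0..1}) x * f x \<partial>unit_interval"
proof -
  fix n k and f g :: "real \<Rightarrow> real"
  assume "L1_rel f g"
  then have i: "integrable unit_interval f" "integrable unit_interval g" and ae: "AE x in unit_interval. f x = g x"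
    by (simp_all add: L1_rel_def)
  show "(\<integral>x. indicator (dyadic n k \<inter> {0..1}) x * f x \<partial>unit_interval) = (\<integral>x. indicator (dyadic n k \<inter> {0..1}) x * g x \<partial>unit_interval)"
    by (rule integral_cong_AE)
      (use integrable_times_dyadic[OF i(1)] integrable_times_dyadic[OF i(2)] ae in \<open>auto elim: eventually_mono\<close>)
qed

lemma dyadic_integral_add: "dyadic_integral n k (\<phi> + \<psi>) = dyadic_integral n k \<phi> + dyadic_integral n k \<psi>"
proof transfer
  fix n k and f g :: "real \<Rightarrow> real"
  assume "L1_rel f f" "L1_rel g g"
  then have "integrable unit_interval f" "integrable unit_interval g" by (simp_all add: L1_rel_def)
  from this[THEN integrable_times_dyadic]
  show "(\<integral>x. indicator (dyadic n k \<inter> {0..1}) x * (f x + g x) \<partial>unit_interval) =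
      (\<integral>x. indicator (dyadic n k \<inter> {0..1}) x * f x \<partial>unit_interval) + (\<integral>x. indicator (dyadic n k \<inter> {0..1}) x * g x \<partial>unit_interval)"
    unfolding distrib_left by (rule Bochner_Integration.integral_add)
qed

lemma dyadic_integral_scaleR: "dyadic_integral n k (r *\<^sub>R \<phi>) = r * dyadic_integral n k \<phi>"
proof transfer
  fix n k and r :: real and f :: "real \<Rightarrow> real"
  show "(\<integral>x. indicator (dyadic n k \<inter> {0..1}) x * (r * f x) \<partial>unit_interval) = r * (\<integral>x. indicator (dyadic n k \<inter> {0..1}) x * f x \<partial>unit_interval)"
    by (simp add: mult.left_commute)
qed

lemma dyadic_integral_sum_le: "(\<Sum>k<2 ^ n. \<bar>dyadic_integral n k \<phi>\<bar>) \<le> norm \<phi>"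
proof transfer
  fix n and f :: "real \<Rightarrow> real"
  assume "L1_rel f f"
  then have i: "integrable unit_interval f" and ia: "integrable unit_interval (\<lambda>x. \<bar>f x\<bar>)" by (simp_all add: L1_rel_def)
  let ?i = "\<lambda>k x. indicator (dyadic n k \<inter> {0..1}) x :: real"
  have "(\<Sum>k<2 ^ n. \<bar>\<integral>x. ?i k x * f x \<partial>unit_interval\<bar>) \<le> (\<Sum>k<2 ^ n. \<integral>x. ?i k x * \<bar>f x\<bar> \<partial>unit_interval)"
  proof (rule sum_mono)
    fix k
    have "\<bar>\<integral>x. ?i k x * f x \<partial>unit_interval\<bar> \<le> (\<integral>x. \<bar>?i k x * f x\<bar> \<partial>unit_interval)" by (rule integral_abs_bound)
    then show "\<bar>\<integral>x. ?i k x * f x \<partial>unit_interval\<bar> \<le> (\<integral>x. ?i k x * \<bar>f x\<bar> \<partial>unit_interval)" by (simp add: abs_mult)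
  qed
  also have "\<dots> = (\<integral>x. (\<Sum>k<2 ^ n. ?i k x * \<bar>f x\<bar>) \<partial>unit_interval)"
    by (rule Bochner_Integration.integral_sum[symmetric]) (rule integrable_times_dyadic[OF ia])
  also have "\<dots> \<le> (\<integral>x. \<bar>f x\<bar> \<partial>unit_interval)"
  proof (rule integral_mono)
    show "integrable unit_interval (\<lambda>x. \<Sum>k<2 ^ n. ?i k x * \<bar>f x\<bar>)"
      by (intro Bochner_Integration.integrable_sum integrable_times_dyadic[OF ia])
    fix x
    have "(\<Sum>k<2 ^ n. ?i k x) \<le> (\<Sum>k<2 ^ n. 1 * indicator (dyadic n k) x)" by (intro sum_mono) (auto simp: indicator_def)
    also have "\<dots> = step n (\<lambda>_. 1) x" by (simp add: step_def)
    also have "\<dots> \<le> 1" by (cases "\<exists>j<2 ^ n. x \<in> dyadic n j") (auto simp: step_eq step_outside)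
    finally have "(\<Sum>k<2 ^ n. ?i k x) * \<bar>f x\<bar> \<le> 1 * \<bar>f x\<bar>" by (rule mult_right_mono) simp
    then show "(\<Sum>k<2 ^ n. ?i k x * \<bar>f x\<bar>) \<le> \<bar>f x\<bar>" by (simp add: sum_distrib_right)
  qed (rule ia)
  finally show "(\<Sum>k<2 ^ n. \<bar>\<integral>x. ?i k x * f x \<partial>unit_interval\<bar>) \<le> (\<integral>x. \<bar>f x\<bar> \<partial>unit_interval)" .
qed

lemma dyadic_integral_L1step:
  assumes k: "k < 2 ^ n"
  shows "dyadic_integral n k (L1step n c) = c k / 2 ^ n"
proof -
  have "dyadic_integral n k (L1step n c) = (\<integral>x. indicator (dyadic n k \<inter> {0..1}) x * step n c x \<partial>unit_interval)"
    unfolding L1step_def by (rule dyadic_integral.abs_eq[OF L1_rel_step])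
  also have "\<dots> = (\<integral>x. c k * indicator (dyadic n k) x \<partial>unit_interval)"
    using step_eq[of _ n k c] k by (intro Bochner_Integration.integral_cong) (auto simp: indicator_def space_restrict_space)
  also have "\<dots> = c k / 2 ^ n"
  proof -
    have "dyadic n k \<inter> {0..1} = dyadic n k" using dyadic_subset[OF k] by auto
    then show ?thesis using measure_dyadic[OF k] by (simp add: space_restrict_space)
  qed
  finally show ?thesis .
qed

text \<open>The embedding is \<phi> mapped to the integral of \<phi> against dE; the Lipschitz bound
  on E makes it bounded. For the lower bound on a step function, \<open>dual\<close> is applied to a
  \<Theta> whose slopes are the signs of the coefficients.\<close>

theorem lipschitz_path_imp_fixes_copy_of_L1:
  fixes T :: "'x::banach \<Rightarrow>\<^sub>L 'y::banach" and E :: "real \<Rightarrow> 'x"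
  assumes C: "\<And>s t. s \<in> {0..1} \<Longrightarrow> t \<in> {0..1} \<Longrightarrow> norm (E s - E t) \<le> C * \<bar>s - t\<bar>" and c: "0 < c"
    and dual: "\<And>\<Theta> :: real \<Rightarrow> real. 1-lipschitz_on UNIV \<Theta> \<Longrightarrow> \<exists>\<psi> :: 'x \<Rightarrow>\<^sub>L real.
      (\<forall>\<mu>. c * \<bar>blinfun_apply \<psi> \<mu>\<bar> \<le> norm (blinfun_apply T \<mu>)) \<and>
      (\<forall>s\<in>{0..1}. \<forall>t\<in>{0..1}. blinfun_apply \<psi> (E s - E t) = \<Theta> s - \<Theta> t)"
  shows "fixes_copy_of_L1 T"
proof -
  have C0: "0 \<le> C" using order_trans[OF norm_ge_zero C[of 1 0]] by simp
  define \<Delta> where "\<Delta> n k = E (real (Suc k) / 2 ^ n) - E (real k / 2 ^ n)" for n k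
  define V where "V n a = (\<Sum>k<2 ^ n. a k *\<^sub>R \<Delta> n k)" for n and a :: "nat \<Rightarrow> real"
  \<comment> \<open>The Stieltjes sum with \<phi> replaced by its averages over the cells of level
    n.\<close>
  define Jn where "Jn n \<phi> = V n (\<lambda>k. 2 ^ n * dyadic_integral n k \<phi>)" for n \<phi>
  have grid: "real k / 2 ^ n \<in> {0..1}" if "k \<le> 2 ^ n" for k n
  proof -
    have "real k \<le> real (2 ^ n)" using that by (rule of_nat_mono)
    then show ?thesis by simp
  qed
  have norm\<Delta>: "norm (\<Delta> n k) \<le> C / 2 ^ n" if k: "k < 2 ^ n" for n k
  proof -
    have "\<bar>real (Suc k) / 2 ^ n - real k / 2 ^ n\<bar> = 1 / 2 ^ n" by (simp add: diff_divide_distrib[symmetric])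
    then show ?thesis using C[OF grid[of "Suc k" n] grid[of k n]] k by (simp add: \<Delta>_def)
  qed
  have Jn_norm: "norm (Jn n \<phi>) \<le> C * norm \<phi>" for n \<phi>
  proof -
    have "norm (Jn n \<phi>) \<le> (\<Sum>k<2 ^ n. C * \<bar>dyadic_integral n k \<phi>\<bar>)"
      unfolding Jn_def V_def
    proof (rule sum_norm_le)
      fix k assume "k \<in> {..<2 ^ n :: nat}"
      then have "norm (\<Delta> n k) \<le> C / 2 ^ n" by (intro norm\<Delta>) simp
      then have "(2 ^ n * \<bar>dyadic_integral n k \<phi>\<bar>) * norm (\<Delta> n k) \<le> (2 ^ n * \<bar>dyadic_integral n k \<phi>\<bar>) * (C / 2 ^ n)"
        by (rule mult_left_mono) simp
      then show "norm ((2 ^ n * dyadic_integral n k \<phi>) *\<^sub>R \<Delta> n k) \<le> C * \<bar>dyadic_integral n k \<phi>\<bar>"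
        by (simp add: abs_mult mult.commute)
    qed
    also have "\<dots> \<le> C * norm \<phi>"
      unfolding sum_distrib_left[symmetric] by (intro mult_left_mono dyadic_integral_sum_le C0)
    finally show ?thesis .
  qed
  have Jn_add: "Jn n (\<phi> + \<psi>) = Jn n \<phi> + Jn n \<psi>" for n \<phi> \<psi>
    by (simp add: Jn_def V_def dyadic_integral_add distrib_left scaleR_left_distrib sum.distrib)
  have Jn_scale: "Jn n (r *\<^sub>R \<phi>) = r *\<^sub>R Jn n \<phi>" for n r \<phi>
    by (simp add: Jn_def V_def dyadic_integral_scaleR scaleR_sum_right mult.left_commute)
  have Jn_diff: "Jn n (\<phi> - \<psi>) = Jn n \<phi> - Jn n \<psi>" for n \<phi> \<psi>
    using Jn_add[of n "\<phi> - \<psi>" \<psi>] by simp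
  have Jn_step: "Jn n (L1step n a) = V n a" for n a
    unfolding Jn_def V_def by (intro sum.cong) (simp_all add: dyadic_integral_L1step)
  have V_Suc: "V (Suc n) (\<lambda>k. a (k div 2)) = V n a" for n a
  proof -
    have "\<Delta> (Suc n) (2 * k) + \<Delta> (Suc n) (Suc (2 * k)) = \<Delta> n k" for k
    proof -
      have "real (2 * k) / 2 ^ Suc n = real k / 2 ^ n" "real (Suc (Suc (2 * k))) / 2 ^ Suc n = real (Suc k) / 2 ^ n"
        by (simp_all add: field_simps)
      then show ?thesis by (simp only: \<Delta>_def) simp
    qed
    moreover have "V (Suc n) (\<lambda>k. a (k div 2)) = (\<Sum>k<2 ^ n. a k *\<^sub>R (\<Delta> (Suc n) (2 * k) + \<Delta> (Suc n) (Suc (2 * k))))"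
      unfolding V_def power_Suc sum_double by (simp add: scaleR_right_distrib)
    ultimately show ?thesis by (simp add: V_def)
  qed
  have V_le: "V m (\<lambda>k. a (k div 2 ^ (m - n))) = V n a" if "n \<le> m" for n m a
    using that
  proof (induction m rule: dec_induct)
    case (step m)
    have "V (Suc m) (\<lambda>k. a (k div 2 ^ (Suc m - n))) = V (Suc m) (\<lambda>k. (\<lambda>j. a (j div 2 ^ (m - n))) (k div 2))"
      using step(1) by (simp add: Suc_diff_le div_mult2_eq[symmetric])
    then show ?case using step.IH V_Suc[of m "\<lambda>j. a (j div 2 ^ (m - n))"] by simp
  qed simp
  have Jm_step: "Jn m (L1step n a) = V n a" if "n \<le> m" for n m a
    using Jn_step[of m "\<lambda>k. a (k div 2 ^ (m - n))"] by (simp add: L1step_refine_le[OF that] V_le[OF that])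
  \<comment> \<open>The operators Jn are uniformly bounded and eventually constant on each step
    function; step functions are dense.\<close>
  have conv: "convergent (\<lambda>n. Jn n \<phi>)" for \<phi>
  proof (rule Cauchy_convergent, rule metric_CauchyI)
    fix e :: real assume e: "0 < e"
    define d where "d = e / (2 * (C + 1))"
    have d: "0 < d" "C * d < e / 2"
    proof -
      show p: "0 < d" using e C0 by (simp add: d_def)
      have "(C + 1) * d = e / 2" unfolding d_def using C0 by (simp add: divide_simps)
      then show "C * d < e / 2" using p by (simp add: distrib_right)
    qed
    obtain N a where a: "norm (\<phi> - L1step N a) < d" using L1step_dense[OF d(1)] by blast
    have close: "dist (Jn n \<phi>) (V N a) < e / 2" if "N \<le> n" for n
    proof -
      have "dist (Jn n \<phi>) (V N a) = norm (Jn n (\<phi> - L1step N a))" by (simp add: dist_norm Jn_diff Jm_step[OF that])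
      also have "\<dots> \<le> C * norm (\<phi> - L1step N a)" by (rule Jn_norm)
      also have "\<dots> \<le> C * d" by (intro mult_left_mono C0 less_imp_le[OF a])
      finally show ?thesis using d(2) by simp
    qed
    show "\<exists>M. \<forall>m\<ge>M. \<forall>n\<ge>M. dist (Jn m \<phi>) (Jn n \<phi>) < e"
      using dist_triangle_half_l close by (metis dist_commute)
  qed
  define J0 where "J0 \<phi> = lim (\<lambda>n. Jn n \<phi>)" for \<phi>
  have J0: "(\<lambda>n. Jn n \<phi>) \<longlonglongrightarrow> J0 \<phi>" for \<phi> unfolding J0_def using conv[of \<phi>] by (simp add: convergent_LIMSEQ_iff)
  have "bounded_linear J0"
  proof (rule bounded_linear_intro)
    show "J0 (\<phi> + \<psi>) = J0 \<phi> + J0 \<psi>" for \<phi> \<psi>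
      using J0[of "\<phi> + \<psi>"] tendsto_add[OF J0[of \<phi>] J0[of \<psi>]] unfolding Jn_add by (rule LIMSEQ_unique)
    show "J0 (r *\<^sub>R \<phi>) = r *\<^sub>R J0 \<phi>" for r \<phi>
      using J0[of "r *\<^sub>R \<phi>"] tendsto_scaleR[OF tendsto_const J0[of \<phi>], of r] unfolding Jn_scale by (rule LIMSEQ_unique)
    show "norm (J0 \<phi>) \<le> norm \<phi> * C" for \<phi>
      by (rule LIMSEQ_le_const2[OF tendsto_norm[OF J0[of \<phi>]]]) (use Jn_norm[of _ \<phi>] in \<open>auto simp: mult.commute\<close>)
  qed
  then obtain J where J: "blinfun_apply J = J0" using bounded_linear_Blinfun_apply by blast
  have J_step: "J0 (L1step n a) = V n a" for n a
    by (rule LIMSEQ_unique[OF J0]) (rule tendsto_eventually, rule eventually_sequentiallyI[of n], rule Jm_step)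
  have lower_step: "c * norm (L1step n a) \<le> norm (blinfun_apply T (V n a))" for n a
  proof -
    \<comment> \<open>Only the values at grid points matter. The increment over cell k is
      \<open>sgn (a k) / 2 ^ n\<close>, so pairing with \<open>V n a\<close> returns the norm of the
      step function.\<close>
    define \<theta> where "\<theta> x = (\<Sum>i<nat \<lfloor>2 ^ n * x\<rfloor>. sgn (a i) / 2 ^ n)" for x :: real
    have \<theta>: "\<theta> (real k / 2 ^ n) = (\<Sum>i<k. sgn (a i) / 2 ^ n)" for k by (simp add: \<theta>_def)
    let ?V = "(\<lambda>k. real k / 2 ^ n) ` {..2 ^ n :: nat}"
    have V: "real j / 2 ^ n \<in> ?V" if "j \<le> 2 ^ n" for j using that by blast
    have le: "\<bar>\<theta> (real k / 2 ^ n) - \<theta> (real l / 2 ^ n)\<bar> \<le> \<bar>real k / 2 ^ n - real l / 2 ^ n\<bar>" if "l \<le> k" for k l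
    proof -
      have "\<theta> (real k / 2 ^ n) - \<theta> (real l / 2 ^ n) = (\<Sum>i\<in>{l..<k}. sgn (a i) / 2 ^ n)"
        unfolding \<theta> using sum_diff_nat_ivl[of 0 l k "\<lambda>i. sgn (a i) / 2 ^ n"] that by (simp add: lessThan_atLeast0)
      also have "\<bar>\<dots>\<bar> \<le> (\<Sum>i\<in>{l..<k}. 1 / 2 ^ n)"
        by (rule order_trans[OF sum_abs]) (intro sum_mono, auto simp: abs_sgn_eq divide_right_mono)
      also have "\<dots> = real k / 2 ^ n - real l / 2 ^ n" using that by (simp add: of_nat_diff diff_divide_distrib)
      finally show ?thesis by simp
    qed
    have "1-lipschitz_on ?V \<theta>"
    proof (rule lipschitz_onI)
      fix x y assume "x \<in> ?V" "y \<in> ?V"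
      then obtain k l where "x = real k / 2 ^ n" "y = real l / 2 ^ n" by blast
      then show "dist (\<theta> x) (\<theta> y) \<le> 1 * dist x y"
        using le[of k l] le[of l k] by (cases "k \<le> l") (auto simp: dist_real_def abs_minus_commute)
    qed simp
    then obtain \<Theta> where \<Theta>: "1-lipschitz_on UNIV \<Theta>" "\<And>x. x \<in> ?V \<Longrightarrow> \<Theta> x = \<theta> x"
      using lipschitz_extension_real by blast
    obtain \<psi> where \<psi>: "\<And>\<mu>. c * \<bar>blinfun_apply \<psi> \<mu>\<bar> \<le> norm (blinfun_apply T \<mu>)"
      "\<And>s t. s \<in> {0..1} \<Longrightarrow> t \<in> {0..1} \<Longrightarrow> blinfun_apply \<psi> (E s - E t) = \<Theta> s - \<Theta> t"
      using dual[OF \<Theta>(1)] by blast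
    have "blinfun_apply \<psi> (V n a) = (\<Sum>k<2 ^ n. a k * blinfun_apply \<psi> (\<Delta> n k))"
      by (simp add: V_def blinfun.sum_right blinfun.scaleR_right)
    also have "\<dots> = (\<Sum>k<2 ^ n. \<bar>a k\<bar> / 2 ^ n)"
    proof (rule sum.cong)
      fix k assume "k \<in> {..<2 ^ n :: nat}"
      then have k: "Suc k \<le> 2 ^ n" "k \<le> 2 ^ n" by auto
      have "blinfun_apply \<psi> (\<Delta> n k) = \<Theta> (real (Suc k) / 2 ^ n) - \<Theta> (real k / 2 ^ n)"
        unfolding \<Delta>_def by (rule \<psi>(2)[OF grid[OF k(1)] grid[OF k(2)]])
      also have "\<dots> = \<theta> (real (Suc k) / 2 ^ n) - \<theta> (real k / 2 ^ n)"
        unfolding \<Theta>(2)[OF V[OF k(1)]] \<Theta>(2)[OF V[OF k(2)]] ..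
      also have "\<dots> = sgn (a k) / 2 ^ n" unfolding \<theta> by simp
      finally show "a k * blinfun_apply \<psi> (\<Delta> n k) = \<bar>a k\<bar> / 2 ^ n" by (simp add: abs_sgn)
    qed simp
    finally have "\<bar>blinfun_apply \<psi> (V n a)\<bar> = norm (L1step n a)" unfolding norm_L1step by (simp add: sum_nonneg)
    then show ?thesis using \<psi>(1)[of "V n a"] by simp
  qed
  have lower: "c * norm \<phi> \<le> norm (blinfun_apply T (J0 \<phi>))" for \<phi>
  proof (rule field_le_epsilon)
    fix e :: real assume e: "0 < e"
    \<comment> \<open>The rate at which the two sides together can change when \<phi> is replaced by
      a step function.\<close>
    define D where "D = c + norm T * C"
    have D: "0 < D" using c C0 by (simp add: D_def add_pos_nonneg)
    obtain n a where a: "norm (\<phi> - L1step n a) < e / D" using L1step_dense[of "e / D" \<phi>] e D by auto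
    let ?z = "L1step n a"
    have "norm (J0 ?z - J0 \<phi>) \<le> C * norm (\<phi> - ?z)"
    proof -
      have "J0 \<phi> - J0 ?z = blinfun_apply J (\<phi> - ?z)" by (simp add: J[symmetric] blinfun.diff_right)
      also have "norm \<dots> \<le> C * norm (\<phi> - ?z)"
        unfolding J by (rule LIMSEQ_le_const2[OF tendsto_norm[OF J0]]) (use Jn_norm in auto)
      finally show ?thesis by (simp add: norm_minus_commute)
    qed
    then have 1: "norm T * norm (J0 ?z - J0 \<phi>) \<le> norm T * (C * norm (\<phi> - ?z))" by (rule mult_left_mono) simp
    have 2: "norm (blinfun_apply T (J0 ?z)) \<le> norm (blinfun_apply T (J0 \<phi>)) + norm (blinfun_apply T (J0 ?z - J0 \<phi>))"
      using norm_triangle_ineq[of "blinfun_apply T (J0 \<phi>)" "blinfun_apply T (J0 ?z - J0 \<phi>)"] by (simp add: blinfun.diff_right)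
    have 3: "c * norm \<phi> \<le> c * norm ?z + c * norm (\<phi> - ?z)"
      using mult_left_mono[OF norm_triangle_ineq[of ?z "\<phi> - ?z"], of c] c by (simp add: distrib_left)
    have 4: "D * norm (\<phi> - ?z) \<le> e" using a D by (simp add: field_simps)
    have 5: "norm (blinfun_apply T (J0 ?z - J0 \<phi>)) \<le> norm T * norm (J0 ?z - J0 \<phi>)" by (rule norm_blinfun)
    have 6: "D * norm (\<phi> - ?z) = c * norm (\<phi> - ?z) + norm T * (C * norm (\<phi> - ?z))"
      by (simp add: D_def distrib_right mult.assoc)
    show "c * norm \<phi> \<le> norm (blinfun_apply T (J0 \<phi>)) + e"
      using 1 2 3 4 5 6 lower_step[of n a] unfolding J_step[symmetric] by linarith
  qed
  show ?thesis
    unfolding fixes_copy_of_L1_def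
  proof (intro exI conjI)
    show "range (blinfun_apply J) = range (blinfun_apply J)" ..
    show "subspace (range (blinfun_apply J))"
      by (rule linear_subspace_image[OF bounded_linear.linear[OF blinfun.bounded_linear_right] subspace_UNIV])
    show "isomorphic_embedding_on UNIV J"
      unfolding isomorphic_embedding_on_def
    \<comment> \<open>Since T after J is bounded below and T is bounded, J is bounded below; adding
      1 avoids division by zero.\<close>
    proof (intro exI[of _ "c / (norm T + 1)"] conjI ballI)
      show "0 < c / (norm T + 1)" using c by (simp add: add_nonneg_pos)
      fix \<phi>
      have "norm (blinfun_apply T (J0 \<phi>)) \<le> (norm T + 1) * norm (J0 \<phi>)"
        by (rule order_trans[OF norm_blinfun]) (simp add: distrib_right)
      with lower[of \<phi>] have le: "c * norm \<phi> \<le> (norm T + 1) * norm (J0 \<phi>)" by linarith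
      have "0 < norm T + 1" by (simp add: add_nonneg_pos)
      then have "c * norm \<phi> / (norm T + 1) \<le> norm (J0 \<phi>)" using le by (simp add: pos_divide_le_eq mult.commute)
      then show "c / (norm T + 1) * norm \<phi> \<le> norm (blinfun_apply J \<phi>)" by (simp add: J)
    qed
    show "isomorphic_embedding_on (range (blinfun_apply J)) T"
      unfolding isomorphic_embedding_on_def
    proof (intro exI[of _ "c / (norm J + 1)"] conjI ballI)
      show "0 < c / (norm J + 1)" using c by (simp add: add_nonneg_pos)
      fix z assume "z \<in> range (blinfun_apply J)"
      then obtain \<phi> where z: "z = blinfun_apply J \<phi>" by blast
      have J1: "0 < norm J + 1" by (simp add: add_nonneg_pos)
      have "norm z \<le> (norm J + 1) * norm \<phi>" unfolding z by (rule order_trans[OF norm_blinfun]) (simp add: distrib_right)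
      then have "c * norm z \<le> c * ((norm J + 1) * norm \<phi>)" using c by (intro mult_left_mono) auto
      also have "\<dots> = (norm J + 1) * (c * norm \<phi>)" by (simp add: mult.left_commute)
      also have "\<dots> \<le> (norm J + 1) * norm (blinfun_apply T z)"
        using lower[of \<phi>] J1 by (intro mult_left_mono) (auto simp: z J)
      finally have "c * norm z / (norm J + 1) \<le> norm (blinfun_apply T z)" using J1 by (simp add: pos_divide_le_eq mult.commute)
      then show "c / (norm J + 1) * norm z \<le> norm (blinfun_apply T z)" by simp
    qed
  qed
qed

section \<open>Bilipschitz pieces of curves\<close>

text \<open>\<open>dist_le_gaps\<close> with rate c = 0 and with U a neighbourhood of K that exceeds
  it by small measure: crossing gaps is free, and the flatness condition is vacuous since K lies in
  U.\<close>

lemma dist_le_measure: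
  fixes h :: "real \<Rightarrow> 'b::metric_space"
  assumes K: "compact K" "a \<in> K" "b \<in> K" "a \<le> b" and L: "L-lipschitz_on K h"
    and gap: "\<And>p q. p \<in> K \<Longrightarrow> q \<in> K \<Longrightarrow> p < q \<Longrightarrow> {p<..<q} \<inter> K = {} \<Longrightarrow> a \<le> p \<Longrightarrow> q \<le> b \<Longrightarrow> h p = h q"
  shows "dist (h a) (h b) \<le> L * measure lebesgue (K \<inter> {a..b})"
proof (rule field_le_epsilon)
  fix e :: real assume e: "0 < e"
  have L0: "0 \<le> L" by (rule lipschitz_on_nonneg[OF L])
  define d where "d = e / (L + 1)"
  have d: "0 < d" "L * d \<le> e"
  proof -
    show p: "0 < d" using e L0 by (simp add: d_def)
    have "(L + 1) * d = e" unfolding d_def using L0 by simp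
    then show "L * d \<le> e" using p by (simp add: distrib_right)
  qed
  have Km: "K \<in> lmeasurable" by (rule lmeasurable_compact[OF K(1)])
  then have Ks: "K \<in> sets lebesgue" by (rule fmeasurableD)
  obtain U where U: "open U" "K \<subseteq> U" "U - K \<in> lmeasurable" "emeasure lebesgue (U - K) < ennreal d"
    using sets_lebesgue_outer_open[OF Ks d(1)] by blast
  have Kab: "K \<inter> {a..b} \<in> lmeasurable" by (rule lmeasurable_compact) (rule compact_Int[OF K(1) compact_Icc])
  have Uab: "U \<inter> {a..b} \<in> sets borel" using U(1) by auto
  have "dist (h a) (h b) \<le> 0 * (b - a) + L * measure lborel (U \<inter> {a..b})"
    by (rule dist_le_gaps[OF K L U(1)]) (use gap U(2) in auto)
  also have "measure lborel (U \<inter> {a..b}) = measure lebesgue (U \<inter> {a..b})"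
    using Uab by (simp add: measure_completion)
  also have "\<dots> \<le> measure lebesgue ((K \<inter> {a..b}) \<union> (U - K))"
    using Kab U(3) Uab by (intro measure_mono_fmeasurable fmeasurable.Un) auto
  also have "\<dots> \<le> measure lebesgue (K \<inter> {a..b}) + measure lebesgue (U - K)"
    using Kab U(3) by (intro measure_Un_le) auto
  also have "measure lebesgue (U - K) \<le> d"
    using U(3,4) d(1) by (simp add: emeasure_eq_measure2 ennreal_less_iff)
  finally have "dist (h a) (h b) \<le> L * (measure lebesgue (K \<inter> {a..b}) + d)"
    using L0 by (simp add: mult_left_mono)
  then show "dist (h a) (h b) \<le> L * measure lebesgue (K \<inter> {a..b}) + e"
    using d(2) unfolding distrib_left by linarith
qed

section \<open>Record points of a Lipschitz function\<close>

definition record_points :: "(real \<Rightarrow> real) \<Rightarrow> real \<Rightarrow> real \<Rightarrow> real set" where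
  "record_points w x y = {t\<in>{x..y}. \<forall>s\<in>{x..t}. w s \<le> w t}"

lemma compact_record_points:
  assumes w: "continuous_on UNIV w"
  shows "compact (record_points w x y)"
proof -
  have "closed (record_points w x y)"
    unfolding closed_sequential_limits
  proof (intro allI impI)
    fix u l assume ul: "(\<forall>n. u n \<in> record_points w x y) \<and> u \<longlonglongrightarrow> l"
    then have u: "\<And>n. u n \<in> {x..y}" "\<And>n s. s \<in> {x..u n} \<Longrightarrow> w s \<le> w (u n)" and lim: "u \<longlonglongrightarrow> l"
      by (auto simp: record_points_def)
    have l: "l \<in> {x..y}" by (rule closed_sequentially[OF closed_real_atLeastAtMost u(1) lim])
    have wl: "(\<lambda>n. w (u n)) \<longlonglongrightarrow> w l"
      using w lim by (auto simp: continuous_on_eq_continuous_at intro: isCont_tendsto_compose)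
    have "w s \<le> w l" if s: "s \<in> {x..l}" for s
    proof (cases "s = l")
      case False
      then have "s < l" using s by simp
      then have "\<forall>\<^sub>F n in sequentially. s < u n" by (rule order_tendstoD(1)[OF lim])
      then have "\<forall>\<^sub>F n in sequentially. w s \<le> w (u n)" by eventually_elim (use s u(2) in auto)
      then show ?thesis by (intro tendsto_lowerbound[OF wl]) auto
    qed simp
    with l show "l \<in> record_points w x y" by (simp add: record_points_def)
  qed
  moreover have "bounded (record_points w x y)"
    by (rule bounded_subset[OF bounded_closed_interval[of x y]]) (auto simp: record_points_def)
  ultimately show ?thesis by (simp add: compact_eq_bounded_closed)
qed

text \<open>A Lipschitz function gains height only at the points where it attains a new maximum.\<close>

lemma record_points_measure:
  assumes w: "L-lipschitz_on UNIV w" and xy: "x \<le> y"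
  shows "w y - w x \<le> L * measure lebesgue (record_points w x y)"
proof -
  let ?A = "record_points w x y"
  have L0: "0 \<le> L" by (rule lipschitz_on_nonneg[OF w])
  have cont: "continuous_on S w" for S
    using lipschitz_on_continuous_on[OF w] continuous_on_subset by blast
  have cA: "compact ?A" by (rule compact_record_points[OF cont])
  obtain t where t: "t \<in> {x..y}" "\<And>s. s \<in> {x..y} \<Longrightarrow> w s \<le> w t"
    using continuous_attains_sup[OF compact_Icc, of x y w] cont xy by auto
  have xA: "x \<in> ?A" using xy by (simp add: record_points_def)
  have tA: "t \<in> ?A" using t by (auto simp: record_points_def)
  have "dist (w x) (w t) \<le> L * measure lebesgue (?A \<inter> {x..t})"
  proof (rule dist_le_measure[OF cA xA tA])
    show "x \<le> t" using t by simp
    show "L-lipschitz_on ?A w" by (rule lipschitz_on_subset[OF w]) simp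
    fix p q assume pq: "p \<in> ?A" "q \<in> ?A" "p < q" and gap: "{p<..<q} \<inter> ?A = {}"
    have "w p \<le> w q" using pq by (auto simp: record_points_def)
    \<comment> \<open>If w were larger at q than at p, the first point of the gap that reaches an
      intermediate level would itself be a record point. So w is constant across gaps of the record
      set and \<open>dist_le_measure\<close> applies.\<close>
    moreover have "\<not> w p < w q"
    proof
      assume lt: "w p < w q"
      define v where "v = (w p + w q) / 2"
      have v: "w p < v" "v < w q" using lt by (auto simp: v_def)
      define S where "S = {p..q} \<inter> {r. v \<le> w r}"
      have "closed {r. v \<le> w r}" using cont by (intro closed_Collect_le) auto
      then have cS: "compact S" unfolding S_def by (intro compact_Int_closed) auto
      have "\<exists>z. p \<le> z \<and> z \<le> q \<and> w z = v" by (rule IVT') (use v pq cont in auto)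
      then obtain z where z: "p \<le> z" "z \<le> q" "w z = v" by blast
      then have "S \<noteq> {}" by (auto simp: S_def)
      then obtain r where r: "r \<in> S" "\<And>s. s \<in> S \<Longrightarrow> r \<le> s" using compact_attains_inf[OF cS] by blast
      have "z \<in> S" using z by (simp add: S_def)
      then have rz: "r \<le> z" by (rule r(2))
      have "z \<noteq> q" using z v by auto
      then have rq: "r < q" using rz z by simp
      have pr: "p < r" using r(1) v by (cases "r = p") (auto simp: S_def)
      have "r \<in> ?A"
        unfolding record_points_def
      proof (intro CollectI conjI ballI)
        show "r \<in> {x..y}" using pr rq pq by (auto simp: record_points_def)
        fix s assume s: "s \<in> {x..r}"
        have vr: "v \<le> w r" using r(1) by (simp add: S_def)
        show "w s \<le> w r"
        proof (cases "s \<le> p")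
          case True
          then have "w s \<le> w p" using pq(1) s by (auto simp: record_points_def)
          then show ?thesis using v vr by linarith
        next
          case False
          show ?thesis
          proof (cases "s = r")
            case neq: False
            have "s \<notin> S" using r(2)[of s] s neq by auto
            then have "w s < v" using False s rq by (auto simp: S_def)
            then show ?thesis using vr by linarith
          qed simp
        qed
      qed
      then show False using gap pr rq by auto
    qed
    ultimately show "w p = w q" by simp
  qed
  also have "\<dots> \<le> L * measure lebesgue ?A"
  proof (intro mult_left_mono L0 measure_mono_fmeasurable)
    show "?A \<in> lmeasurable" by (rule lmeasurable_compact[OF cA])
    show "?A \<inter> {x..t} \<in> sets lebesgue"
      by (rule fmeasurableD, rule lmeasurable_compact, rule compact_Int[OF cA compact_Icc])
  qed simp
  finally show ?thesis using t(2)[of y] xy by (simp add: dist_real_def)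
qed

text \<open>Otherwise the stretched intervals are a Vitali cover whose total length is controlled by the
  small measure of a neighbourhood of \<open>K\<close> outside \<open>K\<close>.\<close>

lemma stretched_dense_interval:
  fixes h :: "real \<Rightarrow> 'b::metric_space"
  assumes K: "compact K" and \<kappa>: "0 < \<kappa>"
    and nneg: "\<not> negligible {x\<in>K. \<forall>d>0. \<exists>y\<in>K. y \<noteq> x \<and> \<bar>x - y\<bar> < d \<and> l * \<bar>x - y\<bar> \<le> dist (h x) (h y)}"
  obtains x y where "x \<in> K" "y \<in> K" "x < y" "l * (y - x) \<le> dist (h x) (h y)"
    "measure lebesgue ({x..y} - K) < \<kappa> * (y - x)"
proof (rule ccontr)
  note found = that
  assume no: "\<not> thesis"
  have sparse: "\<kappa> * (y - x) \<le> measure lebesgue ({x..y} - K)"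
    if "x \<in> K" "y \<in> K" "x < y" "l * (y - x) \<le> dist (h x) (h y)" for x y
    by (rule ccontr) (use that no found[of x y] in \<open>auto simp: not_le\<close>)
  let ?E = "{x\<in>K. \<forall>d>0. \<exists>y\<in>K. y \<noteq> x \<and> \<bar>x - y\<bar> < d \<and> l * \<bar>x - y\<bar> \<le> dist (h x) (h y)}"
  have Ks: "K \<in> sets lebesgue" by (rule fmeasurableD[OF lmeasurable_compact[OF K]])
  have "negligible ?E"
    unfolding negligible_outer_le
  proof (intro allI impI)
    fix e :: real assume e: "0 < e"
    have ke: "0 < \<kappa> * e" using e \<kappa> by simp
    \<comment> \<open>The Vitali intervals will lie in U, and each has length at most 1/\<kappa>
      times its measure outside K. Being disjoint, they have total length at most e.\<close>
    obtain U where U: "open U" "K \<subseteq> U" "U - K \<in> lmeasurable" "emeasure lebesgue (U - K) < ennreal (\<kappa> * e)"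
      using sets_lebesgue_outer_open[OF Ks ke] by blast
    define I where "I = {(p, q). p \<in> K \<and> q \<in> K \<and> p < q \<and> l * (q - p) \<le> dist (h p) (h q) \<and> {p..q} \<subseteq> U}"
    let ?a = "\<lambda>i :: real \<times> real. (fst i + snd i) / 2" and ?r = "\<lambda>i :: real \<times> real. (snd i - fst i) / 2"
    let ?B = "\<lambda>i. cball (?a i) (?r i)"
    have B: "?B i = {fst i..snd i}" for i
    proof -
      have "?a i - ?r i = fst i" "?a i + ?r i = snd i" by (simp_all add: field_simps)
      then show ?thesis by (simp only: cball_eq_atLeastAtMost)
    qed
    have cover: "\<exists>i. i \<in> I \<and> x \<in> ?B i \<and> ?r i < d" if x: "x \<in> ?E" and d: "0 < d" for x d
    proof -
      obtain \<delta> where \<delta>: "0 < \<delta>" "ball x \<delta> \<subseteq> U" using x U openE by blast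
      have "0 < min \<delta> d" using \<delta> d by simp
      with x obtain y where y: "y \<in> K" "y \<noteq> x" "\<bar>x - y\<bar> < min \<delta> d" "l * \<bar>x - y\<bar> \<le> dist (h x) (h y)" by blast
      let ?i = "(min x y, max x y)"
      have "{min x y..max x y} \<subseteq> ball x \<delta>" using y(3) by (auto simp: dist_real_def)
      then have "?i \<in> I" using x y \<delta>(2) unfolding I_def
        by (cases "x \<le> y") (auto simp: abs_if dist_commute min_def max_def split: if_splits)
      moreover have "x \<in> ?B ?i" unfolding B by simp
      moreover have "?r ?i < d" using y(3) d by (auto simp: min_def max_def abs_if split: if_splits)
      ultimately show ?thesis by blast
    qed
    obtain C where C: "countable C" "C \<subseteq> I"
      "pairwise (\<lambda>i j. disjnt (?B i) (?B j)) C" "negligible (?E - (\<Union>i\<in>C. ?B i))"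
    proof (rule Vitali_covering_theorem_cballs[of I ?r ?E ?a])
      show "0 < ?r i" if "i \<in> I" for i using that by (auto simp: I_def)
    qed (use cover in auto)
    have sub: "{fst i..snd i} \<subseteq> U" if "i \<in> C" for i using subsetD[OF C(2) that] by (auto simp: I_def)
    have disj: "disjoint_family_on ?B C" using C(3) by (auto simp: disjoint_family_on_def pairwise_def disjnt_def)
    then have disj': "disjoint_family_on (\<lambda>i. ?B i - K) C" unfolding disjoint_family_on_def by blast
    have Bs: "?B i \<in> sets lebesgue" for i by auto
    have one: "emeasure lebesgue (?B i) \<le> ennreal (1 / \<kappa>) * emeasure lebesgue (?B i - K)" if iC: "i \<in> C" for i
    proof -
      obtain p q where i: "i = (p, q)" "p \<in> K" "q \<in> K" "p < q" "l * (q - p) \<le> dist (h p) (h q)"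
        using iC C(2) by (auto simp: I_def)
      have Bi: "?B i = {p..q}" unfolding B by (simp add: i(1))
      have BK: "?B i - K \<in> lmeasurable" using Ks by (intro fmeasurable_Diff) auto
      have "q - p \<le> 1 / \<kappa> * measure lebesgue ({p..q} - K)" using sparse[OF i(2-5)] \<kappa> by (simp add: field_simps)
      then have "ennreal (q - p) \<le> ennreal (1 / \<kappa> * measure lebesgue (?B i - K))"
        unfolding Bi by (rule ennreal_leI)
      also have "\<dots> = ennreal (1 / \<kappa>) * emeasure lebesgue (?B i - K)"
        using \<kappa> by (simp only: emeasure_eq_measure2[OF BK]) (rule ennreal_mult, auto)
      finally show ?thesis unfolding Bi using i(4) by simp
    qed
    have "emeasure lebesgue (\<Union>i\<in>C. ?B i) = (\<integral>\<^sup>+i. emeasure lebesgue (?B i) \<partial>count_space C)"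
      by (rule emeasure_UN_countable[OF Bs C(1) disj])
    also have "\<dots> \<le> (\<integral>\<^sup>+i. ennreal (1 / \<kappa>) * emeasure lebesgue (?B i - K) \<partial>count_space C)"
      by (intro nn_integral_mono) (use one in auto)
    also have "\<dots> = ennreal (1 / \<kappa>) * (\<integral>\<^sup>+i. emeasure lebesgue (?B i - K) \<partial>count_space C)"
      by (rule nn_integral_cmult) simp
    also have "(\<integral>\<^sup>+i. emeasure lebesgue (?B i - K) \<partial>count_space C) = emeasure lebesgue (\<Union>i\<in>C. ?B i - K)"
      by (rule emeasure_UN_countable[OF _ C(1) disj', symmetric]) (use Bs Ks in auto)
    also have "\<dots> \<le> emeasure lebesgue (U - K)"
    proof (rule emeasure_mono)
      show "(\<Union>i\<in>C. ?B i - K) \<subseteq> U - K" unfolding B using sub by blast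
      show "U - K \<in> sets lebesgue" using U(3) by auto
    qed
    also have "\<dots> \<le> ennreal (\<kappa> * e)" using U(4) by simp
    also have "ennreal (1 / \<kappa>) * ennreal (\<kappa> * e) = ennreal (1 / \<kappa> * (\<kappa> * e))"
      by (rule ennreal_mult[symmetric]) (use \<kappa> e in auto)
    also have "1 / \<kappa> * (\<kappa> * e) = e" using \<kappa> by simp
    finally have le: "emeasure lebesgue (\<Union>i\<in>C. ?B i) \<le> ennreal e" by (simp add: mult_left_mono)
    let ?U = "\<Union>i\<in>C. ?B i"
    let ?T = "?U \<union> (?E - ?U)"
    have Us: "?U \<in> sets lebesgue" using C(1) Bs by (intro sets.countable_UN') auto
    have null: "?E - ?U \<in> null_sets lebesgue" using C(4) by (simp add: negligible_iff_null_sets)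
    have eT: "emeasure lebesgue ?T = emeasure lebesgue ?U" by (rule emeasure_Un_null_set[OF Us null])
    have Tm: "?T \<in> lmeasurable"
    proof (rule fmeasurableI)
      show "?T \<in> sets lebesgue" using Us null by blast
      show "emeasure lebesgue ?T < \<infinity>" unfolding eT using le by (simp add: le_less_trans)
    qed
    have "measure lebesgue ?T \<le> e"
      using le e unfolding eT[symmetric] emeasure_eq_measure2[OF Tm] by (subst (asm) ennreal_le_iff) auto
    with Tm show "\<exists>T. ?E \<subseteq> T \<and> T \<in> lmeasurable \<and> measure lebesgue T \<le> e" by (intro exI[of _ ?T]) auto
  qed
  with nneg show False by blast
qed

text \<open>On an interval that is stretched by l and almost filled by K, the distance from the
  initial image point minus a linear term of slope l/2 still rises. Between two of its record points
  the image distance is at least l/2 times the parameter distance, and the record points are too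
  many to avoid K.\<close>

theorem not_curve_flat_bilipschitz_piece:
  fixes f :: "'m::metric_space \<Rightarrow> 'n::metric_space"
  assumes f: "L-lipschitz_on UNIV f" and nflat: "\<not> curve_flat f"
  obtains A :: "real set" and \<gamma> :: "real \<Rightarrow> 'm" and D c where "compact A" "0 < measure lebesgue A" "D-lipschitz_on A \<gamma>" "0 < c"
    "\<And>s t. s \<in> A \<Longrightarrow> t \<in> A \<Longrightarrow> c * \<bar>s - t\<bar> \<le> dist (f (\<gamma> s)) (f (\<gamma> t))"
proof -
  obtain K :: "real set" and \<gamma> D where K: "compact K" and \<gamma>: "D-lipschitz_on K \<gamma>"
    and nAE: "\<not> (AE x in lebesgue. x \<in> K \<longrightarrow> ((\<lambda>y. dist (f (\<gamma> x)) (f (\<gamma> y)) / \<bar>x - y\<bar>) \<longlongrightarrow> 0) (at x within K))"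
    using nflat unfolding curve_flat_def by blast
  define h where "h t = f (\<gamma> t)" for t
  define E where "E l = {x\<in>K. \<forall>d>0. \<exists>y\<in>K. y \<noteq> x \<and> \<bar>x - y\<bar> < d \<and> l * \<bar>x - y\<bar> \<le> dist (h x) (h y)}" for l
  \<comment> \<open>Flatness fails at x exactly when x belongs to \<open>E (1/(n + 1))\<close> for
    some n; a countable union of null sets would be null.\<close>
  obtain n :: nat where n: "\<not> negligible (E (inverse (real (Suc n))))"
  proof (rule ccontr)
    assume no: "\<not> thesis"
    then have "E (inverse (real (Suc n))) \<in> null_sets lebesgue" for n
      using that by (auto simp: negligible_iff_null_sets)
    then have "(\<Union>n. E (inverse (real (Suc n)))) \<in> null_sets lebesgue" by (rule null_sets_UN)
    then have "AE x in lebesgue. x \<in> K \<longrightarrow> ((\<lambda>y. dist (f (\<gamma> x)) (f (\<gamma> y)) / \<bar>x - y\<bar>) \<longlongrightarrow> 0) (at x within K)"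
    proof (rule AE_I', intro subsetI)
      fix x assume "x \<in> {x \<in> space lebesgue. \<not> (x \<in> K \<longrightarrow> ((\<lambda>y. dist (f (\<gamma> x)) (f (\<gamma> y)) / \<bar>x - y\<bar>) \<longlongrightarrow> 0) (at x within K))}"
      then have x: "x \<in> K" "\<not> ((\<lambda>y. dist (h x) (h y) / \<bar>x - y\<bar>) \<longlongrightarrow> 0) (at x within K)" by (auto simp: h_def)
      show "x \<in> (\<Union>n. E (inverse (real (Suc n))))"
      proof (rule ccontr)
        assume "x \<notin> (\<Union>n. E (inverse (real (Suc n))))"
        then have nE: "x \<notin> E (inverse (real (Suc n)))" for n by blast
        have "((\<lambda>y. dist (h x) (h y) / \<bar>x - y\<bar>) \<longlongrightarrow> 0) (at x within K)"
        proof (rule tendstoI)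
          fix e :: real assume "0 < e"
          then obtain n where n: "inverse (real (Suc n)) < e" using reals_Archimedean by blast
          obtain d where d: "0 < d" "\<And>y. y \<in> K \<Longrightarrow> y \<noteq> x \<Longrightarrow> \<bar>x - y\<bar> < d \<Longrightarrow> dist (h x) (h y) < inverse (real (Suc n)) * \<bar>x - y\<bar>"
            using nE[of n] x(1) unfolding E_def by (auto simp: not_le)
          show "\<forall>\<^sub>F y in at x within K. dist (dist (h x) (h y) / \<bar>x - y\<bar>) 0 < e"
            unfolding eventually_at
          proof (intro exI[of _ d] conjI ballI impI d(1))
            fix y assume y: "y \<in> K" "y \<noteq> x \<and> dist y x < d"
            then have "0 < \<bar>x - y\<bar>" "\<bar>x - y\<bar> < d" by (auto simp: dist_real_def)
            moreover from this have "dist (h x) (h y) < inverse (real (Suc n)) * \<bar>x - y\<bar>" using d(2) y by blast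
            ultimately have "dist (h x) (h y) / \<bar>x - y\<bar> < inverse (real (Suc n))" by (simp add: pos_divide_less_eq)
            then show "dist (dist (h x) (h y) / \<bar>x - y\<bar>) 0 < e" using n by (simp add: dist_real_def)
          qed
        qed
        with x(2) show False by blast
      qed
    qed
    with nAE show False by blast
  qed
  define l where "l = inverse (real (Suc n))"
  have l: "0 < l" by (simp add: l_def)
  have L0: "0 \<le> L" "0 \<le> D" using lipschitz_on_nonneg f \<gamma> by blast+
  have h: "(D * L)-lipschitz_on K h"
    unfolding h_def using lipschitz_on_compose2[OF \<gamma> lipschitz_on_subset[OF f]] by (simp add: mult.commute)
  define Q where "Q = D * L + l / 2"
  have Q: "0 < Q" using l L0 by (simp add: Q_def add_nonneg_pos)
  \<comment> \<open>A Q-Lipschitz function that rises by \<open>l / 2 * (y - x)\<close> has record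
    points of measure at least \<open>l / (2 * Q) * (y - x)\<close>. The part of the interval
    outside K must be smaller than this.\<close>
  have "0 < l / (2 * Q)" using l Q by simp
  then obtain x y where xy: "x \<in> K" "y \<in> K" "x < y" "l * (y - x) \<le> dist (h x) (h y)"
    "measure lebesgue ({x..y} - K) < l / (2 * Q) * (y - x)"
    using n unfolding E_def l_def[symmetric] by (rule stretched_dense_interval[OF K])
  have "(D * L)-lipschitz_on K (\<lambda>t. dist (h x) (h t))"
  proof (rule lipschitz_onI)
    fix s t assume "s \<in> K" "t \<in> K"
    from lipschitz_onD[OF h this] show "dist (dist (h x) (h s)) (dist (h x) (h t)) \<le> D * L * dist s t"
      using dist_triangle[of "h x" "h s" "h t"] dist_triangle[of "h x" "h t" "h s"] dist_commute[of "h s" "h t"]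
      unfolding dist_real_def[of "dist (h x) (h s)"] by linarith
  qed (use L0 in simp)
  then obtain u where u: "(D * L)-lipschitz_on UNIV u" "\<And>t. t \<in> K \<Longrightarrow> u t = dist (h x) (h t)"
    using lipschitz_extension_real by blast
  define w where "w t = u t - l / 2 * t" for t
  have w: "Q-lipschitz_on UNIV w"
  proof -
    have "(\<bar>l / 2\<bar> * 1)-lipschitz_on UNIV (\<lambda>t :: real. l / 2 * t)"
      by (rule lipschitz_on_cmult_real) (rule lipschitz_on_id)
    from lipschitz_on_diff[OF u(1) this] show ?thesis using l by (simp add: w_def[abs_def] Q_def)
  qed
  let ?R = "record_points w x y"
  have cR: "compact ?R" by (rule compact_record_points) (rule lipschitz_on_continuous_on[OF w])
  let ?A = "?R \<inter> K"
  have cA: "compact ?A" by (rule compact_Int[OF cR K])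
  have Ks: "K \<in> sets lebesgue" by (rule fmeasurableD[OF lmeasurable_compact[OF K]])
  have Dm: "{x..y} - K \<in> lmeasurable" using Ks by (intro fmeasurable_Diff) auto
  show ?thesis
  proof (rule that[OF cA])
    have "l / 2 * (y - x) \<le> w y - w x"
      using xy(4) u(2)[OF xy(1)] u(2)[OF xy(2)] by (simp add: w_def field_simps)
    also have "\<dots> \<le> Q * measure lebesgue ?R" by (rule record_points_measure[OF w]) (use xy in simp)
    also have "measure lebesgue ?R \<le> measure lebesgue ?A + measure lebesgue ({x..y} - K)"
    proof -
      have "measure lebesgue ?R \<le> measure lebesgue (?A \<union> ({x..y} - K))"
        using lmeasurable_compact[OF cA] Dm lmeasurable_compact[OF cR]
        by (intro measure_mono_fmeasurable fmeasurable.Un) (auto simp: record_points_def)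
      also have "\<dots> \<le> measure lebesgue ?A + measure lebesgue ({x..y} - K)"
        using lmeasurable_compact[OF cA] Dm by (intro measure_Un_le) auto
      finally show ?thesis .
    qed
    finally have 1: "l / 2 * (y - x) \<le> Q * measure lebesgue ?A + Q * measure lebesgue ({x..y} - K)"
      using Q by (simp add: distrib_left)
    have "Q * measure lebesgue ({x..y} - K) < Q * (l / (2 * Q) * (y - x))" by (rule mult_strict_left_mono[OF xy(5) Q])
    also have "\<dots> = l / 2 * (y - x)" using Q by simp
    finally have "0 < Q * measure lebesgue ?A" using 1 by linarith
    then show "0 < measure lebesgue ?A" using Q by (simp add: zero_less_mult_iff)
    show "D-lipschitz_on ?A \<gamma>" by (rule lipschitz_on_subset[OF \<gamma>]) simp
    show "0 < l / 2" using l by simp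
    have main: "l / 2 * \<bar>s - t\<bar> \<le> dist (f (\<gamma> s)) (f (\<gamma> t))" if s: "s \<in> ?A" and t: "t \<in> ?A" and st: "s \<le> t" for s t
    proof -
      have "w s \<le> w t" using s t st by (auto simp: record_points_def)
      then have "l / 2 * (t - s) \<le> u t - u s" by (simp add: w_def right_diff_distrib)
      also have "\<dots> = dist (h x) (h t) - dist (h x) (h s)" using s t u(2) by simp
      also have "\<dots> \<le> dist (h s) (h t)" using dist_triangle[of "h x" "h t" "h s"] by simp
      finally show ?thesis using st by (simp add: h_def)
    qed
    show "l / 2 * \<bar>s - t\<bar> \<le> dist (f (\<gamma> s)) (f (\<gamma> t))" if "s \<in> ?A" "t \<in> ?A" for s t
      using main[OF that] main[OF that(2,1)] by (cases "s \<le> t") (auto simp: abs_minus_commute dist_commute)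
  qed
qed

section \<open>The curve in the free space with its gaps removed\<close>

lemma norm_free_delta_diff_le: "norm (free_delta x - free_delta y) \<le> dist x y"
proof -
  have "lsem (lip_vanish 1 {0}) (free_delta x - free_delta y) \<le> ennreal (dist x y)"
  proof (rule lsem_least)
    fix u :: "'a \<Rightarrow> real" assume "u \<in> lip_vanish 1 {0}"
    then have u: "1-lipschitz_on UNIV u" by (simp add: lip_vanish_def)
    have "\<bar>u x - u y\<bar> \<le> dist x y" using lipschitz_onD[OF u, of x y] by (simp add: dist_real_def)
    then show "ennreal \<bar>blinfun_apply (lip_functional u) (free_delta x - free_delta y)\<bar> \<le> ennreal (dist x y)"
      by (intro ennreal_leI) (simp add: blinfun.diff_right lip_functional_delta[OF u])
  qed
  then show ?thesis by (simp flip: ennreal_norm_eq_lsem)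
qed

locale compact_curve =
  fixes A :: "real set" and \<gamma> :: "real \<Rightarrow> 'm::{metric_space, zero}" and D :: real
  assumes compact: "compact A" and nonempty: "A \<noteq> {}" and lip: "D-lipschitz_on A \<gamma>"
begin

definition gaps :: "real \<Rightarrow> real \<Rightarrow> (real \<times> real) set" where
  "gaps x y = {(p, q). p \<in> A \<and> q \<in> A \<and> p < q \<and> {p<..<q} \<inter> A = {} \<and> x \<le> p \<and> q \<le> y}"

definition jump :: "real \<times> real \<Rightarrow> 'm lip_free" where
  "jump g = free_delta (\<gamma> (snd g)) - free_delta (\<gamma> (fst g))"

definition jumps :: "real \<Rightarrow> real \<Rightarrow> 'm lip_free" where
  "jumps x y = infsum jump (gaps x y)"

text \<open>Removing the gaps of \<open>A\<close> from the curve makes its length in the free space a multiple of the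
  measure of the part of \<open>A\<close> that it traverses.\<close>

definition path :: "real \<Rightarrow> 'm lip_free" where
  "path x = free_delta (\<gamma> x) - jumps (Inf A) x"

definition mass :: "real \<Rightarrow> real" where
  "mass x = measure lebesgue (A \<inter> {..x})"

lemma D_nonneg: "0 \<le> D"
  by (rule lipschitz_on_nonneg[OF lip])

lemma Inf_mem: "Inf A \<in> A" and Inf_le: "x \<in> A \<Longrightarrow> Inf A \<le> x"
  using closed_contains_Inf[of A] compact nonempty
  by (auto simp: compact_eq_bounded_closed bounded_imp_bdd_below intro: cInf_lower)

lemma gaps_disjoint:
  assumes "(p, q) \<in> gaps x y" "(p', q') \<in> gaps x' y'" "p < p'"
  shows "q \<le> p'"
proof (rule ccontr)
  assume "\<not> q \<le> p'"
  with assms(3) have "p' \<in> {p<..<q}" by simp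
  with assms(1,2) show False by (auto simp: gaps_def)
qed

lemma gaps_eq:
  assumes "(p, q) \<in> gaps x y" "(p, q') \<in> gaps x' y'"
  shows "q = q'"
proof -
  have "\<not> q < q'" "\<not> q' < q" using assms by (auto simp: gaps_def)
  then show ?thesis by simp
qed

text \<open>Distinct gaps are disjoint intervals. This bound makes the series of jumps absolutely
  summable.\<close>

lemma sum_gaps_le:
  assumes "finite G" "G \<subseteq> gaps x y" "x \<le> y"
  shows "(\<Sum>g\<in>G. snd g - fst g) \<le> y - x"
proof -
  let ?I = "\<lambda>g :: real \<times> real. {fst g<..<snd g}"
  have lt: "fst g < snd g" if "g \<in> G" for g using that assms(2) by (auto simp: gaps_def)
  have disj: "disjoint_family_on ?I G"
    unfolding disjoint_family_on_def
  proof (intro ballI impI)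
    fix g h assume g: "g \<in> G" and h: "h \<in> G" and ne: "g \<noteq> h"
    have G: "(fst g, snd g) \<in> gaps x y" "(fst h, snd h) \<in> gaps x y" using g h assms(2) by auto
    have "fst g \<noteq> fst h" using gaps_eq[of "fst g" "snd g" x y "snd h" x y] G ne by (metis prod.collapse)
    then show "?I g \<inter> ?I h = {}"
      using gaps_disjoint[OF G] gaps_disjoint[OF G(2,1)] by (cases "fst g < fst h") auto
  qed
  have "(\<Sum>g\<in>G. snd g - fst g) = (\<Sum>g\<in>G. measure lborel (?I g))"
    using lt by (intro sum.cong) (auto simp: less_imp_le)
  also have "\<dots> = measure lborel (\<Union>g\<in>G. ?I g)"
    by (rule measure_finite_Union[OF assms(1) _ disj, symmetric]) (use lt in \<open>auto simp: less_imp_le\<close>)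
  also have "\<dots> \<le> measure lborel {x..y}"
  proof (rule measure_mono_fmeasurable)
    show "(\<Union>g\<in>G. ?I g) \<subseteq> {x..y}" using assms(2) by (fastforce simp: gaps_def)
    have "open (\<Union>g\<in>G. ?I g)" by auto
    then show "(\<Union>g\<in>G. ?I g) \<in> sets lborel" by simp
    show "{x..y} \<in> fmeasurable lborel" by (rule fmeasurableI) (use assms(3) in auto)
  qed
  finally show ?thesis using assms(3) by simp
qed

lemma norm_jump_le: "g \<in> gaps x y \<Longrightarrow> norm (jump g) \<le> D * (snd g - fst g)"
  using lipschitz_onD[OF lip, of "snd g" "fst g"] norm_free_delta_diff_le[of "\<gamma> (snd g)" "\<gamma> (fst g)"]
  by (auto simp: gaps_def jump_def dist_real_def)

lemma sum_norm_jump_le: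
  assumes "finite G" "G \<subseteq> gaps x y" "x \<le> y"
  shows "(\<Sum>g\<in>G. norm (jump g)) \<le> D * (y - x)"
proof -
  have "(\<Sum>g\<in>G. norm (jump g)) \<le> (\<Sum>g\<in>G. D * (snd g - fst g))"
    by (intro sum_mono norm_jump_le) (use assms(2) in blast)
  also have "\<dots> \<le> D * (y - x)"
    unfolding sum_distrib_left[symmetric] by (intro mult_left_mono sum_gaps_le assms D_nonneg)
  finally show ?thesis .
qed

lemma jump_abs_summable: "x \<le> y \<Longrightarrow> jump abs_summable_on gaps x y"
  by (rule nonneg_bdd_above_summable_on) (auto intro!: bdd_aboveI2[where M = "D * (y - x)"] sum_norm_jump_le)

lemma jump_summable: "x \<le> y \<Longrightarrow> jump summable_on gaps x y"
  by (rule abs_summable_summable[OF jump_abs_summable])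

lemma norm_jumps_le: "x \<le> y \<Longrightarrow> norm (jumps x y) \<le> D * (y - x)"
  unfolding jumps_def
  by (rule order_trans[OF norm_infsum_bound[OF jump_abs_summable] infsum_le_finite_sums[OF jump_abs_summable sum_norm_jump_le]])

lemma path_diff:
  assumes x: "x \<in> A" and y: "y \<in> A" and xy: "x \<le> y"
  shows "path y - path x = free_delta (\<gamma> y) - free_delta (\<gamma> x) - jumps x y"
proof -
  have eq: "gaps (Inf A) y = gaps (Inf A) x \<union> gaps x y"
  proof (intro equalityI subsetI)
    fix g assume g: "g \<in> gaps (Inf A) y"
    have "\<not> (fst g < x \<and> x < snd g)" using g x by (auto simp: gaps_def)
    with g show "g \<in> gaps (Inf A) x \<union> gaps x y" by (auto simp: gaps_def)
  next
    fix g assume "g \<in> gaps (Inf A) x \<union> gaps x y"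
    then show "g \<in> gaps (Inf A) y" using xy Inf_le by (auto simp: gaps_def)
  qed
  have "gaps (Inf A) x \<inter> gaps x y = {}" by (auto simp: gaps_def)
  then have "jumps (Inf A) y = jumps (Inf A) x + jumps x y"
    unfolding jumps_def eq by (intro infsum_Un_disjoint jump_summable Inf_le x xy)
  then show ?thesis by (simp add: path_def)
qed

lemma path_lipschitz: "(2 * D)-lipschitz_on A path"
proof (rule lipschitz_on_leI)
  fix x y assume x: "x \<in> A" and y: "y \<in> A" and xy: "x \<le> y"
  have "norm (free_delta (\<gamma> y) - free_delta (\<gamma> x)) \<le> D * (y - x)"
    using norm_free_delta_diff_le[of "\<gamma> y" "\<gamma> x"] lipschitz_onD[OF lip y x] xy by (simp add: dist_real_def)
  then have "norm (path y - path x) \<le> D * (y - x) + D * (y - x)"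
    using norm_triangle_ineq4[of "free_delta (\<gamma> y) - free_delta (\<gamma> x)" "jumps x y"] norm_jumps_le[OF xy]
    unfolding path_diff[OF x y xy] by linarith
  then show "dist (path x) (path y) \<le> 2 * D * dist x y" using xy by (simp add: dist_norm norm_minus_commute)
qed (use D_nonneg in simp)

text \<open>The only gap between p and q is the pair itself, and its jump is exactly the increment
  of the curve.\<close>

lemma path_gap:
  assumes pq: "p \<in> A" "q \<in> A" "p < q" "{p<..<q} \<inter> A = {}"
  shows "path p = path q"
proof -
  have "gaps p q = {(p, q)}"
  proof (intro equalityI subsetI)
    fix g assume g: "g \<in> gaps p q"
    then have gA: "fst g \<in> A" "snd g \<in> A" "fst g < snd g" "p \<le> fst g" "snd g \<le> q" by (auto simp: gaps_def)
    have "fst g \<notin> {p<..<q}" "snd g \<notin> {p<..<q}" using gA(1,2) pq(4) by blast+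
    then have "fst g = p" "snd g = q" using gA(3-5) by auto
    then show "g \<in> {(p, q)}" by (cases g) simp
  qed (use pq in \<open>auto simp: gaps_def\<close>)
  then have "jumps p q = jump (p, q)" by (simp add: jumps_def)
  then show ?thesis using path_diff[OF pq(1,2)] pq(3) by (simp add: jump_def)
qed

lemma A_meas: "A \<inter> S \<in> lmeasurable" if "S \<in> sets borel"
  using lmeasurable_compact[OF compact] that by (intro fmeasurable_Int_fmeasurable) auto

lemma mass_add: "x \<le> y \<Longrightarrow> mass y = mass x + measure lebesgue (A \<inter> {x<..y})"
proof -
  assume xy: "x \<le> y"
  have "A \<inter> {..y} = (A \<inter> {..x}) \<union> (A \<inter> {x<..y})" using xy by auto
  moreover have 1: "A \<inter> {..x} \<in> lmeasurable" and 2: "A \<inter> {x<..y} \<in> lmeasurable" by (auto intro: A_meas)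
  have "measure lebesgue ((A \<inter> {..x}) \<union> (A \<inter> {x<..y})) = measure lebesgue (A \<inter> {..x}) + measure lebesgue (A \<inter> {x<..y})"
    by (rule measure_Union)
      (use fmeasurableD2[OF 1] fmeasurableD2[OF 2] fmeasurableD[OF 1] fmeasurableD[OF 2] in auto)
  ultimately show ?thesis by (simp only: mass_def)
qed

lemma mass_diff:
  assumes "x \<le> y"
  shows "0 \<le> mass y - mass x" "mass y - mass x \<le> y - x"
proof -
  have "{x<..y} \<in> lmeasurable" by (rule fmeasurableI2[OF lmeasurable_compact[OF compact_Icc[of x y]]]) auto
  then have "measure lebesgue (A \<inter> {x<..y}) \<le> measure lebesgue {x<..y}"
    using A_meas[of "{x<..y}"] by (intro measure_mono_fmeasurable) auto
  then show "0 \<le> mass y - mass x" "mass y - mass x \<le> y - x" using mass_add[OF assms] assms by simp_all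
qed

lemma mass_lipschitz: "1-lipschitz_on UNIV mass"
  by (rule lipschitz_on_leI) (use mass_diff in \<open>auto simp: dist_real_def\<close>)

text \<open>The path is constant across gaps, so \<open>dist_le_measure\<close> replaces the length
  of the parameter interval by the measure of A in it; the endpoint x is a null set.\<close>

lemma norm_path_diff_le:
  assumes x: "x \<in> A" and y: "y \<in> A"
  shows "norm (path x - path y) \<le> 2 * D * \<bar>mass x - mass y\<bar>"
proof -
  have main: "norm (path x - path y) \<le> 2 * D * (mass y - mass x)" if x: "x \<in> A" and y: "y \<in> A" and xy: "x \<le> y" for x y
  proof -
    have "dist (path x) (path y) \<le> 2 * D * measure lebesgue (A \<inter> {x..y})"
      by (rule dist_le_measure[OF compact x y xy path_lipschitz]) (rule path_gap)
    also have "measure lebesgue (A \<inter> {x..y}) \<le> measure lebesgue ((A \<inter> {x<..y}) \<union> {x})"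
      using A_meas[of "{x<..y}"] A_meas[of "{x..y}"] lmeasurable_compact[of "{x}"]
      by (intro measure_mono_fmeasurable fmeasurable.Un) auto
    also have "\<dots> \<le> measure lebesgue (A \<inter> {x<..y}) + measure lebesgue {x}"
      using A_meas[of "{x<..y}"] by (intro measure_Un_le) auto
    also have "\<dots> = mass y - mass x" using mass_add[OF xy] by simp
    finally show ?thesis using D_nonneg by (simp add: dist_norm mult_left_mono)
  qed
  show ?thesis
  proof (cases "x \<le> y")
    case True
    then show ?thesis using main[OF x y] mass_diff(1)[of x y] by simp
  next
    case False
    then show ?thesis using main[OF y x] mass_diff(1)[of y x] by (simp add: norm_minus_commute)
  qed
qed

lemma mass_gap:
  assumes "p \<in> A" "q \<in> A" "p < q" "{p<..<q} \<inter> A = {}"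
  shows "mass p = mass q"
proof -
  have "A \<inter> {p<..q} = {q}" using assms by force
  then show ?thesis using mass_add[of p q] assms(3) by simp
qed

text \<open>The intermediate value theorem gives a real parameter; the last point of A before it has
  the same mass.\<close>

lemma mass_surj:
  assumes "t \<in> {0..1}"
  shows "\<exists>x\<in>A. mass x = t * measure lebesgue A"
proof -
  have cont: "continuous_on S mass" for S
    using lipschitz_on_continuous_on[OF mass_lipschitz] continuous_on_subset by blast
  obtain b where b: "b \<in> A" "\<And>x. x \<in> A \<Longrightarrow> x \<le> b" using compact_attains_sup[OF compact nonempty] by blast
  have "A \<inter> {..b} = A" using b by auto
  then have mb: "mass b = measure lebesgue A" by (simp add: mass_def)
  have "A \<inter> {..Inf A} = {Inf A}" using Inf_mem Inf_le by (auto intro: antisym)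
  then have ma: "mass (Inf A) = 0" by (simp add: mass_def)
  have "t * measure lebesgue A \<le> 1 * measure lebesgue A" using assms by (intro mult_right_mono) auto
  then obtain z where z: "Inf A \<le> z" "z \<le> b" "mass z = t * measure lebesgue A"
    using IVT'[of mass "Inf A" "t * measure lebesgue A" b] ma mb Inf_le[OF b(1)] cont assms by auto
  have cz: "compact (A \<inter> {..z})" by (rule compact_Int_closed[OF compact]) simp
  have nz: "A \<inter> {..z} \<noteq> {}" using Inf_mem z by auto
  obtain x where x: "x \<in> A \<inter> {..z}" "\<forall>y\<in>A \<inter> {..z}. y \<le> x" using compact_attains_sup[OF cz nz] by (elim bexE) (rule that)
  have "A \<inter> {x<..z} = {}"
  proof (rule ccontr)
    assume "A \<inter> {x<..z} \<noteq> {}"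
    then obtain y where y: "y \<in> A" "x < y" "y \<le> z" by auto
    then show False using bspec[OF x(2), of y] by simp
  qed
  then have "mass z = mass x" using mass_add[of x z] x(1) by simp
  with x z show ?thesis by auto
qed

text \<open>On the image of A the inverse of the curve is 1/c-Lipschitz, so \<Theta> of the mass
  extends from there to a 1/c-Lipschitz function G on the target. The pull-back of G annihilates
  every jump because the mass does not change across a gap.\<close>

lemma path_dual:
  fixes f :: "'m \<Rightarrow> 'n::{metric_space, zero}"
  assumes f: "L-lipschitz_on UNIV f" "f 0 = 0" and c: "0 < c"
    and bilip: "\<And>s t. s \<in> A \<Longrightarrow> t \<in> A \<Longrightarrow> c * \<bar>s - t\<bar> \<le> dist (f (\<gamma> s)) (f (\<gamma> t))"
    and \<Theta>: "1-lipschitz_on UNIV (\<Theta> :: real \<Rightarrow> real)"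
  shows "\<exists>\<psi> :: 'm lip_free \<Rightarrow>\<^sub>L real. (\<forall>\<mu>. c * \<bar>blinfun_apply \<psi> \<mu>\<bar> \<le> norm (blinfun_apply (linearization f) \<mu>)) \<and>
    (\<forall>x\<in>A. \<forall>y\<in>A. blinfun_apply \<psi> (path x - path y) = \<Theta> (mass x) - \<Theta> (mass y))"
proof -
  let ?h = "\<lambda>t. f (\<gamma> t)"
  have inj: "inj_on ?h A"
  proof (rule inj_onI)
    fix s t assume st: "s \<in> A" "t \<in> A" "?h s = ?h t"
    then have "c * \<bar>s - t\<bar> \<le> 0" using bilip[of s t] by simp
    then show "s = t" using c by (simp add: mult_le_0_iff)
  qed
  define v where "v n = \<Theta> (mass (inv_into A ?h n))" for n
  have v: "v (?h t) = \<Theta> (mass t)" if "t \<in> A" for t by (simp add: v_def inv_into_f_f[OF inj that])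
  have lipv: "(1 / c)-lipschitz_on (?h ` A) v"
  proof (rule lipschitz_onI)
    fix m n assume "m \<in> ?h ` A" "n \<in> ?h ` A"
    then obtain s t where st: "s \<in> A" "t \<in> A" "m = ?h s" "n = ?h t" by blast
    have "dist (v m) (v n) \<le> dist (mass s) (mass t)"
      using lipschitz_onD[OF \<Theta>, of "mass s" "mass t"] v st by simp
    also have "\<dots> \<le> dist s t" using lipschitz_onD[OF mass_lipschitz, of s t] by simp
    also have "\<dots> \<le> 1 / c * dist m n" using bilip[OF st(1,2)] c by (simp add: st(3,4) dist_real_def field_simps)
    finally show "dist (v m) (v n) \<le> 1 / c * dist m n" .
  qed (use c in simp)
  obtain G where G: "(1 / c)-lipschitz_on UNIV G" "\<And>n. n \<in> ?h ` A \<Longrightarrow> G n = v n"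
  proof (rule lipschitz_extension_real[OF lipv])
    fix u assume "(1 / c)-lipschitz_on UNIV u" "\<And>n. n \<in> ?h ` A \<Longrightarrow> u n = v n"
    then show thesis by (rule that)
  qed
  have Gh: "G (?h t) = \<Theta> (mass t)" if "t \<in> A" for t 
    using G(2)[OF imageI[of t A ?h, OF that]] v[OF that] by simp
  let ?\<psi> = "lip_functional G o\<^sub>L linearization f"
  have ex: "\<exists>L. L-lipschitz_on UNIV f" using f(1) by blast
  have delta: "blinfun_apply ?\<psi> (free_delta (\<gamma> t)) = \<Theta> (mass t) - G 0" if "t \<in> A" for t
    by (simp add: linearization_free_delta[OF ex f(2)] lip_functional_delta[OF G(1)] Gh[OF that])
  have jump0: "blinfun_apply ?\<psi> (jump g) = 0" if "g \<in> gaps x y" for g x y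
  proof -
    have g: "fst g \<in> A" "snd g \<in> A" "fst g < snd g" "{fst g<..<snd g} \<inter> A = {}" using that by (auto simp: gaps_def)
    show ?thesis unfolding jump_def blinfun.diff_right delta[OF g(1)] delta[OF g(2)] by (simp add: mass_gap[OF g])
  qed
  have jumps0: "blinfun_apply ?\<psi> (jumps x y) = 0" if "x \<le> y" for x y
  proof -
    have lin: "bounded_linear (blinfun_apply ?\<psi>)" by (rule blinfun.bounded_linear_right)
    have "blinfun_apply ?\<psi> (jumps x y) = (\<Sum>\<^sub>\<infinity>g\<in>gaps x y. blinfun_apply ?\<psi> (jump g))"
      unfolding jumps_def
      by (rule infsum_bounded_linear_strong[OF _ lin, symmetric])
        (use jump_summable[OF that] summable_on_bounded_linear[OF lin jump_summable[OF that]] in blast)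
    also have "\<dots> = 0" by (rule infsum_0) (rule jump0)
    finally show ?thesis .
  qed
  have main: "blinfun_apply ?\<psi> (path y - path x) = \<Theta> (mass y) - \<Theta> (mass x)" if "x \<in> A" "y \<in> A" "x \<le> y" for x y
    unfolding path_diff[OF that] blinfun.diff_right delta[OF that(1)] delta[OF that(2)] jumps0[OF that(3)] by simp
  have "blinfun_apply ?\<psi> (path x - path y) = \<Theta> (mass x) - \<Theta> (mass y)" if xy: "x \<in> A" "y \<in> A" for x y
  proof (cases "y \<le> x")
    case True
    then show ?thesis by (rule main[OF xy(2,1)])
  next
    case False
    have "blinfun_apply ?\<psi> (path x - path y) = - blinfun_apply ?\<psi> (path y - path x)"
      unfolding blinfun.diff_right by simp
    then show ?thesis using main[OF xy] False by simp
  qed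
  moreover have "c * \<bar>blinfun_apply ?\<psi> \<mu>\<bar> \<le> norm (blinfun_apply (linearization f) \<mu>)" for \<mu>
    using abs_lip_functional_le[OF G(1), of "blinfun_apply (linearization f) \<mu>"] c by (simp add: field_simps)
  ultimately show ?thesis by blast
qed

end

theorem not_curve_flat_imp_fixes_copy_of_L1:
  fixes f :: "'m::{metric_space, zero} \<Rightarrow> 'n::{metric_space, zero}"
  assumes f: "L-lipschitz_on UNIV f" "f 0 = 0" and nflat: "\<not> curve_flat f"
  shows "fixes_copy_of_L1 (linearization f)"
proof -
  obtain A :: "real set" and \<gamma> :: "real \<Rightarrow> 'm" and D c where A: "compact A" "0 < measure lebesgue A"
    and \<gamma>: "D-lipschitz_on A \<gamma>" and c: "0 < c"
    and bilip: "\<And>s t. s \<in> A \<Longrightarrow> t \<in> A \<Longrightarrow> c * \<bar>s - t\<bar> \<le> dist (f (\<gamma> s)) (f (\<gamma> t))"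
  proof (rule not_curve_flat_bilipschitz_piece[OF f(1) nflat])
    fix A :: "real set" and \<gamma> :: "real \<Rightarrow> 'm" and D c
    assume "compact A" "0 < measure lebesgue A" "D-lipschitz_on A \<gamma>" "0 < c"
      "\<And>s t. s \<in> A \<Longrightarrow> t \<in> A \<Longrightarrow> c * \<bar>s - t\<bar> \<le> dist (f (\<gamma> s)) (f (\<gamma> t))"
    then show thesis by (rule that)
  qed
  have "A \<noteq> {}" using A(2) by auto
  then interpret compact_curve A \<gamma> D using A(1) \<gamma> by unfold_locales
  define m where "m = measure lebesgue A"
  have m: "0 < m" using A(2) by (simp add: m_def)
  have "\<forall>t\<in>{0..1}. \<exists>x. x \<in> A \<and> mass x = t * m" using mass_surj unfolding m_def Bex_def by blast
  from bchoice[OF this] obtain X where "\<forall>t\<in>{0..1}. X t \<in> A \<and> mass (X t) = t * m" by (elim exE) (rule that)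
  then have X: "\<And>t. t \<in> {0..1} \<Longrightarrow> X t \<in> A" "\<And>t. t \<in> {0..1} \<Longrightarrow> mass (X t) = t * m" by simp_all
  show ?thesis
  \<comment> \<open>The path is parametrised by the mass divided by the total mass m; this rescaling
    puts the factor m into both constants.\<close>
  proof (rule lipschitz_path_imp_fixes_copy_of_L1[where E = "\<lambda>t. path (X t)" and C = "2 * D * m" and c = "c * m"])
    fix s t :: real assume st: "s \<in> {0..1}" "t \<in> {0..1}"
    have "\<bar>mass (X s) - mass (X t)\<bar> = m * \<bar>s - t\<bar>"
      unfolding X(2)[OF st(1)] X(2)[OF st(2)] left_diff_distrib[symmetric] abs_mult using m by simp
    then show "norm (path (X s) - path (X t)) \<le> 2 * D * m * \<bar>s - t\<bar>"
      using norm_path_diff_le[OF X(1)[OF st(1)] X(1)[OF st(2)]] by (simp add: mult.assoc)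
  next
    fix \<Theta> :: "real \<Rightarrow> real" assume \<Theta>: "1-lipschitz_on UNIV \<Theta>"
    \<comment> \<open>Rescaling \<Theta> to the interval from 0 to m keeps its Lipschitz constant;
      the factor m is divided out again in the functional.\<close>
    have lip': "1-lipschitz_on UNIV (\<lambda>r. m * \<Theta> (r / m))"
    proof (rule lipschitz_onI)
      fix x y :: real
      have "m * dist (\<Theta> (x / m)) (\<Theta> (y / m)) \<le> m * dist (x / m) (y / m)"
        using lipschitz_onD[OF \<Theta>, of "x / m" "y / m"] m by (intro mult_left_mono) auto
      also have "\<dots> = dist x y" using m by (simp add: dist_real_def diff_divide_distrib[symmetric])
      finally show "dist (m * \<Theta> (x / m)) (m * \<Theta> (y / m)) \<le> 1 * dist x y"
        using m by (simp add: dist_real_def right_diff_distrib[symmetric] abs_mult)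
    qed simp
    have "\<exists>\<psi> :: 'm lip_free \<Rightarrow>\<^sub>L real. (\<forall>\<mu>. c * \<bar>blinfun_apply \<psi> \<mu>\<bar> \<le> norm (blinfun_apply (linearization f) \<mu>)) \<and>
      (\<forall>x\<in>A. \<forall>y\<in>A. blinfun_apply \<psi> (path x - path y) = m * \<Theta> (mass x / m) - m * \<Theta> (mass y / m))"
      by (rule path_dual[OF f c _ lip']) (rule bilip)
    then obtain \<psi> :: "'m lip_free \<Rightarrow>\<^sub>L real" where
      "(\<forall>\<mu>. c * \<bar>blinfun_apply \<psi> \<mu>\<bar> \<le> norm (blinfun_apply (linearization f) \<mu>)) \<and>
      (\<forall>x\<in>A. \<forall>y\<in>A. blinfun_apply \<psi> (path x - path y) = m * \<Theta> (mass x / m) - m * \<Theta> (mass y / m))"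
      by (elim exE) (rule that)
    then have \<psi>: "\<And>\<mu>. c * \<bar>blinfun_apply \<psi> \<mu>\<bar> \<le> norm (blinfun_apply (linearization f) \<mu>)"
      "\<And>x y. x \<in> A \<Longrightarrow> y \<in> A \<Longrightarrow> blinfun_apply \<psi> (path x - path y) = m * \<Theta> (mass x / m) - m * \<Theta> (mass y / m)"
      by simp_all
    show "\<exists>\<psi> :: 'm lip_free \<Rightarrow>\<^sub>L real. (\<forall>\<mu>. c * m * \<bar>blinfun_apply \<psi> \<mu>\<bar> \<le> norm (blinfun_apply (linearization f) \<mu>)) \<and>
        (\<forall>s\<in>{0..1}. \<forall>t\<in>{0..1}. blinfun_apply \<psi> (path (X s) - path (X t)) = \<Theta> s - \<Theta> t)"
    proof (intro exI[of _ "(1 / m) *\<^sub>R \<psi>"] conjI allI ballI)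
      show "c * m * \<bar>blinfun_apply ((1 / m) *\<^sub>R \<psi>) \<mu>\<bar> \<le> norm (blinfun_apply (linearization f) \<mu>)" for \<mu>
        using \<psi>(1)[of \<mu>] m by (simp add: blinfun.scaleR_left abs_mult)
      fix s t :: real assume st: "s \<in> {0..1}" "t \<in> {0..1}"
      show "blinfun_apply ((1 / m) *\<^sub>R \<psi>) (path (X s) - path (X t)) = \<Theta> s - \<Theta> t"
        using \<psi>(2)[OF X(1)[OF st(1)] X(1)[OF st(2)]] m
        by (simp add: blinfun.scaleR_left X(2)[OF st(1)] X(2)[OF st(2)] right_diff_distrib[symmetric])
    qed
  qed (use c m in simp)
qed

theorem theorem1p1:
  fixes f :: "'m::{complete_space, zero} \<Rightarrow> 'n::{metric_space, zero}"
  assumes "\<exists>L. L-lipschitz_on UNIV f" and "f 0 = 0"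
  shows "(curve_flat f \<longleftrightarrow> radon_nikodym (linearization f)) \<and>
    (radon_nikodym (linearization f) \<longleftrightarrow> dunford_pettis (linearization f)) \<and>
    (dunford_pettis (linearization f) \<longleftrightarrow> \<not> fixes_copy_of_L1 (linearization f))"
proof -
  obtain L0 where "L0-lipschitz_on UNIV f" using assms(1) by blast
  \<comment> \<open>The Lipschitz constant is enlarged so as to be positive; the preceding arguments
    divide by it.\<close>
  then have f: "(max L0 1)-lipschitz_on UNIV f" "f 0 = 0" and L: "0 < max L0 1"
    using assms(2) by (auto intro: lipschitz_on_le)
  show ?thesis
    using curve_flat_imp_radon_nikodym[OF f _ L] curve_flat_imp_dunford_pettis[OF f _ L]
      dunford_pettis_imp_not_fixes_L1[of "linearization f"] radon_nikodym_imp_not_fixes_L1[of "linearization f"]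
      not_curve_flat_imp_fixes_copy_of_L1[OF f]
    by blast
qed


end
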